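(* Let $M$ be a weight. For each $j\in\{0,1,2\}$ let $A_j$ be either the anisotropic Besov space $B^{M,s_j}_{p_j,q_j}(\mathbb R^n)$ or the anisotropic Triebel--Lizorkin space $F^{M,s_j}_{p_j,q_j}(\mathbb R^n)$, where $s_j\in\mathbb R$ and $p_j,q_j\in\,]0,\infty]$ (with $p_j<\infty$ if $A_j$ is a Triebel--Lizorkin space). Suppose there is a constant $c<\infty$ such that $$\|f\cdot g\,|A_2\|\le c\,\|f\,|A_0\|\,\|g\,|A_1\|\quad\text{for all } f,g\in\mathcal S(\mathbb R^n).\qquad( * )$$ Then the following hold: (1) $s_0+s_1\ge |M|(\frac1{p_0}+\frac1{p_1}-1)$; (2) $s_0+s_1\ge0$; (3) $s_2\le\min(s_0,s_1)$; (4) $\frac1{p_2}\le\frac1{p_0}+\frac1{p_1}$; (5) $s_2-\frac{|M|}{p_2}\le\min(s_0-\frac{|M|}{p_0},\,s_1-\frac{|M|}{p_1})$; (6) $s_2-\frac{|M|}{p_2}\le s_0+s_1-|M|(\frac1{p_0}+\frac1{p_1})$; (7) if $s_2-\frac{|M|}{p_2}=s_1-\frac{|M|}{p_1}$ and $s_0=\frac{|M|}{p_0}$, then $q_0\le1$ when $A_0$ is a Besov space, and $p_0\le1$ when $A_0$ is a Triebel--Lizorkin space. Furthermore: (1') if $s_0+s_1=\frac{|M|}{p_0}+\frac{|M|}{p_1}-|M|$, then $\frac1{q_0}+\frac1{q_1}\ge1$ when $A_0$ and $A_1$ are both Besov spaces, and $\frac1{q_0}+\frac1{p_1}\ge1$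 when $A_0$ is a Besov space and $A_1$ is a Triebel--Lizorkin space; (2') if $s_0+s_1=0$, then $\frac1{q_0}+\frac1{q_1}\ge1$; (3') for $j=0$ and for $j=1$: if $s_2=s_j$, then $q_2\ge q_j$; (5') for $j=0$ and for $j=1$: if $s_2-\frac{|M|}{p_2}=s_j-\frac{|M|}{p_j}$ and $A_j$ and $A_2$ are both Besov spaces, then $q_2\ge q_j$; (6') if $s_2-\frac{|M|}{p_2}=s_0-\frac{|M|}{p_0}+s_1-\frac{|M|}{p_1}$ and $A_0,A_1,A_2$ are all Besov spaces, then $q_2\ge(\frac1{q_0}+\frac1{q_1})^{-1}$. The same conclusions hold if in $( * )$ the pointwise product $f\cdot g$ is replaced by $\pi(f,g)$.
   Context: Anisotropic spaces. A weight is $M=(m_1,\dots,m_n)$ with $m_j\ge1$ and $\min_j m_j=1$; $|M|=m_1+\dots+m_n$. For $t>0$, $t^{M}x=(t^{m_1}x_1,\dots,t^{m_n}x_n)$ and $2^{-kM}x=(2^{-k})^{M}x$. Put $[0]=0$ and, for $x\ne0$, let $[x]$ be the unique $t>0$ with $\sum_i (x_i/t^{m_i})^2=1$. $\mathcal F u(\xi)=\int e^{-ix\cdot\xi}u(x)\,dx$. Fix $\Psi\in C^\infty(\mathbb R)$ with $\Psi(t)=1$ for $0\le t\le\frac{11}{10}$ and $\Psi(t)=0$ for $t\ge\frac{13}{10}$; set $\Psi_j(\xi)=\Psi(2^{-j}[\xi])$ for $j\ge0$, $\Psi_j=0$ for $j<0$, and $\Phi_j=\Psi_j-\Psi_{j-1}$.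 For $s\in\mathbb R$, $p,q\in\,]0,\infty]$, $B^{M,s}_{p,q}(\mathbb R^n)$ is the space of $u\in\mathcal S'(\mathbb R^n)$ with finite quasi-norm $\big\|\{2^{sj}\|\mathcal F^{-1}(\Phi_j\mathcal Fu)\|_{L_p}\}_{j\ge0}\big\|_{\ell_q}$; for $p<\infty$, $F^{M,s}_{p,q}(\mathbb R^n)$ is the space of $u\in\mathcal S'(\mathbb R^n)$ with finite quasi-norm $\big\|\,\|\{2^{sj}\mathcal F^{-1}(\Phi_j\mathcal Fu)(\cdot)\}_{j\ge0}\|_{\ell_q}\big\|_{L_p}$. $\|x\,|X\|$ denotes the (quasi-)norm of $x$ in $X$; $1/\infty=0$. Product. For $\psi\in C_0^\infty(\mathbb R^n)$ equal to $1$ near $0$, let $\psi_k(\xi)=\psi(2^{-kM}\xi)$ and, for $u,v\in\mathcal S'(\mathbb R^n)$, $\pi_\psi(u,v)=\lim_{k\to\infty}\mathcal F^{-1}(\psi_k\mathcal Fu)\cdot\mathcal F^{-1}(\psi_k\mathcal Fv)$ when the limit exists in $\mathcal D'(\mathbb R^n)$. $\pi(u,v):=\pi_\psi(u,v)$ when $\pi_\psi(u,v)$ exists for all such $\psi$ and is independent of $\psi$. *)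

theory Defs
  imports "HOL-Probability.Essential_Supremum"
begin

section \<open>Smooth functions, test functions and distributions\<close>

definition dir_deriv :: "'a::euclidean_space \<Rightarrow> ('a \<Rightarrow> complex) \<Rightarrow> 'a \<Rightarrow> complex"
  where "dir_deriv b f = (\<lambda>x. frechet_derivative f (at x) b)"

text \<open>A list of basis vectors plays the role of a multi-index.\<close>

definition iter_deriv :: "'a::euclidean_space list \<Rightarrow> ('a \<Rightarrow> complex) \<Rightarrow> 'a \<Rightarrow> complex"
  where "iter_deriv bs f = foldr dir_deriv bs f"

text \<open>Differentiability of all iterated partial derivatives is the same as \<open>C\<close>-infinity:
  each of them is then continuous as well.\<close>

definition smooth_fun :: "('a::euclidean_space \<Rightarrow> complex) \<Rightarrow> bool"
  where "smooth_fun f \<longleftrightarrow> (\<forall>bs\<in>lists Basis. iter_deriv bs f differentiable_on UNIV)"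

definition test_funs :: "('a::euclidean_space \<Rightarrow> complex) set"
  where "test_funs = {f. smooth_fun f \<and> compact (closure {x. f x \<noteq> 0})}"

definition schwartz_funs :: "('a::euclidean_space \<Rightarrow> complex) set"
  where "schwartz_funs = {f. smooth_fun f \<and>
    (\<forall>k. \<forall>bs\<in>lists Basis. \<exists>C. \<forall>x. (1 + norm x) ^ k * cmod (iter_deriv bs f x) \<le> C)}"

text \<open>The supremum is finite for Schwartz functions; for other functions the value is meaningless.\<close>

definition schwartz_seminorm :: "nat \<Rightarrow> nat \<Rightarrow> ('a::euclidean_space \<Rightarrow> complex) \<Rightarrow> real"
  where "schwartz_seminorm k N f =
    (SUP (x, bs) \<in> UNIV \<times> {bs \<in> lists Basis. length bs \<le> N}.
       (1 + norm x) ^ k * cmod (iter_deriv bs f x))"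

text \<open>Distributions are represented by functionals on all functions; only their values on
  \<^const>\<open>test_funs\<close> (respectively \<^const>\<open>schwartz_funs\<close> for tempered ones) are relevant.\<close>

type_synonym 'a functional = "('a \<Rightarrow> complex) \<Rightarrow> complex"

definition linear_functional_on :: "('a \<Rightarrow> complex) set \<Rightarrow> 'a functional \<Rightarrow> bool"
  where "linear_functional_on S u \<longleftrightarrow>
    (\<forall>\<phi>\<in>S. \<forall>\<eta>\<in>S. \<forall>a b. u (\<lambda>x. a * \<phi> x + b * \<eta> x) = a * u \<phi> + b * u \<eta>)"

definition is_distribution :: "'a::euclidean_space functional \<Rightarrow> bool"
  where "is_distribution u \<longleftrightarrow> linear_functional_on test_funs u \<and>
    (\<forall>K. compact K \<longrightarrow> (\<exists>C N. \<forall>\<phi>\<in>test_funs. {x. \<phi> x \<noteq> 0} \<subseteq> K \<longrightarrow>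
       cmod (u \<phi>) \<le> C * schwartz_seminorm 0 N \<phi>))"

definition tempered :: "'a::euclidean_space functional \<Rightarrow> bool"
  where "tempered u \<longleftrightarrow> linear_functional_on schwartz_funs u \<and>
    (\<exists>C k N. \<forall>\<phi>\<in>schwartz_funs. cmod (u \<phi>) \<le> C * schwartz_seminorm k N \<phi>)"

definition dist_of_fun :: "('a::euclidean_space \<Rightarrow> complex) \<Rightarrow> 'a functional"
  where "dist_of_fun f = (\<lambda>\<phi>. \<integral>x. f x * \<phi> x \<partial>lborel)"

text \<open>The continuous function representing a distribution (unique if it exists). It is applied
  below to distributions with compactly supported Fourier transform, which are smooth functions by
  the Paley--Wiener--Schwartz theorem.\<close>

definition fun_of_dist :: "'a::euclidean_space functional \<Rightarrow> 'a \<Rightarrow> complex"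
  where "fun_of_dist u =
    (THE f. continuous_on UNIV f \<and> (\<forall>\<phi>\<in>test_funs. u \<phi> = dist_of_fun f \<phi>))"

definition fourier :: "('a::euclidean_space \<Rightarrow> complex) \<Rightarrow> 'a \<Rightarrow> complex"
  where "fourier f = (\<lambda>\<xi>. \<integral>x. exp (- \<i> * of_real (x \<bullet> \<xi>)) * f x \<partial>lborel)"

definition inv_fourier :: "('a::euclidean_space \<Rightarrow> complex) \<Rightarrow> 'a \<Rightarrow> complex"
  where "inv_fourier f =
    (\<lambda>x. of_real (1 / (2 * pi) ^ DIM('a)) * (\<integral>\<xi>. exp (\<i> * of_real (x \<bullet> \<xi>)) * f \<xi> \<partial>lborel))"

definition fourier_dist :: "'a::euclidean_space functional \<Rightarrow> 'a functional"
  where "fourier_dist u = (\<lambda>\<phi>. u (fourier \<phi>))"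

definition inv_fourier_dist :: "'a::euclidean_space functional \<Rightarrow> 'a functional"
  where "inv_fourier_dist u = (\<lambda>\<phi>. u (inv_fourier \<phi>))"

definition mult_dist :: "('a \<Rightarrow> complex) \<Rightarrow> 'a functional \<Rightarrow> 'a functional"
  where "mult_dist m u = (\<lambda>\<phi>. u (\<lambda>x. m x * \<phi> x))"

text \<open>The function obtained from \<open>u\<close> by the Fourier multiplier with compactly supported symbol \<open>m\<close>.\<close>

definition fourier_multiplier ::
    "('a::euclidean_space \<Rightarrow> complex) \<Rightarrow> 'a functional \<Rightarrow> 'a \<Rightarrow> complex"
  where "fourier_multiplier m u = fun_of_dist (inv_fourier_dist (mult_dist m (fourier_dist u)))"

section \<open>Lebesgue quasi-norms\<close>

text \<open>Only used for positive exponents \<open>a\<close>.\<close>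

definition ennreal_powr :: "ennreal \<Rightarrow> real \<Rightarrow> ennreal"
  where "ennreal_powr x a = (if x = \<infinity> then \<infinity> else ennreal (enn2real x powr a))"

text \<open>The reciprocal of an exponent in \<open>]0,\<infinity>]\<close>, with \<open>1/\<infinity> = 0\<close>.\<close>

abbreviation recip :: "ennreal \<Rightarrow> real"
  where "recip p \<equiv> enn2real (inverse p)"

definition Lp_qnorm :: "'a measure \<Rightarrow> ennreal \<Rightarrow> ('a \<Rightarrow> ennreal) \<Rightarrow> ennreal"
  where "Lp_qnorm \<mu> p h =
    (if p = \<infinity> then esssup \<mu> h
     else ennreal_powr (\<integral>\<^sup>+x. ennreal_powr (h x) (enn2real p) \<partial>\<mu>) (recip p))"

abbreviation lq_qnorm :: "ennreal \<Rightarrow> (nat \<Rightarrow> ennreal) \<Rightarrow> ennreal"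
  where "lq_qnorm \<equiv> Lp_qnorm (count_space UNIV)"

section \<open>Anisotropic function spaces\<close>

definition is_weight :: "real ^ 'n \<Rightarrow> bool"
  where "is_weight M \<longleftrightarrow> (\<forall>i. M $ i \<ge> 1) \<and> Min (range (($) M)) = 1"

definition weight_size :: "real ^ 'n \<Rightarrow> real"
  where "weight_size M = (\<Sum>i\<in>UNIV. M $ i)"

definition aniso_dilation :: "real ^ 'n \<Rightarrow> real \<Rightarrow> real ^ 'n \<Rightarrow> real ^ 'n"
  where "aniso_dilation M t x = (\<chi> i. t powr (M $ i) * x $ i)"

definition aniso_dist :: "real ^ 'n \<Rightarrow> real ^ 'n \<Rightarrow> real"
  where "aniso_dist M x =
    (if x = 0 then 0 else THE t. t > 0 \<and> (\<Sum>i\<in>UNIV. (x $ i / t powr (M $ i))\<^sup>2) = 1)"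

definition is_cutoff :: "(real \<Rightarrow> complex) \<Rightarrow> bool"
  where "is_cutoff \<Psi> \<longleftrightarrow> smooth_fun \<Psi> \<and>
    (\<forall>t. 0 \<le> t \<and> t \<le> 11/10 \<longrightarrow> \<Psi> t = 1) \<and> (\<forall>t. t \<ge> 13/10 \<longrightarrow> \<Psi> t = 0)"

definition LP_Psi :: "(real \<Rightarrow> complex) \<Rightarrow> real ^ 'n \<Rightarrow> int \<Rightarrow> real ^ 'n \<Rightarrow> complex"
  where "LP_Psi \<Psi> M j \<xi> = (if j \<ge> 0 then \<Psi> (2 powi (- j) * aniso_dist M \<xi>) else 0)"

definition LP_Phi :: "(real \<Rightarrow> complex) \<Rightarrow> real ^ 'n \<Rightarrow> int \<Rightarrow> real ^ 'n \<Rightarrow> complex"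
  where "LP_Phi \<Psi> M j \<xi> = LP_Psi \<Psi> M j \<xi> - LP_Psi \<Psi> M (j - 1) \<xi>"

definition LP_block ::
    "(real \<Rightarrow> complex) \<Rightarrow> real ^ 'n \<Rightarrow> nat \<Rightarrow> (real ^ 'n) functional \<Rightarrow> real ^ 'n \<Rightarrow> complex"
  where "LP_block \<Psi> M j u = fourier_multiplier (LP_Phi \<Psi> M (int j)) u"

definition besov_qnorm ::
    "(real \<Rightarrow> complex) \<Rightarrow> real ^ 'n \<Rightarrow> real \<Rightarrow> ennreal \<Rightarrow> ennreal \<Rightarrow> (real ^ 'n) functional \<Rightarrow> ennreal"
  where "besov_qnorm \<Psi> M s p q u =
    lq_qnorm q (\<lambda>j. ennreal (2 powr (s * real j)) *
      Lp_qnorm lborel p (\<lambda>x. ennreal (cmod (LP_block \<Psi> M j u x))))"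

definition triebel_lizorkin_qnorm ::
    "(real \<Rightarrow> complex) \<Rightarrow> real ^ 'n \<Rightarrow> real \<Rightarrow> ennreal \<Rightarrow> ennreal \<Rightarrow> (real ^ 'n) functional \<Rightarrow> ennreal"
  where "triebel_lizorkin_qnorm \<Psi> M s p q u =
    Lp_qnorm lborel p (\<lambda>x. lq_qnorm q (\<lambda>j.
      ennreal (2 powr (s * real j)) * ennreal (cmod (LP_block \<Psi> M j u x))))"

datatype space_kind = Besov | Triebel_Lizorkin

text \<open>The quasi-norm of a tempered distribution in the space of the given kind, with value
  \<open>\<infinity>\<close> iff the distribution does not belong to the space.\<close>

fun space_qnorm ::
    "space_kind \<Rightarrow> (real \<Rightarrow> complex) \<Rightarrow> real ^ 'n \<Rightarrow> real \<Rightarrow> ennreal \<Rightarrow> ennreal \<Rightarrow>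
      (real ^ 'n) functional \<Rightarrow> ennreal"
  where
    "space_qnorm Besov \<Psi> M s p q u = besov_qnorm \<Psi> M s p q u"
  | "space_qnorm Triebel_Lizorkin \<Psi> M s p q u = triebel_lizorkin_qnorm \<Psi> M s p q u"

section \<open>The product of tempered distributions\<close>

text \<open>The relation \<open>has_psi_product M \<psi> u v w\<close> says that the limit defining the product with
  respect to \<open>\<psi>\<close> exists in the space of distributions and equals \<open>w\<close>, of
  which only the values on \<^const>\<open>test_funs\<close> matter.\<close>

definition has_psi_product ::
    "real ^ 'n \<Rightarrow> (real ^ 'n \<Rightarrow> complex) \<Rightarrow> (real ^ 'n) functional \<Rightarrow> (real ^ 'n) functional \<Rightarrow>
      (real ^ 'n) functional \<Rightarrow> bool"
  where "has_psi_product M \<psi> u v w \<longleftrightarrow> is_distribution w \<and>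
    (\<forall>\<phi>\<in>test_funs.
      (\<lambda>k::nat. let \<psi>k = (\<lambda>\<xi>. \<psi> (aniso_dilation M (2 powi (- int k)) \<xi>)) in
         dist_of_fun (\<lambda>x. fourier_multiplier \<psi>k u x * fourier_multiplier \<psi>k v x) \<phi>)
      \<longlonglongrightarrow> w \<phi>)"

definition has_product ::
    "real ^ 'n \<Rightarrow> (real ^ 'n) functional \<Rightarrow> (real ^ 'n) functional \<Rightarrow> (real ^ 'n) functional \<Rightarrow> bool"
  where "has_product M u v w \<longleftrightarrow>
    (\<forall>\<psi>\<in>test_funs. (\<forall>\<^sub>F \<xi> in nhds 0. \<psi> \<xi> = 1) \<longrightarrow> has_psi_product M \<psi> u v w)"

end

theory Submission
  imports Defs "HOL-Probability.Characteristic_Functions" "HOL-Probability.Sinc_Integral"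
begin

text \<open>The hypothesis is tested on finite sums of wave packets, that is, of modulated and anisotropically
  dilated copies of one Schwartz function whose Fourier transform has small compact support. As the
  Littlewood--Paley functions equal 1 near the dyadic frequencies, each packet is a single block,
  and for frequencies \<open>2\<^sup>k\<close> with \<open>k\<close> in a finite set \<open>K\<close> the quasi-norms of both factors are of order
  \<open>(card K)\<^sup>\<alpha>\<close>: here \<open>\<alpha>\<close> is \<open>1/q\<close> for modulations of a fixed packet and for dilated packets in Besov
  spaces, but \<open>1/p\<close> for dilated packets in Triebel--Lizorkin spaces. Opposite frequencies send the
  diagonal terms of the product into the lowest block, where they add up; a fixed second factor, or
  equal frequencies in a lacunary set, give one term of the product per block. A single frequency
  tending to infinity yields the inequalities between the parameters (for the one between the integral
  exponents alone, a single packet is spread out instead), and in the limiting cases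
  \<open>card K \<rightarrow> \<infinity>\<close> yields the conditions on the sum exponents.

  For the generalised product nothing new is needed: on band-limited factors the defining sequence
  is eventually constant, so the product is the pointwise one.\<close>

section \<open>Smooth functions\<close>

text \<open>All bumps, uniqueness tests and packet symbols are made from the given
  \<open>\<Psi>\<close>. It may take complex values, so nonnegativity is obtained from
  \<open>cnj \<Psi> * \<Psi>\<close>. Since the hypothesis is applied only to inverse transforms of
  test functions, Fourier inversion for integrable functions computes all blocks. The only genuine
  distribution is the product \<open>w\<close>, which is fixed on test functions and extended to
  Schwartz functions by temperedness.

  For j > 0 the function \<open>LP_Phi \<Psi> M j\<close> is 1 at anisotropic distances between 0.65
  and 1.1 times 2^j. Packets are centred at 2^k on a coordinate axis of weight 1, where the distance
  is the absolute value, and have radius at most 2^k/100, so that the required sums of frequencies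
  still fit into these plateaus.

  The delicate lower bound is the one for dilated packets of opposite frequencies. The spectrum of a
  squared dilated bump spreads over many blocks, and only a vanishing part of it reaches the lowest
  one. After normalisation these low blocks converge to a nonzero limit on some ball, which excludes
  cancellation between the terms.\<close>

lemma iter_deriv_Nil [simp]: "iter_deriv [] f = f"
  by (simp add: iter_deriv_def)

lemma iter_deriv_Cons: "iter_deriv (b # bs) f = dir_deriv b (iter_deriv bs f)"
  by (simp add: iter_deriv_def)

lemma iter_deriv_snoc: "iter_deriv (bs @ [b]) f = iter_deriv bs (dir_deriv b f)"
  by (simp add: iter_deriv_def)

lemma dir_deriv_eq:
  assumes "(f has_derivative f') (at x)"
  shows "dir_deriv b f x = f' b"
  using frechet_derivative_at[OF assms] by (simp add: dir_deriv_def)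

lemma dir_deriv_cong_open:
  assumes "open S" "x \<in> S" "\<And>y. y \<in> S \<Longrightarrow> f y = g y"
  shows "dir_deriv b f x = dir_deriv b g x"
proof -
  have "(f has_derivative f') (at x) \<longleftrightarrow> (g has_derivative f') (at x)" for f'
    using has_derivative_transform_within_open[of f f' x UNIV S g]
      has_derivative_transform_within_open[of g f' x UNIV S f] assms by auto
  thus ?thesis by (simp add: dir_deriv_def frechet_derivative_def)
qed

lemma iter_deriv_cong_open:
  assumes "open S" "\<And>y. y \<in> S \<Longrightarrow> f y = g y" "x \<in> S"
  shows "iter_deriv bs f x = iter_deriv bs g x"
  using assms(3)
proof (induction bs arbitrary: x)
  case (Cons b bs)
  thus ?case
    using dir_deriv_cong_open[OF assms(1), of x "iter_deriv bs f" "iter_deriv bs g"]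
    by (simp add: iter_deriv_Cons)
qed (simp add: assms)

text \<open>Relative to a set because the anisotropic distance is smooth only away from the origin;
  the Littlewood-Paley functions are glued from two open sets by
  \<open>smooth_on_Un\<close>.\<close>

definition smooth_on :: "'a::euclidean_space set \<Rightarrow> ('a \<Rightarrow> complex) \<Rightarrow> bool"
  where "smooth_on S f \<longleftrightarrow> (\<forall>bs\<in>lists Basis. iter_deriv bs f differentiable_on S)"

lemma smooth_fun_iff_smooth_on: "smooth_fun f \<longleftrightarrow> smooth_on UNIV f"
  by (simp add: smooth_fun_def smooth_on_def)

lemma smooth_on_cong:
  assumes "open S" "\<And>y. y \<in> S \<Longrightarrow> f y = g y" "smooth_on S f"
  shows "smooth_on S g"
  unfolding smooth_on_def
proof
  fix bs :: "'a list" assume "bs \<in> lists Basis"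
  hence "iter_deriv bs f differentiable_on S" using assms(3) by (auto simp: smooth_on_def)
  moreover have "iter_deriv bs f x = iter_deriv bs g x" if "x \<in> S" for x
    using iter_deriv_cong_open[OF assms(1,2) that] .
  ultimately show "iter_deriv bs g differentiable_on S"
    by (metis (no_types, lifting) differentiable_on_def differentiable_transform_within zero_less_one)
qed

lemma smooth_on_Un:
  assumes "open S" "open T" "smooth_on S f" "smooth_on T f"
  shows "smooth_on (S \<union> T) f"
  using assms by (auto simp: smooth_on_def differentiable_on_eq_differentiable_at open_Un)

lemma smooth_on_differentiable:
  assumes "smooth_on S f" "open S" "x \<in> S"
  shows "f differentiable (at x)"
proof -
  have "iter_deriv [] f differentiable_on S" using assms(1) unfolding smooth_on_def by blast
  thus ?thesis using assms by (simp add: differentiable_on_eq_differentiable_at)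
qed

lemma smooth_on_has_derivative:
  assumes "smooth_on S f" "open S" "x \<in> S"
  shows "(f has_derivative frechet_derivative f (at x)) (at x)"
  using smooth_on_differentiable[OF assms] by (simp add: frechet_derivative_works)

lemma smooth_on_dir_deriv:
  assumes "smooth_on S f" "b \<in> Basis"
  shows "smooth_on S (dir_deriv b f)"
  unfolding smooth_on_def
proof
  fix bs :: "'a list" assume "bs \<in> lists Basis"
  hence "bs @ [b] \<in> lists Basis" using assms(2) by simp
  hence "iter_deriv (bs @ [b]) f differentiable_on S" using assms(1) unfolding smooth_on_def by blast
  thus "iter_deriv bs (dir_deriv b f) differentiable_on S" by (simp add: iter_deriv_snoc)
qed

lemma smooth_on_iter_deriv:
  assumes "smooth_on S f" "bs \<in> lists Basis"
  shows "smooth_on S (iter_deriv bs f)"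
  using assms(2) by (induction bs) (auto simp: assms(1) iter_deriv_Cons smooth_on_dir_deriv)

text \<open>By induction, every iterated derivative of a member of \<open>C\<close> agrees on
  \<open>S\<close> with a member of \<open>C\<close>. Smoothness is thus reduced to exhibiting a
  class of differentiable functions that contains its own first partial derivatives.\<close>

lemma smooth_on_coinduct:
  assumes "open S"
    and step: "\<And>f. f \<in> C \<Longrightarrow>
      \<exists>f'. (\<forall>x\<in>S. (f has_derivative f' x) (at x)) \<and> (\<forall>b\<in>Basis. (\<lambda>x. f' x b) \<in> C)"
    and "f \<in> C"
  shows "smooth_on S f"
proof -
  have "\<exists>g\<in>C. \<forall>x\<in>S. iter_deriv bs f x = g x" if "bs \<in> lists Basis" for bs
    using that
  proof (induction bs)
    case Nil thus ?case using \<open>f \<in> C\<close> by auto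
  next
    case (Cons b bs)
    then obtain g where g: "g \<in> C" "\<And>x. x \<in> S \<Longrightarrow> iter_deriv bs f x = g x" by auto
    obtain g' where g': "\<And>x. x \<in> S \<Longrightarrow> (g has_derivative g' x) (at x)"
      "\<And>b. b \<in> Basis \<Longrightarrow> (\<lambda>x. g' x b) \<in> C" using step[OF g(1)] by auto
    have "iter_deriv (b # bs) f x = g' x b" if "x \<in> S" for x
      using dir_deriv_cong_open[OF \<open>open S\<close> that g(2)] dir_deriv_eq[OF g'(1)[OF that]]
      by (simp add: iter_deriv_Cons)
    thus ?case using g'(2)[of b] Cons by (intro bexI[of _ "\<lambda>x. g' x b"]) auto
  qed
  moreover have "g differentiable_on S" if "g \<in> C" for g
    using step[OF that] \<open>open S\<close>
    by (auto simp: differentiable_on_eq_differentiable_at differentiable_def)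
  ultimately show ?thesis
    unfolding smooth_on_def
    by (metis (no_types, lifting) differentiable_on_def differentiable_transform_within zero_less_one)
qed

text \<open>The polynomials in the functions of \<open>G\<close>. By the sum and product rules their
  partial derivatives are again such polynomials as soon as this holds for the generators.\<close>

inductive_set alg_closure :: "('a \<Rightarrow> complex) set \<Rightarrow> ('a \<Rightarrow> complex) set" for G where
  base: "f \<in> G \<Longrightarrow> f \<in> alg_closure G"
| const: "(\<lambda>_. c) \<in> alg_closure G"
| add: "f \<in> alg_closure G \<Longrightarrow> g \<in> alg_closure G \<Longrightarrow> (\<lambda>x. f x + g x) \<in> alg_closure G"
| mult: "f \<in> alg_closure G \<Longrightarrow> g \<in> alg_closure G \<Longrightarrow> (\<lambda>x. f x * g x) \<in> alg_closure G"

lemma smooth_on_alg_closure: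
  fixes G :: "('a::euclidean_space \<Rightarrow> complex) set"
  assumes "open S"
    and step: "\<And>f. f \<in> G \<Longrightarrow> \<exists>f'. (\<forall>x\<in>S. (f has_derivative f' x) (at x)) \<and>
      (\<forall>b\<in>Basis. (\<lambda>x. f' x b) \<in> alg_closure G)"
    and "f \<in> alg_closure G"
  shows "smooth_on S f"
proof (rule smooth_on_coinduct[OF assms(1) _ assms(3)])
  fix f assume "f \<in> alg_closure G"
  thus "\<exists>f'. (\<forall>x\<in>S. (f has_derivative f' x) (at x)) \<and> (\<forall>b\<in>Basis. (\<lambda>x. f' x b) \<in> alg_closure G)"
  proof induction
    case (base f) thus ?case by (rule step)
  next
    case (const c)
    show ?case by (rule exI[of _ "\<lambda>_ _. 0"]) (auto intro: alg_closure.const)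
  next
    case (add f g)
    then obtain f' g' where "\<forall>x\<in>S. (f has_derivative f' x) (at x)"
        "\<forall>b\<in>Basis. (\<lambda>x. f' x b) \<in> alg_closure G" "\<forall>x\<in>S. (g has_derivative g' x) (at x)"
        "\<forall>b\<in>Basis. (\<lambda>x. g' x b) \<in> alg_closure G" by blast
    thus ?case
      by (intro exI[of _ "\<lambda>x v. f' x v + g' x v"])
        (auto intro!: derivative_eq_intros alg_closure.add)
  next
    case (mult f g)
    then obtain f' g' where "\<forall>x\<in>S. (f has_derivative f' x) (at x)"
        "\<forall>b\<in>Basis. (\<lambda>x. f' x b) \<in> alg_closure G" "\<forall>x\<in>S. (g has_derivative g' x) (at x)"
        "\<forall>b\<in>Basis. (\<lambda>x. g' x b) \<in> alg_closure G" by blast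
    thus ?case using mult(1,2)
      by (intro exI[of _ "\<lambda>x v. f x * g' x v + f' x v * g x"])
        (auto intro!: has_derivative_mult alg_closure.add alg_closure.mult)
  qed
qed

text \<open>Taking all smooth functions as generators yields closure under sums and products at one
  stroke.\<close>

lemma smooth_on_closed:
  assumes "open S" "f \<in> alg_closure (Collect (smooth_on S))"
  shows "smooth_on S f"
proof (rule smooth_on_alg_closure[OF assms(1) _ assms(2)])
  fix g assume "g \<in> Collect (smooth_on S)"
  thus "\<exists>f'. (\<forall>x\<in>S. (g has_derivative f' x) (at x)) \<and>
      (\<forall>b\<in>Basis. (\<lambda>x. f' x b) \<in> alg_closure (Collect (smooth_on S)))"
    using assms(1) by (intro exI[of _ "\<lambda>x. frechet_derivative g (at x)"])
      (auto intro!: smooth_on_has_derivative alg_closure.base smooth_on_dir_deriv simp flip: dir_deriv_def)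
qed

lemma smooth_on_const: "open S \<Longrightarrow> smooth_on S (\<lambda>_. c)"
  by (rule smooth_on_closed) (auto intro: alg_closure.intros)

lemma smooth_on_add: "open S \<Longrightarrow> smooth_on S f \<Longrightarrow> smooth_on S g \<Longrightarrow> smooth_on S (\<lambda>x. f x + g x)"
  by (rule smooth_on_closed) (simp_all add: alg_closure.add alg_closure.base)

lemma smooth_on_mult: "open S \<Longrightarrow> smooth_on S f \<Longrightarrow> smooth_on S g \<Longrightarrow> smooth_on S (\<lambda>x. f x * g x)"
  by (rule smooth_on_closed) (simp_all add: alg_closure.mult alg_closure.base)

lemma smooth_on_diff:
  assumes "open S" "smooth_on S f" "smooth_on S g"
  shows "smooth_on S (\<lambda>x. f x - g x)"
  using smooth_on_add[OF assms(1,2) smooth_on_mult[OF assms(1) smooth_on_const[OF assms(1), of "-1"] assms(3)]]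
  by simp

lemma smooth_on_sum:
  assumes "open S" "\<And>i. i \<in> I \<Longrightarrow> smooth_on S (f i)"
  shows "smooth_on S (\<lambda>x. \<Sum>i\<in>I. f i x)"
  using assms(2)
  by (induction I rule: infinite_finite_induct) (auto intro!: smooth_on_add smooth_on_const assms(1))

lemma smooth_on_cnj:
  assumes "open S" "smooth_on S f"
  shows "smooth_on S (\<lambda>x. cnj (f x))"
proof (rule smooth_on_coinduct[OF assms(1), of "{\<lambda>x. cnj (f x) | f. smooth_on S f}"])
  fix g assume "g \<in> {\<lambda>x. cnj (f x) | f. smooth_on S f}"
  then obtain f where f: "g = (\<lambda>x. cnj (f x))" "smooth_on S f" by auto
  show "\<exists>f'. (\<forall>x\<in>S. (g has_derivative f' x) (at x)) \<and>
      (\<forall>b\<in>Basis. (\<lambda>x. f' x b) \<in> {\<lambda>x. cnj (f x) | f. smooth_on S f})"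
  proof (intro exI[of _ "\<lambda>x v. cnj (frechet_derivative f (at x) v)"] conjI ballI)
    fix x assume "x \<in> S"
    thus "(g has_derivative (\<lambda>v. cnj (frechet_derivative f (at x) v))) (at x)"
      unfolding f(1) using f(2) assms(1) by (intro has_derivative_cnj smooth_on_has_derivative)
  next
    fix b :: 'a assume "b \<in> Basis"
    hence "smooth_on S (dir_deriv b f)" using f(2) by (rule smooth_on_dir_deriv[rotated])
    thus "(\<lambda>x. cnj (frechet_derivative f (at x) b)) \<in> {\<lambda>x. cnj (f x) | f. smooth_on S f}"
      by (intro CollectI exI[of _ "dir_deriv b f"]) (simp add: dir_deriv_def)
  qed
qed (use assms in auto)

lemma smooth_on_inner: "open S \<Longrightarrow> smooth_on S (\<lambda>x::'a::euclidean_space. of_real (x \<bullet> b))"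
proof (rule smooth_on_alg_closure[of S "{\<lambda>x. of_real (x \<bullet> b)}"], goal_cases)
  case (2 f)
  show ?case using 2(2)
    by (intro exI[of _ "\<lambda>x v. of_real (v \<bullet> b)"])
      (auto intro!: derivative_eq_intros alg_closure.const)
qed (auto intro: alg_closure.base)

text \<open>The generators are the smooth functions on \<open>S\<close> and all derivatives of
  \<open>\<Psi>\<close> composed with \<open>r\<close>. By the chain rule the derivative of a
  composite is the next composite times a derivative of \<open>r\<close>, which is again a
  polynomial in the generators.\<close>

lemma smooth_on_compose_real:
  fixes \<Psi> :: "real \<Rightarrow> complex" and r :: "'a::euclidean_space \<Rightarrow> real"
  assumes "open S" "smooth_fun \<Psi>" "smooth_on S (\<lambda>x. complex_of_real (r x))"
  shows "smooth_on S (\<lambda>x. \<Psi> (r x))"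
proof -
  define G where "G = Collect (smooth_on S) \<union> (\<lambda>l x. iter_deriv (replicate l 1) \<Psi> (r x)) ` UNIV"
  have "\<exists>f'. (\<forall>x\<in>S. (f has_derivative f' x) (at x)) \<and> (\<forall>b\<in>Basis. (\<lambda>x. f' x b) \<in> alg_closure G)"
    if "f \<in> G" for f
  proof (cases "smooth_on S f")
    case True
    thus ?thesis
      using assms(1) by (intro exI[of _ "\<lambda>x. frechet_derivative f (at x)"])
      (auto intro!: smooth_on_has_derivative alg_closure.base smooth_on_dir_deriv simp: G_def simp flip: dir_deriv_def)
  next
    case False
    hence "f \<in> range (\<lambda>l x. iter_deriv (replicate l 1) \<Psi> (r x))" using that unfolding G_def by simp
    then obtain l where f: "f = (\<lambda>x. iter_deriv (replicate l 1) \<Psi> (r x))" by (rule rangeE)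
    define D where "D x v = iter_deriv (replicate (Suc l) 1) \<Psi> (r x) *
       frechet_derivative (\<lambda>x. complex_of_real (r x)) (at x) v" for x v
    have "(f has_derivative D x) (at x)" if "x \<in> S" for x
    proof -
      \<comment> \<open>Smoothness speaks of complex-valued functions. Taking real parts gives a
        derivative of \<open>r\<close> itself, and uniqueness of derivatives then shows that
        \<open>?R\<close> is real-valued.\<close>
      have 1: "((\<lambda>x. complex_of_real (r x)) has_derivative frechet_derivative (\<lambda>x. complex_of_real (r x)) (at x)) (at x)"
        (is "(_ has_derivative ?R) _") using assms that by (intro smooth_on_has_derivative)
      have 2: "(r has_derivative (\<lambda>v. Re (?R v))) (at x)"
        using has_derivative_Re[OF 1] by simp
      have 3: "((\<lambda>x. complex_of_real (r x)) has_derivative (\<lambda>v. of_real (Re (?R v)))) (at x)"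
        by (rule has_derivative_of_real[OF 2])
      have eq: "?R = (\<lambda>v. of_real (Re (?R v)))" by (rule has_derivative_unique[OF 1 3])
      have "smooth_on UNIV (iter_deriv (replicate l 1) \<Psi>)"
        using assms(2) by (auto simp: smooth_fun_iff_smooth_on intro!: smooth_on_iter_deriv)
      hence "(iter_deriv (replicate l 1) \<Psi> has_derivative
         frechet_derivative (iter_deriv (replicate l 1) \<Psi>) (at (r x))) (at (r x))" (is "(_ has_derivative ?P) _")
        by (intro smooth_on_has_derivative) auto
      hence "(f has_derivative (\<lambda>v. ?P (Re (?R v)))) (at x)"
        unfolding f using has_derivative_compose[OF 2] by blast
      moreover have "?P (Re (?R v)) = D x v" for v
      proof -
        have "linear ?P" using \<open>(iter_deriv (replicate l 1) \<Psi> has_derivative ?P) _\<close>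
          by (rule has_derivative_linear)
        hence "?P (Re (?R v)) = Re (?R v) *\<^sub>R ?P 1"
          by (metis linear_cmul mult.right_neutral real_scaleR_def)
        also have "\<dots> = of_real (Re (?R v)) * iter_deriv (replicate (Suc l) 1) \<Psi> (r x)"
          by (simp add: iter_deriv_Cons dir_deriv_def scaleR_conv_of_real)
        also have "of_real (Re (?R v)) = ?R v" using eq by metis
        finally show ?thesis by (simp add: D_def)
      qed
      ultimately show ?thesis by simp
    qed
    moreover have "(\<lambda>x. D x b) \<in> alg_closure G" if "b \<in> Basis" for b
    proof -
      have "(\<lambda>x. iter_deriv (replicate (Suc l) 1) \<Psi> (r x)) \<in> alg_closure G"
        by (rule alg_closure.base, unfold G_def) blast
      moreover have "(\<lambda>x. frechet_derivative (\<lambda>x. complex_of_real (r x)) (at x) b) \<in> alg_closure G"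
        using smooth_on_dir_deriv[OF assms(3) that]
        by (intro alg_closure.base) (simp add: G_def dir_deriv_def)
      ultimately show ?thesis unfolding D_def by (rule alg_closure.mult)
    qed
    ultimately show ?thesis by blast
  qed
  moreover have "(\<lambda>x. \<Psi> (r x)) \<in> alg_closure G"
    by (rule alg_closure.base) (auto simp: G_def image_iff intro!: exI[of _ "0::nat"])
  ultimately show ?thesis using smooth_on_alg_closure[OF assms(1)] by blast
qed

lemma smooth_on_continuous_on: "smooth_on S f \<Longrightarrow> continuous_on S f"
  unfolding smooth_on_def using differentiable_imp_continuous_on
  by (metis iter_deriv_Nil lists.Nil)

section \<open>Calculus of iterated partial derivatives\<close>

lemma dir_deriv_add:
  assumes "smooth_on UNIV f" "smooth_on UNIV g"
  shows "dir_deriv b (\<lambda>x. f x + g x) = (\<lambda>x. dir_deriv b f x + dir_deriv b g x)"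
proof
  fix x
  have "((\<lambda>x. f x + g x) has_derivative
    (\<lambda>v. frechet_derivative f (at x) v + frechet_derivative g (at x) v)) (at x)"
    using assms by (intro has_derivative_add smooth_on_has_derivative) auto
  thus "dir_deriv b (\<lambda>x. f x + g x) x = dir_deriv b f x + dir_deriv b g x"
    unfolding dir_deriv_def[of b f] dir_deriv_def[of b g] by (rule dir_deriv_eq)
qed

lemma dir_deriv_mult:
  assumes "smooth_on UNIV f" "smooth_on UNIV g"
  shows "dir_deriv b (\<lambda>x. f x * g x) = (\<lambda>x. dir_deriv b f x * g x + f x * dir_deriv b g x)"
proof
  fix x
  have "((\<lambda>x. f x * g x) has_derivative
    (\<lambda>v. f x * frechet_derivative g (at x) v + frechet_derivative f (at x) v * g x)) (at x)"
    using assms by (intro has_derivative_mult smooth_on_has_derivative) auto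
  from dir_deriv_eq[OF this, of b]
  show "dir_deriv b (\<lambda>x. f x * g x) x = dir_deriv b f x * g x + f x * dir_deriv b g x"
    unfolding dir_deriv_def[of b f] dir_deriv_def[of b g] by simp
qed

lemma dir_deriv_const: "dir_deriv b (\<lambda>_. c) = (\<lambda>_. 0)"
  by (rule ext, rule dir_deriv_eq) (rule has_derivative_const)

lemma iter_deriv_add:
  assumes "smooth_on UNIV f" "smooth_on UNIV g" "bs \<in> lists Basis"
  shows "iter_deriv bs (\<lambda>x. f x + g x) = (\<lambda>x. iter_deriv bs f x + iter_deriv bs g x)"
  using assms(3)
  by (induction bs) (auto simp: iter_deriv_Cons dir_deriv_add smooth_on_iter_deriv assms)

lemma iter_deriv_cmult:
  assumes "smooth_on UNIV f" "bs \<in> lists Basis"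
  shows "iter_deriv bs (\<lambda>x. c * f x) = (\<lambda>x. c * iter_deriv bs f x)"
  using assms(2)
  by (induction bs)
    (auto simp: iter_deriv_Cons dir_deriv_mult smooth_on_iter_deriv smooth_on_const assms(1) dir_deriv_const)

section \<open>Fourier transforms of integrable functions\<close>

text \<open>One unnormalised kernel with a sign parameter serves both transforms; its symmetry in
  the two variables is what \<open>ft_swap\<close> exploits.\<close>

definition ft :: "real \<Rightarrow> ('a::euclidean_space \<Rightarrow> complex) \<Rightarrow> 'a \<Rightarrow> complex"
  where "ft s h = (\<lambda>x. \<integral>\<xi>. iexp (s * (x \<bullet> \<xi>)) * h \<xi> \<partial>lborel)"

lemma fourier_eq_ft: "fourier f = ft (-1) f"
  by (rule ext) (simp add: fourier_def ft_def inner_commute)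

lemma inv_fourier_eq_ft: "inv_fourier f = (\<lambda>x. of_real (1 / (2 * pi) ^ DIM('a)) * ft 1 f x)"
  for f :: "'a::euclidean_space \<Rightarrow> complex"
  by (rule ext) (simp add: inv_fourier_def ft_def)

lemma measurable_iexp_inner [measurable]:
  "(\<lambda>\<xi>::'a::euclidean_space. iexp (s * (x \<bullet> \<xi>))) \<in> borel_measurable borel"
  by (intro borel_measurable_continuous_onI continuous_intros)

lemma integrable_bounded_mult:
  fixes f g :: "'a::euclidean_space \<Rightarrow> complex"
  assumes "integrable lborel g" "f \<in> borel_measurable borel" "\<And>x. cmod (f x) \<le> B"
  shows "integrable lborel (\<lambda>x. f x * g x)"
proof (rule Bochner_Integration.integrable_bound)
  show "integrable lborel (\<lambda>x. B * cmod (g x))"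
    using assms(1) by (intro integrable_mult_right integrable_norm)
  have [measurable]: "g \<in> borel_measurable borel" using borel_measurable_integrable[OF assms(1)] by simp
  note assms(2)[measurable]
  show "(\<lambda>x. f x * g x) \<in> borel_measurable lborel" by measurable
  show "AE x in lborel. cmod (f x * g x) \<le> norm (B * cmod (g x))"
  proof (rule AE_I2)
    fix x
    have "0 \<le> B" using assms(3)[of x] norm_ge_zero[of "f x"] by linarith
    thus "cmod (f x * g x) \<le> norm (B * cmod (g x))"
      using assms(3)[of x] by (simp add: norm_mult mult_right_mono)
  qed
qed

lemma ft_integrable: "integrable lborel h \<Longrightarrow> integrable lborel (\<lambda>\<xi>. iexp (s * (x \<bullet> \<xi>)) * h \<xi>)"
  for h :: "'a::euclidean_space \<Rightarrow> complex"
  by (rule integrable_bounded_mult[where B=1]) auto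

lemma ft_bound: "cmod (ft s h x) \<le> (\<integral>\<xi>. cmod (h \<xi>) \<partial>lborel)"
proof -
  have "cmod (ft s h x) \<le> (\<integral>\<xi>. cmod (iexp (s * (x \<bullet> \<xi>)) * h \<xi>) \<partial>lborel)"
    unfolding ft_def by (rule integral_norm_bound)
  thus ?thesis by (simp add: norm_mult)
qed

lemma ft_cmult: "ft s (\<lambda>x. c * h x) = (\<lambda>x. c * ft s h x)"
proof
  fix x
  have "ft s (\<lambda>x. c * h x) x = (\<integral>\<xi>. c * (iexp (s * (x \<bullet> \<xi>)) * h \<xi>) \<partial>lborel)"
    by (simp add: ft_def algebra_simps)
  thus "ft s (\<lambda>x. c * h x) x = c * ft s h x" by (simp add: ft_def)
qed

lemma ft_sum:
  assumes "\<And>i. i \<in> I \<Longrightarrow> integrable lborel (h i)"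
  shows "ft s (\<lambda>x. \<Sum>i\<in>I. h i x) = (\<lambda>x. \<Sum>i\<in>I. ft s (h i) x)"
proof
  fix x
  have "ft s (\<lambda>x. \<Sum>i\<in>I. h i x) x = (\<integral>\<xi>. (\<Sum>i\<in>I. iexp (s * (x \<bullet> \<xi>)) * h i \<xi>) \<partial>lborel)"
    by (simp add: ft_def sum_distrib_left)
  also have "\<dots> = (\<Sum>i\<in>I. ft s (h i) x)"
    unfolding ft_def by (rule Bochner_Integration.integral_sum) (intro ft_integrable assms)
  finally show "ft s (\<lambda>x. \<Sum>i\<in>I. h i x) x = (\<Sum>i\<in>I. ft s (h i) x)" .
qed

lemma ft_add:
  assumes "integrable lborel f" "integrable lborel g"
  shows "ft s (\<lambda>x. f x + g x) = (\<lambda>x. ft s f x + ft s g x)"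
  using ft_sum[of "{True, False}" "\<lambda>b. if b then f else g" s] assms by simp

lemma ft_minus_arg: "ft s h (- x) = ft (- s) h x"
  by (simp add: ft_def)

lemma ft_continuous:
  assumes "integrable lborel h"
  shows "continuous_on UNIV (ft s h)"
  unfolding continuous_on_sequentially
proof (intro ballI allI impI)
  fix X :: "nat \<Rightarrow> 'a" and a assume "(\<forall>n. X n \<in> UNIV) \<and> X \<longlonglongrightarrow> a"
  hence X: "X \<longlonglongrightarrow> a" by auto
  have [measurable]: "h \<in> borel_measurable borel" using borel_measurable_integrable[OF assms] by simp
  have "(\<lambda>n. \<integral>\<xi>. iexp (s * (X n \<bullet> \<xi>)) * h \<xi> \<partial>lborel) \<longlonglongrightarrow> (\<integral>\<xi>. iexp (s * (a \<bullet> \<xi>)) * h \<xi> \<partial>lborel)"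
    by (rule integral_dominated_convergence[where w="\<lambda>\<xi>. cmod (h \<xi>)"])
      (auto simp: norm_mult assms intro!: AE_I2 tendsto_intros X)
  thus "(ft s h \<circ> X) \<longlonglongrightarrow> ft s h a" by (simp add: ft_def comp_def)
qed

lemma ft_measurable [measurable (raw)]: "integrable lborel h \<Longrightarrow> ft s h \<in> borel_measurable borel"
  by (intro borel_measurable_continuous_onI ft_continuous)

lemma integrable_tensor:
  fixes f g :: "'a::euclidean_space \<Rightarrow> complex"
  assumes f: "integrable lborel f" and g: "integrable lborel g"
  shows "integrable (lborel \<Otimes>\<^sub>M lborel) (\<lambda>(x,y). iexp (s * (x \<bullet> y)) * (f x * g y))"
proof (rule lborel_pair.Fubini_integrable)
  have [measurable]: "f \<in> borel_measurable borel" "g \<in> borel_measurable borel"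
    using borel_measurable_integrable[OF f] borel_measurable_integrable[OF g] by simp_all
  have "(\<lambda>z::'a\<times>'a. iexp (s * (fst z \<bullet> snd z))) \<in> borel_measurable borel"
    by (intro borel_measurable_continuous_onI continuous_intros)
  hence [measurable]: "(\<lambda>z::'a\<times>'a. iexp (s * (fst z \<bullet> snd z))) \<in> borel_measurable (lborel \<Otimes>\<^sub>M lborel)"
    by (simp add: borel_prod[symmetric])
  show "(\<lambda>(x,y). iexp (s * (x \<bullet> y)) * (f x * g y)) \<in> borel_measurable (lborel \<Otimes>\<^sub>M lborel)"
    unfolding case_prod_beta by measurable
  have "(\<lambda>x. \<integral>y. norm (iexp (s * (x \<bullet> y)) * (f x * g y)) \<partial>lborel)
     = (\<lambda>x. cmod (f x) * (\<integral>y. cmod (g y) \<partial>lborel))"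
    by (simp add: norm_mult)
  thus "integrable lborel (\<lambda>x. \<integral>y. norm (case (x, y) of (x, y) \<Rightarrow> iexp (s * (x \<bullet> y)) * (f x * g y)) \<partial>lborel)"
    using f by simp
  show "AE x in lborel. integrable lborel (\<lambda>y. case (x, y) of (x, y) \<Rightarrow> iexp (s * (x \<bullet> y)) * (f x * g y))"
  proof (rule AE_I2)
    fix x
    have "integrable lborel (\<lambda>y. f x * (iexp (s * (x \<bullet> y)) * g y))"
      by (intro integrable_mult_right ft_integrable g)
    thus "integrable lborel (\<lambda>y. case (x, y) of (x, y) \<Rightarrow> iexp (s * (x \<bullet> y)) * (f x * g y))"
      by (simp add: algebra_simps)
  qed
qed

text \<open>The multiplication formula, by Fubini and the symmetry of the kernel. It underlies
  inversion, the convolution formula and the evaluation of Fourier multipliers.\<close>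

lemma ft_swap:
  fixes f g :: "'a::euclidean_space \<Rightarrow> complex"
  assumes f: "integrable lborel f" and g: "integrable lborel g"
  shows "(\<integral>x. f x * ft s g x \<partial>lborel) = (\<integral>x. ft s f x * g x \<partial>lborel)"
proof -
  have "(\<integral>x. f x * ft s g x \<partial>lborel) = (\<integral>x. (\<integral>y. iexp (s * (x \<bullet> y)) * (f x * g y) \<partial>lborel) \<partial>lborel)"
    unfolding ft_def by (subst integral_mult_right_zero[symmetric]) (simp add: algebra_simps)
  also have "\<dots> = (\<integral>y. (\<integral>x. iexp (s * (x \<bullet> y)) * (f x * g y) \<partial>lborel) \<partial>lborel)"
    using lborel_pair.Fubini_integral[OF integrable_tensor[OF f g, of s]] by simp
  also have "\<dots> = (\<integral>y. ft s f y * g y \<partial>lborel)"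
    unfolding ft_def by (subst integral_mult_left_zero[symmetric]) (simp add: algebra_simps inner_commute)
  finally show ?thesis .
qed

section \<open>Changes of variables and Gaussian integrals\<close>

lemma
  fixes f :: "'a::euclidean_space \<Rightarrow> 'b::{banach,second_countable_topology}"
  assumes c: "c \<noteq> 0" and [measurable]: "f \<in> borel_measurable borel"
  shows lborel_integral_affine:
      "(\<integral>x. f x \<partial>lborel) = \<bar>c\<bar> ^ DIM('a) *\<^sub>R (\<integral>x. f (t + c *\<^sub>R x) \<partial>lborel)"
    and lborel_integrable_affine:
      "integrable lborel (\<lambda>x. f (t + c *\<^sub>R x)) \<longleftrightarrow> integrable lborel f"
proof -
  have "(\<integral>x. f x \<partial>lborel) = (\<integral>x. f x \<partial>(density (distr lborel borel (\<lambda>x. t + c *\<^sub>R x)) (\<lambda>_. \<bar>c\<bar>^DIM('a))))"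
    using lborel_affine[OF c, of t] by simp
  also have "\<dots> = \<bar>c\<bar> ^ DIM('a) *\<^sub>R (\<integral>x. f (t + c *\<^sub>R x) \<partial>lborel)"
    by (subst integral_density) (auto simp: integral_distr)
  finally show "(\<integral>x. f x \<partial>lborel) = \<bar>c\<bar> ^ DIM('a) *\<^sub>R (\<integral>x. f (t + c *\<^sub>R x) \<partial>lborel)" .
  have "integrable lborel f \<longleftrightarrow> integrable (density (distr lborel borel (\<lambda>x. t + c *\<^sub>R x)) (\<lambda>_. \<bar>c\<bar>^DIM('a))) f"
    using lborel_affine[OF c, of t] by simp
  also have "\<dots> \<longleftrightarrow> integrable lborel (\<lambda>x. \<bar>c\<bar>^DIM('a) *\<^sub>R f (t + c *\<^sub>R x))"
    by (subst integrable_density) (auto simp: integrable_distr_eq)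
  also have "\<dots> \<longleftrightarrow> integrable lborel (\<lambda>x. f (t + c *\<^sub>R x))"
  proof
    assume "integrable lborel (\<lambda>x. \<bar>c\<bar>^DIM('a) *\<^sub>R f (t + c *\<^sub>R x))"
    hence *: "integrable lborel (\<lambda>x. (1 / \<bar>c\<bar>^DIM('a)) *\<^sub>R (\<bar>c\<bar>^DIM('a) *\<^sub>R f (t + c *\<^sub>R x)))"
      by (rule integrable_scaleR_right)
    have eq: "(\<lambda>x. (1 / \<bar>c\<bar>^DIM('a)) *\<^sub>R (\<bar>c\<bar>^DIM('a) *\<^sub>R f (t + c *\<^sub>R x))) = (\<lambda>x. f (t + c *\<^sub>R x))"
      using c by simp
    show "integrable lborel (\<lambda>x. f (t + c *\<^sub>R x))" using * unfolding eq .
  qed (intro integrable_scaleR_right)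
  finally show "integrable lborel (\<lambda>x. f (t + c *\<^sub>R x)) \<longleftrightarrow> integrable lborel f" by simp
qed

lemma
  fixes f :: "'a::euclidean_space \<Rightarrow> real \<Rightarrow> complex"
  assumes "\<And>b. b \<in> Basis \<Longrightarrow> integrable lborel (f b)"
  shows integral_lborel_prod:
      "(\<integral>x. (\<Prod>b\<in>Basis. f b (x \<bullet> b)) \<partial>lborel) = (\<Prod>b\<in>Basis. (\<integral>x. f b x \<partial>lborel))"
    and integrable_lborel_prod:
      "integrable lborel (\<lambda>x. (\<Prod>b\<in>Basis. f b (x \<bullet> b)))"
proof -
  interpret product_sigma_finite "\<lambda>_::'a. lborel :: real measure" by standard
  have [measurable]: "f b \<in> borel_measurable borel" if "b \<in> Basis" for b
    using borel_measurable_integrable[OF assms[OF that]] by simp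
  have m: "(\<lambda>x. (\<Prod>b\<in>Basis. f b (x \<bullet> b))) \<in> borel_measurable borel" by measurable
  have eq: "(\<Prod>b\<in>Basis. f b ((\<Sum>b\<in>Basis. x b *\<^sub>R b) \<bullet> b)) = (\<Prod>b\<in>Basis. f b (x b))" for x :: "'a \<Rightarrow> real"
    by (intro prod.cong) auto
  have "(\<integral>x. (\<Prod>b\<in>Basis. f b (x \<bullet> b)) \<partial>lborel)
     = (\<integral>x. (\<Prod>b\<in>Basis. f b (x b)) \<partial>(\<Pi>\<^sub>M b\<in>Basis. lborel))"
    by (subst lborel_eq, subst integral_distr) (auto simp: m eq)
  also have "\<dots> = (\<Prod>b\<in>Basis. (\<integral>x. f b x \<partial>lborel))"
    by (rule product_integral_prod) (auto intro: assms)
  finally show "(\<integral>x. (\<Prod>b\<in>Basis. f b (x \<bullet> b)) \<partial>lborel) = (\<Prod>b\<in>Basis. (\<integral>x. f b x \<partial>lborel))" .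
  have "integrable (\<Pi>\<^sub>M b\<in>Basis. lborel) (\<lambda>x. (\<Prod>b\<in>Basis. f b (x b)))"
    by (rule product_integrable_prod) (auto intro: assms)
  thus "integrable lborel (\<lambda>x. (\<Prod>b\<in>Basis. f b (x \<bullet> b)))"
    by (subst lborel_eq, subst integrable_distr_eq) (auto simp: m eq)
qed

text \<open>Up to normalisation this is the characteristic function of the standard normal law; the
  product structure of the Gaussian carries it to all dimensions.\<close>

lemma
  shows integrable_gaussian_1d: "integrable lborel (\<lambda>y::real. iexp (t * y) * of_real (exp (- y\<^sup>2 / 2)))"
    and integral_gaussian_1d: "(\<integral>y. iexp (t * y) * of_real (exp (- y\<^sup>2 / 2)) \<partial>lborel)
      = of_real (sqrt (2 * pi) * exp (- t\<^sup>2 / 2))"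
proof -
  have e: "of_real (exp (- y\<^sup>2 / 2)) = complex_of_real (sqrt (2 * pi) * std_normal_density y)" for y :: real
    by (simp add: std_normal_density_def)
  have i: "integrable lborel (\<lambda>y::real. complex_of_real (exp (- y\<^sup>2 / 2)))"
    unfolding e using integrable_std_normal_moment[of 0] by simp
  show "integrable lborel (\<lambda>y::real. iexp (t * y) * of_real (exp (- y\<^sup>2 / 2)))"
    using ft_integrable[OF i, of 1 t] by simp
  have "(\<integral>y. iexp (t * y) * of_real (exp (- y\<^sup>2 / 2)) \<partial>lborel) =
      (\<integral>y. sqrt (2 * pi) * (std_normal_density y *\<^sub>R iexp (t * y)) \<partial>lborel)"
    unfolding e by (intro Bochner_Integration.integral_cong refl) (simp add: scaleR_conv_of_real)
  also have "\<dots> = sqrt (2 * pi) * (\<integral>y. std_normal_density y *\<^sub>R iexp (t * y) \<partial>lborel)"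
    by (rule integral_mult_right_zero)
  also have "(\<integral>y. std_normal_density y *\<^sub>R iexp (t * y) \<partial>lborel) = char std_normal_distribution t"
    unfolding char_def by (subst integral_density) auto
  also have "\<dots> = of_real (exp (- t\<^sup>2 / 2))" by (simp add: char_std_normal_distribution)
  finally show "(\<integral>y. iexp (t * y) * of_real (exp (- y\<^sup>2 / 2)) \<partial>lborel)
      = of_real (sqrt (2 * pi) * exp (- t\<^sup>2 / 2))" by simp
qed

definition gaussian :: "'a::euclidean_space \<Rightarrow> complex"
  where "gaussian x = of_real (exp (- (norm x)\<^sup>2 / 2))"

lemma gaussian_continuous [continuous_intros]: "continuous_on A f \<Longrightarrow> continuous_on A (\<lambda>x. gaussian (f x))"
  unfolding gaussian_def by (intro continuous_intros) auto

lemma gaussian_measurable [measurable]: "gaussian \<in> borel_measurable borel"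
  by (intro borel_measurable_continuous_onI continuous_intros)

lemma gaussian_prod:
  "iexp (x \<bullet> y) * gaussian y = (\<Prod>b\<in>Basis. iexp ((x \<bullet> b) * (y \<bullet> b)) * of_real (exp (- (y \<bullet> b)\<^sup>2 / 2)))"
proof -
  have "gaussian y = of_real (exp (\<Sum>b\<in>Basis. - (y \<bullet> b)\<^sup>2 / 2))"
    unfolding gaussian_def power2_norm_eq_inner
    by (subst euclidean_inner) (simp add: sum_negf sum_divide_distrib power2_eq_square)
  also have "\<dots> = (\<Prod>b\<in>Basis. of_real (exp (- (y \<bullet> b)\<^sup>2 / 2)))"
    by (simp add: exp_sum)
  finally have 1: "gaussian y = (\<Prod>b\<in>Basis. of_real (exp (- (y \<bullet> b)\<^sup>2 / 2)))" .
  have "iexp (x \<bullet> y) = exp (\<Sum>b\<in>Basis. \<i> * of_real ((x \<bullet> b) * (y \<bullet> b)))"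
    by (subst euclidean_inner) (simp add: sum_distrib_left)
  also have "\<dots> = (\<Prod>b\<in>Basis. iexp ((x \<bullet> b) * (y \<bullet> b)))" by (simp add: exp_sum)
  finally show ?thesis unfolding 1 by (simp add: prod.distrib)
qed

lemma gaussian_integrable: "integrable lborel (gaussian :: 'a::euclidean_space \<Rightarrow> complex)"
  using integrable_lborel_prod[of "\<lambda>b y. iexp (((0::'a) \<bullet> b) * y) * of_real (exp (- y\<^sup>2 / 2))"]
    integrable_gaussian_1d by (simp only: gaussian_prod[symmetric]) simp

lemma ft_gaussian: "ft 1 gaussian x = of_real (sqrt (2 * pi) ^ DIM('a)) * gaussian x"
  for x :: "'a::euclidean_space"
proof -
  have "ft 1 gaussian x = (\<Prod>b\<in>Basis. of_real (sqrt (2 * pi) * exp (- (x \<bullet> b)\<^sup>2 / 2)))"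
    unfolding ft_def mult_1_left gaussian_prod
    by (subst integral_lborel_prod[OF integrable_gaussian_1d]) (simp only: integral_gaussian_1d)
  also have "\<dots> = of_real (sqrt (2 * pi) ^ DIM('a)) * (\<Prod>b\<in>Basis. iexp ((0 \<bullet> b) * (x \<bullet> b)) * of_real (exp (- (x \<bullet> b)\<^sup>2 / 2)))"
    by (simp add: prod.distrib)
  finally show ?thesis unfolding gaussian_prod[symmetric] by simp
qed

text \<open>Gaussian regularisation: the integral of \<open>k n\<close> times
  \<open>fourier F\<close> is evaluated in two ways. Directly it tends to the inversion integral;
  after the transform has been moved to \<open>k n\<close> it is a weighted mean of \<open>F\<close>
  around \<open>x0\<close> that tends to a multiple of \<open>F x0\<close>.\<close>

theorem inv_fourier_fourier:
  fixes F :: "'a::euclidean_space \<Rightarrow> complex"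
  assumes cont: "continuous_on UNIV F" and int: "integrable lborel F"
    and bd: "\<And>x. cmod (F x) \<le> B" and int2: "integrable lborel (fourier F)"
  shows "inv_fourier (fourier F) = F"
proof
  fix x0 :: 'a
  define \<epsilon> :: "nat \<Rightarrow> real" where "\<epsilon> n = 1 / (real n + 1)" for n
  have \<epsilon>0: "\<epsilon> n > 0" for n by (simp add: \<epsilon>_def)
  have \<epsilon>lim: "\<epsilon> \<longlonglongrightarrow> 0" unfolding \<epsilon>_def by real_asymp
  define D where "D = DIM('a)"
  have [measurable]: "F \<in> borel_measurable borel" using cont by (rule borel_measurable_continuous_onI)
  have [measurable]: "fourier F \<in> borel_measurable borel" using borel_measurable_integrable[OF int2] by simp
  define k where "k n \<xi> = iexp (1 * (x0 \<bullet> \<xi>)) * gaussian (\<epsilon> n *\<^sub>R \<xi>)" for n \<xi>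
  have gint: "integrable lborel (\<lambda>\<xi>::'a. gaussian (\<epsilon> n *\<^sub>R \<xi>))" for n
    using lborel_integrable_affine[of "\<epsilon> n" "gaussian :: 'a \<Rightarrow> complex" 0] \<epsilon>0[of n] gaussian_integrable by simp
  have kint: "integrable lborel (k n)" for n
    unfolding k_def by (rule ft_integrable[OF gint])
  \<comment> \<open>The transform of \<open>k n\<close> is a Gaussian of width
    \<open>\<epsilon> n\<close> centred at \<open>x0\<close>, an approximate identity up to a
    constant factor.\<close>
  have ftk: "ft (-1) (k n) x = of_real (sqrt (2 * pi) ^ D / \<epsilon> n ^ D) * gaussian ((x - x0) /\<^sub>R \<epsilon> n)" for n x
  proof -
    have "ft (-1) (k n) x = (\<integral>\<xi>. iexp (((x0 - x) /\<^sub>R \<epsilon> n) \<bullet> (\<epsilon> n *\<^sub>R \<xi>)) * gaussian (\<epsilon> n *\<^sub>R \<xi>) \<partial>lborel)"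
    proof -
      have "iexp (((x0 - x) /\<^sub>R \<epsilon> n) \<bullet> (\<epsilon> n *\<^sub>R \<xi>)) = iexp (-1 * (x \<bullet> \<xi>)) * iexp (1 * (x0 \<bullet> \<xi>))" for \<xi>
      proof -
        have e: "((x0 - x) /\<^sub>R \<epsilon> n) \<bullet> (\<epsilon> n *\<^sub>R \<xi>) = -1 * (x \<bullet> \<xi>) + 1 * (x0 \<bullet> \<xi>)"
          using \<epsilon>0[of n] by (simp add: inner_diff_left)
        show ?thesis unfolding e of_real_add distrib_left exp_add ..
      qed
      thus ?thesis unfolding ft_def k_def by (simp only: mult.assoc)
    qed
    also have "\<dots> = (1 / \<epsilon> n ^ D) *\<^sub>R (\<integral>\<xi>. iexp (((x0 - x) /\<^sub>R \<epsilon> n) \<bullet> \<xi>) * gaussian \<xi> \<partial>lborel)"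
      using lborel_integral_affine[of "\<epsilon> n" "\<lambda>\<xi>. iexp (((x0 - x) /\<^sub>R \<epsilon> n) \<bullet> \<xi>) * gaussian \<xi>" 0] \<epsilon>0[of n]
      by (simp add: D_def)
    also have "(\<integral>\<xi>. iexp (((x0 - x) /\<^sub>R \<epsilon> n) \<bullet> \<xi>) * gaussian \<xi> \<partial>lborel) = ft 1 gaussian ((x0 - x) /\<^sub>R \<epsilon> n)"
      by (simp add: ft_def)
    also have "\<dots> = of_real (sqrt (2 * pi) ^ D) * gaussian ((x - x0) /\<^sub>R \<epsilon> n)"
      unfolding ft_gaussian D_def by (simp add: gaussian_def norm_minus_commute)
    finally show ?thesis by (simp add: scaleR_conv_of_real)
  qed
  have "(\<integral>\<xi>. k n \<xi> * fourier F \<xi> \<partial>lborel) = of_real (sqrt (2 * pi) ^ D) * (\<integral>y. gaussian y * F (x0 + \<epsilon> n *\<^sub>R y) \<partial>lborel)" for n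
  proof -
    have "(\<integral>\<xi>. k n \<xi> * fourier F \<xi> \<partial>lborel) = (\<integral>x. ft (-1) (k n) x * F x \<partial>lborel)"
      unfolding fourier_eq_ft by (rule ft_swap[OF kint int])
    also have "\<dots> = (\<epsilon> n ^ D) *\<^sub>R (\<integral>y. ft (-1) (k n) (x0 + \<epsilon> n *\<^sub>R y) * F (x0 + \<epsilon> n *\<^sub>R y) \<partial>lborel)"
      using lborel_integral_affine[of "\<epsilon> n" "\<lambda>x. ft (-1) (k n) x * F x" x0] \<epsilon>0[of n] kint
      by (simp add: D_def)
    also have "\<dots> = (\<epsilon> n ^ D) *\<^sub>R (\<integral>y. of_real (sqrt (2 * pi) ^ D / \<epsilon> n ^ D) * (gaussian y * F (x0 + \<epsilon> n *\<^sub>R y)) \<partial>lborel)"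
      unfolding ftk using \<epsilon>0[of n] by (simp add: mult.assoc)
    also have "\<dots> = of_real (sqrt (2 * pi) ^ D) * (\<integral>y. gaussian y * F (x0 + \<epsilon> n *\<^sub>R y) \<partial>lborel)"
      using \<epsilon>0[of n] by (simp add: scaleR_conv_of_real)
    finally show ?thesis .
  qed
  \<comment> \<open>Continuity of \<open>F\<close> gives the pointwise limit, and its bound
    \<open>B\<close> the integrable majorant.\<close>
  moreover have "(\<lambda>n. \<integral>y. gaussian y * F (x0 + \<epsilon> n *\<^sub>R y) \<partial>lborel) \<longlonglongrightarrow> (\<integral>y. gaussian y * F (x0 + 0 *\<^sub>R y) \<partial>lborel)"
  proof (rule integral_dominated_convergence[where w="\<lambda>y. B * cmod (gaussian y)"])
    show "AE y in lborel. (\<lambda>n. gaussian y * F (x0 + \<epsilon> n *\<^sub>R y)) \<longlonglongrightarrow> gaussian y * F (x0 + 0 *\<^sub>R y)"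
    proof (rule AE_I2)
      fix y
      have "(\<lambda>n. x0 + \<epsilon> n *\<^sub>R y) \<longlonglongrightarrow> x0 + 0 *\<^sub>R y" by (intro tendsto_intros \<epsilon>lim)
      hence "(\<lambda>n. F (x0 + \<epsilon> n *\<^sub>R y)) \<longlonglongrightarrow> F (x0 + 0 *\<^sub>R y)"
        using continuous_on_tendsto_compose[OF cont] by simp
      thus "(\<lambda>n. gaussian y * F (x0 + \<epsilon> n *\<^sub>R y)) \<longlonglongrightarrow> gaussian y * F (x0 + 0 *\<^sub>R y)"
        by (intro tendsto_intros)
    qed
    show "AE y in lborel. cmod (gaussian y * F (x0 + \<epsilon> n *\<^sub>R y)) \<le> B * cmod (gaussian y)" for n
      by (intro AE_I2) (simp add: norm_mult mult.commute[of "cmod (gaussian _)"] mult_right_mono bd)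
    show "integrable lborel (\<lambda>y::'a. B * cmod (gaussian y))"
      by (intro integrable_mult_right integrable_norm gaussian_integrable)
  qed measurable
  hence "(\<lambda>n. of_real (sqrt (2 * pi) ^ D) * (\<integral>y. gaussian y * F (x0 + \<epsilon> n *\<^sub>R y) \<partial>lborel))
     \<longlonglongrightarrow> of_real (sqrt (2 * pi) ^ D) * ((\<integral>y. gaussian (y::'a) \<partial>lborel) * F x0)"
    by (intro tendsto_intros) simp
  moreover have "(\<integral>y. gaussian (y::'a) \<partial>lborel) = of_real (sqrt (2 * pi) ^ D)"
    using ft_gaussian[of "0::'a"] by (simp add: ft_def D_def gaussian_def)
  moreover have "complex_of_real (sqrt (2 * pi) ^ D) * (complex_of_real (sqrt (2 * pi) ^ D) * F x0)
      = of_real ((2 * pi) ^ D) * F x0"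
    unfolding mult.assoc[symmetric] of_real_mult[symmetric] power_mult_distrib[symmetric] by simp
  ultimately have 1: "(\<lambda>n. \<integral>\<xi>. k n \<xi> * fourier F \<xi> \<partial>lborel) \<longlonglongrightarrow> of_real ((2 * pi) ^ D) * F x0"
    by (simp only:)
  have 2: "(\<lambda>n. \<integral>\<xi>. k n \<xi> * fourier F \<xi> \<partial>lborel) \<longlonglongrightarrow> (\<integral>\<xi>. iexp (1 * (x0 \<bullet> \<xi>)) * gaussian (0 *\<^sub>R \<xi>) * fourier F \<xi> \<partial>lborel)"
  proof (rule integral_dominated_convergence[where w="\<lambda>y. cmod (fourier F y)"])
    show "AE \<xi> in lborel. (\<lambda>n. k n \<xi> * fourier F \<xi>) \<longlonglongrightarrow> iexp (1 * (x0 \<bullet> \<xi>)) * gaussian (0 *\<^sub>R \<xi>) * fourier F \<xi>"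
      unfolding k_def gaussian_def by (intro AE_I2 tendsto_intros \<epsilon>lim) auto
    show "AE \<xi> in lborel. cmod (k n \<xi> * fourier F \<xi>) \<le> cmod (fourier F \<xi>)" for n
      by (intro AE_I2) (auto simp: k_def norm_mult gaussian_def intro!: mult_left_le_one_le)
    show "integrable lborel (\<lambda>y. cmod (fourier F y))" by (intro integrable_norm int2)
    show "(\<lambda>\<xi>. k n \<xi> * fourier F \<xi>) \<in> borel_measurable lborel" for n
      using borel_measurable_integrable[OF kint[of n]] by measurable
  qed measurable
  have "(\<integral>\<xi>. iexp (1 * (x0 \<bullet> \<xi>)) * gaussian (0 *\<^sub>R \<xi>) * fourier F \<xi> \<partial>lborel) = of_real ((2 * pi) ^ D) * F x0"
    by (rule LIMSEQ_unique[OF 2 1])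
  thus "inv_fourier (fourier F) x0 = F x0"
    by (simp add: inv_fourier_def gaussian_def D_def)
qed

text \<open>The product over the coordinates of the integrable functions 1/(1 + t^2) is a majorant,
  because each 1 + (x \<bullet> b)^2 is at most (1 + norm x)^2. This accounts for the exponent
  \<open>2 * DIM('a)\<close>.\<close>

lemma integrable_decay:
  "integrable lborel (\<lambda>x::'a::euclidean_space. 1 / (1 + norm x) ^ (2 * DIM('a)))"
proof -
  have "integrable lborel (\<lambda>x::real. inverse (1 + x\<^sup>2))"
    using integrable_inverse_1_plus_square by (simp add: set_integrable_def)
  hence 1: "integrable lborel (\<lambda>x::real. complex_of_real (inverse (1 + x\<^sup>2)))"
    by (rule integrable_of_real)
  have 2: "integrable lborel (\<lambda>x::'a. \<Prod>b\<in>Basis. complex_of_real (inverse (1 + (x \<bullet> b)\<^sup>2)))"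
    by (rule integrable_lborel_prod[OF 1])
  show ?thesis
  proof (rule Bochner_Integration.integrable_bound[OF 2])
    show "(\<lambda>x::'a. 1 / (1 + norm x) ^ (2 * DIM('a))) \<in> borel_measurable lborel" by measurable
    have "1 / (1 + norm x) ^ (2 * DIM('a)) \<le> (\<Prod>b\<in>Basis. inverse (1 + (x \<bullet> b)\<^sup>2))" for x :: 'a
    proof -
      have "(\<Prod>b\<in>Basis. 1 + (x \<bullet> b)\<^sup>2) \<le> (\<Prod>b\<in>(Basis::'a set). (1 + norm x)\<^sup>2)"
      proof (intro prod_mono conjI)
        fix b :: 'a assume "b \<in> Basis"
        hence "\<bar>x \<bullet> b\<bar> \<le> norm x" by (rule Basis_le_norm)
        hence "(x \<bullet> b)\<^sup>2 \<le> (norm x)\<^sup>2" by (metis abs_ge_zero power2_abs power_mono)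
        thus "1 + (x \<bullet> b)\<^sup>2 \<le> (1 + norm x)\<^sup>2"
          by (simp add: power2_sum add_increasing2)
      qed auto
      hence "(\<Prod>b\<in>Basis. 1 + (x \<bullet> b)\<^sup>2) \<le> (1 + norm x) ^ (2 * DIM('a))"
        by (simp add: power_mult)
      moreover have "(\<Prod>b\<in>Basis. 1 + (x \<bullet> b)\<^sup>2) > 0" by (intro prod_pos) (simp add: add_pos_nonneg)
      ultimately show ?thesis unfolding prod_inversef inverse_eq_divide[symmetric]
        by (simp add: prod_inversef[unfolded comp_def] le_imp_inverse_le)
    qed
    moreover have "(\<Prod>b\<in>Basis. inverse (1 + (x \<bullet> b)\<^sup>2)) \<ge> 0" for x :: 'a
      by (intro prod_nonneg) auto
    ultimately show "AE x::'a in lborel. norm (1 / (1 + norm x) ^ (2 * DIM('a)))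
        \<le> norm (\<Prod>b\<in>Basis. complex_of_real (inverse (1 + (x \<bullet> b)\<^sup>2)))"
      by (intro AE_I2) (simp add: of_real_prod[symmetric] abs_of_nonneg prod_nonneg
        del: of_real_inverse of_real_prod)
  qed
qed

section \<open>Fourier transforms of test functions\<close>

lemma bounded_support_subset_cbox:
  fixes h :: "'a::euclidean_space \<Rightarrow> complex"
  assumes "bounded {x. h x \<noteq> 0}"
  obtains a b where "\<And>x. x \<notin> cbox a b \<Longrightarrow> h x = 0"
proof -
  obtain a where "{x. h x \<noteq> 0} \<subseteq> cbox (- a) a" using bounded_subset_cbox_symmetric[OF assms] .
  thus ?thesis using that[of "- a" a] by auto
qed

lemma bounded_support_integrable:
  fixes h :: "'a::euclidean_space \<Rightarrow> complex"
  assumes "continuous_on UNIV h" "bounded {x. h x \<noteq> 0}"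
  shows "integrable lborel h"
proof -
  obtain a b where ab: "\<And>x. x \<notin> cbox a b \<Longrightarrow> h x = 0"
    using bounded_support_subset_cbox[OF assms(2)] by blast
  have 1: "integrable lborel (\<lambda>x. indicator (cbox a b) x *\<^sub>R h x)"
    by (rule borel_integrable_compact) (auto intro: continuous_on_subset[OF assms(1)])
  have eq: "(\<lambda>x. indicator (cbox a b) x *\<^sub>R h x) = h"
  proof
    fix x show "indicator (cbox a b) x *\<^sub>R h x = h x" using ab[of x] by (cases "x \<in> cbox a b") simp_all
  qed
  show ?thesis using 1 unfolding eq .
qed

lemma bounded_support_bounded:
  fixes h :: "'a::euclidean_space \<Rightarrow> complex"
  assumes "continuous_on UNIV h" "bounded {x. h x \<noteq> 0}"
  obtains B where "B \<ge> 0" "\<And>x. cmod (h x) \<le> B"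
proof -
  obtain a b where ab: "\<And>x. x \<notin> cbox a b \<Longrightarrow> h x = 0"
    using bounded_support_subset_cbox[OF assms(2)] by blast
  have "compact (h ` cbox a b)"
    by (rule compact_continuous_image) (auto intro: continuous_on_subset[OF assms(1)])
  then obtain B where B: "\<And>x. x \<in> cbox a b \<Longrightarrow> cmod (h x) \<le> B"
    using compact_imp_bounded[of "h ` cbox a b"] unfolding bounded_iff by auto
  have "cmod (h x) \<le> max B 0" for x using B[of x] ab[of x] by (cases "x \<in> cbox a b") auto
  thus ?thesis using that[of "max B 0"] by auto
qed

section \<open>Closure properties of test functions\<close>

lemma test_funs_iff: "f \<in> test_funs \<longleftrightarrow> smooth_on UNIV f \<and> bounded {x. f x \<noteq> 0}"
  by (simp add: test_funs_def smooth_fun_iff_smooth_on)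

lemma test_funsI: "smooth_on UNIV f \<Longrightarrow> bounded S \<Longrightarrow> (\<And>x. x \<notin> S \<Longrightarrow> f x = 0) \<Longrightarrow> f \<in> test_funs"
  unfolding test_funs_iff by (auto intro: bounded_subset)

lemma test_funs_smooth: "f \<in> test_funs \<Longrightarrow> smooth_on UNIV f"
  and test_funs_support: "f \<in> test_funs \<Longrightarrow> bounded {x. f x \<noteq> 0}"
  and test_funs_continuous: "f \<in> test_funs \<Longrightarrow> continuous_on UNIV f"
  by (auto simp: test_funs_iff smooth_on_continuous_on)

lemma test_funs_integrable: "f \<in> test_funs \<Longrightarrow> integrable lborel f"
  by (intro bounded_support_integrable test_funs_continuous test_funs_support)

lemma test_funs_mult:
  assumes "f \<in> test_funs" "smooth_on UNIV g"
  shows "(\<lambda>x. g x * f x) \<in> test_funs"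
  by (rule test_funsI[OF smooth_on_mult test_funs_support[OF assms(1)]])
    (auto simp: assms test_funs_smooth)

lemma test_funs_cmult: "f \<in> test_funs \<Longrightarrow> (\<lambda>x. c * f x) \<in> test_funs"
  by (rule test_funs_mult) (auto intro: smooth_on_const)

lemma test_funs_zero: "(\<lambda>_. 0) \<in> test_funs"
  by (auto simp: test_funs_iff smooth_on_const)

lemma test_funs_add:
  assumes "f \<in> test_funs" "g \<in> test_funs"
  shows "(\<lambda>x. f x + g x) \<in> test_funs"
  by (rule test_funsI[of _ "{x. f x \<noteq> 0} \<union> {x. g x \<noteq> 0}"])
    (use assms in \<open>auto simp: test_funs_smooth test_funs_support intro: smooth_on_add\<close>)

lemma test_funs_sum: "(\<And>i. i \<in> I \<Longrightarrow> f i \<in> test_funs) \<Longrightarrow> (\<lambda>x. \<Sum>i\<in>I. f i x) \<in> test_funs"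
  by (induction I rule: infinite_finite_induct) (auto intro: test_funs_zero test_funs_add)

lemma test_funs_dir_deriv:
  assumes "f \<in> test_funs" "b \<in> Basis"
  shows "dir_deriv b f \<in> test_funs"
proof (rule test_funsI)
  show "smooth_on UNIV (dir_deriv b f)" using assms by (intro smooth_on_dir_deriv test_funs_smooth)
  show "bounded (closure {x. f x \<noteq> 0})" using test_funs_support[OF assms(1)] by (rule bounded_closure)
  fix x assume "x \<notin> closure {x. f x \<noteq> 0}"
  hence "dir_deriv b f x = dir_deriv b (\<lambda>_. 0) x"
    using closure_subset[of "{x. f x \<noteq> 0}"]
    by (intro dir_deriv_cong_open[of "- closure {x. f x \<noteq> 0}"]) auto
  thus "dir_deriv b f x = 0" by (simp add: dir_deriv_const)
qed

lemma test_funs_inner_mult: "f \<in> test_funs \<Longrightarrow> (\<lambda>x. c * of_real (x \<bullet> b) * f x) \<in> test_funs"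
  by (rule test_funs_mult) (auto intro!: smooth_on_mult smooth_on_const smooth_on_inner)

text \<open>Integrating |exp(iu) - 1 - iu| <= u^2/2 bounds the Taylor remainder by \<open>K\<close>
  times the square of \<open>norm v\<close>; bounded support keeps the second moment
  \<open>K\<close> finite.\<close>

lemma ft_has_derivative:
  fixes h :: "'a::euclidean_space \<Rightarrow> complex"
  assumes h: "continuous_on UNIV h" "bounded {x. h x \<noteq> 0}"
  shows "(ft s h has_derivative (\<lambda>v. ft s (\<lambda>\<xi>. \<i> * of_real s * of_real (\<xi> \<bullet> v) * h \<xi>) x)) (at x)"
proof -
  define L where "L v = ft s (\<lambda>\<xi>. \<i> * of_real s * of_real (\<xi> \<bullet> v) * h \<xi>) x" for v
  have hi: "integrable lborel h" by (rule bounded_support_integrable[OF h])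
  have ci: "integrable lborel (\<lambda>\<xi>. g \<xi> * h \<xi>)" if "continuous_on UNIV g" for g
    by (rule bounded_support_integrable) (auto intro!: continuous_intros that h(1) bounded_subset[OF h(2)])
  have Li: "integrable lborel (\<lambda>\<xi>. \<i> * of_real s * of_real (\<xi> \<bullet> v) * h \<xi>)" for v
    by (rule ci) (auto intro!: continuous_intros)
  have "linear L"
  proof
    fix v w
    have "L (v + w) = ft s (\<lambda>\<xi>. \<i> * of_real s * of_real (\<xi> \<bullet> v) * h \<xi> + \<i> * of_real s * of_real (\<xi> \<bullet> w) * h \<xi>) x"
      unfolding L_def by (simp add: inner_add_right algebra_simps)
    thus "L (v + w) = L v + L w" using ft_add[OF Li[of v] Li[of w], of s] by (simp add: L_def)
  next
    fix r v
    have "L (r *\<^sub>R v) = ft s (\<lambda>\<xi>. of_real r * (\<i> * of_real s * of_real (\<xi> \<bullet> v) * h \<xi>)) x"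
      unfolding L_def by (simp add: algebra_simps)
    thus "L (r *\<^sub>R v) = r *\<^sub>R L v" unfolding ft_cmult by (simp add: L_def scaleR_conv_of_real)
  qed
  hence bl: "bounded_linear L" by (rule linear_conv_bounded_linear[THEN iffD1])
  define K where "K = (\<integral>\<xi>. s\<^sup>2 * (norm \<xi>)\<^sup>2 / 2 * cmod (h \<xi>) \<partial>lborel)"
  have Ki: "integrable lborel (\<lambda>\<xi>. s\<^sup>2 * (norm \<xi>)\<^sup>2 / 2 * cmod (h \<xi>))"
  proof -
    have "integrable lborel (\<lambda>\<xi>. cmod (of_real (s\<^sup>2 * (norm \<xi>)\<^sup>2 / 2) * h \<xi>))"
      by (rule integrable_norm, rule ci) (auto intro!: continuous_intros)
    thus ?thesis by (simp only: norm_mult norm_of_real) simp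
  qed
  have bound: "cmod (ft s h (x + v) - ft s h x - L v) \<le> K * (norm v)\<^sup>2" for v
  proof -
    define D where "D \<xi> = iexp (s * ((x + v) \<bullet> \<xi>)) * h \<xi> - iexp (s * (x \<bullet> \<xi>)) * h \<xi>
        - iexp (s * (x \<bullet> \<xi>)) * (\<i> * of_real s * of_real (\<xi> \<bullet> v) * h \<xi>)" for \<xi>
    have "ft s h (x + v) - ft s h x - L v = (\<integral>\<xi>. D \<xi> \<partial>lborel)"
      unfolding ft_def L_def D_def
      by (subst Bochner_Integration.integral_diff, (intro Bochner_Integration.integrable_diff ft_integrable hi Li)+)
        (subst Bochner_Integration.integral_diff, (intro ft_integrable hi)+, simp)
    also have "cmod \<dots> \<le> (\<integral>\<xi>. cmod (D \<xi>) \<partial>lborel)" by (rule integral_norm_bound)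
    also have "\<dots> \<le> (\<integral>\<xi>. (norm v)\<^sup>2 * (s\<^sup>2 * (norm \<xi>)\<^sup>2 / 2 * cmod (h \<xi>)) \<partial>lborel)"
    proof (rule integral_mono)
      show "integrable lborel (\<lambda>\<xi>. cmod (D \<xi>))"
        unfolding D_def by (intro integrable_norm Bochner_Integration.integrable_diff ft_integrable hi Li)
      show "integrable lborel (\<lambda>\<xi>. (norm v)\<^sup>2 * (s\<^sup>2 * (norm \<xi>)\<^sup>2 / 2 * cmod (h \<xi>)))"
        by (intro integrable_mult_right Ki)
      fix \<xi>
      have e: "s * ((x + v) \<bullet> \<xi>) = s * (x \<bullet> \<xi>) + s * (v \<bullet> \<xi>)" by (simp add: inner_add_left algebra_simps)
      have "D \<xi> = iexp (s * (x \<bullet> \<xi>)) * (iexp (s * (v \<bullet> \<xi>)) - (\<Sum>k\<le>1. (\<i> * of_real (s * (v \<bullet> \<xi>))) ^ k / fact k)) * h \<xi>"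
        unfolding D_def e of_real_add distrib_left exp_add
        by (simp add: algebra_simps inner_commute)
      hence "cmod (D \<xi>) = cmod (iexp (s * (v \<bullet> \<xi>)) - (\<Sum>k\<le>1. (\<i> * of_real (s * (v \<bullet> \<xi>))) ^ k / fact k)) * cmod (h \<xi>)"
        by (simp only: norm_mult norm_exp_i_times mult_1_left)
      also have "\<dots> \<le> (\<bar>s * (v \<bullet> \<xi>)\<bar> ^ Suc 1 / fact (Suc 1)) * cmod (h \<xi>)"
        by (intro mult_right_mono iexp_approx1) auto
      also have "\<dots> = s\<^sup>2 * \<bar>v \<bullet> \<xi>\<bar>\<^sup>2 / 2 * cmod (h \<xi>)"
        by (simp add: power2_eq_square[symmetric] abs_mult power_mult_distrib)
      also have "\<dots> \<le> s\<^sup>2 * (norm v * norm \<xi>)\<^sup>2 / 2 * cmod (h \<xi>)"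
        by (intro mult_right_mono divide_right_mono mult_left_mono power_mono Cauchy_Schwarz_ineq2) auto
      finally show "cmod (D \<xi>) \<le> (norm v)\<^sup>2 * (s\<^sup>2 * (norm \<xi>)\<^sup>2 / 2 * cmod (h \<xi>))"
        by (simp add: power_mult_distrib algebra_simps)
    qed
    also have "\<dots> = K * (norm v)\<^sup>2" by (simp add: K_def)
    finally show ?thesis .
  qed
  have "(\<lambda>v. norm (ft s h (x + v) - ft s h x - L v) / norm v) \<midarrow>0\<rightarrow> 0"
  proof (rule Lim_null_comparison)
    show "\<forall>\<^sub>F v in at 0. norm (norm (ft s h (x + v) - ft s h x - L v) / norm v) \<le> K * norm v"
    proof (rule always_eventually, rule allI)
      fix v show "norm (norm (ft s h (x + v) - ft s h x - L v) / norm v) \<le> K * norm v"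
        using bound[of v] by (cases "v = 0") (simp_all add: divide_simps power2_eq_square mult.assoc)
    qed
    show "((\<lambda>v::'a. K * norm v) \<longlongrightarrow> 0) (at 0)" by (auto intro!: tendsto_eq_intros)
  qed
  thus ?thesis using bl unfolding has_derivative_at L_def by blast
qed

lemma dir_deriv_ft:
  assumes "h \<in> test_funs"
  shows "dir_deriv b (ft s h) = ft s (\<lambda>\<xi>. \<i> * of_real s * of_real (\<xi> \<bullet> b) * h \<xi>)"
  by (rule ext, rule dir_deriv_eq, rule ft_has_derivative)
    (use assms in \<open>auto intro: test_funs_continuous test_funs_support\<close>)

text \<open>Differentiating a transform multiplies the integrand by a coordinate, so the transforms
  of test functions form a class as required by \<open>smooth_on_coinduct\<close>.\<close>

lemma smooth_on_ft:
  assumes "h \<in> test_funs"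
  shows "smooth_on UNIV (ft s h)"
proof (rule smooth_on_coinduct[of _ "ft s ` test_funs"])
  fix f assume "f \<in> ft s ` test_funs"
  then obtain k where k: "k \<in> test_funs" "f = ft s k" by auto
  show "\<exists>f'. (\<forall>x\<in>UNIV. (f has_derivative f' x) (at x)) \<and> (\<forall>b\<in>Basis. (\<lambda>x. f' x b) \<in> ft s ` test_funs)"
    unfolding k(2)
    by (intro exI[of _ "\<lambda>x v. ft s (\<lambda>\<xi>. \<i> * of_real s * of_real (\<xi> \<bullet> v) * k \<xi>) x"] conjI ballI ft_has_derivative)
      (use k in \<open>auto intro: test_funs_continuous test_funs_support test_funs_inner_mult\<close>)
qed (use assms in auto)

lemma iter_deriv_ft:
  assumes "h \<in> test_funs" "bs \<in> lists Basis"
  obtains k where "k \<in> test_funs" "iter_deriv bs (ft s h) = ft s k"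
proof -
  have "\<exists>k\<in>test_funs. iter_deriv bs (ft s h) = ft s k" using assms(2)
  proof (induction bs)
    case Nil thus ?case using assms(1) by auto
  next
    case (Cons b bs)
    then obtain k where "k \<in> test_funs" "iter_deriv bs (ft s h) = ft s k" by auto
    thus ?case
      by (intro bexI[of _ "\<lambda>\<xi>. \<i> * of_real s * of_real (\<xi> \<bullet> b) * k \<xi>"])
        (simp_all add: iter_deriv_Cons dir_deriv_ft test_funs_inner_mult)
  qed
  thus ?thesis using that by blast
qed

lemma ft_translate:
  fixes h :: "'a::euclidean_space \<Rightarrow> complex"
  assumes [measurable]: "h \<in> borel_measurable borel"
  shows "ft s (\<lambda>\<xi>. h (\<xi> + a)) x = iexp (- s * (x \<bullet> a)) * ft s h x"
proof -
  have "ft s h x = (\<integral>\<xi>. iexp (s * (x \<bullet> (a + \<xi>))) * h (a + \<xi>) \<partial>lborel)"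
    unfolding ft_def by (subst lborel_integral_affine[of 1 _ a]) auto
  also have "\<dots> = (\<integral>\<xi>. iexp (s * (x \<bullet> a)) * (iexp (s * (x \<bullet> \<xi>)) * h (\<xi> + a)) \<partial>lborel)"
    by (simp only: inner_add_right distrib_left of_real_add exp_add mult.assoc add.commute[of a] mult.left_commute)
  also have "\<dots> = iexp (s * (x \<bullet> a)) * ft s (\<lambda>\<xi>. h (\<xi> + a)) x"
    unfolding ft_def by (rule integral_mult_right_zero)
  finally show ?thesis by (simp add: mult.assoc[symmetric] exp_add[symmetric])
qed

text \<open>Integration by parts through difference quotients. Their transforms are known from
  \<open>ft_translate\<close>; they converge to the transform of the derivative by dominated
  convergence, and to a multiple of \<open>ft s h x\<close> by differentiating an
  exponential.\<close>

lemma ft_dir_deriv: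
  assumes h: "h \<in> test_funs" and b: "b \<in> Basis"
  shows "ft s (dir_deriv b h) x = - \<i> * of_real (s * (x \<bullet> b)) * ft s h x"
proof -
  define \<tau> :: "nat \<Rightarrow> real" where "\<tau> n = 1 / (real n + 1)" for n
  have \<tau>: "0 < \<tau> n" "\<tau> n \<le> 1" for n by (auto simp: \<tau>_def)
  have \<tau>0: "\<tau> \<longlonglongrightarrow> 0" unfolding \<tau>_def by real_asymp
  define q where "q n \<xi> = (h (\<xi> + \<tau> n *\<^sub>R b) - h \<xi>) / of_real (\<tau> n)" for n \<xi>
  have hc: "continuous_on UNIV h" by (rule test_funs_continuous[OF h])
  have [measurable]: "h \<in> borel_measurable borel" by (rule borel_measurable_continuous_onI[OF hc])
  have hd: "(h has_derivative frechet_derivative h (at \<xi>)) (at \<xi>)" for \<xi>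
    by (rule smooth_on_has_derivative[OF test_funs_smooth[OF h]]) auto
  have dt: "dir_deriv b h \<in> test_funs" by (rule test_funs_dir_deriv[OF h b])
  obtain B where B: "B \<ge> 0" "\<And>\<xi>. cmod (dir_deriv b h \<xi>) \<le> B"
    using bounded_support_bounded[OF test_funs_continuous[OF dt] test_funs_support[OF dt]] by blast
  have nb: "norm b = 1" using b by simp
  have qlim: "(\<lambda>n. q n \<xi>) \<longlonglongrightarrow> dir_deriv b h \<xi>" for \<xi>
  proof -
    let ?D = "frechet_derivative h (at \<xi>)"
    have "filterlim (\<lambda>n. \<tau> n *\<^sub>R b) (at 0) sequentially"
      unfolding filterlim_at
    proof
      show "(\<lambda>n. \<tau> n *\<^sub>R b) \<longlonglongrightarrow> 0" using tendsto_scaleR[OF \<tau>0 tendsto_const[of b]] by simp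
      show "\<forall>\<^sub>F n in sequentially. \<tau> n *\<^sub>R b \<in> UNIV \<and> \<tau> n *\<^sub>R b \<noteq> 0"
        using \<tau>(1) b by (auto simp: less_imp_neq[symmetric])
    qed
    moreover have "(\<lambda>v. norm (h (\<xi> + v) - h \<xi> - ?D v) / norm v) \<midarrow>0\<rightarrow> 0"
      using hd[of \<xi>] unfolding has_derivative_at by blast
    ultimately have "(\<lambda>n. norm (h (\<xi> + \<tau> n *\<^sub>R b) - h \<xi> - ?D (\<tau> n *\<^sub>R b)) / norm (\<tau> n *\<^sub>R b)) \<longlonglongrightarrow> 0"
      by (rule filterlim_compose[rotated])
    moreover have "norm (h (\<xi> + \<tau> n *\<^sub>R b) - h \<xi> - ?D (\<tau> n *\<^sub>R b)) / norm (\<tau> n *\<^sub>R b) = norm (q n \<xi> - dir_deriv b h \<xi>)" for n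
    proof -
      have "?D (\<tau> n *\<^sub>R b) = of_real (\<tau> n) * dir_deriv b h \<xi>"
        using has_derivative_linear[OF hd[of \<xi>]] by (simp add: linear_cmul dir_deriv_def scaleR_conv_of_real)
      hence "h (\<xi> + \<tau> n *\<^sub>R b) - h \<xi> - ?D (\<tau> n *\<^sub>R b) = of_real (\<tau> n) * (q n \<xi> - dir_deriv b h \<xi>)"
        using \<tau>(1)[of n] by (simp add: q_def field_simps)
      thus ?thesis using \<tau>(1)[of n] nb by (simp add: norm_mult)
    qed
    ultimately have "(\<lambda>n. norm (q n \<xi> - dir_deriv b h \<xi>)) \<longlonglongrightarrow> 0" by simp
    thus ?thesis by (subst LIM_zero_iff[symmetric]) (rule tendsto_norm_zero_cancel)
  qed
  \<comment> \<open>The mean value inequality bounds all quotients uniformly. As the shifts have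
    length at most 1, the quotients also vanish off one common ball, so that a constant on this ball
    is an integrable majorant.\<close>
  have qb: "cmod (q n \<xi>) \<le> B" for n \<xi>
  proof -
    have "norm (h (\<xi> + \<tau> n *\<^sub>R b) - h (\<xi> + 0 *\<^sub>R b)) \<le> B * norm (\<tau> n - 0)"
    proof (rule differentiable_bound[of "UNIV" "\<lambda>t. h (\<xi> + t *\<^sub>R b)" "\<lambda>t u. frechet_derivative h (at (\<xi> + t *\<^sub>R b)) (u *\<^sub>R b)"])
      fix t :: real
      show "((\<lambda>t. h (\<xi> + t *\<^sub>R b)) has_derivative (\<lambda>u. frechet_derivative h (at (\<xi> + t *\<^sub>R b)) (u *\<^sub>R b))) (at t within UNIV)"
        by (rule has_derivative_compose[OF _ hd]) (auto intro!: derivative_eq_intros)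
      show "onorm (\<lambda>u. frechet_derivative h (at (\<xi> + t *\<^sub>R b)) (u *\<^sub>R b)) \<le> B"
      proof (rule onorm_le)
        fix u :: real
        have "frechet_derivative h (at (\<xi> + t *\<^sub>R b)) (u *\<^sub>R b) = u *\<^sub>R dir_deriv b h (\<xi> + t *\<^sub>R b)"
          using has_derivative_linear[OF hd] by (simp add: linear_cmul dir_deriv_def)
        thus "norm (frechet_derivative h (at (\<xi> + t *\<^sub>R b)) (u *\<^sub>R b)) \<le> B * norm u"
          using B(2)[of "\<xi> + t *\<^sub>R b"] by (simp add: mult.commute[of B] mult_left_mono)
      qed
    qed auto
    thus ?thesis using \<tau>(1)[of n] by (simp add: q_def norm_divide divide_simps)
  qed
  obtain a1 a2 where supp: "\<And>x. x \<notin> cbox a1 a2 \<Longrightarrow> h x = 0"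
    using bounded_support_subset_cbox[OF test_funs_support[OF h]] by blast
  obtain R where R: "\<And>x. h x \<noteq> 0 \<Longrightarrow> norm x \<le> R"
    using test_funs_support[OF h] unfolding bounded_iff by blast
  have qs: "q n \<xi> = 0" if "\<xi> \<notin> cball 0 (R + 1)" for n \<xi>
  proof -
    have "norm \<xi> > R + 1" using that by simp
    moreover have "norm \<xi> \<le> norm (\<xi> + \<tau> n *\<^sub>R b) + 1"
      using norm_triangle_ineq4[of "\<xi> + \<tau> n *\<^sub>R b" "\<tau> n *\<^sub>R b"] \<tau>[of n] nb by simp
    ultimately have "h \<xi> = 0" "h (\<xi> + \<tau> n *\<^sub>R b) = 0"
      using R[of \<xi>] R[of "\<xi> + \<tau> n *\<^sub>R b"] by fastforce+
    thus ?thesis by (simp add: q_def)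
  qed
  have 1: "(\<lambda>n. ft s (q n) x) \<longlonglongrightarrow> ft s (dir_deriv b h) x"
    unfolding ft_def
  proof (rule integral_dominated_convergence[where w="\<lambda>\<xi>. indicator (cball 0 (R + 1)) \<xi> *\<^sub>R B"])
    show "(\<lambda>\<xi>. iexp (s * (x \<bullet> \<xi>)) * dir_deriv b h \<xi>) \<in> borel_measurable lborel"
      using borel_measurable_integrable[OF test_funs_integrable[OF dt]] by measurable
    show "(\<lambda>\<xi>. iexp (s * (x \<bullet> \<xi>)) * q n \<xi>) \<in> borel_measurable lborel" for n
      unfolding q_def by measurable
    show "integrable lborel (\<lambda>\<xi>::'a. indicator (cball 0 (R + 1)) \<xi> *\<^sub>R B)"
      by (rule borel_integrable_compact) auto
    show "AE \<xi> in lborel. (\<lambda>n. iexp (s * (x \<bullet> \<xi>)) * q n \<xi>) \<longlonglongrightarrow> iexp (s * (x \<bullet> \<xi>)) * dir_deriv b h \<xi>"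
      by (intro AE_I2 tendsto_intros qlim)
    show "AE \<xi> in lborel. norm (iexp (s * (x \<bullet> \<xi>)) * q n \<xi>) \<le> indicator (cball 0 (R + 1)) \<xi> *\<^sub>R B" for n
    proof (rule AE_I2)
      fix \<xi>
      have "norm (iexp (s * (x \<bullet> \<xi>)) * q n \<xi>) = cmod (q n \<xi>)" by (simp only: norm_mult norm_exp_i_times mult_1_left)
      thus "norm (iexp (s * (x \<bullet> \<xi>)) * q n \<xi>) \<le> indicator (cball 0 (R + 1)) \<xi> *\<^sub>R B"
        using qb[of n \<xi>] qs[of \<xi> n] by (cases "\<xi> \<in> cball 0 (R + 1)") auto
    qed
  qed
  define c where "c = \<i> * complex_of_real (- s * (x \<bullet> b))"
  have "ft s (q n) x = (exp (c * (0 + of_real (\<tau> n))) - exp (c * 0)) / of_real (\<tau> n) * ft s h x" for n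
  proof -
    have i: "integrable lborel (\<lambda>\<xi>. h (\<xi> + \<tau> n *\<^sub>R b))"
      using lborel_integrable_affine[of 1 h "\<tau> n *\<^sub>R b"] test_funs_integrable[OF h] by (simp add: add.commute)
    have "q n = (\<lambda>\<xi>. (1 / of_real (\<tau> n)) * (h (\<xi> + \<tau> n *\<^sub>R b) + (-1) * h \<xi>))"
      by (rule ext) (simp add: q_def)
    hence "ft s (q n) x = (1 / of_real (\<tau> n)) * (iexp (- s * (x \<bullet> (\<tau> n *\<^sub>R b))) * ft s h x - ft s h x)"
      by (simp only: ft_cmult ft_add[OF i integrable_mult_right[OF test_funs_integrable[OF h]]]
        ft_translate[OF \<open>h \<in> borel_measurable borel\<close>]) simp
    moreover have "\<i> * of_real (- s * (x \<bullet> (\<tau> n *\<^sub>R b))) = c * of_real (\<tau> n)" by (simp add: c_def)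
    ultimately show ?thesis by (simp only:) (simp add: left_diff_distrib)
  qed
  moreover have "(\<lambda>n. (exp (c * (0 + of_real (\<tau> n))) - exp (c * 0)) / of_real (\<tau> n)) \<longlonglongrightarrow> c"
  proof -
    have "((\<lambda>z. exp (c * z)) has_field_derivative c) (at 0)"
      by (auto intro!: derivative_eq_intros)
    hence "(\<lambda>z. (exp (c * (0 + z)) - exp (c * 0)) / z) \<midarrow>0\<rightarrow> c" by (rule DERIV_D)
    moreover have "filterlim (\<lambda>n. complex_of_real (\<tau> n)) (at 0) sequentially"
      unfolding filterlim_at using \<tau>(1) tendsto_of_real[OF \<tau>0, where 'a=complex] by (auto simp: less_imp_neq[symmetric])
    ultimately show ?thesis by (rule filterlim_compose)
  qed
  ultimately have "(\<lambda>n. ft s (q n) x) \<longlonglongrightarrow> c * ft s h x"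
    by (simp only:) (intro tendsto_intros)
  from LIMSEQ_unique[OF 1 this] show ?thesis by (simp add: c_def)
qed

text \<open>Each coordinate factor is absorbed by passing from \<open>h\<close> to a partial
  derivative of \<open>h\<close>, and \<open>norm x\<close> is at most the sum of the absolute
  values of the coordinates.\<close>

lemma ft_decay:
  fixes h :: "'a::euclidean_space \<Rightarrow> complex"
  assumes "h \<in> test_funs" "s \<noteq> 0"
  shows "\<exists>C. \<forall>x. (1 + norm x) ^ k * cmod (ft s h x) \<le> C"
  using assms(1)
proof (induction k arbitrary: h)
  case 0
  show ?case using ft_bound[of s h] by auto
next
  case (Suc k)
  have "\<forall>b\<in>Basis. \<exists>C. \<forall>x. (1 + norm x) ^ k * cmod (ft s (dir_deriv b h) x) \<le> C"
    using Suc.IH test_funs_dir_deriv[OF Suc.prems] by blast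
  then obtain C where C: "\<And>b x. b \<in> Basis \<Longrightarrow> (1 + norm x) ^ k * cmod (ft s (dir_deriv b h) x) \<le> C b"
    by metis
  obtain C0 where C0: "\<And>x. (1 + norm x) ^ k * cmod (ft s h x) \<le> C0" using Suc by blast
  have "(1 + norm x) ^ Suc k * cmod (ft s h x) \<le> C0 + (\<Sum>b\<in>Basis. C b) / \<bar>s\<bar>" for x
  proof -
    have "(1 + norm x) ^ Suc k * cmod (ft s h x)
      = (1 + norm x) ^ k * cmod (ft s h x) + (1 + norm x) ^ k * cmod (ft s h x) * norm x"
      by (simp add: algebra_simps)
    also have "(1 + norm x) ^ k * cmod (ft s h x) * norm x \<le> (1 + norm x) ^ k * cmod (ft s h x) * (\<Sum>b\<in>Basis. \<bar>x \<bullet> b\<bar>)"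
      by (intro mult_left_mono norm_le_l1) auto
    also have "\<dots> = (\<Sum>b\<in>Basis. (1 + norm x) ^ k * (\<bar>x \<bullet> b\<bar> * cmod (ft s h x)))"
      by (simp add: sum_distrib_left mult_ac)
    also have "\<dots> = (\<Sum>b\<in>Basis. (1 + norm x) ^ k * cmod (ft s (dir_deriv b h) x) / \<bar>s\<bar>)"
      using assms(2) by (intro sum.cong refl) (simp add: ft_dir_deriv[OF Suc.prems] norm_mult abs_mult)
    also have "\<dots> \<le> (\<Sum>b\<in>Basis. C b / \<bar>s\<bar>)"
      by (intro sum_mono divide_right_mono C) auto
    finally show ?thesis using C0[of x] by (simp add: sum_divide_distrib)
  qed
  thus ?case by blast
qed

section \<open>Schwartz functions and inversion for test functions\<close>

lemma ft_schwartz: "h \<in> test_funs \<Longrightarrow> s \<noteq> 0 \<Longrightarrow> ft s h \<in> schwartz_funs"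
  unfolding schwartz_funs_def smooth_fun_iff_smooth_on
proof (intro CollectI conjI smooth_on_ft allI ballI)
  fix k and bs :: "'a list"
  assume *: "h \<in> test_funs" "s \<noteq> 0" "bs \<in> lists Basis"
  then obtain g where "g \<in> test_funs" "iter_deriv bs (ft s h) = ft s g" by (metis iter_deriv_ft)
  thus "\<exists>C. \<forall>x. (1 + norm x) ^ k * cmod (iter_deriv bs (ft s h) x) \<le> C"
    using ft_decay *(2) by metis
qed

lemma inv_fourier_schwartz: "h \<in> test_funs \<Longrightarrow> inv_fourier h \<in> schwartz_funs"
  unfolding inv_fourier_eq_ft ft_cmult[symmetric] by (intro ft_schwartz test_funs_cmult) auto

lemma fourier_schwartz: "h \<in> test_funs \<Longrightarrow> fourier h \<in> schwartz_funs"
  unfolding fourier_eq_ft by (intro ft_schwartz) auto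

lemma schwartz_smooth: "f \<in> schwartz_funs \<Longrightarrow> smooth_on UNIV f"
  by (simp add: schwartz_funs_def smooth_fun_iff_smooth_on)

lemma schwartz_decay: "f \<in> schwartz_funs \<Longrightarrow> \<exists>C. \<forall>x. (1 + norm x) ^ k * cmod (f x) \<le> C"
proof -
  assume "f \<in> schwartz_funs"
  hence "\<exists>C. \<forall>x. (1 + norm x) ^ k * cmod (iter_deriv [] f x) \<le> C"
    unfolding schwartz_funs_def by blast
  thus ?thesis by simp
qed

lemma schwartz_continuous: "f \<in> schwartz_funs \<Longrightarrow> continuous_on UNIV f"
  by (intro smooth_on_continuous_on schwartz_smooth)

lemma schwartz_integrable:
  fixes f :: "'a::euclidean_space \<Rightarrow> complex"
  assumes "f \<in> schwartz_funs"
  shows "integrable lborel f"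
proof -
  define w where "w x = (1 + norm x) ^ (2 * DIM('a))" for x :: 'a
  have w: "w x > 0" for x unfolding w_def by (rule zero_less_power) (simp add: add_pos_nonneg)
  obtain C where C: "\<And>x. w x * cmod (f x) \<le> C"
    using schwartz_decay[OF assms, of "2 * DIM('a)"] unfolding w_def by blast
  have i: "integrable lborel (\<lambda>x::'a. C * (1 / w x))"
    unfolding w_def by (intro integrable_mult_right integrable_decay)
  have m: "f \<in> borel_measurable lborel"
    using borel_measurable_continuous_onI[OF schwartz_continuous[OF assms]] by simp
  have "norm (f x) \<le> norm (C * (1 / w x))" for x
  proof -
    have "norm (f x) \<le> C * (1 / w x)" using C[of x] w[of x] by (simp add: pos_le_divide_eq mult.commute)
    thus ?thesis unfolding real_norm_def by (rule order_trans[OF _ abs_ge_self])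
  qed
  hence "AE x in lborel. norm (f x) \<le> norm (C * (1 / w x))" by (rule AE_I2)
  thus ?thesis by (rule Bochner_Integration.integrable_bound[OF i m])
qed

lemma schwartz_bounded:
  assumes "f \<in> schwartz_funs"
  obtains B where "\<And>x. cmod (f x) \<le> B"
proof -
  obtain B where "\<forall>x. (1 + norm x) ^ 0 * cmod (f x) \<le> B" using schwartz_decay[OF assms, of 0] by blast
  thus ?thesis using that[of B] by simp
qed

lemma inv_fourier_fourier_test:
  assumes "h \<in> test_funs"
  shows "inv_fourier (fourier h) = h"
proof -
  obtain B where B: "B \<ge> 0" "\<And>x. cmod (h x) \<le> B"
    using bounded_support_bounded[OF test_funs_continuous[OF assms] test_funs_support[OF assms]] by blast
  show ?thesis
    by (rule inv_fourier_fourier[OF test_funs_continuous test_funs_integrable B(2)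
      schwartz_integrable[OF fourier_schwartz]]) (rule assms)+
qed

text \<open>Reflecting the integration variable interchanges the two signs, which reduces this order
  of the transforms to the other one.\<close>

lemma fourier_inv_fourier_test:
  fixes h :: "'a::euclidean_space \<Rightarrow> complex"
  assumes "h \<in> test_funs"
  shows "fourier (inv_fourier h) = h"
proof
  fix x :: 'a
  define c where "c = complex_of_real (1 / (2 * pi) ^ DIM('a))"
  have [measurable]: "ft 1 h \<in> borel_measurable borel"
    by (intro ft_measurable test_funs_integrable assms)
  have "fourier (inv_fourier h) x = c * ft (-1) (ft 1 h) x"
    by (simp only: fourier_eq_ft inv_fourier_eq_ft ft_cmult c_def)
  also have "ft (-1) (ft 1 h) x = (\<integral>\<xi>. iexp (-1 * (x \<bullet> (0 + (-1) *\<^sub>R \<xi>))) * ft 1 h (0 + (-1) *\<^sub>R \<xi>) \<partial>lborel)"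
    unfolding ft_def[of "-1" "ft 1 h"] by (subst lborel_integral_affine[of "-1" _ 0]) auto
  also have "\<dots> = ft 1 (ft (-1) h) x"
    unfolding ft_def[of 1 "ft (-1) h"] by (simp add: ft_minus_arg)
  also have "c * \<dots> = inv_fourier (fourier h) x"
    by (simp add: fourier_eq_ft inv_fourier_eq_ft c_def)
  finally show "fourier (inv_fourier h) x = h x" using inv_fourier_fourier_test[OF assms] by simp
qed

text \<open>The convolution formula in the form that yields spectra of products: one factor is given
  by its spectrum \<open>h\<close>, and the multiplication formula is applied to \<open>h\<close>
  and the modulated \<open>g\<close>.\<close>

lemma fourier_mult:
  fixes h g :: "'a::euclidean_space \<Rightarrow> complex"
  assumes h: "integrable lborel h" and g: "integrable lborel g"
  shows "fourier (\<lambda>x. inv_fourier h x * g x) \<xi>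
    = of_real (1 / (2 * pi) ^ DIM('a)) * (\<integral>\<zeta>. h \<zeta> * fourier g (\<xi> - \<zeta>) \<partial>lborel)"
proof -
  define c where "c = complex_of_real (1 / (2 * pi) ^ DIM('a))"
  define k where "k x = iexp (-1 * (\<xi> \<bullet> x)) * g x" for x
  have ki: "integrable lborel k" unfolding k_def by (rule ft_integrable[OF g])
  have "fourier (\<lambda>x. inv_fourier h x * g x) \<xi> = (\<integral>x. c * (ft 1 h x * k x) \<partial>lborel)"
    unfolding fourier_eq_ft inv_fourier_eq_ft ft_def[of "-1"] k_def c_def by (simp add: mult_ac)
  also have "\<dots> = c * (\<integral>x. ft 1 h x * k x \<partial>lborel)" by (rule integral_mult_right_zero)
  also have "(\<integral>x. ft 1 h x * k x \<partial>lborel) = (\<integral>\<zeta>. h \<zeta> * ft 1 k \<zeta> \<partial>lborel)"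
    by (rule ft_swap[symmetric, OF h ki])
  also have "ft 1 k = (\<lambda>\<zeta>. fourier g (\<xi> - \<zeta>))"
  proof
    fix \<zeta>
    have "iexp (1 * (\<zeta> \<bullet> x)) * k x = iexp (-1 * ((\<xi> - \<zeta>) \<bullet> x)) * g x" for x
      unfolding k_def by (simp add: mult.assoc[symmetric] exp_add[symmetric] inner_diff_left right_diff_distrib)
    thus "ft 1 k \<zeta> = fourier g (\<xi> - \<zeta>)" unfolding ft_def fourier_eq_ft by (simp only:)
  qed
  finally show ?thesis by (simp add: c_def)
qed

section \<open>Fourier multipliers and band-limited functions\<close>

lemma smooth_on_quadratic:
  fixes a :: "'a::euclidean_space"
  shows "smooth_on UNIV (\<lambda>x. complex_of_real (\<Sum>b\<in>Basis. c b * (x \<bullet> b - a \<bullet> b)\<^sup>2))"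
proof -
  have "smooth_on UNIV (\<lambda>x::'a. \<Sum>b\<in>Basis. complex_of_real (c b) *
      ((of_real (x \<bullet> b) - of_real (a \<bullet> b)) * (of_real (x \<bullet> b) - of_real (a \<bullet> b))))"
    by (intro smooth_on_sum smooth_on_mult smooth_on_diff smooth_on_const smooth_on_inner open_UNIV)
  thus ?thesis by (simp add: power2_eq_square)
qed

text \<open>Bumps with ellipsoidal support about any point. The form is at least \<open>c0\<close>
  times the squared distance, and \<open>\<Psi>\<close> vanishes beyond 13/10, hence beyond 2.
  Unequal coefficients are what anisotropic dilations call for.\<close>

lemma cutoff_quadratic_test_funs:
  fixes a :: "'a::euclidean_space"
  assumes \<Psi>: "is_cutoff \<Psi>" and c: "\<And>b. b \<in> Basis \<Longrightarrow> c b > 0"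
  shows "(\<lambda>x. \<Psi> (\<Sum>b\<in>Basis. c b * (x \<bullet> b - a \<bullet> b)\<^sup>2)) \<in> test_funs"
proof (rule test_funsI)
  show "smooth_on UNIV (\<lambda>x. \<Psi> (\<Sum>b\<in>Basis. c b * (x \<bullet> b - a \<bullet> b)\<^sup>2))"
    using \<Psi> by (intro smooth_on_compose_real[where \<Psi> = \<Psi>, OF open_UNIV _ smooth_on_quadratic])
      (simp add: is_cutoff_def)
  define c0 where "c0 = Min (c ` Basis)"
  have c0: "c0 > 0" "\<And>b. b \<in> Basis \<Longrightarrow> c0 \<le> c b" using c by (auto simp: c0_def)
  show "bounded (cball a (sqrt (2 / c0)))" by simp
  fix x assume x: "x \<notin> cball a (sqrt (2 / c0))"
  have n: "(norm (x - a))\<^sup>2 = (\<Sum>b\<in>Basis. (x \<bullet> b - a \<bullet> b)\<^sup>2)"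
    unfolding power2_norm_eq_inner by (subst euclidean_inner) (simp add: inner_diff_left power2_eq_square)
  have "sqrt (2 / c0) < norm (x - a)" using x by (simp add: dist_norm norm_minus_commute)
  hence "(sqrt (2 / c0))\<^sup>2 < (norm (x - a))\<^sup>2" using c0 by (intro power_strict_mono) auto
  hence "2 / c0 < (norm (x - a))\<^sup>2" using c0 by simp
  hence "2 < c0 * (norm (x - a))\<^sup>2" using c0 by (simp add: pos_divide_less_eq mult.commute)
  also have "\<dots> \<le> (\<Sum>b\<in>Basis. c b * (x \<bullet> b - a \<bullet> b)\<^sup>2)"
    unfolding n sum_distrib_left by (intro sum_mono mult_right_mono c0) auto
  finally show "\<Psi> (\<Sum>b\<in>Basis. c b * (x \<bullet> b - a \<bullet> b)\<^sup>2) = 0"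
    using \<Psi> by (auto simp: is_cutoff_def)
qed

lemma norm_square_eq_sum:
  "(norm (x - a))\<^sup>2 = (\<Sum>b\<in>Basis. (x \<bullet> b - a \<bullet> b)\<^sup>2)" for x :: "'a::euclidean_space"
  unfolding power2_norm_eq_inner by (subst euclidean_inner) (simp add: inner_diff_left power2_eq_square)

lemma cutoff_ball_test_funs:
  assumes "is_cutoff \<Psi>" "c > 0"
  shows "(\<lambda>x::'a::euclidean_space. \<Psi> (c * (norm (x - a))\<^sup>2)) \<in> test_funs"
  using cutoff_quadratic_test_funs[OF assms(1), of "\<lambda>_. c" a] assms(2)
  by (simp add: norm_square_eq_sum sum_distrib_left)

lemma continuous_AE_zero:
  fixes f :: "'a::euclidean_space \<Rightarrow> real"
  assumes "continuous_on UNIV f" "AE x in lborel. f x = 0"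
  shows "f x = 0"
proof (rule ccontr)
  assume "f x \<noteq> 0"
  moreover have "open {x. f x \<noteq> 0}" by (intro open_Collect_neq assms continuous_intros)
  ultimately have "\<not> negligible {x. f x \<noteq> 0}" using open_not_negligible by blast
  moreover have "{x. f x \<noteq> 0} \<in> null_sets lborel"
    using assms(2) borel_measurable_continuous_onI[OF assms(1)] by (subst (asm) AE_iff_null) auto
  ultimately show False
    using negligible_iff_null_sets null_sets_completionI by blast
qed

text \<open>Uniqueness of the representing function. Where \<open>g\<close> and \<open>f\<close>
  differ at \<open>x0\<close>, multiplying the difference by its conjugate value at
  \<open>x0\<close> gives a function with positive real part near \<open>x0\<close>; the squared
  modulus of a cutoff is a nonnegative test function that detects it.\<close>

lemma fun_of_dist_eq:
  fixes f :: "'a::euclidean_space \<Rightarrow> complex"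
  assumes \<Psi>: "is_cutoff \<Psi>" and f: "continuous_on UNIV f"
    and u: "\<And>\<phi>. \<phi> \<in> test_funs \<Longrightarrow> u \<phi> = dist_of_fun f \<phi>"
  shows "fun_of_dist u = f"
  unfolding fun_of_dist_def
proof (rule the_equality)
  show "continuous_on UNIV f \<and> (\<forall>\<phi>\<in>test_funs. u \<phi> = dist_of_fun f \<phi>)" using f u by blast
  fix g assume g: "continuous_on UNIV g \<and> (\<forall>\<phi>\<in>test_funs. u \<phi> = dist_of_fun g \<phi>)"
  show "g = f"
  proof
    fix x0
    show "g x0 = f x0"
    proof (rule ccontr)
      assume "g x0 \<noteq> f x0"
      define d where "d x = (g x - f x) * cnj (g x0 - f x0)" for x
      have dc: "continuous_on UNIV d" unfolding d_def using f g by (intro continuous_intros) auto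
      have d0: "d x0 = of_real ((cmod (g x0 - f x0))\<^sup>2)" unfolding d_def by (simp add: complex_norm_square[symmetric] del: complex_cnj_diff)
      hence "Re (d x0) > 0" using \<open>g x0 \<noteq> f x0\<close> by simp
      moreover have "continuous_on UNIV (\<lambda>x. Re (d x))" using dc by (intro continuous_intros)
      ultimately have "open {x. Re (d x) > 0}" "x0 \<in> {x. Re (d x) > 0}"
        by (auto intro!: open_Collect_less continuous_intros)
      then obtain e where e: "e > 0" "ball x0 e \<subseteq> {x. Re (d x) > 0}" by (meson open_contains_ball)
      \<comment> \<open>With this scale the argument of \<open>\<Psi>\<close> is at least 2 outside
        the ball of radius \<open>e\<close>, so the test function vanishes there.\<close>
      define c where "c = 2 / e\<^sup>2"
      have c: "c > 0" using e by (simp add: c_def)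
      define v where "v x = \<Psi> (c * (norm (x - x0))\<^sup>2)" for x
      have vt: "v \<in> test_funs" unfolding v_def by (rule cutoff_ball_test_funs[OF \<Psi> c])
      define \<phi> where "\<phi> x = cnj (v x) * v x" for x
      have \<phi>t: "\<phi> \<in> test_funs" unfolding \<phi>_def
        by (intro test_funs_mult smooth_on_cnj test_funs_smooth open_UNIV vt)
      have \<phi>r: "\<phi> x = of_real ((cmod (v x))\<^sup>2)" for x
        unfolding \<phi>_def by (subst mult.commute) (rule complex_norm_square[symmetric])
      have int: "integrable lborel (\<lambda>x. F x * \<phi> x)" if "continuous_on UNIV F" for F
        by (rule bounded_support_integrable) (use that test_funs_continuous[OF \<phi>t] test_funs_support[OF \<phi>t] in
          \<open>auto intro!: continuous_intros intro: bounded_subset\<close>)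
      have "(\<integral>x. g x * \<phi> x \<partial>lborel) = (\<integral>x. f x * \<phi> x \<partial>lborel)"
        using g u[OF \<phi>t] \<phi>t unfolding dist_of_fun_def by metis
      hence "(\<integral>x. g x * \<phi> x - f x * \<phi> x \<partial>lborel) = 0"
        using f g by (subst Bochner_Integration.integral_diff) (auto intro!: int)
      hence "(\<integral>x. cnj (g x0 - f x0) * (g x * \<phi> x - f x * \<phi> x) \<partial>lborel) = 0"
        by (simp only: integral_mult_right_zero mult_zero_right)
      moreover have "cnj (g x0 - f x0) * (g x * \<phi> x - f x * \<phi> x) = d x * \<phi> x" for x
        by (simp add: d_def algebra_simps)
      ultimately have z: "(\<integral>x. d x * \<phi> x \<partial>lborel) = 0" by (simp only:)
      have di: "integrable lborel (\<lambda>x. d x * \<phi> x)" by (rule int[OF dc])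
      have z2: "(\<integral>x. Re (d x * \<phi> x) \<partial>lborel) = 0"
        using integral_Re[OF di] z by simp
      have nn: "Re (d x * \<phi> x) \<ge> 0" for x
      proof (cases "x \<in> ball x0 e")
        case True
        thus ?thesis using e by (auto simp: \<phi>r)
      next
        case False
        hence "e \<le> norm (x - x0)" by (simp add: dist_norm norm_minus_commute)
        hence "e\<^sup>2 \<le> (norm (x - x0))\<^sup>2" using e by (intro power_mono) auto
        hence "2 \<le> c * (norm (x - x0))\<^sup>2" using e by (simp add: c_def pos_le_divide_eq)
        hence "v x = 0" using \<Psi> by (auto simp: v_def is_cutoff_def)
        thus ?thesis by (simp add: \<phi>r)
      qed
      have "AE x in lborel. Re (d x * \<phi> x) = 0"
        using integral_nonneg_eq_0_iff_AE[OF integrable_Re[OF di]] nn z2 by auto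
      hence "Re (d x0 * \<phi> x0) = 0"
        using dc test_funs_continuous[OF \<phi>t] by (intro continuous_AE_zero) (auto intro!: continuous_intros)
      moreover have "\<phi> x0 = 1" using \<Psi> by (simp add: \<phi>r v_def is_cutoff_def)
      ultimately show False using \<open>Re (d x0) > 0\<close> by simp
    qed
  qed
qed

text \<open>The hypothesis on \<open>u\<close> concerns just those functions at which the definition
  evaluates it. In this form the lemma serves both for functions and for tempered products
  identified on Schwartz functions. Two applications of the multiplication formula move the
  transforms onto \<open>f\<close>.\<close>

lemma fourier_multiplier_eq:
  fixes f :: "'a::euclidean_space \<Rightarrow> complex"
  assumes \<Psi>: "is_cutoff \<Psi>" and f: "integrable lborel f"
    and m: "continuous_on UNIV m" "bounded {x. m x \<noteq> 0}"
    and u: "\<And>\<phi>. \<phi> \<in> test_funs \<Longrightarrow>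
      u (fourier (\<lambda>\<xi>. m \<xi> * inv_fourier \<phi> \<xi>)) = dist_of_fun f (fourier (\<lambda>\<xi>. m \<xi> * inv_fourier \<phi> \<xi>))"
  shows "fourier_multiplier m u = inv_fourier (\<lambda>\<xi>. m \<xi> * fourier f \<xi>)"
  unfolding fourier_multiplier_def
proof (rule fun_of_dist_eq[OF \<Psi>])
  have mi: "integrable lborel (\<lambda>\<xi>. m \<xi> * g \<xi>)" if "continuous_on UNIV g" for g
    by (rule bounded_support_integrable) (use m that in \<open>auto intro!: continuous_intros intro: bounded_subset\<close>)
  have H: "integrable lborel (\<lambda>\<xi>. m \<xi> * fourier f \<xi>)"
    unfolding fourier_eq_ft by (intro mi ft_continuous f)
  show "continuous_on UNIV (inv_fourier (\<lambda>\<xi>. m \<xi> * fourier f \<xi>))"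
    unfolding inv_fourier_eq_ft by (intro continuous_intros ft_continuous H)
  fix \<phi> :: "'a \<Rightarrow> complex" assume \<phi>: "\<phi> \<in> test_funs"
  define c where "c = complex_of_real (1 / (2 * pi) ^ DIM('a))"
  have \<phi>i: "integrable lborel \<phi>" by (rule test_funs_integrable[OF \<phi>])
  have G: "integrable lborel (\<lambda>\<xi>. m \<xi> * inv_fourier \<phi> \<xi>)"
    by (intro mi schwartz_continuous inv_fourier_schwartz \<phi>)
  have "inv_fourier_dist (mult_dist m (fourier_dist u)) \<phi> = dist_of_fun f (fourier (\<lambda>\<xi>. m \<xi> * inv_fourier \<phi> \<xi>))"
    by (simp add: inv_fourier_dist_def mult_dist_def fourier_dist_def u[OF \<phi>])
  also have "\<dots> = (\<integral>x. fourier f x * (m x * inv_fourier \<phi> x) \<partial>lborel)"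
    unfolding dist_of_fun_def fourier_eq_ft by (rule ft_swap[OF f G])
  also have "\<dots> = (\<integral>x. c * ((m x * fourier f x) * ft 1 \<phi> x) \<partial>lborel)"
    by (simp only: inv_fourier_eq_ft c_def mult_ac)
  also have "\<dots> = c * (\<integral>x. (m x * fourier f x) * ft 1 \<phi> x \<partial>lborel)" by (rule integral_mult_right_zero)
  also have "(\<integral>x. (m x * fourier f x) * ft 1 \<phi> x \<partial>lborel) = (\<integral>x. ft 1 (\<lambda>x. m x * fourier f x) x * \<phi> x \<partial>lborel)"
    by (rule ft_swap[OF H \<phi>i])
  also have "c * \<dots> = (\<integral>x. c * (ft 1 (\<lambda>x. m x * fourier f x) x * \<phi> x) \<partial>lborel)"
    by (rule integral_mult_right_zero[symmetric])
  also have "\<dots> = dist_of_fun (inv_fourier (\<lambda>\<xi>. m \<xi> * fourier f \<xi>)) \<phi>"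
    unfolding dist_of_fun_def inv_fourier_eq_ft c_def by (simp only: mult.assoc)
  finally show "inv_fourier_dist (mult_dist m (fourier_dist u)) \<phi> =
    dist_of_fun (inv_fourier (\<lambda>\<xi>. m \<xi> * fourier f \<xi>)) \<phi>" .
qed

section \<open>Approximation of Schwartz functions by test functions\<close>

lemma schwartz_dir_deriv:
  assumes "f \<in> schwartz_funs" "b \<in> Basis"
  shows "dir_deriv b f \<in> schwartz_funs"
  unfolding schwartz_funs_def smooth_fun_iff_smooth_on
proof (intro CollectI conjI allI ballI)
  show "smooth_on UNIV (dir_deriv b f)" by (intro smooth_on_dir_deriv schwartz_smooth assms)
  fix k and bs :: "'a list" assume "bs \<in> lists Basis"
  hence "bs @ [b] \<in> lists Basis" using assms(2) by simp
  hence "\<exists>C. \<forall>x. (1 + norm x) ^ k * cmod (iter_deriv (bs @ [b]) f x) \<le> C"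
    using assms(1) unfolding schwartz_funs_def by blast
  thus "\<exists>C. \<forall>x. (1 + norm x) ^ k * cmod (iter_deriv bs (dir_deriv b f) x) \<le> C"
    by (simp add: iter_deriv_snoc)
qed

lemma dir_deriv_scaled:
  assumes "smooth_on UNIV m"
  shows "dir_deriv b (\<lambda>x. m (c *\<^sub>R x)) = (\<lambda>x. of_real c * dir_deriv b m (c *\<^sub>R x))"
    and "((\<lambda>x. m (c *\<^sub>R x)) has_derivative (\<lambda>v. of_real c * frechet_derivative m (at (c *\<^sub>R x)) v)) (at x)"
proof -
  show d: "((\<lambda>x. m (c *\<^sub>R x)) has_derivative (\<lambda>v. of_real c * frechet_derivative m (at (c *\<^sub>R x)) v)) (at x)" for x
  proof -
    have md: "(m has_derivative frechet_derivative m (at (c *\<^sub>R x))) (at (c *\<^sub>R x))"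
      by (rule smooth_on_has_derivative[OF assms]) auto
    have "((\<lambda>x. m (c *\<^sub>R x)) has_derivative (\<lambda>v. frechet_derivative m (at (c *\<^sub>R x)) (c *\<^sub>R v))) (at x)"
      by (rule has_derivative_compose[of "\<lambda>x. c *\<^sub>R x" "\<lambda>v. c *\<^sub>R v" x UNIV m, OF _ md])
        (auto intro!: derivative_eq_intros)
    thus ?thesis using has_derivative_linear[OF md] by (simp add: linear_cmul scaleR_conv_of_real)
  qed
  show "dir_deriv b (\<lambda>x. m (c *\<^sub>R x)) = (\<lambda>x. of_real c * dir_deriv b m (c *\<^sub>R x))"
    by (rule ext) (subst dir_deriv_eq[OF d], simp add: dir_deriv_def)
qed

lemma smooth_on_scaled:
  fixes m :: "'a::euclidean_space \<Rightarrow> complex"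
  assumes "smooth_on UNIV m"
  shows "smooth_on UNIV (\<lambda>x. m (c *\<^sub>R x))"
proof (rule smooth_on_coinduct[of _ "{\<lambda>x. a * m (c *\<^sub>R x) | a (m :: 'a \<Rightarrow> complex). smooth_on UNIV m}"])
  fix f assume "f \<in> {\<lambda>x. a * m (c *\<^sub>R x) | a (m :: 'a \<Rightarrow> complex). smooth_on UNIV m}"
  then obtain a m where f: "f = (\<lambda>x. a * m (c *\<^sub>R x))" "smooth_on UNIV m" by auto
  show "\<exists>f'. (\<forall>x\<in>UNIV. (f has_derivative f' x) (at x)) \<and>
    (\<forall>b\<in>Basis. (\<lambda>x. f' x b) \<in> {\<lambda>x. a * m (c *\<^sub>R x) | a (m :: 'a \<Rightarrow> complex). smooth_on UNIV m})"
  proof (intro exI[of _ "\<lambda>x v. a * (of_real c * frechet_derivative m (at (c *\<^sub>R x)) v)"] conjI ballI)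
    show "(f has_derivative (\<lambda>v. a * (of_real c * frechet_derivative m (at (c *\<^sub>R x)) v))) (at x)" for x
      unfolding f(1) by (intro has_derivative_mult_right dir_deriv_scaled(2) f(2))
    fix b :: 'a assume "b \<in> Basis"
    hence "smooth_on UNIV (dir_deriv b m)" by (intro smooth_on_dir_deriv f(2))
    thus "(\<lambda>x. a * (of_real c * frechet_derivative m (at (c *\<^sub>R x)) b)) \<in> {\<lambda>x. a * m (c *\<^sub>R x) | a (m :: 'a \<Rightarrow> complex). smooth_on UNIV m}"
      by (intro CollectI exI[of _ "a * of_real c"] exI[of _ "dir_deriv b m"]) (simp add: dir_deriv_def mult.assoc)
  qed
next
  show "(\<lambda>x. m (c *\<^sub>R x)) \<in> {\<lambda>x. a * m (c *\<^sub>R x) | a (m :: 'a \<Rightarrow> complex). smooth_on UNIV m}"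
    using assms by (intro CollectI exI[of _ 1] exI[of _ m]) simp
qed auto

text \<open>As \<open>m\<close> vanishes on the unit ball, the rescaled factor lives where
  \<open>norm x\<close> is at least n + 1; one extra power of decay of \<open>\<kappa>\<close> then
  gains the factor 1/(n + 1). The induction removes the innermost derivative, since the product rule
  turns it into two expressions of the same form.\<close>

lemma schwartz_cutoff_error:
  fixes \<kappa> m :: "'a::euclidean_space \<Rightarrow> complex"
  assumes "bs \<in> lists Basis" "\<kappa> \<in> schwartz_funs" "smooth_on UNIV m"
    and "\<And>cs. cs \<in> lists Basis \<Longrightarrow> \<exists>K. \<forall>x. cmod (iter_deriv cs m x) \<le> K"
    and "\<And>x. norm x < 1 \<Longrightarrow> m x = 0"
  shows "\<exists>B. B \<longlonglongrightarrow> 0 \<and> (\<forall>n x. (1 + norm x) ^ k *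
    cmod (iter_deriv bs (\<lambda>x. \<kappa> x * m ((1 / (real n + 1)) *\<^sub>R x)) x) \<le> B n)"
  using assms
proof (induction bs arbitrary: \<kappa> m rule: rev_induct)
  case Nil
  obtain C where C: "\<And>x. (1 + norm x) ^ Suc k * cmod (\<kappa> x) \<le> C"
    using schwartz_decay[OF Nil.prems(2), of "Suc k"] by blast
  obtain K where K: "\<And>x. cmod (iter_deriv [] m x) \<le> K" using Nil.prems(4)[of "[]"] by auto
  have "K \<ge> 0" using K[of 0] norm_ge_zero[of "iter_deriv [] m 0"] by linarith
  have "C \<ge> 0" using C[of 0] by (simp add: order_trans[OF norm_ge_zero])
  have "(1 + norm x) ^ k * cmod (\<kappa> x * m ((1 / (real n + 1)) *\<^sub>R x)) \<le> C * K * (1 / (real n + 1))" for n x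
  proof (cases "norm x < real n + 1")
    case True
    hence "norm ((1 / (real n + 1)) *\<^sub>R x) < 1" by (simp add: divide_simps)
    hence "m ((1 / (real n + 1)) *\<^sub>R x) = 0" by (rule Nil.prems(5))
    thus ?thesis using \<open>K \<ge> 0\<close> \<open>C \<ge> 0\<close> by simp
  next
    case False
    have "(1 + norm x) ^ k * cmod (\<kappa> x) * (real n + 1) \<le> (1 + norm x) ^ k * cmod (\<kappa> x) * (1 + norm x)"
      using False by (intro mult_left_mono) auto
    also have "\<dots> \<le> C" using C[of x] by (simp add: mult_ac)
    finally have "(1 + norm x) ^ k * cmod (\<kappa> x) \<le> C / (real n + 1)" by (simp add: pos_le_divide_eq)
    hence "(1 + norm x) ^ k * cmod (\<kappa> x) * cmod (m ((1 / (real n + 1)) *\<^sub>R x)) \<le> C / (real n + 1) * K"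
      using K[of "(1 / (real n + 1)) *\<^sub>R x"] \<open>C \<ge> 0\<close> by (intro mult_mono) auto
    thus ?thesis by (simp add: norm_mult mult_ac)
  qed
  moreover have "(\<lambda>n. C * K * (1 / (real n + 1))) \<longlonglongrightarrow> 0" by real_asymp
  ultimately show ?case by (intro exI[of _ "\<lambda>n. C * K * (1 / (real n + 1))"]) simp
next
  case (snoc b bs)
  have b: "b \<in> Basis" "bs \<in> lists Basis" using snoc.prems(1) by auto
  define e where "e n = 1 / (real n + 1)" for n
  have m': "smooth_on UNIV (dir_deriv b m)" by (intro smooth_on_dir_deriv snoc.prems b)
  have \<kappa>': "dir_deriv b \<kappa> \<in> schwartz_funs" by (intro schwartz_dir_deriv snoc.prems b)
  have bd': "\<exists>K. \<forall>x. cmod (iter_deriv cs (dir_deriv b m) x) \<le> K" if "cs \<in> lists Basis" for cs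
    using snoc.prems(4)[of "cs @ [b]"] that b by (simp add: iter_deriv_snoc)
  have z': "dir_deriv b m x = 0" if "norm x < 1" for x
  proof -
    have "dir_deriv b m x = dir_deriv b (\<lambda>_. 0) x"
      using that by (intro dir_deriv_cong_open[of "ball 0 1"]) (auto simp: snoc.prems(5))
    thus ?thesis by (simp add: dir_deriv_const)
  qed
  obtain B1 where B1: "B1 \<longlonglongrightarrow> 0" "\<And>n x. (1 + norm x) ^ k *
    cmod (iter_deriv bs (\<lambda>x. dir_deriv b \<kappa> x * m (e n *\<^sub>R x)) x) \<le> B1 n"
    using snoc.IH[OF b(2) \<kappa>' snoc.prems(3-5)] unfolding e_def by blast
  obtain B2 where B2: "B2 \<longlonglongrightarrow> 0" "\<And>n x. (1 + norm x) ^ k *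
    cmod (iter_deriv bs (\<lambda>x. \<kappa> x * dir_deriv b m (e n *\<^sub>R x)) x) \<le> B2 n"
    using snoc.IH[OF b(2) snoc.prems(2) m' bd' z'] unfolding e_def by blast
  have "(1 + norm x) ^ k * cmod (iter_deriv (bs @ [b]) (\<lambda>x. \<kappa> x * m (e n *\<^sub>R x)) x) \<le> B1 n + B2 n" for n x
  proof -
    have s: "smooth_on UNIV \<kappa>" "smooth_on UNIV (\<lambda>x. m (e n *\<^sub>R x))" "smooth_on UNIV (dir_deriv b \<kappa>)"
      "smooth_on UNIV (\<lambda>x. dir_deriv b m (e n *\<^sub>R x))"
      by (intro schwartz_smooth snoc.prems smooth_on_scaled m' \<kappa>')+
    have "dir_deriv b (\<lambda>x. \<kappa> x * m (e n *\<^sub>R x)) = (\<lambda>x. dir_deriv b \<kappa> x * m (e n *\<^sub>R x) +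
       of_real (e n) * (\<kappa> x * dir_deriv b m (e n *\<^sub>R x)))"
      unfolding dir_deriv_mult[OF s(1,2)] dir_deriv_scaled(1)[OF snoc.prems(3)] by (simp add: mult_ac)
    hence eq: "iter_deriv (bs @ [b]) (\<lambda>x. \<kappa> x * m (e n *\<^sub>R x)) x =
       iter_deriv bs (\<lambda>x. dir_deriv b \<kappa> x * m (e n *\<^sub>R x)) x +
       of_real (e n) * iter_deriv bs (\<lambda>x. \<kappa> x * dir_deriv b m (e n *\<^sub>R x)) x"
      unfolding iter_deriv_snoc using s b
      by (simp add: iter_deriv_add iter_deriv_cmult smooth_on_mult smooth_on_const)
    have e1: "0 \<le> e n" "e n \<le> 1" by (auto simp: e_def)
    have "cmod (iter_deriv (bs @ [b]) (\<lambda>x. \<kappa> x * m (e n *\<^sub>R x)) x) \<le>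
       cmod (iter_deriv bs (\<lambda>x. dir_deriv b \<kappa> x * m (e n *\<^sub>R x)) x) +
       1 * cmod (iter_deriv bs (\<lambda>x. \<kappa> x * dir_deriv b m (e n *\<^sub>R x)) x)"
      unfolding eq using e1
      by (intro order_trans[OF norm_triangle_ineq] add_left_mono) (auto simp: norm_mult intro!: mult_left_le_one_le)
    hence "(1 + norm x) ^ k * cmod (iter_deriv (bs @ [b]) (\<lambda>x. \<kappa> x * m (e n *\<^sub>R x)) x) \<le>
       (1 + norm x) ^ k * (cmod (iter_deriv bs (\<lambda>x. dir_deriv b \<kappa> x * m (e n *\<^sub>R x)) x) +
       1 * cmod (iter_deriv bs (\<lambda>x. \<kappa> x * dir_deriv b m (e n *\<^sub>R x)) x))"
      by (rule mult_left_mono) auto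
    also have "\<dots> \<le> B1 n + B2 n" using B1(2)[of x n] B2(2)[of x n] by (simp add: distrib_left)
    finally show ?thesis .
  qed
  moreover have "(\<lambda>n. B1 n + B2 n) \<longlonglongrightarrow> 0" using tendsto_add[OF B1(1) B2(1)] by simp
  ultimately show ?case unfolding e_def by (intro exI[of _ "\<lambda>n. B1 n + B2 n"]) blast
qed

lemma test_funs_iter_deriv: "f \<in> test_funs \<Longrightarrow> bs \<in> lists Basis \<Longrightarrow> iter_deriv bs f \<in> test_funs"
  by (induction bs) (auto simp: iter_deriv_Cons test_funs_dir_deriv)

lemma test_funs_schwartz:
  fixes f :: "'a::euclidean_space \<Rightarrow> complex"
  assumes "f \<in> test_funs"
  shows "f \<in> schwartz_funs"
  unfolding schwartz_funs_def smooth_fun_iff_smooth_on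
proof (intro CollectI conjI allI ballI)
  show "smooth_on UNIV f" by (rule test_funs_smooth[OF assms])
  fix k and bs :: "'a list" assume "bs \<in> lists Basis"
  hence "iter_deriv bs f \<in> test_funs" by (rule test_funs_iter_deriv[OF assms])
  hence c: "continuous_on UNIV (iter_deriv bs f)" "bounded {x. iter_deriv bs f x \<noteq> 0}"
    by (auto intro: test_funs_continuous test_funs_support)
  have "\<exists>B. \<forall>x. cmod (of_real ((1 + norm x) ^ k) * iter_deriv bs f x) \<le> B"
    by (rule bounded_support_bounded[of "\<lambda>x. of_real ((1 + norm x) ^ k) * iter_deriv bs f x"])
      (use c in \<open>auto intro!: continuous_intros intro: bounded_subset\<close>)
  thus "\<exists>C. \<forall>x. (1 + norm x) ^ k * cmod (iter_deriv bs f x) \<le> C"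
    by (simp only: norm_mult norm_of_real) (simp add: power_abs[symmetric])
qed

lemma schwartz_seminorm_le:
  assumes "\<And>x bs. bs \<in> lists Basis \<Longrightarrow> length bs \<le> N \<Longrightarrow> (1 + norm x) ^ k * cmod (iter_deriv bs f x) \<le> C"
  shows "schwartz_seminorm k N f \<le> C"
  unfolding schwartz_seminorm_def
proof (rule cSUP_least)
  have "([] :: 'a list) \<in> {bs \<in> lists Basis. length bs \<le> N}" by simp
  thus "UNIV \<times> {bs :: 'a list. bs \<in> lists Basis \<and> length bs \<le> N} \<noteq> {}" by blast
qed (use assms in auto)

text \<open>Cutting off at radius about n approximates \<open>\<kappa>\<close> in every seminorm, so
  continuity of \<open>w\<close> on one side and dominated convergence on the other give the
  equality. It is called for because a product of distributions is fixed on test functions, while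
  multipliers evaluate it at Schwartz functions.\<close>

lemma tempered_eq_on_schwartz:
  fixes F \<kappa> :: "'a::euclidean_space \<Rightarrow> complex"
  assumes \<Psi>: "is_cutoff \<Psi>" and w: "tempered w" and F: "integrable lborel F"
    and eq: "\<And>\<phi>. \<phi> \<in> test_funs \<Longrightarrow> w \<phi> = dist_of_fun F \<phi>" and \<kappa>: "\<kappa> \<in> schwartz_funs"
  shows "w \<kappa> = dist_of_fun F \<kappa>"
proof -
  define e where "e n = 1 / (real n + 1)" for n
  define \<eta> where "\<eta> x = \<Psi> (1 * (norm (x - 0))\<^sup>2)" for x :: 'a
  have \<eta>t: "\<eta> \<in> test_funs" unfolding \<eta>_def by (rule cutoff_ball_test_funs[OF \<Psi>]) simp
  have \<eta>s: "smooth_on UNIV \<eta>" by (rule test_funs_smooth[OF \<eta>t])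
  have \<eta>1: "\<eta> x = 1" if "norm x < 1" for x
  proof -
    have "(norm x)\<^sup>2 \<le> 1" using that by (simp add: power_le_one)
    thus ?thesis using \<Psi> by (simp add: \<eta>_def is_cutoff_def)
  qed
  define m where "m x = \<eta> x + (- 1)" for x
  have ms: "smooth_on UNIV m" unfolding m_def by (intro smooth_on_add \<eta>s smooth_on_const) auto
  have bd: "\<exists>K. \<forall>x. cmod (iter_deriv cs m x) \<le> K" if cs: "cs \<in> lists Basis" for cs
  proof -
    have "iter_deriv cs \<eta> \<in> test_funs" by (rule test_funs_iter_deriv[OF \<eta>t cs])
    then obtain K where K: "K \<ge> 0" "\<And>x. cmod (iter_deriv cs \<eta> x) \<le> K"
      using bounded_support_bounded[OF test_funs_continuous[of "iter_deriv cs \<eta>"] test_funs_support] by blast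
    have "\<exists>c. cmod c \<le> 1 \<and> iter_deriv cs (\<lambda>x::'a. -1) = (\<lambda>_. c)"
      using cs
    proof (induction cs)
      case Nil show ?case by (rule exI[of _ "-1"]) simp
    next
      case (Cons b cs) thus ?case by (intro exI[of _ 0]) (auto simp: iter_deriv_Cons dir_deriv_const)
    qed
    then obtain c where c: "cmod c \<le> 1" "iter_deriv cs (\<lambda>x::'a. -1) = (\<lambda>_. c)" by blast
    have "iter_deriv cs m = (\<lambda>x. iter_deriv cs \<eta> x + iter_deriv cs (\<lambda>x. - 1) x)"
      unfolding m_def by (rule iter_deriv_add[OF \<eta>s smooth_on_const[OF open_UNIV] cs])
    moreover have "cmod (iter_deriv cs \<eta> x + c) \<le> K + 1" for x
      using norm_triangle_ineq[of "iter_deriv cs \<eta> x" c] K(2)[of x] c by linarith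
    ultimately show ?thesis using c(2) by auto
  qed
  have mz: "m x = 0" if "norm x < 1" for x using \<eta>1[OF that] by (simp add: m_def)
  obtain C k N where CkN: "\<And>\<phi>. \<phi> \<in> schwartz_funs \<Longrightarrow> cmod (w \<phi>) \<le> C * schwartz_seminorm k N \<phi>"
    using w unfolding tempered_def by blast
  define D where "D n x = \<kappa> x * m (e n *\<^sub>R x)" for n x
  define T where "T n x = \<kappa> x * \<eta> (e n *\<^sub>R x)" for n x
  have e0: "e n > 0" for n by (simp add: e_def)
  have Tt: "T n \<in> test_funs" for n
  proof -
   obtain R where R: "\<And>x. \<eta> x \<noteq> 0 \<Longrightarrow> norm x \<le> R"
     using test_funs_support[OF \<eta>t] unfolding bounded_iff by blast
   show ?thesis
   proof (rule test_funsI)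
    show "smooth_on UNIV (T n)" unfolding T_def
      by (intro smooth_on_mult schwartz_smooth \<kappa> smooth_on_scaled \<eta>s open_UNIV)
    show "bounded (cball (0::'a) (R / e n))" by simp
    fix x :: 'a assume "x \<notin> cball 0 (R / e n)"
    hence "norm (e n *\<^sub>R x) > R" using e0[of n] by (simp add: not_le pos_divide_less_eq mult.commute)
    thus "T n x = 0" using R[of "e n *\<^sub>R x"] by (auto simp: T_def)
   qed
  qed
  have lin: "w (\<lambda>x. a * f x + b * g x) = a * w f + b * w g" if "f \<in> schwartz_funs" "g \<in> schwartz_funs" for a b f g
  proof -
    have "\<forall>\<phi>\<in>schwartz_funs. \<forall>\<eta>\<in>schwartz_funs. \<forall>a b. w (\<lambda>x. a * \<phi> x + b * \<eta> x) = a * w \<phi> + b * w \<eta>"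
      using w by (simp add: tempered_def linear_functional_on_def)
    from bspec[OF bspec[OF this that(1)] that(2)] show ?thesis by simp
  qed
  have err: "\<exists>B. B \<longlonglongrightarrow> 0 \<and> (\<forall>n x. (1 + norm x) ^ j * cmod (iter_deriv bs (D n) x) \<le> B n)"
    if "bs \<in> lists Basis" for bs j
    unfolding D_def e_def by (rule schwartz_cutoff_error[OF that \<kappa> ms bd mz])
  hence "\<forall>bs\<in>{bs. set bs \<subseteq> Basis \<and> length bs \<le> N}.
      \<exists>B. B \<longlonglongrightarrow> 0 \<and> (\<forall>n x. (1 + norm x) ^ k * cmod (iter_deriv bs (D n) x) \<le> B n)"
    by (simp add: lists_eq_set)
  from bchoice[OF this] obtain B where B': "\<forall>bs\<in>{bs. set bs \<subseteq> Basis \<and> length bs \<le> N}. B bs \<longlonglongrightarrow> 0 \<and>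
      (\<forall>n x. (1 + norm x) ^ k * cmod (iter_deriv bs (D n) x) \<le> B bs n)" ..
  hence B: "\<And>bs. bs \<in> {bs. set bs \<subseteq> Basis \<and> length bs \<le> N} \<Longrightarrow> B bs \<longlonglongrightarrow> 0"
    "\<And>bs n x. bs \<in> {bs. set bs \<subseteq> Basis \<and> length bs \<le> N} \<Longrightarrow> (1 + norm x) ^ k * cmod (iter_deriv bs (D n) x) \<le> B bs n"
    by blast+
  \<comment> \<open>Only finitely many lists of derivatives have length at most \<open>N\<close>, so
    the sum of their null sequences dominates the seminorm and still tends to 0.\<close>
  define L where "L = {bs. set bs \<subseteq> (Basis :: 'a set) \<and> length bs \<le> N}"
  have finL: "finite L" unfolding L_def by (rule finite_lists_length_le) simp
  have B0: "B bs n \<ge> 0" if "bs \<in> L" for bs n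
    using B(2)[of bs 0 n] that by (simp add: L_def order_trans[OF norm_ge_zero])
  have sb: "schwartz_seminorm k N (D n) \<le> (\<Sum>bs\<in>L. B bs n)" for n
  proof (rule schwartz_seminorm_le)
    fix x and bs :: "'a list" assume "bs \<in> lists Basis" "length bs \<le> N"
    hence bs: "bs \<in> L" by (auto simp: L_def)
    have "(1 + norm x) ^ k * cmod (iter_deriv bs (D n) x) \<le> B bs n" using B(2) bs unfolding L_def by blast
    also have "\<dots> \<le> (\<Sum>bs\<in>L. B bs n)" by (rule member_le_sum[OF bs _ finL]) (auto intro: B0)
    finally show "(1 + norm x) ^ k * cmod (iter_deriv bs (D n) x) \<le> (\<Sum>bs\<in>L. B bs n)" .
  qed
  have Ts: "T n \<in> schwartz_funs" for n by (rule test_funs_schwartz[OF Tt])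
  have "(\<lambda>n. w (T n) - w \<kappa>) \<longlonglongrightarrow> 0"
  proof (rule Lim_null_comparison)
    show "\<forall>\<^sub>F n in sequentially. norm (w (T n) - w \<kappa>) \<le> \<bar>C\<bar> * (\<Sum>bs\<in>L. B bs n)"
    proof (rule always_eventually, rule allI)
      fix n
      have De: "D n = (\<lambda>x. 1 * T n x + (-1) * \<kappa> x)"
        by (rule ext) (simp add: D_def T_def m_def algebra_simps)
      have "smooth_on UNIV (D n)" unfolding D_def
        by (intro smooth_on_mult schwartz_smooth \<kappa> smooth_on_scaled ms open_UNIV)
      moreover have "\<exists>K. \<forall>x. (1 + norm x) ^ j * cmod (iter_deriv bs (D n) x) \<le> K" if "bs \<in> lists Basis" for j bs
        using err[OF that, of j] by blast
      ultimately have Ds: "D n \<in> schwartz_funs" unfolding schwartz_funs_def smooth_fun_iff_smooth_on by blast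
      have "w (T n) - w \<kappa> = w (D n)" unfolding De using lin[OF Ts[of n] \<kappa>, of 1 "-1"] by simp
      hence "norm (w (T n) - w \<kappa>) \<le> C * schwartz_seminorm k N (D n)" using CkN[OF Ds] by simp
      \<comment> \<open>This permits replacing \<open>C\<close> by its absolute value. The seminorm
        is a real supremum, which must be known to be bounded above before it can be compared with
        one of its terms.\<close>
      moreover have "0 \<le> schwartz_seminorm k N (D n)"
      proof -
        have "bdd_above ((\<lambda>(x, bs). (1 + norm x) ^ k * cmod (iter_deriv bs (D n) x)) ` (UNIV \<times> {bs \<in> lists Basis. length bs \<le> N}))"
        proof (rule bdd_aboveI2)
          fix z :: "'a \<times> 'a list" assume "z \<in> UNIV \<times> {bs \<in> lists Basis. length bs \<le> N}"
          then obtain x bs where z: "z = (x, bs)" "bs \<in> L" by (auto simp: L_def)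
          have "(1 + norm x) ^ k * cmod (iter_deriv bs (D n) x) \<le> B bs n" using B(2) z(2) unfolding L_def by blast
          also have "\<dots> \<le> (\<Sum>bs\<in>L. B bs n)" by (rule member_le_sum[OF z(2) _ finL]) (auto intro: B0)
          finally show "(case z of (x, bs) \<Rightarrow> (1 + norm x) ^ k * cmod (iter_deriv bs (D n) x)) \<le> (\<Sum>bs\<in>L. B bs n)"
            by (simp add: z)
        qed
        hence "(case (0, []) of (x, bs) \<Rightarrow> (1 + norm x) ^ k * cmod (iter_deriv bs (D n) x)) \<le> schwartz_seminorm k N (D n)"
          unfolding schwartz_seminorm_def by (intro cSUP_upper) auto
        thus ?thesis by (rule order_trans[rotated]) auto
      qed
      ultimately have "norm (w (T n) - w \<kappa>) \<le> \<bar>C\<bar> * schwartz_seminorm k N (D n)"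
        by (meson abs_ge_self mult_right_mono order_trans)
      also have "\<dots> \<le> \<bar>C\<bar> * (\<Sum>bs\<in>L. B bs n)" by (intro mult_left_mono sb) auto
      finally show "norm (w (T n) - w \<kappa>) \<le> \<bar>C\<bar> * (\<Sum>bs\<in>L. B bs n)" .
    qed
    have "(\<lambda>n. \<bar>C\<bar> * (\<Sum>bs\<in>L. B bs n)) \<longlonglongrightarrow> \<bar>C\<bar> * (\<Sum>bs\<in>L. 0)"
      by (intro tendsto_intros B(1)) (auto simp: L_def)
    thus "(\<lambda>n. \<bar>C\<bar> * (\<Sum>bs\<in>L. B bs n)) \<longlonglongrightarrow> 0" by simp
  qed
  hence 1: "(\<lambda>n. w (T n)) \<longlonglongrightarrow> w \<kappa>" by (rule LIM_zero_cancel)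
  obtain K where K: "K \<ge> 0" "\<And>x. cmod (\<eta> x) \<le> K"
    using bounded_support_bounded[OF test_funs_continuous[OF \<eta>t] test_funs_support[OF \<eta>t]] by blast
  obtain B' where B': "\<And>x. cmod (\<kappa> x) \<le> B'" using schwartz_bounded[OF \<kappa>] by blast
  have [measurable]: "F \<in> borel_measurable borel" using borel_measurable_integrable[OF F] by simp
  have [measurable]: "\<kappa> \<in> borel_measurable borel" by (intro borel_measurable_continuous_onI schwartz_continuous \<kappa>)
  have [measurable]: "\<eta> \<in> borel_measurable borel" by (intro borel_measurable_continuous_onI test_funs_continuous \<eta>t)
  have 2: "(\<lambda>n. dist_of_fun F (T n)) \<longlonglongrightarrow> dist_of_fun F \<kappa>"
    unfolding dist_of_fun_def
  proof (rule integral_dominated_convergence[where w="\<lambda>x. cmod (F x) * (B' * K)"])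
    show "integrable lborel (\<lambda>x. cmod (F x) * (B' * K))" by (intro integrable_mult_left integrable_norm F)
    show "AE x in lborel. (\<lambda>n. F x * T n x) \<longlonglongrightarrow> F x * \<kappa> x"
    proof (rule AE_I2)
      fix x :: 'a
      have "(\<lambda>n. norm (e n *\<^sub>R x)) \<longlonglongrightarrow> 0" unfolding e_def norm_scaleR by real_asymp
      hence "\<forall>\<^sub>F n in sequentially. norm (e n *\<^sub>R x) < 1" by (rule order_tendstoD(2)) simp
      hence "\<forall>\<^sub>F n in sequentially. F x * \<kappa> x = F x * T n x"
        by eventually_elim (simp add: T_def \<eta>1)
      thus "(\<lambda>n. F x * T n x) \<longlonglongrightarrow> F x * \<kappa> x" by (rule Lim_transform_eventually[OF tendsto_const])
    qed
    show "AE x in lborel. norm (F x * T n x) \<le> cmod (F x) * (B' * K)" for n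
    proof (rule AE_I2)
      fix x :: 'a
      have "0 \<le> B'" using B'[of 0] norm_ge_zero[of "\<kappa> 0"] by linarith
      hence "cmod (\<kappa> x) * cmod (\<eta> (e n *\<^sub>R x)) \<le> B' * K" by (intro mult_mono B' K) auto
      thus "norm (F x * T n x) \<le> cmod (F x) * (B' * K)"
        unfolding T_def norm_mult by (intro mult_left_mono) auto
    qed
  qed (simp_all add: T_def)
  show ?thesis using LIMSEQ_unique[OF 1] 2 eq[OF Tt] by simp
qed

text \<open>\<open>S\<close> merely contains the spectrum. Continuity, integrability and boundedness
  are included so that Fourier inversion applies and the class is closed under products.\<close>

definition bandlimited :: "'a::euclidean_space set \<Rightarrow> ('a \<Rightarrow> complex) \<Rightarrow> bool"
  where "bandlimited S f \<longleftrightarrow> continuous_on UNIV f \<and> integrable lborel f \<and> (\<exists>B. \<forall>x. cmod (f x) \<le> B) \<and>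
    bounded S \<and> (\<forall>\<xi>. \<xi> \<notin> S \<longrightarrow> fourier f \<xi> = 0)"

lemma bandlimited_continuous: "bandlimited S f \<Longrightarrow> continuous_on UNIV f"
  and bandlimited_integrable: "bandlimited S f \<Longrightarrow> integrable lborel f"
  and bandlimited_fourier: "bandlimited S f \<Longrightarrow> \<xi> \<notin> S \<Longrightarrow> fourier f \<xi> = 0"
  by (auto simp: bandlimited_def)

lemma fourier_continuous: "integrable lborel f \<Longrightarrow> continuous_on UNIV (fourier f)"
  unfolding fourier_eq_ft by (rule ft_continuous)

lemma bandlimited_fourier_integrable:
  assumes "bandlimited S f"
  shows "integrable lborel (fourier f)"
proof (rule bounded_support_integrable)
  show "continuous_on UNIV (fourier f)" by (rule fourier_continuous[OF bandlimited_integrable[OF assms]])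
  show "bounded {x. fourier f x \<noteq> 0}" using assms unfolding bandlimited_def by (auto intro: bounded_subset)
qed

lemma bandlimited_inv_fourier:
  assumes "bandlimited S f"
  shows "inv_fourier (fourier f) = f"
proof -
  obtain B where B: "\<And>x. cmod (f x) \<le> B" using assms by (auto simp: bandlimited_def)
  show ?thesis
    by (rule inv_fourier_fourier[OF bandlimited_continuous bandlimited_integrable B
      bandlimited_fourier_integrable]) (rule assms)+
qed

lemma bandlimited_mono: "bandlimited S f \<Longrightarrow> S \<subseteq> T \<Longrightarrow> bounded T \<Longrightarrow> bandlimited T f"
  unfolding bandlimited_def by blast

text \<open>By the convolution formula every frequency of the product is a sum of a frequency from
  \<open>S\<close> and one from \<open>T\<close>.\<close>

lemma bandlimited_mult:
  assumes f: "bandlimited S f" and g: "bandlimited T g"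
  shows "bandlimited {a + b | a b. a \<in> S \<and> b \<in> T} (\<lambda>x. f x * g x)"
proof -
  obtain B where B: "\<And>x. cmod (f x) \<le> B" using f by (auto simp: bandlimited_def)
  obtain B' where B': "\<And>x. cmod (g x) \<le> B'" using g by (auto simp: bandlimited_def)
  have "0 \<le> B" using B[of 0] norm_ge_zero[of "f 0"] by linarith
  have c: "continuous_on UNIV (\<lambda>x. f x * g x)"
    using f g by (intro continuous_intros) (auto simp: bandlimited_def)
  have i: "integrable lborel (\<lambda>x. f x * g x)"
    by (rule integrable_bounded_mult[OF bandlimited_integrable[OF g]
      borel_measurable_continuous_onI[OF bandlimited_continuous[OF f]] B])
  have b: "cmod (f x * g x) \<le> B * B'" for x
    unfolding norm_mult by (intro mult_mono B B' \<open>0 \<le> B\<close>) auto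
  have S: "bounded {a + b | a b. a \<in> S \<and> b \<in> T}"
  proof -
    have "{a + b | a b. a \<in> S \<and> b \<in> T} = (\<Union>x\<in>S. \<Union>y\<in>T. {x + y})" by blast
    thus ?thesis using bounded_sums[of S T] f g by (simp add: bandlimited_def)
  qed
  have "fourier (\<lambda>x. f x * g x) \<xi> = 0" if "\<xi> \<notin> {a + b | a b. a \<in> S \<and> b \<in> T}" for \<xi>
  proof -
    have z: "fourier f \<zeta> * fourier g (\<xi> - \<zeta>) = 0" for \<zeta>
    proof (cases "\<zeta> \<in> S")
      case True
      have "\<xi> - \<zeta> \<notin> T"
      proof
        assume "\<xi> - \<zeta> \<in> T"
        hence "\<zeta> + (\<xi> - \<zeta>) \<in> {a + b | a b. a \<in> S \<and> b \<in> T}" using True by blast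
        thus False using that by simp
      qed
      thus ?thesis by (simp add: bandlimited_fourier[OF g])
    qed (simp add: bandlimited_fourier[OF f])
    show ?thesis
      using fourier_mult[OF bandlimited_fourier_integrable[OF f] bandlimited_integrable[OF g], of \<xi>]
      unfolding bandlimited_inv_fourier[OF f] z by simp
  qed
  thus ?thesis unfolding bandlimited_def using c i b S by blast
qed

lemma bandlimited_inv_fourier_test:
  assumes "h \<in> test_funs" "bounded S" "\<And>x. x \<notin> S \<Longrightarrow> h x = 0"
  shows "bandlimited S (inv_fourier h)"
proof -
  have s: "inv_fourier h \<in> schwartz_funs" by (rule inv_fourier_schwartz[OF assms(1)])
  have "\<exists>B. \<forall>x. cmod (inv_fourier h x) \<le> B" by (rule schwartz_bounded[OF s]) blast
  thus ?thesis unfolding bandlimited_def fourier_inv_fourier_test[OF assms(1)]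
    using schwartz_continuous[OF s] schwartz_integrable[OF s] assms(2,3) by simp
qed

section \<open>The anisotropic distance\<close>

lemma sum_Basis_vec: "(\<Sum>b\<in>(Basis::(real^'n) set). F b) = (\<Sum>i\<in>UNIV. F (axis i 1))"
proof -
  have eq: "Basis = range (\<lambda>i::'n. axis i (1::real))" by (auto simp: Basis_vec_def)
  have "inj (\<lambda>i::'n. axis i (1::real))" by (auto simp: inj_def axis_eq_axis)
  thus ?thesis unfolding eq by (simp add: sum.reindex)
qed

lemma alg_closure_sum:
  "(\<And>i. i \<in> I \<Longrightarrow> f i \<in> alg_closure G) \<Longrightarrow> (\<lambda>x. \<Sum>i\<in>I. f i x) \<in> alg_closure G"
  by (induction I rule: infinite_finite_induct) (auto intro: alg_closure.const alg_closure.add)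

text \<open>For implicitly defined \<open>F\<close> the mean value theorem supplies a factor
  \<open>Q\<close> of which only the limit is known. The error splits into \<open>Q\<close> times
  the remainder of \<open>H\<close> and \<open>Q - q\<close> times its linear part, both of which
  are small.\<close>

lemma has_derivative_factored:
  fixes F H :: "'a::real_normed_vector \<Rightarrow> real"
  assumes H: "(H has_derivative H') (at x)" and Q: "(Q \<longlongrightarrow> q) (at x)"
    and F: "\<forall>\<^sub>F y in at x. F y - F x = Q y * (H y - H x)"
  shows "(F has_derivative (\<lambda>v. q * H' v)) (at x)"
  unfolding has_derivative_iff_norm
proof
  have bl: "bounded_linear H'" by (rule has_derivative_bounded_linear[OF H])
  show "bounded_linear (\<lambda>v. q * H' v)" by (rule bounded_linear_const_mult[OF bl])
  obtain K where K: "\<And>v. norm (H' v) \<le> norm v * K" using bounded_linear.bounded[OF bl] by blast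
  have lim: "((\<lambda>y. norm (H y - H x - H' (y - x)) / norm (y - x)) \<longlongrightarrow> 0) (at x)"
    using H unfolding has_derivative_iff_norm by blast
  show "((\<lambda>y. norm (F y - F x - q * H' (y - x)) / norm (y - x)) \<longlongrightarrow> 0) (at x)"
  proof (rule Lim_null_comparison)
    show "\<forall>\<^sub>F y in at x. norm (norm (F y - F x - q * H' (y - x)) / norm (y - x))
       \<le> \<bar>Q y\<bar> * (norm (H y - H x - H' (y - x)) / norm (y - x)) + \<bar>Q y - q\<bar> * K"
      using F eventually_neq_at_within[of x x UNIV]
    proof eventually_elim
      case (elim y)
      have "F y - F x - q * H' (y - x) = Q y * (H y - H x - H' (y - x)) + (Q y - q) * H' (y - x)"
        unfolding elim(1) by (simp add: algebra_simps)
      hence "norm (F y - F x - q * H' (y - x)) \<le> \<bar>Q y\<bar> * norm (H y - H x - H' (y - x)) + \<bar>Q y - q\<bar> * norm (H' (y - x))"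
        using norm_triangle_ineq[of "Q y * (H y - H x - H' (y - x))" "(Q y - q) * H' (y - x)"] by (simp add: abs_mult)
      also have "\<dots> \<le> \<bar>Q y\<bar> * norm (H y - H x - H' (y - x)) + \<bar>Q y - q\<bar> * (norm (y - x) * K)"
        by (intro add_left_mono mult_left_mono K) auto
      finally have "norm (F y - F x - q * H' (y - x)) / norm (y - x) \<le>
         (\<bar>Q y\<bar> * norm (H y - H x - H' (y - x)) + \<bar>Q y - q\<bar> * (norm (y - x) * K)) / norm (y - x)"
        by (rule divide_right_mono) auto
      thus ?case using elim(2) by (simp add: add_divide_distrib)
    qed
    have "((\<lambda>y. \<bar>Q y\<bar> * (norm (H y - H x - H' (y - x)) / norm (y - x)) + \<bar>Q y - q\<bar> * K) \<longlongrightarrow> \<bar>q\<bar> * 0 + \<bar>q - q\<bar> * K) (at x)"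
      by (intro tendsto_intros Q lim)
    thus "((\<lambda>y. \<bar>Q y\<bar> * (norm (H y - H x - H' (y - x)) / norm (y - x)) + \<bar>Q y - q\<bar> * K) \<longlongrightarrow> 0) (at x)" by simp
  qed
qed

locale aniso =
  fixes M :: "real ^ 'n"
  assumes weight: "is_weight M"
begin

abbreviation adist :: "real ^ 'n \<Rightarrow> real" where "adist \<equiv> aniso_dist M"
abbreviation dil :: "real \<Rightarrow> real ^ 'n \<Rightarrow> real ^ 'n" where "dil \<equiv> aniso_dilation M"

lemma M_ge: "M $ i \<ge> 1" using weight by (simp add: is_weight_def)

lemma M_eq: obtains i where "M $ i = 1"
proof -
  have "Min (range (($) M)) \<in> range (($) M)" by (rule Min_in) auto
  then obtain i where "M $ i = Min (range (($) M))" by (metis imageE)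
  thus ?thesis using weight that[of i] by (simp add: is_weight_def)
qed

text \<open>The squared Euclidean norm of \<open>x\<close> after the dilation by 1/t, written with
  powers so that it can be differentiated in \<open>t\<close>. Off the origin it decreases strictly
  in \<open>t\<close>, and the anisotropic distance is the point where it equals 1.\<close>

definition gauge :: "real \<Rightarrow> real ^ 'n \<Rightarrow> real"
  where "gauge t x = (\<Sum>i\<in>UNIV. (x $ i)\<^sup>2 * t powr (- 2 * M $ i))"

lemma gauge_eq: "t > 0 \<Longrightarrow> (\<Sum>i\<in>UNIV. (x $ i / t powr (M $ i))\<^sup>2) = gauge t x"
proof -
  assume t: "t > 0"
  have "t powr (- 2 * M $ i) = 1 / (t powr (M $ i))\<^sup>2" for i
    using t by (simp add: powr_minus powr_powr[symmetric] powr_numeral inverse_eq_divide mult.commute[of 2])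
  thus ?thesis by (simp add: gauge_def power_divide)
qed

lemma gauge_strict_antimono:
  assumes "x \<noteq> 0" "0 < s" "s < t"
  shows "gauge t x < gauge s x"
  unfolding gauge_def
proof (rule sum_strict_mono_ex1)
  have lt: "t powr (- 2 * M $ i) < s powr (- 2 * M $ i)" for i
    using assms M_ge[of i] by (intro powr_less_mono2_neg) auto
  show "\<forall>i\<in>UNIV. (x $ i)\<^sup>2 * t powr (- 2 * M $ i) \<le> (x $ i)\<^sup>2 * s powr (- 2 * M $ i)"
    by (intro ballI mult_left_mono less_imp_le[OF lt]) auto
  obtain i where i: "x $ i \<noteq> 0" using assms(1) by (auto simp: vec_eq_iff)
  show "\<exists>i\<in>UNIV. (x $ i)\<^sup>2 * t powr (- 2 * M $ i) < (x $ i)\<^sup>2 * s powr (- 2 * M $ i)"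
    by (intro bexI[of _ i] mult_strict_left_mono lt) (use i in auto)
qed auto

lemma gauge_le_norm: "t \<ge> 1 \<Longrightarrow> gauge t x \<le> (norm x)\<^sup>2 / t\<^sup>2"
proof -
  assume t: "t \<ge> 1"
  have "t powr (- 2 * M $ i) \<le> t powr (-2)" for i using M_ge[of i] t by (intro powr_mono) auto
  hence "gauge t x \<le> (\<Sum>i\<in>UNIV. (x $ i)\<^sup>2 * t powr (-2))"
    unfolding gauge_def by (intro sum_mono mult_left_mono) auto
  also have "\<dots> = (\<Sum>i\<in>UNIV. (x $ i)\<^sup>2) * t powr (-2)" by (simp add: sum_distrib_right)
  also have "(\<Sum>i\<in>UNIV. (x $ i)\<^sup>2) = (norm x)\<^sup>2" by (simp add: norm_vec_def L2_set_def sum_nonneg)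
  also have "t powr (-2) = 1 / t\<^sup>2" using t by (simp add: powr_minus powr_numeral inverse_eq_divide)
  finally show ?thesis by simp
qed

lemma gauge_continuous: "continuous_on {0<..} (\<lambda>t. gauge t x)"
  unfolding gauge_def by (intro continuous_intros) auto

text \<open>Intermediate values between \<open>a\<close>, where the term of index \<open>k\<close>
  alone equals 1, and \<open>b\<close>, where comparison with the Euclidean norm gives at most
  1.\<close>

lemma gauge_solvable:
  assumes "x \<noteq> 0"
  obtains t where "t > 0" "gauge t x = 1"
proof -
  obtain k where k: "x $ k \<noteq> 0" using assms by (auto simp: vec_eq_iff)
  define a where "a = \<bar>x $ k\<bar> powr (1 / M $ k)"
  define b where "b = max 1 (norm x)"
  have a: "a > 0" using k by (simp add: a_def)
  have Mk: "M $ k \<ge> 1" by (rule M_ge)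
  have "(x $ k)\<^sup>2 * a powr (- 2 * M $ k) \<le> gauge a x"
    unfolding gauge_def by (rule member_le_sum) auto
  moreover have "(x $ k)\<^sup>2 * a powr (- 2 * M $ k) = 1"
  proof -
    have "a powr (- 2 * M $ k) = \<bar>x $ k\<bar> powr (- 2)" using Mk by (simp add: a_def powr_powr)
    also have "\<dots> = 1 / (x $ k)\<^sup>2" using k by (simp add: powr_minus powr_numeral inverse_eq_divide)
    finally show ?thesis using k by simp
  qed
  ultimately have ga: "gauge a x \<ge> 1" by simp
  have gb: "gauge b x \<le> 1"
  proof -
    have "gauge b x \<le> (norm x)\<^sup>2 / b\<^sup>2" by (rule gauge_le_norm) (simp add: b_def)
    also have "(norm x)\<^sup>2 \<le> b\<^sup>2" by (rule power_mono) (auto simp: b_def)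
    hence "(norm x)\<^sup>2 / b\<^sup>2 \<le> 1" by (simp add: b_def divide_simps)
    finally show ?thesis .
  qed
  have "a \<le> b"
  proof (cases "\<bar>x $ k\<bar> \<le> 1")
    case True
    hence "a \<le> 1" unfolding a_def using Mk k by (intro powr_le1) auto
    thus ?thesis by (simp add: b_def)
  next
    case False
    hence "a \<le> \<bar>x $ k\<bar> powr 1" unfolding a_def using Mk by (intro powr_mono) auto
    also have "\<dots> \<le> norm x" using k component_le_norm_cart[of x k] by simp
    finally show ?thesis by (simp add: b_def)
  qed
  have "\<exists>t. a \<le> t \<and> t \<le> b \<and> gauge t x = 1"
    using ga gb \<open>a \<le> b\<close> a by (intro IVT2') (auto intro!: continuous_on_subset[OF gauge_continuous])
  then obtain t where "a \<le> t" "gauge t x = 1" by blast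
  thus ?thesis using a by (intro that[of t]) auto
qed

lemma adist_zero [simp]: "adist 0 = 0" by (simp add: aniso_dist_def)

lemma adist_unique:
  assumes "x \<noteq> 0" "t > 0" "gauge t x = 1"
  shows "adist x = t"
proof -
  have "(THE t. t > 0 \<and> (\<Sum>i\<in>UNIV. (x $ i / t powr (M $ i))\<^sup>2) = 1) = t"
  proof (rule the_equality)
    fix s assume s: "s > 0 \<and> (\<Sum>i\<in>UNIV. (x $ i / s powr (M $ i))\<^sup>2) = 1"
    hence "gauge s x = 1" using gauge_eq[of s x] by simp
    thus "s = t" using gauge_strict_antimono[OF assms(1)] assms s by (metis less_irrefl linorder_neqE_linordered_idom)
  qed (use assms in \<open>simp add: gauge_eq\<close>)
  thus ?thesis using assms(1) by (simp add: aniso_dist_def)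
qed

lemma adist_pos: "x \<noteq> 0 \<Longrightarrow> adist x > 0"
  and gauge_adist: "x \<noteq> 0 \<Longrightarrow> gauge (adist x) x = 1"
  by (metis adist_unique gauge_solvable)+

lemma adist_nonneg [simp]: "adist x \<ge> 0"
  using adist_pos[of x] by (cases "x = 0") auto

lemma adist_less_iff: "t > 0 \<Longrightarrow> adist x < t \<longleftrightarrow> gauge t x < 1"
proof (cases "x = 0")
  case False
  assume "t > 0"
  thus ?thesis
    using gauge_strict_antimono[OF False, of t "adist x"] gauge_strict_antimono[OF False, of "adist x" t]
      gauge_adist[OF False] adist_pos[OF False]
    by (cases "adist x" t rule: linorder_cases) auto
qed (simp add: gauge_def)

lemma adist_le_iff: "t > 0 \<Longrightarrow> adist x \<le> t \<longleftrightarrow> gauge t x \<le> 1"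
proof (cases "x = 0")
  case False
  assume "t > 0"
  thus ?thesis
    using gauge_strict_antimono[OF False, of t "adist x"] gauge_strict_antimono[OF False, of "adist x" t]
      gauge_adist[OF False] adist_pos[OF False]
    by (cases "adist x" t rule: linorder_cases) auto
qed (simp add: gauge_def)

lemma dil_component [simp]: "dil t x $ i = t powr (M $ i) * x $ i"
  by (simp add: aniso_dilation_def)

lemma adist_dil:
  assumes "t > 0"
  shows "adist (dil t x) = t * adist x"
proof (cases "x = 0")
  case True
  hence "dil t x = 0" by (simp add: vec_eq_iff)
  thus ?thesis using True by simp
next
  case False
  hence "dil t x \<noteq> 0" using assms by (auto simp: vec_eq_iff)
  thus ?thesis
  proof (rule adist_unique)
    show "t * adist x > 0" using assms adist_pos[OF False] by simp
    have "(t powr (M $ i) * x $ i)\<^sup>2 * (t * adist x) powr (- 2 * M $ i) = (x $ i)\<^sup>2 * adist x powr (- 2 * M $ i)" for i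
    proof -
      have "(t powr (M $ i))\<^sup>2 = t powr (2 * M $ i)" using assms by (simp add: powr_powr[symmetric] powr_numeral mult.commute[of 2])
      moreover have "(t * adist x) powr (- 2 * M $ i) = t powr (- 2 * M $ i) * adist x powr (- 2 * M $ i)"
        using assms by (intro powr_mult)
      moreover have "t powr (2 * M $ i) * t powr (- 2 * M $ i) = 1" using assms by (simp add: powr_add[symmetric])
      ultimately show ?thesis by (simp add: power_mult_distrib mult_ac)
    qed
    thus "gauge (t * adist x) (dil t x) = 1" using gauge_adist[OF False] by (simp add: gauge_def)
  qed
qed

lemma adist_minus [simp]: "adist (- x) = adist x"
proof (cases "x = 0")
  case False
  thus ?thesis using adist_pos[OF False] gauge_adist[OF False] by (intro adist_unique) (auto simp: gauge_def)
qed simp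

text \<open>With \<open>\<lambda> = s / (s + t)\<close> the point \<open>(x + y) / (s + t)\<^sup>M\<close> is componentwise bounded by the convex
  combination of the unit vectors \<open>x / s\<^sup>M\<close> and \<open>y / t\<^sup>M\<close>, because all exponents are at least 1.\<close>

lemma adist_triangle: "adist (x + y) \<le> adist x + adist y"
proof (cases "x = 0 \<or> y = 0")
  case False
  define s t where "s = adist x" and "t = adist y"
  have st: "s > 0" "t > 0" using False adist_pos by (auto simp: s_def t_def)
  define u where "u = (\<chi> i. \<bar>x $ i\<bar> / s powr (M $ i))"
  define v where "v = (\<chi> i. \<bar>y $ i\<bar> / t powr (M $ i))"
  have nu: "norm u = 1" using gauge_adist[of x] False st
    by (simp add: norm_vec_def L2_set_def u_def gauge_eq[symmetric] s_def power_divide)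
  have nv: "norm v = 1" using gauge_adist[of y] False st
    by (simp add: norm_vec_def L2_set_def v_def gauge_eq[symmetric] t_def power_divide)
  define l where "l = s / (s + t)"
  have l: "0 < l" "l < 1" "1 - l = t / (s + t)" using st by (auto simp: l_def field_simps)
  have *: "a / (s + t) powr m \<le> l' * (a / r powr m)" if "l' = r / (s + t)" "0 < r" "a \<ge> 0" "m \<ge> 1" "r \<le> s + t" for a m r l'
  proof -
    have "(r / (s + t)) powr m \<le> (r / (s + t)) powr 1" using that st by (intro powr_mono') auto
    hence "r powr m / (s + t) powr m \<le> l'" using that st by (simp add: powr_divide)
    hence "(a / r powr m) * (r powr m / (s + t) powr m) \<le> (a / r powr m) * l'" using that by (intro mult_left_mono) auto
    thus ?thesis using that by (simp add: mult.commute)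
  qed
  have "gauge (s + t) (x + y) \<le> (norm (l *\<^sub>R u + (1 - l) *\<^sub>R v))\<^sup>2"
  proof -
    have "((x + y) $ i / (s + t) powr (M $ i))\<^sup>2 \<le> ((l *\<^sub>R u + (1 - l) *\<^sub>R v) $ i)\<^sup>2" for i
    proof -
      have "\<bar>(x + y) $ i / (s + t) powr (M $ i)\<bar> \<le> \<bar>x $ i\<bar> / (s + t) powr (M $ i) + \<bar>y $ i\<bar> / (s + t) powr (M $ i)"
        by (simp add: abs_divide add_divide_distrib[symmetric] divide_right_mono)
      also have "\<dots> \<le> l * (\<bar>x $ i\<bar> / s powr (M $ i)) + (1 - l) * (\<bar>y $ i\<bar> / t powr (M $ i))"
        using st l by (intro add_mono *) (auto simp: l_def M_ge)
      also have "\<dots> = (l *\<^sub>R u + (1 - l) *\<^sub>R v) $ i" by (simp add: u_def v_def)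
      also have "\<dots> \<le> \<bar>(l *\<^sub>R u + (1 - l) *\<^sub>R v) $ i\<bar>" by simp
      finally show ?thesis by (rule abs_le_square_iff[THEN iffD1])
    qed
    hence "gauge (s + t) (x + y) \<le> (\<Sum>i\<in>UNIV. ((l *\<^sub>R u + (1 - l) *\<^sub>R v) $ i)\<^sup>2)"
      using st by (simp only: gauge_eq[symmetric] add_pos_pos) (rule sum_mono)
    thus ?thesis by (simp add: norm_vec_def L2_set_def sum_nonneg)
  qed
  also have "\<dots> \<le> 1"
  proof -
    have "norm (l *\<^sub>R u + (1 - l) *\<^sub>R v) \<le> 1"
      using norm_triangle_ineq[of "l *\<^sub>R u" "(1 - l) *\<^sub>R v"] nu nv l(1,2) by simp
    thus ?thesis by (simp add: power_le_one)
  qed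
  finally show ?thesis using adist_le_iff[of "s + t" "x + y"] st by (simp add: s_def t_def)
qed auto

lemma component_le_adist_powr: "\<bar>x $ i\<bar> \<le> adist x powr (M $ i)"
proof (cases "x = 0")
  case False
  have p: "adist x > 0" by (rule adist_pos[OF False])
  have "(x $ i / adist x powr (M $ i))\<^sup>2 \<le> (\<Sum>i\<in>UNIV. (x $ i / adist x powr (M $ i))\<^sup>2)"
    by (rule member_le_sum) auto
  also have "\<dots> = 1" using gauge_eq[OF p, of x] gauge_adist[OF False] by simp
  finally have "\<bar>x $ i / adist x powr (M $ i)\<bar> \<le> 1" by (metis abs_square_le_1)
  thus ?thesis using p by (simp add: abs_divide)
qed simp

lemma adist_axis:
  assumes "M $ i = 1"
  shows "adist (axis i \<sigma>) = \<bar>\<sigma>\<bar>"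
proof (cases "\<sigma> = 0")
  case False
  have "gauge \<bar>\<sigma>\<bar> (axis i \<sigma>) = (\<Sum>j\<in>UNIV. if j = i then \<sigma>\<^sup>2 * \<bar>\<sigma>\<bar> powr (- 2 * M $ j) else 0)"
    unfolding gauge_def by (intro sum.cong) (auto simp: axis_def)
  also have "\<dots> = 1" using False assms by (simp add: powr_minus powr_numeral)
  finally show ?thesis using False by (intro adist_unique) (auto simp: axis_eq_0_iff)
qed (simp add: axis_eq_0_iff[THEN iffD2])

lemma adist_le_norm: "adist x \<le> max 1 (norm x)"
proof -
  define b where "b = max 1 (norm x)"
  have "gauge b x \<le> (norm x)\<^sup>2 / b\<^sup>2" by (rule gauge_le_norm) (simp add: b_def)
  also have "(norm x)\<^sup>2 \<le> b\<^sup>2" by (rule power_mono) (auto simp: b_def)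
  hence "(norm x)\<^sup>2 / b\<^sup>2 \<le> 1" by (simp add: b_def divide_simps)
  finally have "adist x \<le> b" by (subst adist_le_iff) (auto simp: b_def)
  thus ?thesis by (simp add: b_def)
qed

lemma bounded_adist_ball: "bounded {x. adist (x - a) \<le> r}"
proof -
  have "norm x \<le> (\<Sum>i\<in>UNIV. \<bar>r\<bar> powr (M $ i)) + norm a" if "adist (x - a) \<le> r" for x
  proof -
    have "norm (x - a) \<le> (\<Sum>i\<in>UNIV. \<bar>(x - a) $ i\<bar>)" by (rule norm_le_l1_cart)
    also have "\<dots> \<le> (\<Sum>i\<in>UNIV. \<bar>r\<bar> powr (M $ i))"
    proof (rule sum_mono)
      fix i
      have "adist (x - a) powr (M $ i) \<le> \<bar>r\<bar> powr (M $ i)"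
        using that M_ge[of i] by (intro powr_mono2) auto
      thus "\<bar>(x - a) $ i\<bar> \<le> \<bar>r\<bar> powr (M $ i)" using component_le_adist_powr[of "x - a" i] by simp
    qed
    finally show ?thesis using norm_triangle_ineq[of "x - a" a] by simp
  qed
  thus ?thesis unfolding bounded_iff by blast
qed

lemma gauge_continuous_x: "continuous_on UNIV (gauge t)"
  unfolding gauge_def by (intro continuous_intros)

lemma open_adist_less: "open {x. adist x < r}"
proof (cases "r > 0")
  case True
  have "open {x. gauge r x < 1}" by (intro open_Collect_less continuous_intros gauge_continuous_x)
  thus ?thesis using True by (simp add: adist_less_iff)
next
  case False
  hence "{x. adist x < r} = {}" by (auto simp: not_less intro: order_trans)
  thus ?thesis by simp
qed

lemma open_adist_greater: "open {x. r < adist x}"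
proof (cases "r > 0")
  case True
  have "open {x. 1 < gauge r x}" by (intro open_Collect_less continuous_intros gauge_continuous_x)
  moreover have "{x. r < adist x} = {x. 1 < gauge r x}" using adist_le_iff[OF True] by (auto simp: not_le[symmetric])
  ultimately show ?thesis by simp
next
  case False
  show ?thesis
  proof (cases "r = 0")
    case True
    have "{x. r < adist x} = - {0}" using True adist_pos by fastforce
    thus ?thesis by auto
  next
    case False
    hence "{x. r < adist x} = UNIV" using \<open>\<not> r > 0\<close> by (auto intro: less_le_trans[OF _ adist_nonneg])
    thus ?thesis by simp
  qed
qed

lemma adist_tendsto: "(adist \<longlongrightarrow> adist x) (at x)"
proof (rule order_tendstoI)
  fix a assume "a < adist x"
  thus "\<forall>\<^sub>F y in at x. a < adist y"
    using eventually_at_topological open_adist_greater[of a] by blast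
next
  fix a assume "adist x < a"
  thus "\<forall>\<^sub>F y in at x. adist y < a"
    using eventually_at_topological open_adist_less[of a] by blast
qed

lemma adist_continuous: "continuous_on UNIV adist"
  unfolding continuous_on_def by (auto intro: adist_tendsto)

section \<open>Smoothness of the anisotropic distance off the origin\<close>

definition gauge_dt :: "real \<Rightarrow> real ^ 'n \<Rightarrow> real"
  where "gauge_dt t x = (\<Sum>i\<in>UNIV. (- 2 * M $ i) * ((x $ i)\<^sup>2 * t powr (- 2 * M $ i - 1)))"

lemma gauge_has_derivative_t:
  assumes "t > 0"
  shows "((\<lambda>t. gauge t x) has_field_derivative gauge_dt t x) (at t)"
proof -
  have "((\<lambda>t. \<Sum>i\<in>UNIV. (x $ i)\<^sup>2 * t powr (- 2 * M $ i)) has_field_derivative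
    (\<Sum>i\<in>UNIV. (x $ i)\<^sup>2 * ((- 2 * M $ i) * t powr (- 2 * M $ i - 1)))) (at t)"
    using assms by (intro DERIV_sum DERIV_cmult has_real_derivative_powr)
  thus ?thesis by (simp add: gauge_def gauge_dt_def mult_ac)
qed

lemma gauge_dt_neg: "x \<noteq> 0 \<Longrightarrow> t > 0 \<Longrightarrow> gauge_dt t x < 0"
proof -
  assume x: "x \<noteq> 0" and t: "t > 0"
  obtain k where k: "x $ k \<noteq> 0" using x by (auto simp: vec_eq_iff)
  have M0: "0 < M $ i" for i using M_ge[of i] by linarith
  have "0 < (\<Sum>i\<in>UNIV. (2 * M $ i) * ((x $ i)\<^sup>2 * t powr (- 2 * M $ i - 1)))"
    by (rule sum_pos2[of _ k]) (use k t M0 in \<open>auto intro!: mult_nonneg_nonneg less_imp_le[OF M0]\<close>)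
  thus ?thesis by (simp add: gauge_dt_def sum_negf)
qed

definition adist_grad :: "real ^ 'n \<Rightarrow> real ^ 'n \<Rightarrow> real"
  where "adist_grad x v = inverse (- gauge_dt (adist x) x) *
    (\<Sum>i\<in>UNIV. 2 * (x $ i * (v $ i * adist x powr (- 2 * M $ i))))"

text \<open>Implicit differentiation of \<open>gauge (adist y) y = 1\<close>: the mean value theorem in the first
  argument expresses \<open>adist y - adist x\<close> as a convergent factor times the increment of
  \<open>gauge (adist x)\<close>.\<close>

lemma adist_has_derivative:
  assumes x: "x \<noteq> 0"
  shows "(adist has_derivative adist_grad x) (at x)"
proof -
  define s where "s = adist x"
  have s: "s > 0" using adist_pos[OF x] by (simp add: s_def)
  have ex: "\<exists>\<tau>. \<bar>\<tau> - s\<bar> \<le> \<bar>adist y - s\<bar> \<and> \<tau> > 0 \<and> gauge (adist y) y - gauge s y = (adist y - s) * gauge_dt \<tau> y"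
    if y: "y \<noteq> 0" for y
  proof (cases "adist y" s rule: linorder_cases)
    case less
    obtain z where "adist y < z" "z < s" "gauge s y - gauge (adist y) y = (s - adist y) * gauge_dt z y"
      using MVT2[OF less, of "\<lambda>t. gauge t y" "\<lambda>t. gauge_dt t y"] gauge_has_derivative_t adist_pos[OF y] by (meson less_le_trans)
    thus ?thesis using adist_pos[OF y] by (intro exI[of _ z]) (auto simp: algebra_simps)
  next
    case greater
    obtain z where "s < z" "z < adist y" "gauge (adist y) y - gauge s y = (adist y - s) * gauge_dt z y"
      using MVT2[OF greater, of "\<lambda>t. gauge t y" "\<lambda>t. gauge_dt t y"] gauge_has_derivative_t s by (meson less_le_trans)
    thus ?thesis using s by (intro exI[of _ z]) auto
  next
    case equal
    thus ?thesis using s by (intro exI[of _ s]) auto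
  qed
  define \<tau> where "\<tau> y = (SOME \<tau>. \<bar>\<tau> - s\<bar> \<le> \<bar>adist y - s\<bar> \<and> \<tau> > 0 \<and> gauge (adist y) y - gauge s y = (adist y - s) * gauge_dt \<tau> y)" for y
  have \<tau>: "\<bar>\<tau> y - s\<bar> \<le> \<bar>adist y - s\<bar> \<and> \<tau> y > 0 \<and> gauge (adist y) y - gauge s y = (adist y - s) * gauge_dt (\<tau> y) y"
    if "y \<noteq> 0" for y unfolding \<tau>_def by (rule someI_ex[OF ex[OF that]])
  have nz: "\<forall>\<^sub>F y in at x. y \<noteq> 0"
    using x by (intro eventually_at_topological[THEN iffD2] exI[of _ "- {0}"]) auto
  \<comment> \<open>The intermediate points are no farther from \<open>s\<close> than
    \<open>adist y\<close> is, so continuity of the distance forces their convergence.\<close>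
  have "(\<tau> \<longlongrightarrow> s) (at x)"
  proof (rule LIM_zero_cancel, rule Lim_null_comparison)
    show "\<forall>\<^sub>F y in at x. norm (\<tau> y - s) \<le> \<bar>adist y - s\<bar>" using nz by eventually_elim (use \<tau> in auto)
    show "((\<lambda>y. \<bar>adist y - s\<bar>) \<longlongrightarrow> 0) (at x)"
      using tendsto_rabs_zero[OF LIM_zero[OF adist_tendsto[of x]]] by (simp add: s_def)
  qed
  hence "((\<lambda>y. gauge_dt (\<tau> y) y) \<longlongrightarrow> gauge_dt s x) (at x)"
    unfolding gauge_dt_def using s by (intro tendsto_intros) auto
  hence Q: "((\<lambda>y. - inverse (gauge_dt (\<tau> y) y)) \<longlongrightarrow> - inverse (gauge_dt s x)) (at x)"
    using gauge_dt_neg[OF x s] by (intro tendsto_intros) auto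
  have H: "(gauge s has_derivative (\<lambda>v. \<Sum>i\<in>UNIV. 2 * (x $ i * (v $ i * s powr (- 2 * M $ i))))) (at x)"
    unfolding gauge_def power2_eq_square
    by (rule has_derivative_eq_rhs, (rule derivative_intros bounded_linear_imp_has_derivative bounded_linear_vec_nth)+)
      (simp add: algebra_simps)
  have "(adist has_derivative (\<lambda>v. - inverse (gauge_dt s x) * (\<Sum>i\<in>UNIV. 2 * (x $ i * (v $ i * s powr (- 2 * M $ i)))))) (at x)"
  proof (rule has_derivative_factored[OF H Q])
    show "\<forall>\<^sub>F y in at x. adist y - adist x = - inverse (gauge_dt (\<tau> y) y) * (gauge s y - gauge s x)"
      using nz
    proof eventually_elim
      case (elim y)
      have "1 - gauge s y = (adist y - s) * gauge_dt (\<tau> y) y" using \<tau>[OF elim] gauge_adist[OF elim] by simp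
      moreover have "gauge_dt (\<tau> y) y < 0" using \<tau>[OF elim] by (intro gauge_dt_neg elim) auto
      ultimately have "adist y - s = - inverse (gauge_dt (\<tau> y) y) * (gauge s y - 1)"
        by (simp add: field_simps)
      thus ?case using gauge_adist[OF x] by (simp add: s_def)
    qed
  qed
  moreover have "- inverse (gauge_dt s x) = inverse (- gauge_dt s x)" by simp
  ultimately show ?thesis unfolding adist_grad_def s_def by (simp only:)
qed

text \<open>Polynomials in the coordinates, the real powers of the distance and the reciprocal of
  \<open>E\<close> are closed under differentiation: the gradient of the distance is of this form,
  and hence so are the derivatives of the powers and of the reciprocal.\<close>

lemma smooth_on_adist: "smooth_on (- {0}) (\<lambda>x. complex_of_real (adist x))"
proof -
  define G where "G = range (\<lambda>i x. complex_of_real (x $ i)) \<union> range (\<lambda>a x. complex_of_real (adist x powr a))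
    \<union> {\<lambda>x. complex_of_real (inverse (- gauge_dt (adist x) x))}"
  define A where "A = alg_closure G"
  have coord: "(\<lambda>x. complex_of_real (x $ i)) \<in> A" and pow: "(\<lambda>x. complex_of_real (adist x powr a)) \<in> A"
    and inv: "(\<lambda>x. complex_of_real (inverse (- gauge_dt (adist x) x))) \<in> A" for i a
    unfolding A_def by (rule alg_closure.base, simp add: G_def)+
  have c: "(\<lambda>_. c) \<in> A" for c unfolding A_def by (rule alg_closure.const)
  have mult: "(\<lambda>x. complex_of_real (f x * g x)) \<in> A"
    if "(\<lambda>x. complex_of_real (f x)) \<in> A" "(\<lambda>x. complex_of_real (g x)) \<in> A" for f g
    using alg_closure.mult that unfolding A_def of_real_mult by blast
  have add: "(\<lambda>x. complex_of_real (f x + g x)) \<in> A"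
    if "(\<lambda>x. complex_of_real (f x)) \<in> A" "(\<lambda>x. complex_of_real (g x)) \<in> A" for f g
    using alg_closure.add that unfolding A_def of_real_add by blast
  have sum: "(\<lambda>x. complex_of_real (\<Sum>i\<in>UNIV. f i x)) \<in> A"
    if "\<And>i. (\<lambda>x. complex_of_real (f i x)) \<in> A" for f :: "'n \<Rightarrow> real ^ 'n \<Rightarrow> real"
    using alg_closure_sum[of UNIV "\<lambda>i x. complex_of_real (f i x)" G] that unfolding A_def of_real_sum by blast
  have grad: "(\<lambda>x. complex_of_real (adist_grad x v)) \<in> A" for v
    unfolding adist_grad_def by (intro mult sum inv coord pow c)
  define E where "E x = - gauge_dt (adist x) x" for x
  have E_eq: "E = (\<lambda>x. \<Sum>i\<in>UNIV. (2 * M $ i) * ((x $ i * x $ i) * adist x powr (- 2 * M $ i - 1)))"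
    by (rule ext) (simp add: E_def gauge_dt_def sum_negf power2_eq_square)
  have E0: "E x > 0" if "x \<noteq> 0" for x using gauge_dt_neg[OF that adist_pos[OF that]] by (simp add: E_def)
  define P where "P a x v = a * adist x powr (a - 1) * adist_grad x v" for a x v
  have Pd: "((\<lambda>x. adist x powr a) has_derivative P a x) (at x)" if "x \<noteq> 0" for a x
  proof -
    have "((\<lambda>t. t powr a) has_derivative (*) (a * adist x powr (a - 1))) (at (adist x))"
      using has_real_derivative_powr[OF adist_pos[OF that], of a] by (simp add: has_field_derivative_def)
    from has_derivative_compose[OF adist_has_derivative[OF that] this]
    show ?thesis by (simp add: P_def[abs_def])
  qed
  have PA: "(\<lambda>x. complex_of_real (P a x v)) \<in> A" for a v unfolding P_def by (intro mult c pow grad)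
  define E' where "E' x v = (\<Sum>i\<in>UNIV. (2 * M $ i) * ((x $ i * x $ i) * P (- 2 * M $ i - 1) x v
     + (x $ i * v $ i + v $ i * x $ i) * adist x powr (- 2 * M $ i - 1)))" for x v
  have Ed: "(E has_derivative E' x) (at x)" if "x \<noteq> 0" for x
    unfolding E_eq E'_def
    by (intro has_derivative_sum has_derivative_mult_right has_derivative_mult Pd that bounded_linear_imp_has_derivative bounded_linear_vec_nth)
  have E'A: "(\<lambda>x. complex_of_real (E' x v)) \<in> A" for v
    unfolding E'_def by (intro sum mult add c coord PA pow)
  \<comment> \<open>The power with exponent 1 is a generator and coincides with the distance, which
    is nonnegative.\<close>
  have "smooth_on (- {0}) (\<lambda>x. complex_of_real (adist x powr 1))"
  proof (rule smooth_on_alg_closure[of _ G])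
    fix f assume "f \<in> G"
    then consider i where "f = (\<lambda>x. complex_of_real (x $ i))" | a where "f = (\<lambda>x. complex_of_real (adist x powr a))"
      | "f = (\<lambda>x. complex_of_real (inverse (E x)))" unfolding G_def E_def by blast
    thus "\<exists>f'. (\<forall>x\<in>- {0}. (f has_derivative f' x) (at x)) \<and> (\<forall>b\<in>Basis. (\<lambda>x. f' x b) \<in> alg_closure G)"
    proof cases
      case 1
      show ?thesis unfolding 1 A_def[symmetric]
        by (rule exI[of _ "\<lambda>x v. complex_of_real (v $ i)"])
          (intro conjI ballI c has_derivative_of_real bounded_linear_imp_has_derivative bounded_linear_vec_nth)
    next
      case 2
      show ?thesis unfolding 2 A_def[symmetric]
        by (rule exI[of _ "\<lambda>x v. complex_of_real (P a x v)"])
          (intro conjI ballI PA has_derivative_of_real Pd, simp)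
    next
      case 3
      define f' where "f' x v = (- 1) * ((inverse (E x) * E' x v) * inverse (E x))" for x v
      have "((\<lambda>x. inverse (E x)) has_derivative f' x) (at x)" if "x \<noteq> 0" for x
        using Deriv.has_derivative_inverse[OF _ Ed[OF that]] E0[OF that] by (simp add: f'_def[abs_def])
      moreover have "(\<lambda>x. complex_of_real (f' x v)) \<in> A" for v
        unfolding f'_def using inv by (intro mult E'A c) (simp_all add: E_def)
      ultimately show ?thesis unfolding 3 A_def[symmetric]
        by (intro exI[of _ "\<lambda>x v. complex_of_real (f' x v)"] conjI ballI has_derivative_of_real) auto
    qed
  next
    show "(\<lambda>x. complex_of_real (adist x powr 1)) \<in> alg_closure G" using pow unfolding A_def .
  qed auto
  thus ?thesis by (rule smooth_on_cong[rotated 2]) auto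
qed

end

section \<open>Littlewood-Paley functions\<close>

locale cutoff = aniso M for M :: "real ^ 'n" +
  fixes \<Psi> :: "real \<Rightarrow> complex"
  assumes cutoff: "is_cutoff \<Psi>"
begin

lemma \<Psi>_one: "0 \<le> t \<Longrightarrow> t \<le> 11/10 \<Longrightarrow> \<Psi> t = 1"
  and \<Psi>_zero: "t \<ge> 13/10 \<Longrightarrow> \<Psi> t = 0"
  and \<Psi>_smooth: "smooth_fun \<Psi>"
  using cutoff by (auto simp: is_cutoff_def)

text \<open>The distance is singular at the origin, but the cutoff is constantly 1 there. Smoothness
  is glued from a neighbourhood of 0 and the complement of the origin.\<close>

lemma LP_Psi_test_funs: "LP_Psi \<Psi> M j \<in> test_funs"
proof (cases "j \<ge> 0")
  case True
  define c :: real where "c = 2 powi (- j)"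
  have c: "c > 0" by (simp add: c_def)
  have e: "LP_Psi \<Psi> M j = (\<lambda>\<xi>. \<Psi> (c * adist \<xi>))" using True by (simp add: fun_eq_iff LP_Psi_def c_def)
  have "smooth_on (- {0}) (\<lambda>\<xi>. complex_of_real (c * adist \<xi>))"
    unfolding of_real_mult by (intro smooth_on_mult smooth_on_const smooth_on_adist) auto
  hence 1: "smooth_on (- {0}) (\<lambda>\<xi>. \<Psi> (c * adist \<xi>))"
    by (intro smooth_on_compose_real[where \<Psi> = \<Psi>, OF _ \<Psi>_smooth]) auto
  have 2: "smooth_on {\<xi>. adist \<xi> < 1 / c} (\<lambda>\<xi>. \<Psi> (c * adist \<xi>))"
  proof (rule smooth_on_cong[OF open_adist_less _ smooth_on_const[OF open_adist_less, where c = 1]])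
    fix \<xi> assume "\<xi> \<in> {\<xi>. adist \<xi> < 1 / c}"
    hence "c * adist \<xi> \<le> 11/10" using c by (simp add: field_simps)
    thus "1 = \<Psi> (c * adist \<xi>)" using c by (simp add: \<Psi>_one)
  qed
  have "- {0} \<union> {\<xi>. adist \<xi> < 1 / c} = UNIV" using c by auto
  hence "smooth_on UNIV (LP_Psi \<Psi> M j)"
    using smooth_on_Un[OF _ open_adist_less 1 2] unfolding e by auto
  thus ?thesis
  proof (rule test_funsI)
    show "bounded {\<xi>. adist (\<xi> - 0) \<le> (13/10) / c}" by (rule bounded_adist_ball)
    fix \<xi> assume "\<xi> \<notin> {\<xi>. adist (\<xi> - 0) \<le> (13/10) / c}"
    hence "c * adist \<xi> \<ge> 13/10" using c by (simp add: field_simps)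
    thus "LP_Psi \<Psi> M j \<xi> = 0" unfolding e by (rule \<Psi>_zero)
  qed
next
  case False
  hence "LP_Psi \<Psi> M j = (\<lambda>_. 0)" by (simp add: fun_eq_iff LP_Psi_def)
  thus ?thesis by (simp add: test_funs_zero)
qed

lemma LP_Phi_test_funs: "LP_Phi \<Psi> M j \<in> test_funs"
proof -
  have "(\<lambda>\<xi>. LP_Psi \<Psi> M j \<xi> + (- 1) * LP_Psi \<Psi> M (j - 1) \<xi>) \<in> test_funs"
    by (intro test_funs_add test_funs_cmult LP_Psi_test_funs)
  moreover have "LP_Phi \<Psi> M j = (\<lambda>\<xi>. LP_Psi \<Psi> M j \<xi> + (- 1) * LP_Psi \<Psi> M (j - 1) \<xi>)"
    by (simp add: fun_eq_iff LP_Phi_def)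
  ultimately show ?thesis by simp
qed

text \<open>The plateau of the block function of index j: \<open>\<Psi>\<close> at level j is 1 up
  to 11/10 times 2^j, and at level j - 1 it vanishes from 13/10 times 2^(j-1) on, which is 65/100
  times 2^j. For j = 0 there is no lower level to subtract.\<close>

definition annulus :: "nat \<Rightarrow> (real ^ 'n) set"
  where "annulus j = {\<xi>. adist \<xi> \<le> 11/10 * 2 ^ j \<and> (j = 0 \<or> 65/100 * 2 ^ j \<le> adist \<xi>)}"

lemma LP_Psi_nat: "LP_Psi \<Psi> M (int l) \<xi> = \<Psi> (adist \<xi> / 2 ^ l)"
  by (simp add: LP_Psi_def power_int_minus divide_inverse mult.commute)

lemma LP_Psi_one: "adist \<xi> \<le> 11/10 * 2 ^ l \<Longrightarrow> LP_Psi \<Psi> M (int l) \<xi> = 1"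
  unfolding LP_Psi_nat by (intro \<Psi>_one) (auto simp: divide_simps)

lemma LP_Psi_zero: "13/10 * 2 ^ l \<le> adist \<xi> \<Longrightarrow> LP_Psi \<Psi> M (int l) \<xi> = 0"
  unfolding LP_Psi_nat by (intro \<Psi>_zero) (auto simp: divide_simps)

lemma LP_Phi_Suc: "LP_Phi \<Psi> M (int (Suc l)) \<xi> = LP_Psi \<Psi> M (int (Suc l)) \<xi> - LP_Psi \<Psi> M (int l) \<xi>"
  by (simp add: LP_Phi_def)

lemma LP_Phi_0: "LP_Phi \<Psi> M 0 \<xi> = LP_Psi \<Psi> M 0 \<xi>"
  by (simp add: LP_Phi_def LP_Psi_def)

lemma LP_Psi_annulus:
  assumes "\<xi> \<in> annulus j"
  shows "LP_Psi \<Psi> M (int l) \<xi> = (if l \<ge> j then 1 else 0)"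
proof (cases "l \<ge> j")
  case True
  hence "(2::real) ^ j \<le> 2 ^ l" by (intro power_increasing) auto
  hence "11/10 * (2::real) ^ j \<le> 11/10 * 2 ^ l" by simp
  moreover have "adist \<xi> \<le> 11/10 * 2 ^ j" using assms by (simp add: annulus_def)
  ultimately show ?thesis using True LP_Psi_one order_trans by (simp only: if_True)
next
  case False
  hence "(2::real) ^ Suc l \<le> 2 ^ j" by (intro power_increasing) auto
  thus ?thesis using False assms by (auto simp: annulus_def intro!: LP_Psi_zero)
qed

lemma LP_Phi_annulus:
  assumes "\<xi> \<in> annulus j"
  shows "LP_Phi \<Psi> M (int l) \<xi> = (if l = j then 1 else 0)"
proof (cases l)
  case 0
  thus ?thesis using LP_Psi_annulus[OF assms, of 0] by (simp add: LP_Phi_0)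
next
  case (Suc k)
  thus ?thesis unfolding Suc LP_Phi_Suc LP_Psi_annulus[OF assms] by auto
qed

end

section \<open>Quasi-norms of sequences of blocks\<close>

lemma ennreal_powr_ennreal [simp]: "r \<ge> 0 \<Longrightarrow> ennreal_powr (ennreal r) a = ennreal (r powr a)"
  by (simp add: ennreal_powr_def)

lemma ennreal_powr_top [simp]: "ennreal_powr top a = top" and ennreal_powr_0 [simp]: "ennreal_powr 0 a = 0"
  by (simp_all add: ennreal_powr_def)

lemma ennreal_powr_one [simp]: "ennreal_powr x 1 = x"
  by (cases x) simp_all

lemma ennreal_powr_mono:
  assumes "x \<le> y" "a \<ge> 0"
  shows "ennreal_powr x a \<le> ennreal_powr y a"
proof (cases y)
  case (real r)
  then obtain s where "x = ennreal s" "0 \<le> s" "s \<le> r"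
    using assms(1) by (cases x) (auto simp: top_unique)
  thus ?thesis using real assms(2) by (simp add: ennreal_leI powr_mono2)
qed simp

lemma ennreal_powr_powr: "ennreal_powr (ennreal_powr x a) b = ennreal_powr x (a * b)"
  by (cases x) (simp_all add: powr_powr)

lemma ennreal_powr_mult:
  assumes "c > 0"
  shows "ennreal_powr (ennreal c * x) a = ennreal (c powr a) * ennreal_powr x a"
  using assms by (cases x) (simp_all add: ennreal_mult[symmetric] powr_mult ennreal_mult_top)

lemma ennreal_powr_measurable [measurable]: "(\<lambda>x. ennreal_powr x a) \<in> borel_measurable borel"
  unfolding ennreal_powr_def by measurable

lemma ennreal_powr_inverse:
  "a > 0 \<Longrightarrow> ennreal_powr (ennreal_powr x a) (1 / a) = x"
  by (simp add: ennreal_powr_powr)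

lemma exponent_cases:
  fixes p :: ennreal
  assumes "0 < p"
  obtains "p = top" "recip p = 0" | r where "0 < r" "p \<noteq> top" "enn2real p = r" "recip p = 1 / r" "p = ennreal r"
proof (cases p)
  case (real r)
  hence "r > 0" using assms by (cases "r = 0") auto
  thus ?thesis using that(2)[of r] real by (simp add: inverse_ennreal inverse_eq_divide)
next
  case top
  thus ?thesis using that(1) by simp
qed

section \<open>Elementary properties of Lebesgue quasi-norms\<close>

lemma Lp_qnorm_top: "Lp_qnorm \<mu> top h = esssup \<mu> h"
  by (simp add: Lp_qnorm_def)

lemma Lp_qnorm_finite:
  "r > 0 \<Longrightarrow> Lp_qnorm \<mu> (ennreal r) h = ennreal_powr (\<integral>\<^sup>+x. ennreal_powr (h x) r \<partial>\<mu>) (1 / r)"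
  by (simp add: Lp_qnorm_def inverse_ennreal inverse_eq_divide)

text \<open>The alternative in the last hypothesis separates the nonnegative integral, which is
  monotone on all functions, from the essential supremum, which is handled for measurable ones. Its
  first half is what Triebel-Lizorkin quasi-norms use.\<close>

lemma Lp_qnorm_mono:
  assumes "0 < p" "\<And>x. h x \<le> g x" "p \<noteq> \<infinity> \<or> h \<in> borel_measurable \<mu>"
  shows "Lp_qnorm \<mu> p h \<le> Lp_qnorm \<mu> p g"
  using \<open>0 < p\<close>
proof (cases rule: exponent_cases)
  case 1
  thus ?thesis using assms by (simp add: Lp_qnorm_top esssup_mono)
next
  case (2 r)
  show ?thesis unfolding 2(5) using 2(1)
    by (simp add: Lp_qnorm_finite) (intro ennreal_powr_mono nn_integral_mono assms(2); simp)
qed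

lemma Lp_qnorm_cmult_le:
  assumes "0 < p" "c > 0" and [measurable]: "h \<in> borel_measurable \<mu>"
  shows "Lp_qnorm \<mu> p (\<lambda>x. ennreal c * h x) \<le> ennreal c * Lp_qnorm \<mu> p h"
  using \<open>0 < p\<close>
proof (cases rule: exponent_cases)
  case 1
  have "AE x in \<mu>. ennreal c * h x \<le> ennreal c * esssup \<mu> h"
    using esssup_AE[where M = \<mu> and f = h] by eventually_elim (rule mult_left_mono, auto)
  thus ?thesis unfolding 1(1) Lp_qnorm_top by (intro esssup_I) auto
next
  case (2 r)
  show ?thesis unfolding 2(5) using 2(1) assms(2)
    by (simp add: Lp_qnorm_finite ennreal_powr_mult nn_integral_cmult powr_powr)
qed

lemma Lp_qnorm_cmult:
  assumes "0 < p" "c > 0" and [measurable]: "h \<in> borel_measurable \<mu>"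
  shows "Lp_qnorm \<mu> p (\<lambda>x. ennreal c * h x) = ennreal c * Lp_qnorm \<mu> p h"
proof (rule antisym)
  \<comment> \<open>The reverse inequality follows by applying \<open>Lp_qnorm_cmult_le\<close> with
    1/c to the already scaled function.\<close>
  have e: "ennreal (1 / c) * (ennreal c * y) = y" for y
    using assms(2) by (simp add: mult.assoc[symmetric] ennreal_mult[symmetric])
  have "Lp_qnorm \<mu> p (\<lambda>x. ennreal (1 / c) * (ennreal c * h x)) \<le> ennreal (1 / c) * Lp_qnorm \<mu> p (\<lambda>x. ennreal c * h x)"
    using assms by (intro Lp_qnorm_cmult_le) auto
  hence "ennreal c * Lp_qnorm \<mu> p h \<le> ennreal c * (ennreal (1 / c) * Lp_qnorm \<mu> p (\<lambda>x. ennreal c * h x))"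
    unfolding e by (rule mult_left_mono) simp
  also have "\<dots> = Lp_qnorm \<mu> p (\<lambda>x. ennreal c * h x)"
    using assms(2) by (simp add: mult.assoc[symmetric] ennreal_mult[symmetric])
  finally show "ennreal c * Lp_qnorm \<mu> p h \<le> Lp_qnorm \<mu> p (\<lambda>x. ennreal c * h x)" .
qed (rule Lp_qnorm_cmult_le[OF assms])

lemma Lp_qnorm_zero:
  assumes "0 < p" "emeasure \<mu> (space \<mu>) \<noteq> 0"
  shows "Lp_qnorm \<mu> p (\<lambda>_. 0) = 0"
  using \<open>0 < p\<close>
  by (cases rule: exponent_cases) (use assms(2) in \<open>simp_all add: Lp_qnorm_top esssup_const Lp_qnorm_def\<close>)

lemma lq_qnorm_ge:
  assumes q: "0 < q"
  shows "a j \<le> lq_qnorm q a"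
  using q
proof (cases q rule: exponent_cases)
  case 1
  thus ?thesis using esssup_AE[where M = "count_space UNIV" and f = a] by (simp add: 1 Lp_qnorm_top AE_count_space)
next
  case (2 r)
  have "ennreal_powr (a j) r = (\<integral>\<^sup>+i. ennreal_powr (a i) r * indicator {j} i \<partial>count_space UNIV)"
    by (subst nn_integral_indicator_singleton) auto
  also have "\<dots> \<le> (\<integral>\<^sup>+i. ennreal_powr (a i) r \<partial>count_space UNIV)"
    by (intro nn_integral_mono) (auto simp: indicator_def)
  finally have "ennreal_powr (ennreal_powr (a j) r) (1 / r) \<le> ennreal_powr (\<integral>\<^sup>+i. ennreal_powr (a i) r \<partial>count_space UNIV) (1 / r)"
    using 2(1) by (intro ennreal_powr_mono) auto
  thus ?thesis unfolding 2(5) Lp_qnorm_finite[OF 2(1)] using 2(1) by (simp add: ennreal_powr_inverse)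
qed

lemma lq_qnorm_mono: "0 < q \<Longrightarrow> (\<And>j. a j \<le> b j) \<Longrightarrow> lq_qnorm q a \<le> lq_qnorm q b"
  by (rule Lp_qnorm_mono) auto

lemma lq_qnorm_finite_support:
  assumes "finite K" "r > 0" "\<And>j. j \<notin> K \<Longrightarrow> a j = 0"
  shows "lq_qnorm (ennreal r) a = ennreal_powr (\<Sum>j\<in>K. ennreal_powr (a j) r) (1 / r)"
  unfolding Lp_qnorm_finite[OF assms(2)]
  by (subst nn_integral_count_space'[OF assms(1)]) (auto simp: assms(3))

text \<open>The source of the powers of \<open>card K\<close> with exponent 1/q. With 1/\<infinity>
  = 0 the supremum obeys the same formula.\<close>

lemma lq_qnorm_const:
  assumes q: "0 < q" and K: "finite K" "K \<noteq> {}"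
  shows "lq_qnorm q (\<lambda>j. if j \<in> K then a else 0) = ennreal (real (card K) powr recip q) * a"
  using q
proof (cases q rule: exponent_cases)
  case 1
  obtain j where "j \<in> K" using K by blast
  have "esssup (count_space UNIV) (\<lambda>j. if j \<in> K then a else 0) = a"
  proof (rule antisym)
    show "esssup (count_space UNIV) (\<lambda>j. if j \<in> K then a else 0) \<le> a"
      by (rule esssup_I) (auto simp: AE_count_space)
    show "a \<le> esssup (count_space UNIV) (\<lambda>j. if j \<in> K then a else 0)"
      using lq_qnorm_ge[of top "\<lambda>j. if j \<in> K then a else 0" j] \<open>j \<in> K\<close> by (simp add: Lp_qnorm_top)
  qed
  thus ?thesis using K by (simp add: 1 Lp_qnorm_top card_gt_0_iff)
next
  case (2 r)
  have c: "real (card K) > 0" using K by (simp add: card_gt_0_iff)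
  have "lq_qnorm q (\<lambda>j. if j \<in> K then a else 0) = ennreal_powr (ennreal (real (card K)) * ennreal_powr a r) (1 / r)"
    unfolding 2(5) using 2(1) K
    by (subst lq_qnorm_finite_support[OF K(1)]) (auto simp: ennreal_of_nat_eq_real_of_nat)
  also have "\<dots> = ennreal (real (card K) powr (1 / r)) * a"
    using 2(1) c by (simp add: ennreal_powr_mult ennreal_powr_inverse)
  finally show ?thesis using 2 by simp
qed

lemma lborel_AE_positive:
  assumes "S \<in> sets lborel" "emeasure lborel S > 0" "AE x in lborel. P x"
  shows "\<exists>x\<in>S. P x"
proof (rule ccontr)
  assume "\<not> (\<exists>x\<in>S. P x)"
  hence "AE x in lborel. x \<notin> S" using assms(3) by (auto elim: eventually_mono)
  hence "S \<in> null_sets lborel" using assms(1) by (simp add: AE_iff_null_sets)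
  thus False using assms(2) by auto
qed

text \<open>Chebyshev's inequality for all exponents, the essential supremum included.\<close>

lemma Lp_qnorm_ge:
  fixes h :: "'a::euclidean_space \<Rightarrow> ennreal"
  assumes p: "0 < p" and [measurable]: "h \<in> borel_measurable borel" and \<delta>: "\<delta> > 0"
    and S: "S \<in> sets lborel" "emeasure lborel S = ennreal v" "v > 0" and ge: "\<And>x. x \<in> S \<Longrightarrow> h x \<ge> ennreal \<delta>"
  shows "Lp_qnorm lborel p h \<ge> ennreal (\<delta> * v powr recip p)"
  using p
proof (cases p rule: exponent_cases)
  case 1
  obtain x where "x \<in> S" "h x \<le> esssup lborel h"
    using lborel_AE_positive[OF S(1) _ esssup_AE[where M = lborel and f = h]] S by auto
  hence "ennreal \<delta> \<le> esssup lborel h" using ge order_trans by blast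
  thus ?thesis using S(3) by (simp add: 1 Lp_qnorm_top)
next
  case (2 r)
  have "ennreal (\<delta> powr r * v) = (\<integral>\<^sup>+x. ennreal (\<delta> powr r) * indicator S x \<partial>lborel)"
    using S \<delta> by (simp add: nn_integral_cmult_indicator ennreal_mult)
  also have "\<dots> \<le> (\<integral>\<^sup>+x. ennreal_powr (h x) r \<partial>lborel)"
  proof (rule nn_integral_mono)
    fix x
    have "ennreal_powr (ennreal \<delta>) r \<le> ennreal_powr (h x) r" if "x \<in> S"
      using ge[OF that] 2(1) by (intro ennreal_powr_mono) auto
    thus "ennreal (\<delta> powr r) * indicator S x \<le> ennreal_powr (h x) r"
      using \<delta> by (cases "x \<in> S") auto
  qed
  finally have "ennreal_powr (ennreal (\<delta> powr r * v)) (1 / r) \<le> Lp_qnorm lborel p h"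
    unfolding 2(5) Lp_qnorm_finite[OF 2(1)] using 2(1) by (intro ennreal_powr_mono) auto
  moreover have "(\<delta> powr r * v) powr (1 / r) = \<delta> * v powr (1 / r)"
    using \<delta> S(3) 2(1) by (simp add: powr_mult powr_powr)
  ultimately show ?thesis using 2 \<delta> S(3) by simp
qed

text \<open>The quasi-norm of a family of blocks, so that \<open>space_qnorm\<close> is its value at the
  Littlewood--Paley blocks of a distribution.\<close>

definition block_qnorm ::
    "space_kind \<Rightarrow> real \<Rightarrow> ennreal \<Rightarrow> ennreal \<Rightarrow> (nat \<Rightarrow> 'a::euclidean_space \<Rightarrow> complex) \<Rightarrow> ennreal"
  where "block_qnorm A s p q B = (if A = Besov
    then lq_qnorm q (\<lambda>j. ennreal (2 powr (s * real j)) * Lp_qnorm lborel p (\<lambda>x. ennreal (cmod (B j x))))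
    else Lp_qnorm lborel p (\<lambda>x. lq_qnorm q (\<lambda>j. ennreal (2 powr (s * real j)) * ennreal (cmod (B j x)))))"

lemma space_qnorm_eq: "space_qnorm A \<Psi> M s p q u = block_qnorm A s p q (\<lambda>j. LP_block \<Psi> M j u)"
  by (cases A) (simp_all add: block_qnorm_def besov_qnorm_def triebel_lizorkin_qnorm_def)

lemma Lp_norm_measurable:
  "continuous_on UNIV (v :: 'a::euclidean_space \<Rightarrow> complex) \<Longrightarrow> (\<lambda>x. ennreal (cmod (v x))) \<in> borel_measurable borel"
  by (intro measurable_compose[OF _ measurable_ennreal] borel_measurable_continuous_onI continuous_on_norm)

text \<open>In the Triebel-Lizorkin case the inner \<open>lq_qnorm\<close> dominates each of its
  terms pointwise. A single block therefore suffices for lower bounds in either scale.\<close>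

lemma block_qnorm_ge:
  assumes "0 < p" "0 < q" "A = Triebel_Lizorkin \<longrightarrow> p < \<infinity>" "continuous_on UNIV (B j)"
  shows "ennreal (2 powr (s * real j)) * Lp_qnorm lborel p (\<lambda>x. ennreal (cmod (B j x))) \<le> block_qnorm A s p q B"
proof (cases "A = Besov")
  case True
  thus ?thesis unfolding block_qnorm_def
    using lq_qnorm_ge[OF assms(2), of "\<lambda>j. ennreal (2 powr (s * real j)) * Lp_qnorm lborel p (\<lambda>x. ennreal (cmod (B j x)))" j]
    by simp
next
  case False
  hence "p \<noteq> \<infinity>" using assms(3) by (cases A) auto
  have "ennreal (2 powr (s * real j)) * Lp_qnorm lborel p (\<lambda>x. ennreal (cmod (B j x)))
    = Lp_qnorm lborel p (\<lambda>x. ennreal (2 powr (s * real j)) * ennreal (cmod (B j x)))"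
    using assms Lp_norm_measurable[OF assms(4)] by (subst Lp_qnorm_cmult) auto
  also have "\<dots> \<le> Lp_qnorm lborel p (\<lambda>x. lq_qnorm q (\<lambda>j. ennreal (2 powr (s * real j)) * ennreal (cmod (B j x))))"
  proof (rule Lp_qnorm_mono[OF assms(1)])
    fix x show "ennreal (2 powr (s * real j)) * ennreal (cmod (B j x)) \<le>
      lq_qnorm q (\<lambda>j. ennreal (2 powr (s * real j)) * ennreal (cmod (B j x)))"
      by (rule lq_qnorm_ge[OF assms(2), of "\<lambda>j. ennreal (2 powr (s * real j)) * ennreal (cmod (B j x))"])
  qed (rule disjI1, rule \<open>p \<noteq> \<infinity>\<close>)
  finally show ?thesis using False by (simp add: block_qnorm_def)
qed

text \<open>When all blocks have the same modulus up to the weight, summation and integration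
  decouple and both kinds of spaces give the same value. This is why modulations of a fixed packet
  detect \<open>q\<close> in either scale.\<close>

lemma block_qnorm_common_modulus:
  assumes "0 < p" "0 < q" "A = Triebel_Lizorkin \<longrightarrow> p < \<infinity>" "finite K" "K \<noteq> {}"
    and v: "continuous_on UNIV v"
    and B: "\<And>j x. cmod (B j x) = (if j \<in> K then 2 powr (- s * real j) * cmod (v x) else 0)"
  shows "block_qnorm A s p q B = ennreal (real (card K) powr recip q) * Lp_qnorm lborel p (\<lambda>x. ennreal (cmod (v x)))"
proof (cases "A = Besov")
  case True
  have "ennreal (2 powr (s * real j)) * Lp_qnorm lborel p (\<lambda>x. ennreal (cmod (B j x)))
     = (if j \<in> K then Lp_qnorm lborel p (\<lambda>x. ennreal (cmod (v x))) else 0)" for j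
  proof (cases "j \<in> K")
    case True
    have "Lp_qnorm lborel p (\<lambda>x. ennreal (cmod (B j x))) = Lp_qnorm lborel p (\<lambda>x. ennreal (2 powr (- s * real j)) * ennreal (cmod (v x)))"
      using True by (simp add: B ennreal_mult)
    also have "\<dots> = ennreal (2 powr (- s * real j)) * Lp_qnorm lborel p (\<lambda>x. ennreal (cmod (v x)))"
      using assms(1) Lp_norm_measurable[OF v] by (subst Lp_qnorm_cmult) auto
    finally show ?thesis using True
      by (simp add: mult.assoc[symmetric] ennreal_mult[symmetric] powr_add[symmetric])
  next
    case False
    thus ?thesis using assms(1) by (simp add: B Lp_qnorm_zero)
  qed
  thus ?thesis using True lq_qnorm_const[OF assms(2,4,5)] by (simp add: block_qnorm_def)
next
  case False
  have "ennreal (2 powr (s * real j)) * ennreal (cmod (B j x)) = (if j \<in> K then ennreal (cmod (v x)) else 0)" for j x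
    by (simp add: B ennreal_mult[symmetric] mult.assoc[symmetric] powr_add[symmetric])
  hence "block_qnorm A s p q B = Lp_qnorm lborel p (\<lambda>x. ennreal (real (card K) powr recip q) * ennreal (cmod (v x)))"
    using False lq_qnorm_const[OF assms(2,4,5)] by (simp add: block_qnorm_def)
  also have "\<dots> = ennreal (real (card K) powr recip q) * Lp_qnorm lborel p (\<lambda>x. ennreal (cmod (v x)))"
    using assms(1,4,5) Lp_norm_measurable[OF v] by (subst Lp_qnorm_cmult) (auto simp: card_gt_0_iff)
  finally show ?thesis .
qed

lemma besov_block_qnorm_le:
  assumes "0 < q" "finite K" "K \<noteq> {}"
    and "\<And>j. ennreal (2 powr (s * real j)) * Lp_qnorm lborel p (\<lambda>x. ennreal (cmod (B j x))) \<le> (if j \<in> K then C else 0)"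
  shows "block_qnorm Besov s p q B \<le> ennreal (real (card K) powr recip q) * C"
proof -
  have "block_qnorm Besov s p q B \<le> lq_qnorm q (\<lambda>j. if j \<in> K then C else 0)"
    unfolding block_qnorm_def using assms(1,4) by (auto intro!: lq_qnorm_mono)
  thus ?thesis by (simp add: lq_qnorm_const[OF assms(1-3)])
qed

lemma besov_block_qnorm_ge:
  assumes "0 < q" "finite K" "K \<noteq> {}"
    and "\<And>j. j \<in> K \<Longrightarrow> C \<le> ennreal (2 powr (s * real j)) * Lp_qnorm lborel p (\<lambda>x. ennreal (cmod (B j x)))"
  shows "ennreal (real (card K) powr recip q) * C \<le> block_qnorm Besov s p q B"
proof -
  have "lq_qnorm q (\<lambda>j. if j \<in> K then C else 0) \<le> block_qnorm Besov s p q B"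
    unfolding block_qnorm_def using assms(1,4) by (auto intro!: lq_qnorm_mono)
  thus ?thesis by (simp add: lq_qnorm_const[OF assms(1-3)])
qed

section \<open>Geometric majorants of dilated bumps\<close>

lemma two_power_powr: "(2 ^ l) powr b = 2 powr (b * real l)"
  by (subst powr_realpow[symmetric]) (simp_all add: powr_powr mult.commute)

lemma geometric_sum_finite_le:
  fixes \<rho> :: real
  assumes "0 \<le> \<rho>" "\<rho> < 1" "finite K" "inj_on f K"
  shows "(\<Sum>j\<in>K. \<rho> ^ f j) \<le> 1 / (1 - \<rho>)"
proof -
  have "(\<Sum>j\<in>K. \<rho> ^ f j) = (\<Sum>i\<in>f ` K. \<rho> ^ i)" using assms(4) by (simp add: sum.reindex)
  also have "\<dots> \<le> (\<Sum>i. \<rho> ^ i)" using assms by (intro sum_le_suminf) (auto intro: summable_geometric)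
  also have "\<dots> = 1 / (1 - \<rho>)" using assms by (simp add: suminf_geometric)
  finally show ?thesis .
qed

text \<open>The majorant of the dilated bumps: it increases geometrically in \<open>j\<close> as long as
  \<open>2\<^sup>j r \<le> 1\<close> and decreases geometrically afterwards, so any partial sum is controlled by
  its largest term.\<close>

definition bump_bound :: "real \<Rightarrow> real \<Rightarrow> nat \<Rightarrow> real"
  where "bump_bound a r j = (if 2 ^ j * r \<le> 1 then 2 powr (a * real j) else 2 powr (- a * real j) * r powr (- 2 * a))"

lemma bump_bound_pos: "r \<ge> 0 \<Longrightarrow> bump_bound a r j > 0"
  by (cases "r = 0") (auto simp: bump_bound_def)

lemma bump_bound_powr: "r \<ge> 0 \<Longrightarrow> bump_bound a r j powr p = bump_bound (a * p) r j"
  by (auto simp: bump_bound_def powr_mult powr_powr algebra_simps)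

lemma bump_bound_sum_le:
  assumes a: "a > 0" and r: "r \<ge> 0" and K: "finite K" "K \<noteq> {}"
  shows "\<exists>k\<in>K. (\<Sum>j\<in>K. bump_bound a r j) \<le> 2 / (1 - 2 powr (- a)) * bump_bound a r k"
proof -
  \<comment> \<open>The common ratio of both progressions: terms in \<open>K1\<close> are compared
    with the one of largest index, terms in \<open>K2\<close> with the one of smallest
    index.\<close>
  define \<rho> :: real where "\<rho> = 2 powr (- a)"
  have \<rho>: "0 < \<rho>" "\<rho> < 1" using a by (auto simp: \<rho>_def powr_less_one)
  have \<rho>p: "\<rho> ^ n = 2 powr (- a * real n)" for n by (simp add: \<rho>_def powr_powr powr_realpow[symmetric])
  define K1 where "K1 = {j\<in>K. 2 ^ j * r \<le> 1}"
  define K2 where "K2 = {j\<in>K. \<not> 2 ^ j * r \<le> 1}"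
  have fin: "finite K1" "finite K2" using K by (auto simp: K1_def K2_def)
  have split: "(\<Sum>j\<in>K. bump_bound a r j) = (\<Sum>j\<in>K1. bump_bound a r j) + (\<Sum>j\<in>K2. bump_bound a r j)"
    using K by (subst sum.union_disjoint[symmetric]) (auto simp: K1_def K2_def intro!: sum.cong)
  define m where "m = Max (bump_bound a r ` K)"
  have "m \<in> bump_bound a r ` K" unfolding m_def using K by (intro Max_in) auto
  then obtain k where k: "k \<in> K" "m = bump_bound a r k" by blast
  have le: "bump_bound a r j \<le> m" if "j \<in> K" for j unfolding m_def using that K by (intro Max_ge) auto
  have m0: "m \<ge> 0" using bump_bound_pos[OF r, of a k] by (simp add: k(2))
  have "(\<Sum>j\<in>K1. bump_bound a r j) \<le> 1 / (1 - \<rho>) * m"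
  proof (cases "K1 = {}")
    case False
    define k1 where "k1 = Max K1"
    have k1: "k1 \<in> K1" "\<And>j. j \<in> K1 \<Longrightarrow> j \<le> k1" using fin False by (auto simp: k1_def)
    have inj: "inj_on (\<lambda>j. k1 - j) K1" using k1(2) by (intro inj_onI) (metis diff_diff_cancel)
    have "bump_bound a r j = \<rho> ^ (k1 - j) * bump_bound a r k1" if "j \<in> K1" for j
    proof -
      have e: "a * real j = - a * real (k1 - j) + a * real k1"
        using k1(2)[OF that] by (simp add: of_nat_diff algebra_simps)
      have "2 powr (a * real j) = \<rho> ^ (k1 - j) * 2 powr (a * real k1)" unfolding \<rho>p e powr_add ..
      thus ?thesis using that k1(1) by (simp add: bump_bound_def K1_def)
    qed
    hence "(\<Sum>j\<in>K1. bump_bound a r j) = (\<Sum>j\<in>K1. \<rho> ^ (k1 - j)) * bump_bound a r k1"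
      by (simp add: sum_distrib_right)
    also have "\<dots> \<le> 1 / (1 - \<rho>) * m"
      using \<rho> fin k1 le[of k1] bump_bound_pos[OF r, of a k1]
      by (intro mult_mono geometric_sum_finite_le inj) (auto simp: K1_def)
    finally show ?thesis .
  qed (use \<rho> m0 in auto)
  moreover have "(\<Sum>j\<in>K2. bump_bound a r j) \<le> 1 / (1 - \<rho>) * m"
  proof (cases "K2 = {}")
    case False
    define k2 where "k2 = Min K2"
    have k2: "k2 \<in> K2" "\<And>j. j \<in> K2 \<Longrightarrow> k2 \<le> j" using fin False by (auto simp: k2_def)
    have inj: "inj_on (\<lambda>j. j - k2) K2" using k2(2) by (intro inj_onI) (metis le_add_diff_inverse)
    have "bump_bound a r j = \<rho> ^ (j - k2) * bump_bound a r k2" if "j \<in> K2" for j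
    proof -
      have e: "- a * real j = - a * real (j - k2) + - a * real k2"
        using k2(2)[OF that] by (simp add: of_nat_diff algebra_simps)
      have "2 powr (- a * real j) = \<rho> ^ (j - k2) * 2 powr (- a * real k2)" unfolding \<rho>p e powr_add ..
      thus ?thesis using that k2(1) by (simp add: bump_bound_def K2_def)
    qed
    hence "(\<Sum>j\<in>K2. bump_bound a r j) = (\<Sum>j\<in>K2. \<rho> ^ (j - k2)) * bump_bound a r k2"
      by (simp add: sum_distrib_right)
    also have "\<dots> \<le> 1 / (1 - \<rho>) * m"
      using \<rho> fin k2 le[of k2] bump_bound_pos[OF r, of a k2]
      by (intro mult_mono geometric_sum_finite_le inj) (auto simp: K2_def)
    finally show ?thesis .
  qed (use \<rho> m0 in auto)
  ultimately have "(\<Sum>j\<in>K. bump_bound a r j) \<le> 2 / (1 - \<rho>) * m" unfolding split by (simp add: add_divide_distrib[symmetric])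
  thus ?thesis using k by (auto simp: \<rho>_def)
qed

text \<open>Raising to the power \<open>t\<close> turns the exponent \<open>a\<close> into
  \<open>a * t\<close>, so that \<open>bump_bound_sum_le\<close> applies. The dominating index may
  vary with \<open>r\<close>, whereas the constant is uniform.\<close>

lemma lq_qnorm_bump_bound:
  assumes q: "0 < q" and a: "a > 0"
  shows "\<exists>C>0. \<forall>K r. finite K \<longrightarrow> K \<noteq> {} \<longrightarrow> r \<ge> 0 \<longrightarrow>
    (\<exists>k\<in>K. lq_qnorm q (\<lambda>j. if j \<in> K then ennreal (bump_bound a r j) else 0) \<le> ennreal (C * bump_bound a r k))"
  using q
proof (cases q rule: exponent_cases)
  case 1
  have "\<exists>k\<in>K. lq_qnorm q (\<lambda>j. if j \<in> K then ennreal (bump_bound a r j) else 0) \<le> ennreal (1 * bump_bound a r k)"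
    if K: "finite K" "K \<noteq> {}" and r: "r \<ge> 0" for K and r :: real
  proof -
    have "Max (bump_bound a r ` K) \<in> bump_bound a r ` K" using K by (intro Max_in) auto
    then obtain k where k: "k \<in> K" "Max (bump_bound a r ` K) = bump_bound a r k" by blast
    have "bump_bound a r j \<le> bump_bound a r k" if "j \<in> K" for j
      unfolding k(2)[symmetric] using that K by (intro Max_ge) auto
    hence "esssup (count_space UNIV) (\<lambda>j. if j \<in> K then ennreal (bump_bound a r j) else 0) \<le> ennreal (bump_bound a r k)"
      by (intro esssup_I) (auto simp: AE_count_space intro!: ennreal_leI)
    thus ?thesis using k(1) by (intro bexI[of _ k]) (auto simp: 1 Lp_qnorm_top)
  qed
  thus ?thesis by (intro exI[of _ 1]) simp
next
  case (2 t)
  define c where "c = 2 / (1 - (2::real) powr (- (a * t)))"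
  have c: "c > 0" using a 2(1) by (simp add: c_def powr_less_one)
  have "\<exists>k\<in>K. lq_qnorm q (\<lambda>j. if j \<in> K then ennreal (bump_bound a r j) else 0) \<le> ennreal (c powr (1 / t) * bump_bound a r k)"
    if K: "finite K" "K \<noteq> {}" and r: "r \<ge> 0" for K and r :: real
  proof -
    obtain k where k: "k \<in> K" "(\<Sum>j\<in>K. bump_bound (a * t) r j) \<le> c * bump_bound (a * t) r k"
      using bump_bound_sum_le[OF _ r K, of "a * t"] a 2(1) unfolding c_def by auto
    have nn: "0 \<le> bump_bound b r j" for b j using bump_bound_pos[OF r, of b j] by simp
    have "lq_qnorm q (\<lambda>j. if j \<in> K then ennreal (bump_bound a r j) else 0)
       = ennreal_powr (\<Sum>j\<in>K. ennreal (bump_bound (a * t) r j)) (1 / t)"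
      unfolding 2(5) by (subst lq_qnorm_finite_support[OF K(1) 2(1)]) (auto simp: nn bump_bound_powr[OF r])
    also have "(\<Sum>j\<in>K. ennreal (bump_bound (a * t) r j)) = ennreal (\<Sum>j\<in>K. bump_bound (a * t) r j)"
      by (rule sum_ennreal) (rule nn)
    also have "ennreal_powr \<dots> (1 / t) \<le> ennreal_powr (ennreal (c * bump_bound (a * t) r k)) (1 / t)"
      using k 2(1) by (intro ennreal_powr_mono ennreal_leI) auto
    also have "\<dots> = ennreal (c powr (1 / t) * bump_bound a r k)"
      using c nn 2(1) r by (simp add: powr_mult bump_bound_powr)
    finally show ?thesis using k(1) by blast
  qed
  thus ?thesis using c by (intro exI[of _ "c powr (1 / t)"]) simp
qed

section \<open>Dilations, anisotropic decay and lacunary sums\<close>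

context aniso
begin

abbreviation wsize where "wsize \<equiv> weight_size M"

lemma size_pos: "wsize > 0"
  unfolding weight_size_def using M_ge by (intro sum_pos) (auto intro: less_le_trans[OF zero_less_one])

text \<open>The Jacobian determinant of the diagonal map is the product of the t^(m_i), that is,
  t^|M|.\<close>

lemma lborel_dil:
  assumes "t > 0"
  shows "lborel = density (distr lborel borel (dil t)) (\<lambda>_. ennreal (t powr wsize))"
proof -
  define c where "c b = (\<Sum>i\<in>UNIV. t powr (M $ i) * b $ i)" for b :: "real ^ 'n"
  have ca: "c (axis i 1) = t powr (M $ i)" for i
  proof -
    have "c (axis i 1) = (\<Sum>j\<in>UNIV. if j = i then t powr (M $ j) else 0)"
      unfolding c_def by (intro sum.cong) (auto simp: axis_def)
    thus ?thesis by simp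
  qed
  have c0: "c b \<noteq> 0" if "b \<in> Basis" for b
    using that assms by (auto simp: Basis_vec_def ca)
  have eq: "(\<lambda>x. 0 + (\<Sum>j\<in>Basis. (c j * (x \<bullet> j)) *\<^sub>R j)) = dil t"
    by (rule ext) (simp only: sum_Basis_vec ca inner_axis,
      simp add: vec_eq_iff inner_axis axis_def if_distrib cong: if_cong)
  have "(\<Prod>b\<in>Basis. \<bar>c b\<bar>) = (\<Prod>i\<in>UNIV. t powr (M $ i))"
  proof -
    have eqB: "Basis = range (\<lambda>i::'n. axis i (1::real))" by (auto simp: Basis_vec_def)
    have "inj (\<lambda>i::'n. axis i (1::real))" by (auto simp: inj_def axis_eq_axis)
    thus ?thesis unfolding eqB by (simp add: prod.reindex ca)
  qed
  also have "\<dots> = t powr wsize" using assms by (simp add: weight_size_def powr_sum)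
  finally show ?thesis using lborel_affine_euclidean[of c 0] c0 unfolding eq by simp
qed

lemma dil_continuous: "continuous_on UNIV (dil t)"
  unfolding aniso_dilation_def by (intro continuous_intros)

lemma dil_measurable [measurable]: "dil t \<in> borel_measurable borel"
  by (rule borel_measurable_continuous_onI[OF dil_continuous])

lemma nn_integral_dil:
  assumes "t > 0" and [measurable]: "h \<in> borel_measurable borel"
  shows "(\<integral>\<^sup>+x. h x \<partial>lborel) = ennreal (t powr wsize) * (\<integral>\<^sup>+x. h (dil t x) \<partial>lborel)"
  by (subst lborel_dil[OF assms(1)])
    (simp add: nn_integral_density nn_integral_distr nn_integral_cmult)

lemma integral_dil:
  fixes h :: "real ^ 'n \<Rightarrow> complex"
  assumes "t > 0" and [measurable]: "h \<in> borel_measurable borel"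
  shows "(\<integral>x. h x \<partial>lborel) = of_real (t powr wsize) * (\<integral>x. h (dil t x) \<partial>lborel)"
  by (subst lborel_dil[OF assms(1)])
    (simp add: integral_density integral_distr scaleR_conv_of_real)

lemma dil_dil [simp]: "s > 0 \<Longrightarrow> t > 0 \<Longrightarrow> dil s (dil t x) = dil (s * t) x"
  by (simp add: vec_eq_iff powr_mult)

lemma dil_1 [simp]: "dil 1 x = x"
  by (simp add: vec_eq_iff)

lemma AE_dil:
  assumes "t > 0" "AE x in lborel. P x"
  shows "AE x in lborel. P (dil t x)"
proof -
  have "AE x in density (distr lborel borel (dil t)) (\<lambda>_. ennreal (t powr wsize)). P x"
    using assms(2) by (subst (asm) lborel_dil[OF assms(1)])
  hence "AE x in distr lborel borel (dil t). P x"
    using assms(1) by (subst (asm) AE_density) auto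
  thus ?thesis by (rule AE_distrD[rotated]) simp
qed

lemma Lp_qnorm_dil:
  assumes p: "0 < p" and t: "t > 0" and [measurable]: "h \<in> borel_measurable borel"
  shows "Lp_qnorm lborel p (\<lambda>x. h (dil t x)) = ennreal (t powr (- wsize * recip p)) * Lp_qnorm lborel p h"
  using p
proof (cases p rule: exponent_cases)
  case 1
  \<comment> \<open>One inequality valid for all scales is enough: its instance with 1/t gives the
    converse.\<close>
  have le: "esssup lborel (\<lambda>x. g (dil s x)) \<le> esssup lborel g" if "s > 0" "g \<in> borel_measurable borel"
    for g :: "real ^ 'n \<Rightarrow> ennreal" and s
  proof (rule esssup_I)
    have [measurable]: "g \<in> borel_measurable borel" by (rule that(2))
    show "(\<lambda>x. g (dil s x)) \<in> borel_measurable lborel" by simp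
    show "AE x in lborel. g (dil s x) \<le> esssup lborel g" by (rule AE_dil[OF that(1) esssup_AE])
  qed
  have "esssup lborel (\<lambda>x. h (dil t (dil (1 / t) x))) \<le> esssup lborel (\<lambda>x. h (dil t x))"
    using t by (intro le) auto
  hence "esssup lborel (\<lambda>x. h (dil t x)) = esssup lborel h"
    using t le[OF t, of h] by (intro antisym) auto
  thus ?thesis using t by (simp add: 1 Lp_qnorm_top)
next
  case (2 r)
  define I where "I = (\<integral>\<^sup>+x. ennreal_powr (h x) r \<partial>lborel)"
  have "I = ennreal (t powr wsize) * (\<integral>\<^sup>+x. ennreal_powr (h (dil t x)) r \<partial>lborel)"
    unfolding I_def using t by (intro nn_integral_dil) auto
  hence "ennreal (t powr (- wsize)) * I = (\<integral>\<^sup>+x. ennreal_powr (h (dil t x)) r \<partial>lborel)"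
    using t by (simp add: mult.assoc[symmetric] ennreal_mult[symmetric] powr_add[symmetric])
  hence "Lp_qnorm lborel p (\<lambda>x. h (dil t x)) = ennreal_powr (ennreal (t powr (- wsize)) * I) (1 / r)"
    unfolding 2(5) Lp_qnorm_finite[OF 2(1)] by simp
  also have "\<dots> = ennreal (t powr (- wsize * (1 / r))) * ennreal_powr I (1 / r)"
    using t by (simp add: ennreal_powr_mult powr_powr)
  finally show ?thesis using 2 by (simp add: I_def Lp_qnorm_finite)
qed

text \<open>The exponent is twice the critical one, hence integrable at infinity; the cap at
  distance 1 keeps the function bounded.\<close>

definition decay :: "real ^ 'n \<Rightarrow> real"
  where "decay x = (if adist x \<le> 1 then 1 else adist x powr (- 2 * wsize))"

lemma decay_pos: "decay x > 0"
  by (auto simp: decay_def)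

lemma adist_measurable [measurable]: "adist \<in> borel_measurable borel"
  by (rule borel_measurable_continuous_onI[OF adist_continuous])

lemma decay_measurable [measurable]: "decay \<in> borel_measurable borel"
  unfolding decay_def by measurable

text \<open>Summation over the dyadic shells \<open>adist x \<le> 2\<^sup>l\<close>, whose volume is proportional to
  \<open>2\<^bsup>l wsize\<^esup>\<close>.\<close>

lemma nn_integral_decay_finite: "(\<integral>\<^sup>+x. ennreal (decay x) \<partial>lborel) < \<infinity>"
proof -
  define S where "S l = {x. adist x \<le> 2 ^ l}" for l :: nat
  have Sm [measurable]: "S l \<in> sets borel" for l unfolding S_def by measurable
  have "bounded (S 0)" using bounded_adist_ball[of 0 1] by (simp add: S_def)
  hence V: "emeasure lborel (S 0) < \<infinity>" by (rule emeasure_bounded_finite)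
  have vol: "emeasure lborel (S l) = ennreal ((2 ^ l) powr wsize) * emeasure lborel (S 0)" for l
  proof -
    have "emeasure lborel (S l) = (\<integral>\<^sup>+x. indicator (S l) x \<partial>lborel)" by simp
    also have "\<dots> = ennreal ((2 ^ l) powr wsize) * (\<integral>\<^sup>+x. indicator (S l) (dil (2 ^ l) x) \<partial>lborel)"
      by (rule nn_integral_dil) auto
    also have "(\<lambda>x. indicator (S l) (dil (2 ^ l) x)) = (indicator (S 0) :: _ \<Rightarrow> ennreal)"
      by (rule ext) (simp add: indicator_def S_def adist_dil)
    finally show ?thesis by simp
  qed
  \<comment> \<open>On the shell where the distance lies between 2^(l-1) and 2^l the decay is at
    most 2^(-2|M|(l-1)), which is \<open>w l\<close>.\<close>
  define w where "w l = 2 powr (2 * wsize) * (2 ^ l) powr (- 2 * wsize)" for l :: nat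
  have le: "ennreal (decay x) \<le> (\<Sum>l. ennreal (w l) * indicator (S l) x)" for x
  proof -
    have "\<exists>l. ennreal (decay x) \<le> ennreal (w l) * indicator (S l) x"
    proof (cases "adist x \<le> 1")
      case True
      thus ?thesis using size_pos by (intro exI[of _ 0]) (simp add: decay_def S_def w_def ge_one_powr_ge_zero)
    next
      case False
      obtain n where "adist x < 2 ^ n" using real_arch_pow[of 2 "adist x"] by auto
      define l where "l = (LEAST l. adist x \<le> 2 ^ l)"
      have l1: "adist x \<le> 2 ^ l" unfolding l_def by (rule LeastI[of _ n]) (use \<open>adist x < 2 ^ n\<close> in simp)
      then obtain k where k: "l = Suc k" using False by (cases l) auto
      have "\<not> adist x \<le> 2 ^ k" using not_less_Least[of k "\<lambda>l. adist x \<le> 2 ^ l"] k l_def by simp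
      hence "adist x powr (- 2 * wsize) \<le> (2 ^ k) powr (- 2 * wsize)"
        using size_pos by (intro powr_mono2') auto
      also have "(2 ^ k) powr (- 2 * wsize) = w l"
      proof -
        have "w l = 2 powr (2 * wsize) * (2 powr (- 2 * wsize) * (2 ^ k) powr (- 2 * wsize))"
          unfolding w_def k power_Suc by (simp add: powr_mult)
        also have "\<dots> = (2 powr (2 * wsize) * 2 powr (- 2 * wsize)) * (2 ^ k) powr (- 2 * wsize)" by (simp only: mult.assoc)
        also have "2 powr (2 * wsize) * 2 powr (- 2 * wsize) = 1" by (simp add: powr_add[symmetric])
        finally show ?thesis by simp
      qed
      finally show ?thesis using l1 False by (intro exI[of _ l]) (simp add: S_def decay_def ennreal_leI)
    qed
    then obtain l where "ennreal (decay x) \<le> ennreal (w l) * indicator (S l) x" by blast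
    also have "\<dots> \<le> (\<Sum>l. ennreal (w l) * indicator (S l) x)"
    proof -
      define f where "f l = ennreal (w l) * indicator (S l) x" for l
      have "sum f {l} \<le> suminf f" by (rule sum_le_suminf) auto
      thus ?thesis by (simp add: f_def[symmetric])
    qed
    finally show ?thesis .
  qed
  have w0: "w l \<ge> 0" for l by (simp add: w_def)
  have "(\<integral>\<^sup>+x. ennreal (decay x) \<partial>lborel) \<le> (\<integral>\<^sup>+x. (\<Sum>l. ennreal (w l) * indicator (S l) x) \<partial>lborel)"
    by (intro nn_integral_mono le)
  also have "\<dots> = (\<Sum>l. ennreal (w l) * emeasure lborel (S l))"
    by (subst nn_integral_suminf) (auto simp: nn_integral_cmult_indicator)
  also have "\<dots> = (\<Sum>l. ennreal (2 powr (2 * wsize) * (2 powr (- wsize)) ^ l) * emeasure lborel (S 0))"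
  proof -
    have "ennreal (w l) * emeasure lborel (S l) = ennreal (2 powr (2 * wsize) * (2 powr (- wsize)) ^ l) * emeasure lborel (S 0)" for l
    proof -
      have "w l * (2 ^ l) powr wsize = 2 powr (2 * wsize) * (2 powr (- wsize)) ^ l"
      proof -
        note e = two_power_powr
        have "(2 powr (- wsize)) ^ l = 2 powr (- wsize * real l)" by (simp add: powr_power mult.commute)
        moreover have "2 powr (- 2 * wsize * real l) * 2 powr (wsize * real l) = 2 powr (- wsize * real l)"
          unfolding powr_add[symmetric] by (simp add: algebra_simps)
        ultimately show ?thesis unfolding w_def e by (simp only: mult.assoc)
      qed
      moreover have "ennreal (w l) * ennreal ((2 ^ l) powr wsize) = ennreal (w l * (2 ^ l) powr wsize)"
        by (rule ennreal_mult[symmetric]) (auto simp: w0)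
      ultimately show ?thesis by (subst vol) (simp only: mult.assoc[symmetric])
    qed
    thus ?thesis by simp
  qed
  also have "\<dots> = (\<Sum>l. ennreal (2 powr (2 * wsize) * (2 powr (- wsize)) ^ l)) * emeasure lborel (S 0)"
    by (rule ennreal_suminf_multc)
  also have "\<dots> < \<infinity>"
  proof -
    have "summable (\<lambda>l. 2 powr (2 * wsize) * (2 powr (- wsize)) ^ l)"
      using size_pos by (intro summable_mult summable_geometric) (simp add: powr_less_one)
    hence "(\<Sum>l. ennreal (2 powr (2 * wsize) * (2 powr (- wsize)) ^ l)) \<noteq> top"
      by (intro ennreal_suminf_neq_top) auto
    thus ?thesis using V by (simp add: ennreal_mult_less_top less_top)
  qed
  finally show ?thesis .
qed

text \<open>The distance is at most the maximum of 1 and \<open>norm x\<close>, so Euclidean decay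
  of order at least 2|M|/p suffices. The exponent 1/p is chosen so that the p-th power of the bound
  is integrable.\<close>

lemma schwartz_decay_bound:
  assumes f: "f \<in> schwartz_funs" and p: "p > 0"
  obtains C where "C > 0" "\<And>x. cmod (f x) \<le> C * decay x powr (1 / p)"
proof -
  obtain k :: nat where k: "2 * wsize / p \<le> real k" using real_arch_simple by blast
  obtain C where C: "\<And>x. (1 + norm x) ^ k * cmod (f x) \<le> C" using schwartz_decay[OF f, of k] by blast
  have "C \<ge> 0" using C[of 0] by (simp add: order_trans[OF norm_ge_zero])
  have "cmod (f x) \<le> (C + 1) * decay x powr (1 / p)" for x
  proof -
    have one: "1 \<le> (1 + norm x) ^ k" by (rule one_le_power) simp
    have fC: "cmod (f x) \<le> C / (1 + norm x) ^ k" using C[of x] one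
      by (simp add: pos_le_divide_eq mult.commute add_pos_nonneg)
    show ?thesis
    proof (cases "adist x \<le> 1")
      case True
      have "C / (1 + norm x) ^ k \<le> C / 1"
        using one \<open>C \<ge> 0\<close> less_le_trans[OF zero_less_one one] by (intro divide_left_mono) auto
      thus ?thesis using True fC by (simp add: decay_def)
    next
      case False
      hence a: "1 < adist x" by simp
      hence "adist x \<le> 1 + norm x" using adist_le_norm[of x] by auto
      have "adist x powr (2 * wsize / p) \<le> adist x powr real k" using a k by (intro powr_mono) auto
      also have "\<dots> = adist x ^ k" using a by (simp add: powr_realpow)
      also have "\<dots> \<le> (1 + norm x) ^ k" using a \<open>adist x \<le> 1 + norm x\<close> by (intro power_mono) auto
      finally have "C / (1 + norm x) ^ k \<le> C / adist x powr (2 * wsize / p)"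
        using \<open>C \<ge> 0\<close> a less_le_trans[OF zero_less_one one] by (intro divide_left_mono mult_pos_pos) auto
      also have "\<dots> = C * decay x powr (1 / p)"
      proof -
        have "decay x powr (1 / p) = adist x powr (- (2 * wsize / p))" using a by (simp add: decay_def powr_powr)
        thus ?thesis by (simp add: powr_minus_divide)
      qed
      finally have "cmod (f x) \<le> C * decay x powr (1 / p)" using fC by simp
      also have "\<dots> \<le> (C + 1) * decay x powr (1 / p)" by (intro mult_right_mono) auto
      finally show ?thesis .
    qed
  qed
  thus ?thesis using that[of "C + 1"] \<open>C \<ge> 0\<close> by simp
qed

lemma schwartz_Lp_finite:
  fixes f :: "real ^ 'n \<Rightarrow> complex"
  assumes f: "f \<in> schwartz_funs" and p: "0 < p"
  shows "Lp_qnorm lborel p (\<lambda>x. ennreal (cmod (f x))) < \<infinity>"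
  using p
proof (cases p rule: exponent_cases)
  case 1
  obtain B where "\<And>x. cmod (f x) \<le> B" using schwartz_bounded[OF f] by blast
  hence "esssup lborel (\<lambda>x. ennreal (cmod (f x))) \<le> ennreal B"
    using Lp_norm_measurable[OF schwartz_continuous[OF f]] by (intro esssup_I) (auto intro!: ennreal_leI)
  thus ?thesis unfolding 1(1) Lp_qnorm_top by (rule le_less_trans) simp
next
  case (2 r)
  obtain C where C: "C > 0" "\<And>x. cmod (f x) \<le> C * decay x powr (1 / r)"
    using schwartz_decay_bound[OF f 2(1)] by blast
  have "(\<integral>\<^sup>+x. ennreal_powr (ennreal (cmod (f x))) r \<partial>lborel) \<le> (\<integral>\<^sup>+x. ennreal (C powr r) * ennreal (decay x) \<partial>lborel)"
  proof (rule nn_integral_mono)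
    fix x
    have "cmod (f x) powr r \<le> (C * decay x powr (1 / r)) powr r"
      using C 2(1) by (intro powr_mono2) auto
    also have "\<dots> = C powr r * decay x" using C(1) 2(1) decay_pos[of x] by (simp add: powr_mult powr_powr)
    finally show "ennreal_powr (ennreal (cmod (f x))) r \<le> ennreal (C powr r) * ennreal (decay x)"
      using decay_pos[of x] by (simp add: ennreal_mult[symmetric] ennreal_leI)
  qed
  also have "\<dots> < \<infinity>" using nn_integral_decay_finite by (simp add: nn_integral_cmult ennreal_mult_less_top)
  finally have "(\<integral>\<^sup>+x. ennreal_powr (ennreal (cmod (f x))) r \<partial>lborel) < top" by simp
  thus ?thesis unfolding 2(5) Lp_qnorm_finite[OF 2(1)]
    by (cases "\<integral>\<^sup>+x. ennreal_powr (ennreal (cmod (f x))) r \<partial>lborel") auto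
qed

text \<open>Identifies the majorant with exponent |M| as the integral-preserving dilate of
  \<open>decay\<close>, so that its integral is the same for all j.\<close>

lemma bump_bound_decay: "bump_bound wsize (adist x) j = (2 ^ j) powr wsize * decay (dil (2 ^ j) x)"
proof (cases "2 ^ j * adist x \<le> 1")
  case True
  thus ?thesis by (simp add: bump_bound_def decay_def adist_dil two_power_powr)
next
  case False
  have "(2 ^ j) powr wsize * (2 ^ j * adist x) powr (- 2 * wsize) = 2 powr (- wsize * real j) * adist x powr (- 2 * wsize)"
  proof -
    note e = two_power_powr
    have "(2 ^ j) powr wsize * (2 ^ j * adist x) powr (- 2 * wsize)
        = (2 powr (wsize * real j) * 2 powr (- 2 * wsize * real j)) * adist x powr (- 2 * wsize)"
      unfolding powr_mult[of "2 ^ j" "adist x", simplified] e by (simp only: mult.assoc)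
    also have "2 powr (wsize * real j) * 2 powr (- 2 * wsize * real j) = 2 powr (- wsize * real j)"
      unfolding powr_add[symmetric] by (simp add: algebra_simps)
    finally show ?thesis .
  qed
  thus ?thesis using False by (simp add: bump_bound_def decay_def adist_dil)
qed

text \<open>The Jawerth phenomenon: a lacunary sum of dilated bumps has Triebel--Lizorkin quasi-norm
  \<open>O((card K)\<^bsup>1/p\<^esup>)\<close>, whatever \<open>q\<close> is.\<close>

lemma triebel_lizorkin_bumps_le:
  assumes p: "0 < p" "p < \<infinity>" and q: "0 < q" and \<theta>: "\<theta> \<in> schwartz_funs"
  obtains C where "C > 0" "\<And>K s B. finite K \<Longrightarrow> K \<noteq> {} \<Longrightarrow>
    (\<And>j x. 2 powr (s * real j) * cmod (B j x) \<le> (if j \<in> K then (2 ^ j) powr (wsize * recip p) * cmod (\<theta> (dil (2 ^ j) x)) else 0)) \<Longrightarrow>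
    block_qnorm Triebel_Lizorkin s p q B \<le> ennreal (C * real (card K) powr recip p)"
  using p(1)
proof (cases p rule: exponent_cases)
  case (2 r)
  obtain C1 where C1: "C1 > 0" "\<And>x. cmod (\<theta> x) \<le> C1 * decay x powr (1 / r)"
    using schwartz_decay_bound[OF \<theta> 2(1)] by blast
  define a where "a = wsize / r"
  have a: "a > 0" using size_pos 2(1) by (simp add: a_def)
  from lq_qnorm_bump_bound[OF q a] obtain C2 where C2: "C2 > 0" and C2': "\<forall>K r. finite K \<longrightarrow> K \<noteq> {} \<longrightarrow> r \<ge> 0 \<longrightarrow>
    (\<exists>k\<in>K. lq_qnorm q (\<lambda>j. if j \<in> K then ennreal (bump_bound a r j) else 0) \<le> ennreal (C2 * bump_bound a r k))"
    by (elim exE conjE) (rule that)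
  obtain W where W: "W \<ge> 0" "(\<integral>\<^sup>+x. ennreal (decay x) \<partial>lborel) = ennreal W"
    using nn_integral_decay_finite by (cases "\<integral>\<^sup>+x. ennreal (decay x) \<partial>lborel") auto
  \<comment> \<open>Adding 1 to \<open>W\<close> makes positivity of the constant immediate.\<close>
  define C where "C = C1 * C2 * (W + 1) powr (1 / r)"
  have Cpos: "C > 0" using C1 C2 W by (simp add: C_def)
  have main: "block_qnorm Triebel_Lizorkin s p q B \<le> ennreal (C * real (card K) powr recip p)"
    if K: "finite K" "K \<noteq> {}" and
      B: "\<And>j x. 2 powr (s * real j) * cmod (B j x) \<le> (if j \<in> K then (2 ^ j) powr (wsize * recip p) * cmod (\<theta> (dil (2 ^ j) x)) else 0)"
    for K s B
  proof -
    have ra: "a * r = wsize" using 2(1) by (simp add: a_def)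
    have bb: "(2 ^ j) powr (wsize * recip p) * cmod (\<theta> (dil (2 ^ j) x)) \<le> C1 * bump_bound a (adist x) j" for j x
    proof -
      have "bump_bound a (adist x) j = (bump_bound a (adist x) j powr r) powr (1 / r)"
        using 2(1) bump_bound_pos[of "adist x" a j] by (simp add: powr_powr)
      also have "bump_bound a (adist x) j powr r = (2 ^ j) powr wsize * decay (dil (2 ^ j) x)"
        by (simp add: bump_bound_powr ra bump_bound_decay)
      also have "\<dots> powr (1 / r) = (2 ^ j) powr (wsize * recip p) * decay (dil (2 ^ j) x) powr (1 / r)"
        using 2 decay_pos[of "dil (2 ^ j) x"] by (simp add: powr_mult powr_powr)
      finally have e: "C1 * bump_bound a (adist x) j = (2 ^ j) powr (wsize * recip p) * (C1 * decay (dil (2 ^ j) x) powr (1 / r))"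
        by simp
      show ?thesis unfolding e by (intro mult_left_mono C1) auto
    qed
    \<comment> \<open>Pointwise the inner quasi-norm is controlled by one of its majorants. Its
      power \<open>r\<close> is estimated by the sum over \<open>K\<close>, all of whose summands
      have the same integral \<open>W\<close>; this turns the count into
      \<open>card K\<close>.\<close>
    have pw: "ennreal_powr (lq_qnorm q (\<lambda>j. ennreal (2 powr (s * real j)) * ennreal (cmod (B j x)))) r
       \<le> ennreal ((C1 * C2) powr r) * (\<Sum>j\<in>K. ennreal ((2 ^ j) powr wsize) * ennreal (decay (dil (2 ^ j) x)))" for x
    proof -
      have "lq_qnorm q (\<lambda>j. ennreal (2 powr (s * real j)) * ennreal (cmod (B j x)))
         \<le> lq_qnorm q (\<lambda>j. ennreal C1 * (if j \<in> K then ennreal (bump_bound a (adist x) j) else 0))"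
      proof (rule lq_qnorm_mono[OF q])
        fix j
        have "2 powr (s * real j) * cmod (B j x) \<le> (if j \<in> K then C1 * bump_bound a (adist x) j else 0)"
          using B[of j x] bb[of j x] by (auto split: if_splits)
        hence "ennreal (2 powr (s * real j) * cmod (B j x)) \<le> ennreal (if j \<in> K then C1 * bump_bound a (adist x) j else 0)"
          by (rule ennreal_leI)
        thus "ennreal (2 powr (s * real j)) * ennreal (cmod (B j x)) \<le> ennreal C1 * (if j \<in> K then ennreal (bump_bound a (adist x) j) else 0)"
          using C1 bump_bound_pos[of "adist x" a j] by (auto simp: ennreal_mult)
      qed
      also have "\<dots> = ennreal C1 * lq_qnorm q (\<lambda>j. if j \<in> K then ennreal (bump_bound a (adist x) j) else 0)"
        using q C1(1) by (intro Lp_qnorm_cmult) auto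
      finally have le: "lq_qnorm q (\<lambda>j. ennreal (2 powr (s * real j)) * ennreal (cmod (B j x)))
         \<le> ennreal C1 * lq_qnorm q (\<lambda>j. if j \<in> K then ennreal (bump_bound a (adist x) j) else 0)" .
      from C2' K have "\<exists>k\<in>K. lq_qnorm q (\<lambda>j. if j \<in> K then ennreal (bump_bound a (adist x) j) else 0) \<le> ennreal (C2 * bump_bound a (adist x) k)"
        by simp
      then obtain k where k: "k \<in> K"
        "lq_qnorm q (\<lambda>j. if j \<in> K then ennreal (bump_bound a (adist x) j) else 0) \<le> ennreal (C2 * bump_bound a (adist x) k)" ..
      note le
      also note mult_left_mono[OF k(2), of "ennreal C1"]
      finally have "lq_qnorm q (\<lambda>j. ennreal (2 powr (s * real j)) * ennreal (cmod (B j x))) \<le> ennreal C1 * ennreal (C2 * bump_bound a (adist x) k)"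
        by simp
      also have "\<dots> = ennreal ((C1 * C2) * bump_bound a (adist x) k)"
        using C1 C2 bump_bound_pos[of "adist x" a k] by (simp add: ennreal_mult[symmetric] mult.assoc)
      finally have "ennreal_powr (lq_qnorm q (\<lambda>j. ennreal (2 powr (s * real j)) * ennreal (cmod (B j x)))) r
         \<le> ennreal_powr (ennreal ((C1 * C2) * bump_bound a (adist x) k)) r"
        using 2(1) by (intro ennreal_powr_mono) auto
      also have "\<dots> = ennreal ((C1 * C2) powr r * ((2 ^ k) powr wsize * decay (dil (2 ^ k) x)))"
        using C1 C2 bump_bound_pos[of "adist x" a k] by (simp add: powr_mult bump_bound_powr ra bump_bound_decay)
      also have "\<dots> = ennreal ((C1 * C2) powr r) * (ennreal ((2 ^ k) powr wsize) * ennreal (decay (dil (2 ^ k) x)))"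
        using decay_pos[of "dil (2 ^ k) x"] by (simp add: ennreal_mult)
      also have "\<dots> \<le> ennreal ((C1 * C2) powr r) * (\<Sum>j\<in>K. ennreal ((2 ^ j) powr wsize) * ennreal (decay (dil (2 ^ j) x)))"
        by (intro mult_left_mono member_le_sum k(1) K(1)) auto
      finally show ?thesis .
    qed
    have "(\<integral>\<^sup>+x. ennreal_powr (lq_qnorm q (\<lambda>j. ennreal (2 powr (s * real j)) * ennreal (cmod (B j x)))) r \<partial>lborel)
      \<le> (\<integral>\<^sup>+x. ennreal ((C1 * C2) powr r) * (\<Sum>j\<in>K. ennreal ((2 ^ j) powr wsize) * ennreal (decay (dil (2 ^ j) x))) \<partial>lborel)"
      by (intro nn_integral_mono pw)
    also have "\<dots> = ennreal ((C1 * C2) powr r) * (\<Sum>j\<in>K. ennreal ((2 ^ j) powr wsize) * (\<integral>\<^sup>+x. ennreal (decay (dil (2 ^ j) x)) \<partial>lborel))"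
      by (subst nn_integral_cmult, measurable) (subst nn_integral_sum, auto simp: nn_integral_cmult)
    also have "\<dots> = ennreal ((C1 * C2) powr r) * (\<Sum>j\<in>K. ennreal W)"
    proof -
      have "ennreal ((2 ^ j) powr wsize) * (\<integral>\<^sup>+x. ennreal (decay (dil (2 ^ j) x)) \<partial>lborel) = ennreal W" for j :: nat
        unfolding W(2)[symmetric] by (rule nn_integral_dil[symmetric]) auto
      thus ?thesis by (simp only:)
    qed
    also have "\<dots> \<le> ennreal ((C1 * C2) powr r * (real (card K) * (W + 1)))"
    proof -
      have "(\<Sum>j\<in>K. ennreal W) = ennreal (real (card K) * W)"
        using W(1) by (simp add: ennreal_mult ennreal_of_nat_eq_real_of_nat)
      also have "\<dots> \<le> ennreal (real (card K) * (W + 1))" by (intro ennreal_leI mult_left_mono) auto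
      finally have "(\<Sum>j\<in>K. ennreal W) \<le> ennreal (real (card K) * (W + 1))" .
      from mult_left_mono[OF this, of "ennreal ((C1 * C2) powr r)"] show ?thesis
        using W(1) by (simp add: ennreal_mult)
    qed
    finally have "ennreal_powr (\<integral>\<^sup>+x. ennreal_powr (lq_qnorm q (\<lambda>j. ennreal (2 powr (s * real j)) * ennreal (cmod (B j x)))) r \<partial>lborel) (1 / r)
      \<le> ennreal_powr (ennreal ((C1 * C2) powr r * (real (card K) * (W + 1)))) (1 / r)"
      using 2(1) by (intro ennreal_powr_mono) auto
    also have "\<dots> = ennreal (((C1 * C2) powr r * (real (card K) * (W + 1))) powr (1 / r))"
      using W(1) by (intro ennreal_powr_ennreal) auto
    also have "((C1 * C2) powr r * (real (card K) * (W + 1))) powr (1 / r) = C * real (card K) powr recip p"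
    proof -
      have "((C1 * C2) powr r) powr (1 / r) = C1 * C2" using 2(1) C1(1) C2 by (simp add: powr_powr)
      moreover have "((C1 * C2) powr r * (real (card K) * (W + 1))) powr (1 / r)
          = ((C1 * C2) powr r) powr (1 / r) * (real (card K) powr (1 / r) * (W + 1) powr (1 / r))"
        using W(1) by (simp add: powr_mult)
      ultimately show ?thesis unfolding 2(4) C_def by simp
    qed
    finally show ?thesis unfolding block_qnorm_def using 2 by (simp add: Lp_qnorm_finite)
  qed
  show ?thesis by (rule that[OF Cpos main])
qed (use p(2) in auto)

end

section \<open>Wave packets\<close>

context cutoff
begin

text \<open>Frequencies are placed on an axis of weight 1, where the anisotropic distance is the
  absolute value; thus the frequency 2^k lies exactly at distance 2^k, and frequencies on this axis
  add like real numbers.\<close>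

definition i0 :: 'n where "i0 = (SOME i. M $ i = 1)"

lemma M_i0: "M $ i0 = 1"
  unfolding i0_def by (rule someI_ex) (metis M_eq)

definition spot :: "real \<Rightarrow> real \<Rightarrow> (real ^ 'n) set"
  where "spot \<sigma> r = {\<xi>. adist (\<xi> - axis i0 \<sigma>) \<le> r}"

lemma axis_add: "axis i (a + b) = axis i a + (axis i b :: real ^ 'n)" for a b :: real
  by (simp add: vec_eq_iff axis_def)

lemma bounded_spot: "bounded (spot \<sigma> r)"
  unfolding spot_def by (rule bounded_adist_ball)

lemma spot_add: "{a + b | a b. a \<in> spot \<sigma> r \<and> b \<in> spot \<sigma>' r'} \<subseteq> spot (\<sigma> + \<sigma>') (r + r')"
proof clarify
  fix a b assume ab: "a \<in> spot \<sigma> r" "b \<in> spot \<sigma>' r'"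
  have eq: "a + b - axis i0 (\<sigma> + \<sigma>') = (a - axis i0 \<sigma>) + (b - axis i0 \<sigma>')"
    by (simp add: axis_add)
  show "a + b \<in> spot (\<sigma> + \<sigma>') (r + r')"
    using ab unfolding spot_def eq mem_Collect_eq by (intro order_trans[OF adist_triangle add_mono])
qed

lemma spot_adist:
  assumes "\<xi> \<in> spot \<sigma> r"
  shows "adist \<xi> \<le> \<bar>\<sigma>\<bar> + r" "\<bar>\<sigma>\<bar> - r \<le> adist \<xi>"
proof -
  have a: "adist (axis i0 \<sigma>) = \<bar>\<sigma>\<bar>" by (rule adist_axis[OF M_i0])
  show "adist \<xi> \<le> \<bar>\<sigma>\<bar> + r"
    using adist_triangle[of "\<xi> - axis i0 \<sigma>" "axis i0 \<sigma>"] assms by (simp add: spot_def a)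
  show "\<bar>\<sigma>\<bar> - r \<le> adist \<xi>"
    using adist_triangle[of "\<xi>" "- (\<xi> - axis i0 \<sigma>)"] assms adist_minus[of "\<xi> - axis i0 \<sigma>"]
    by (simp add: spot_def a del: adist_minus)
qed

lemma spot_annulus:
  "\<bar>\<sigma>\<bar> + r \<le> 11/10 * 2 ^ j \<Longrightarrow> j = 0 \<or> 65/100 * 2 ^ j \<le> \<bar>\<sigma>\<bar> - r \<Longrightarrow> spot \<sigma> r \<subseteq> annulus j"
  using spot_adist unfolding annulus_def by (fastforce intro: order_trans)

text \<open>The squared modulus removes the complex values of \<open>\<Psi>\<close>. The factor
  t^(-|M|) makes the inverse transform a plain dilate, the factor 2 turns the vanishing of
  \<open>\<Psi>\<close> beyond 13/10 into support within radius t/100, and 100 leaves room for sums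
  of two frequencies inside the annuli.\<close>

definition symb :: "real \<Rightarrow> real \<Rightarrow> real ^ 'n \<Rightarrow> complex"
  where "symb t \<sigma> \<xi> = of_real (t powr (- wsize)) *
    (cnj (\<Psi> (2 * gauge (t / 100) (\<xi> - axis i0 \<sigma>))) * \<Psi> (2 * gauge (t / 100) (\<xi> - axis i0 \<sigma>)))"

lemma symb_eq: "symb t \<sigma> \<xi> = of_real (t powr (- wsize) * (cmod (\<Psi> (2 * gauge (t / 100) (\<xi> - axis i0 \<sigma>))))\<^sup>2)"
  unfolding symb_def of_real_mult by (subst mult.commute[of "cnj _"]) (simp add: complex_norm_square[symmetric])

lemma symb_test_funs: "symb t \<sigma> \<in> test_funs" if "t > 0"
proof -
  define c where "c b = 2 * (t / 100) powr (- 2 * (M \<bullet> b))" for b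
  have "2 * gauge (t / 100) (\<xi> - axis i0 \<sigma>) = (\<Sum>b\<in>Basis. c b * (\<xi> \<bullet> b - axis i0 \<sigma> \<bullet> b)\<^sup>2)" for \<xi>
    unfolding sum_Basis_vec gauge_def c_def inner_axis sum_distrib_left by (simp add: mult_ac)
  hence eq: "symb t \<sigma> = (\<lambda>\<xi>. of_real (t powr (- wsize)) * (cnj (\<Psi> (\<Sum>b\<in>Basis. c b * (\<xi> \<bullet> b - axis i0 \<sigma> \<bullet> b)\<^sup>2)) *
     \<Psi> (\<Sum>b\<in>Basis. c b * (\<xi> \<bullet> b - axis i0 \<sigma> \<bullet> b)\<^sup>2)))"
    by (simp add: fun_eq_iff symb_def)
  have t: "(\<lambda>\<xi>. \<Psi> (\<Sum>b\<in>Basis. c b * (\<xi> \<bullet> b - axis i0 \<sigma> \<bullet> b)\<^sup>2)) \<in> test_funs"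
    using that by (intro cutoff_quadratic_test_funs cutoff) (auto simp: c_def)
  show ?thesis unfolding eq
    by (intro test_funs_cmult test_funs_mult t smooth_on_cnj test_funs_smooth open_UNIV)
qed

lemma symb_support: "t > 0 \<Longrightarrow> \<xi> \<notin> spot \<sigma> (t / 100) \<Longrightarrow> symb t \<sigma> \<xi> = 0"
proof -
  assume "t > 0" "\<xi> \<notin> spot \<sigma> (t / 100)"
  hence "1 < gauge (t / 100) (\<xi> - axis i0 \<sigma>)" using adist_le_iff[of "t / 100" "\<xi> - axis i0 \<sigma>"]
    by (simp add: spot_def)
  thus "symb t \<sigma> \<xi> = 0" by (simp add: symb_def \<Psi>_zero)
qed

definition wave :: "real \<Rightarrow> real \<Rightarrow> real ^ 'n \<Rightarrow> complex"
  where "wave t \<sigma> = inv_fourier (symb t \<sigma>)"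

definition bump :: "real ^ 'n \<Rightarrow> complex" where "bump = wave 1 0"

lemma gauge_dil: "t > 0 \<Longrightarrow> s > 0 \<Longrightarrow> gauge (t * s) (dil t x) = gauge s x"
proof -
  assume ts: "t > 0" "s > 0"
  have "(t powr (M $ i) * x $ i)\<^sup>2 * (t * s) powr (- 2 * M $ i) = (x $ i)\<^sup>2 * s powr (- 2 * M $ i)" for i
  proof -
    have "(t powr (M $ i))\<^sup>2 = t powr (2 * M $ i)"
      using ts by (simp add: powr_powr[symmetric] powr_numeral mult.commute[of 2])
    moreover have "(t * s) powr (- 2 * M $ i) = t powr (- 2 * M $ i) * s powr (- 2 * M $ i)"
      using ts by (intro powr_mult)
    moreover have "t powr (2 * M $ i) * t powr (- 2 * M $ i) = 1" using ts by (simp add: powr_add[symmetric])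
    ultimately show ?thesis by (simp add: power_mult_distrib mult_ac)
  qed
  thus ?thesis by (simp add: gauge_def)
qed

lemma inner_dil: "x \<bullet> dil t y = dil t x \<bullet> y"
  by (simp add: inner_vec_def mult_ac)

lemma inv_fourier_dil:
  assumes t: "t > 0" and [measurable]: "h \<in> borel_measurable borel"
  shows "inv_fourier (\<lambda>\<xi>. of_real (t powr (- wsize)) * h (dil (1 / t) \<xi>)) x = inv_fourier h (dil t x)"
proof -
  have "(\<integral>\<xi>. exp (\<i> * of_real (x \<bullet> \<xi>)) * (of_real (t powr (- wsize)) * h (dil (1 / t) \<xi>)) \<partial>lborel)
    = of_real (t powr wsize) * (\<integral>\<xi>. exp (\<i> * of_real (x \<bullet> dil t \<xi>)) * (of_real (t powr (- wsize)) * h (dil (1 / t) (dil t \<xi>))) \<partial>lborel)"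
  proof (rule integral_dil[OF t])
    show "(\<lambda>\<xi>. exp (\<i> * of_real (x \<bullet> \<xi>)) * (of_real (t powr (- wsize)) * h (dil (1 / t) \<xi>))) \<in> borel_measurable borel"
      using measurable_iexp_inner[of 1 x] by measurable
  qed
  also have "\<dots> = (\<integral>\<xi>. of_real (t powr wsize) * (exp (\<i> * of_real (x \<bullet> dil t \<xi>)) * (of_real (t powr (- wsize)) * h (dil (1 / t) (dil t \<xi>)))) \<partial>lborel)"
    by (rule integral_mult_right_zero[symmetric])
  also have "\<dots> = (\<integral>\<xi>. exp (\<i> * of_real (dil t x \<bullet> \<xi>)) * h \<xi> \<partial>lborel)"
  proof (rule Bochner_Integration.integral_cong[OF refl])
    fix \<xi>
    have "complex_of_real (t powr wsize) * of_real (t powr (- wsize)) = 1"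
      unfolding of_real_mult[symmetric] using t by (simp add: powr_add[symmetric])
    moreover have "complex_of_real (t powr wsize) * (exp (\<i> * of_real (x \<bullet> dil t \<xi>)) * (of_real (t powr (- wsize)) * h \<xi>))
       = (complex_of_real (t powr wsize) * of_real (t powr (- wsize))) * (exp (\<i> * of_real (x \<bullet> dil t \<xi>)) * h \<xi>)"
      by (simp only: mult_ac)
    ultimately show "complex_of_real (t powr wsize) * (exp (\<i> * of_real (x \<bullet> dil t \<xi>)) * (of_real (t powr (- wsize)) * h (dil (1 / t) (dil t \<xi>))))
       = exp (\<i> * of_real (dil t x \<bullet> \<xi>)) * h \<xi>"
      using t by (simp add: inner_dil)
  qed
  finally show ?thesis by (simp add: inv_fourier_def)
qed

text \<open>Translation of the symbol modulates and its scaling dilates. In particular the modulus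
  of a packet does not depend on its frequency.\<close>

lemma wave_eq:
  assumes t: "t > 0"
  shows "wave t \<sigma> x = iexp (\<sigma> * x $ i0) * bump (dil t x)"
proof -
  have m: "symb 1 0 \<in> borel_measurable borel"
    by (intro borel_measurable_continuous_onI test_funs_continuous symb_test_funs) simp
  have m': "symb t 0 \<in> borel_measurable borel"
    by (intro borel_measurable_continuous_onI test_funs_continuous symb_test_funs t)
  have a0: "axis i0 0 = (0 :: real ^ 'n)" by (simp add: vec_eq_iff axis_def)
  have "symb t 0 = (\<lambda>\<xi>. of_real (t powr (- wsize)) * symb 1 0 (dil (1 / t) \<xi>))"
  proof
    fix \<xi>
    have "gauge (1 / 100) (dil (1 / t) \<xi>) = gauge (t / 100) \<xi>"
      using gauge_dil[of "1 / t" "t / 100" \<xi>] t by simp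
    thus "symb t 0 \<xi> = of_real (t powr (- wsize)) * symb 1 0 (dil (1 / t) \<xi>)"
      by (simp add: symb_def a0)
  qed
  hence 1: "inv_fourier (symb t 0) x = bump (dil t x)"
    using inv_fourier_dil[OF t m] by (simp add: bump_def wave_def)
  have "symb t \<sigma> = (\<lambda>\<xi>. symb t 0 (\<xi> + (- axis i0 \<sigma>)))" by (simp add: fun_eq_iff symb_def a0)
  hence "ft 1 (symb t \<sigma>) x = iexp (- 1 * (x \<bullet> (- axis i0 \<sigma>))) * ft 1 (symb t 0) x"
    using ft_translate[OF m', of 1 "- axis i0 \<sigma>" x] by simp
  hence "inv_fourier (symb t \<sigma>) x = iexp (- 1 * (x \<bullet> (- axis i0 \<sigma>))) * inv_fourier (symb t 0) x"
    by (simp only: inv_fourier_eq_ft mult.left_commute)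
  thus ?thesis unfolding wave_def 1 by (simp add: inner_axis mult.commute)
qed

lemma cmod_wave: "t > 0 \<Longrightarrow> cmod (wave t \<sigma> x) = cmod (bump (dil t x))"
  by (simp add: wave_eq norm_mult)

lemma wave_bandlimited: "t > 0 \<Longrightarrow> bandlimited (spot \<sigma> (t / 100)) (wave t \<sigma>)"
  unfolding wave_def by (intro bandlimited_inv_fourier_test symb_test_funs bounded_spot symb_support)

lemma wave_mult_bandlimited:
  assumes "t > 0" "t' > 0"
  shows "bandlimited (spot (\<sigma> + \<sigma>') ((t + t') / 100)) (\<lambda>x. wave t \<sigma> x * wave t' \<sigma>' x)"
  using bandlimited_mono[OF bandlimited_mult[OF wave_bandlimited[OF assms(1)] wave_bandlimited[OF assms(2)]] spot_add bounded_spot]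
  by (simp add: add_divide_distrib)

lemma bump_schwartz: "bump \<in> schwartz_funs"
  unfolding bump_def wave_def by (intro inv_fourier_schwartz symb_test_funs) simp

lemma bump_continuous: "continuous_on UNIV bump"
  by (rule schwartz_continuous[OF bump_schwartz])

text \<open>Schwartz functions with compactly supported transform: the class to which the hypothesis
  is applied.\<close>

definition paley :: "(real ^ 'n \<Rightarrow> complex) set"
  where "paley = inv_fourier ` test_funs"

lemma paley_schwartz: "f \<in> paley \<Longrightarrow> f \<in> schwartz_funs"
  by (auto simp: paley_def inv_fourier_schwartz)

lemma paley_bandlimited:
  assumes "f \<in> paley"
  obtains S where "bandlimited S f"
proof -
  obtain h where h: "f = inv_fourier h" "h \<in> test_funs" using assms by (auto simp: paley_def)
  have "bandlimited {x. h x \<noteq> 0} f" unfolding h(1)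
    by (rule bandlimited_inv_fourier_test[OF h(2) test_funs_support[OF h(2)]]) simp
  thus ?thesis by (rule that)
qed

lemma wave_sum_paley:
  assumes "\<And>k. k \<in> K \<Longrightarrow> t k > 0"
  shows "(\<lambda>x. \<Sum>k\<in>K. a k * wave (t k) (\<sigma> k) x) \<in> paley"
proof -
  have t: "(\<lambda>\<xi>. a k * symb (t k) (\<sigma> k) \<xi>) \<in> test_funs" if "k \<in> K" for k
    by (intro test_funs_cmult symb_test_funs assms that)
  have "inv_fourier (\<lambda>\<xi>. \<Sum>k\<in>K. a k * symb (t k) (\<sigma> k) \<xi>) = (\<lambda>x. \<Sum>k\<in>K. a k * wave (t k) (\<sigma> k) x)"
    unfolding inv_fourier_eq_ft wave_def
    by (subst ft_sum[OF test_funs_integrable[OF t]]) (auto simp: ft_cmult sum_distrib_left mult_ac)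
  thus ?thesis unfolding paley_def using test_funs_sum[of K "\<lambda>k \<xi>. a k * symb (t k) (\<sigma> k) \<xi>", OF t]
    by (metis (no_types, lifting) imageI)
qed

text \<open>The Littlewood-Paley block of an integrable function, which keeps all later computations
  free of distributions.\<close>

definition blk :: "nat \<Rightarrow> (real ^ 'n \<Rightarrow> complex) \<Rightarrow> real ^ 'n \<Rightarrow> complex"
  where "blk l F = inv_fourier (\<lambda>\<xi>. LP_Phi \<Psi> M (int l) \<xi> * fourier F \<xi>)"

lemma LP_Phi_mult_integrable:
  assumes "continuous_on UNIV g"
  shows "integrable lborel (\<lambda>\<xi>. LP_Phi \<Psi> M l \<xi> * g \<xi>)"
  by (rule bounded_support_integrable)
    (use test_funs_continuous[OF LP_Phi_test_funs[of l]] test_funs_support[OF LP_Phi_test_funs[of l]] assms in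
      \<open>auto intro!: continuous_intros intro: bounded_subset\<close>)

lemma blk_continuous: "integrable lborel F \<Longrightarrow> continuous_on UNIV (blk l F)"
  unfolding blk_def inv_fourier_eq_ft
  by (intro continuous_intros ft_continuous LP_Phi_mult_integrable fourier_continuous)

lemma blk_sum:
  assumes "\<And>i. i \<in> I \<Longrightarrow> integrable lborel (F i)"
  shows "blk l (\<lambda>x. \<Sum>i\<in>I. a i * F i x) = (\<lambda>x. \<Sum>i\<in>I. a i * blk l (F i) x)"
proof -
  have "fourier (\<lambda>x. \<Sum>i\<in>I. a i * F i x) = (\<lambda>\<xi>. \<Sum>i\<in>I. a i * fourier (F i) \<xi>)"
    unfolding fourier_eq_ft using assms by (subst ft_sum) (auto simp: ft_cmult)
  hence "(\<lambda>\<xi>. LP_Phi \<Psi> M (int l) \<xi> * fourier (\<lambda>x. \<Sum>i\<in>I. a i * F i x) \<xi>)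
    = (\<lambda>\<xi>. \<Sum>i\<in>I. a i * (LP_Phi \<Psi> M (int l) \<xi> * fourier (F i) \<xi>))"
    by (simp add: sum_distrib_left mult_ac)
  moreover have "integrable lborel (\<lambda>\<xi>. a i * (LP_Phi \<Psi> M (int l) \<xi> * fourier (F i) \<xi>))" if "i \<in> I" for i
    by (intro integrable_mult_right LP_Phi_mult_integrable fourier_continuous assms that)
  ultimately show ?thesis unfolding blk_def inv_fourier_eq_ft
    by (simp add: ft_sum ft_cmult sum_distrib_left mult_ac)
qed

lemma blk_annulus:
  assumes F: "bandlimited S F" and S: "S \<subseteq> annulus j"
  shows "blk l F = (if l = j then F else (\<lambda>_. 0))"
proof -
  have "LP_Phi \<Psi> M (int l) \<xi> * fourier F \<xi> = (if l = j then fourier F \<xi> else 0)" for \<xi>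
    using LP_Phi_annulus[of \<xi> j l] bandlimited_fourier[OF F, of \<xi>] S by (cases "\<xi> \<in> S") auto
  thus ?thesis using bandlimited_inv_fourier[OF F] by (simp add: blk_def) (simp add: inv_fourier_def fun_eq_iff)
qed

text \<open>For packets of opposite frequencies the mixed products matter only through their absence
  from the lowest block, whose function vanishes from distance 13/10 on.\<close>

lemma blk_0_far:
  assumes F: "bandlimited (spot \<sigma> r) F" and S: "13/10 \<le> \<bar>\<sigma>\<bar> - r"
  shows "blk 0 F = (\<lambda>_. 0)"
proof -
  have "LP_Phi \<Psi> M (int 0) \<xi> * fourier F \<xi> = 0" for \<xi>
  proof (cases "\<xi> \<in> spot \<sigma> r")
    case True
    thus ?thesis using spot_adist(2)[OF True] S LP_Psi_zero[of 0 \<xi>] by (simp add: LP_Phi_0)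
  qed (simp add: bandlimited_fourier[OF F])
  thus ?thesis unfolding blk_def by (simp only:) (simp add: inv_fourier_def fun_eq_iff)
qed

section \<open>From distributions to functions\<close>

lemma LP_block_dist_of_fun:
  assumes "integrable lborel F"
  shows "LP_block \<Psi> M l (dist_of_fun F) = blk l F"
  unfolding LP_block_def blk_def
  by (rule fourier_multiplier_eq[OF cutoff assms test_funs_continuous[OF LP_Phi_test_funs]
    test_funs_support[OF LP_Phi_test_funs] refl])

text \<open>The limit \<open>w\<close> is the same for every admissible cutoff, so a single one
  built from \<open>\<Psi>\<close> may be tested; for large k it is 1 on both spectra and reproduces
  the factors.\<close>

lemma has_product_bandlimited:
  assumes f: "bandlimited S f" and g: "bandlimited T g"
    and w: "has_product M (dist_of_fun f) (dist_of_fun g) w" and \<phi>: "\<phi> \<in> test_funs"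
  shows "w \<phi> = dist_of_fun (\<lambda>x. f x * g x) \<phi>"
proof -
  define \<psi> where "\<psi> \<xi> = \<Psi> (1 * (norm (\<xi> - 0))\<^sup>2)" for \<xi> :: "real ^ 'n"
  define pk where "pk k = (\<lambda>\<xi>. \<psi> (aniso_dilation M (2 powi (- int k)) \<xi>))" for k :: nat
  have \<psi>t: "\<psi> \<in> test_funs" unfolding \<psi>_def by (rule cutoff_ball_test_funs[OF cutoff]) simp
  have \<psi>1: "\<psi> \<xi> = 1" if "norm \<xi> < 1" for \<xi>
  proof -
    have "(norm \<xi>)\<^sup>2 \<le> 1" using that by (simp add: power_le_one)
    thus ?thesis by (simp add: \<psi>_def \<Psi>_one)
  qed
  have "\<forall>\<^sub>F \<xi> in nhds 0. \<psi> \<xi> = 1"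
    unfolding eventually_nhds by (rule exI[of _ "ball 0 1"]) (auto simp: \<psi>1)
  hence lim: "(\<lambda>k. dist_of_fun (\<lambda>x. fourier_multiplier (pk k) (dist_of_fun f) x * fourier_multiplier (pk k) (dist_of_fun g) x) \<phi>) \<longlonglongrightarrow> w \<phi>"
    using w \<psi>t \<phi> by (simp add: has_product_def has_psi_product_def Let_def pk_def)
  have pkt: "pk k \<in> test_funs" for k
  proof -
    define t :: real where "t = 2 powi (- int k)"
    have t: "t > 0" by (simp add: t_def)
    define c where "c b = t powr (2 * (M \<bullet> b))" for b
    have "(norm (dil t \<xi>))\<^sup>2 = (\<Sum>b\<in>Basis. c b * (\<xi> \<bullet> b - 0 \<bullet> b)\<^sup>2)" for \<xi>
    proof -
      have "(t powr (M $ i) * \<xi> $ i)\<^sup>2 = t powr (2 * M $ i) * (\<xi> $ i)\<^sup>2" for i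
        using t by (simp add: power_mult_distrib powr_powr[symmetric] powr_numeral mult.commute[of 2])
      thus ?thesis by (simp add: norm_vec_def L2_set_def sum_nonneg sum_Basis_vec c_def inner_axis)
    qed
    hence "pk k = (\<lambda>\<xi>. \<Psi> (\<Sum>b\<in>Basis. c b * (\<xi> \<bullet> b - 0 \<bullet> b)\<^sup>2))"
      unfolding pk_def \<psi>_def t_def[symmetric] by simp
    thus ?thesis using t by (simp only:) (rule cutoff_quadratic_test_funs[OF cutoff], simp add: c_def)
  qed
  have ev: "\<forall>\<^sub>F k in sequentially. fourier_multiplier (pk k) (dist_of_fun F) = F"
    if F: "bandlimited U F" for U and F :: "real ^ 'n \<Rightarrow> complex"
  proof -
    obtain R where R: "\<And>\<xi>. \<xi> \<in> U \<Longrightarrow> norm \<xi> \<le> R" using F by (auto simp: bandlimited_def bounded_iff)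
    obtain k0 where k0: "R < 2 ^ k0" using real_arch_pow[of 2 R] by auto
    have "fourier_multiplier (pk k) (dist_of_fun F) = F" if "k \<ge> k0" for k
    proof -
      define t :: real where "t = 2 powi (- int k)"
      have t: "t > 0" "t \<le> 1" "t = 1 / 2 ^ k" by (auto simp: t_def power_int_minus divide_inverse power_le_one_iff inverse_le_1_iff)
      have "pk k \<xi> * fourier F \<xi> = fourier F \<xi>" for \<xi>
      proof (cases "\<xi> \<in> U")
        case True
        \<comment> \<open>For t at most 1 and weights at least 1, the anisotropic dilation contracts
          at least as much as multiplication by t.\<close>
        have "norm (dil t \<xi>) \<le> norm (t *\<^sub>R \<xi>)"
        proof (rule norm_le_componentwise_cart)
          fix i
          have "t powr (M $ i) \<le> t powr 1" using t M_ge by (intro powr_mono') auto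
          hence "t powr (M $ i) * \<bar>\<xi> $ i\<bar> \<le> t * \<bar>\<xi> $ i\<bar>" using t(1) by (intro mult_right_mono) auto
          thus "norm (dil t \<xi> $ i) \<le> norm ((t *\<^sub>R \<xi>) $ i)"
            using t(1) by (simp add: abs_mult)
        qed
        also have "\<dots> \<le> t * R" using R[OF True] t(1) by simp
        also have "\<dots> < 1"
        proof -
          have "R < 2 ^ k" using k0 power_increasing[OF that, of "2::real"] by linarith
          thus ?thesis by (simp add: t(3))
        qed
        finally show ?thesis by (simp add: pk_def t_def[symmetric] \<psi>1)
      qed (simp add: bandlimited_fourier[OF F])
      moreover have "fourier_multiplier (pk k) (dist_of_fun F) = inv_fourier (\<lambda>\<xi>. pk k \<xi> * fourier F \<xi>)"
        by (rule fourier_multiplier_eq[OF cutoff bandlimited_integrable[OF F] test_funs_continuous[OF pkt]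
          test_funs_support[OF pkt] refl])
      ultimately show ?thesis using bandlimited_inv_fourier[OF F] by (simp only:)
    qed
    thus ?thesis by (auto simp: eventually_sequentially)
  qed
  have "\<forall>\<^sub>F k in sequentially. dist_of_fun (\<lambda>x. f x * g x) \<phi> =
    dist_of_fun (\<lambda>x. fourier_multiplier (pk k) (dist_of_fun f) x * fourier_multiplier (pk k) (dist_of_fun g) x) \<phi>"
    using ev[OF f] ev[OF g] by eventually_elim simp
  from Lim_transform_eventually[OF tendsto_const this]
  show ?thesis using lim LIMSEQ_unique by blast
qed

text \<open>The product fixes \<open>w\<close> on test functions, whereas a block evaluates it at
  transforms of test functions; \<open>tempered_eq_on_schwartz\<close> bridges the two.\<close>

lemma LP_block_product:
  assumes f: "f \<in> paley" and g: "g \<in> paley" and w: "tempered w"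
    and p: "has_product M (dist_of_fun f) (dist_of_fun g) w"
  shows "LP_block \<Psi> M l w = blk l (\<lambda>x. f x * g x)"
proof -
  obtain S where S: "bandlimited S f" using paley_bandlimited[OF f] .
  obtain T where T: "bandlimited T g" using paley_bandlimited[OF g] .
  have i: "integrable lborel (\<lambda>x. f x * g x)" by (rule bandlimited_integrable[OF bandlimited_mult[OF S T]])
  have eq: "w \<kappa> = dist_of_fun (\<lambda>x. f x * g x) \<kappa>" if "\<kappa> \<in> schwartz_funs" for \<kappa>
    by (rule tempered_eq_on_schwartz[OF cutoff w i has_product_bandlimited[OF S T p] that])
  show ?thesis unfolding LP_block_def blk_def
  proof (rule fourier_multiplier_eq[OF cutoff i test_funs_continuous[OF LP_Phi_test_funs] test_funs_support[OF LP_Phi_test_funs]])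
    fix \<phi> :: "real ^ 'n \<Rightarrow> complex" assume \<phi>: "\<phi> \<in> test_funs"
    have "(\<lambda>\<xi>. inv_fourier \<phi> \<xi> * LP_Phi \<Psi> M (int l) \<xi>) \<in> test_funs"
      by (intro test_funs_mult LP_Phi_test_funs schwartz_smooth inv_fourier_schwartz \<phi>)
    hence "(\<lambda>\<xi>. LP_Phi \<Psi> M (int l) \<xi> * inv_fourier \<phi> \<xi>) \<in> test_funs" by (simp add: mult.commute)
    thus "w (fourier (\<lambda>\<xi>. LP_Phi \<Psi> M (int l) \<xi> * inv_fourier \<phi> \<xi>)) =
      dist_of_fun (\<lambda>x. f x * g x) (fourier (\<lambda>\<xi>. LP_Phi \<Psi> M (int l) \<xi> * inv_fourier \<phi> \<xi>))"
      by (intro eq fourier_schwartz)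
  qed
qed

end

text \<open>Both alternatives of the hypothesis imply this single inequality between block
  quasi-norms, from which all conditions are derived.\<close>

locale multiplication = cutoff M \<Psi> for M :: "real ^ 'n" and \<Psi> +
  fixes A :: "nat \<Rightarrow> space_kind" and s :: "nat \<Rightarrow> real" and p q :: "nat \<Rightarrow> ennreal"
  assumes pos: "\<forall>j\<in>{0, 1, 2}. 0 < p j \<and> 0 < q j"
    and fin: "\<forall>j\<in>{0, 1, 2}. A j = Triebel_Lizorkin \<longrightarrow> p j < \<infinity>"
    and bounded_product: "\<exists>c<\<infinity>. \<forall>f\<in>paley. \<forall>g\<in>paley.
      block_qnorm (A 2) (s 2) (p 2) (q 2) (\<lambda>l. blk l (\<lambda>x. f x * g x))
        \<le> c * block_qnorm (A 0) (s 0) (p 0) (q 0) (\<lambda>l. blk l f) * block_qnorm (A 1) (s 1) (p 1) (q 1) (\<lambda>l. blk l g)"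

lemma (in cutoff) multiplicationI:
  assumes pos: "\<forall>j\<in>{0, 1, 2}. 0 < p j \<and> 0 < q j"
    and fin: "\<forall>j\<in>{0, 1, 2}. A j = Triebel_Lizorkin \<longrightarrow> p j < \<infinity>"
    and ineq:
      "(\<exists>c<\<infinity>. \<forall>f\<in>schwartz_funs. \<forall>g\<in>schwartz_funs.
          space_qnorm (A 2) \<Psi> M (s 2) (p 2) (q 2) (dist_of_fun (\<lambda>x. f x * g x))
            \<le> c * space_qnorm (A 0) \<Psi> M (s 0) (p 0) (q 0) (dist_of_fun f)
                * space_qnorm (A 1) \<Psi> M (s 1) (p 1) (q 1) (dist_of_fun g))
       \<or>
       (\<exists>c<\<infinity>. \<forall>f\<in>schwartz_funs. \<forall>g\<in>schwartz_funs.
          \<exists>w. tempered w \<and> has_product M (dist_of_fun f) (dist_of_fun g) w \<and>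
            space_qnorm (A 2) \<Psi> M (s 2) (p 2) (q 2) w
              \<le> c * space_qnorm (A 0) \<Psi> M (s 0) (p 0) (q 0) (dist_of_fun f)
                  * space_qnorm (A 1) \<Psi> M (s 1) (p 1) (q 1) (dist_of_fun g))"
  shows "multiplication M \<Psi> A s p q"
proof
  have f: "space_qnorm (A j) \<Psi> M (s j) (p j) (q j) (dist_of_fun f) = block_qnorm (A j) (s j) (p j) (q j) (\<lambda>l. blk l f)"
    if "f \<in> paley" for f j
    using LP_block_dist_of_fun[OF schwartz_integrable[OF paley_schwartz[OF that]]] by (simp add: space_qnorm_eq)
  have fg: "space_qnorm (A j) \<Psi> M (s j) (p j) (q j) (dist_of_fun (\<lambda>x. f x * g x))
      = block_qnorm (A j) (s j) (p j) (q j) (\<lambda>l. blk l (\<lambda>x. f x * g x))" if fg: "f \<in> paley" "g \<in> paley" for f g j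
  proof -
    obtain S where S: "bandlimited S f" using paley_bandlimited[OF fg(1)] .
    obtain T where T: "bandlimited T g" using paley_bandlimited[OF fg(2)] .
    show ?thesis using LP_block_dist_of_fun[OF bandlimited_integrable[OF bandlimited_mult[OF S T]]]
      by (simp add: space_qnorm_eq)
  qed
  from ineq show "\<exists>c<\<infinity>. \<forall>f\<in>paley. \<forall>g\<in>paley.
      block_qnorm (A 2) (s 2) (p 2) (q 2) (\<lambda>l. blk l (\<lambda>x. f x * g x))
        \<le> c * block_qnorm (A 0) (s 0) (p 0) (q 0) (\<lambda>l. blk l f) * block_qnorm (A 1) (s 1) (p 1) (q 1) (\<lambda>l. blk l g)"
  proof
    assume "\<exists>c<\<infinity>. \<forall>f\<in>schwartz_funs. \<forall>g\<in>schwartz_funs.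
          space_qnorm (A 2) \<Psi> M (s 2) (p 2) (q 2) (dist_of_fun (\<lambda>x. f x * g x))
            \<le> c * space_qnorm (A 0) \<Psi> M (s 0) (p 0) (q 0) (dist_of_fun f)
                * space_qnorm (A 1) \<Psi> M (s 1) (p 1) (q 1) (dist_of_fun g)"
    then obtain c where "c < \<infinity>" and c: "\<forall>f\<in>schwartz_funs. \<forall>g\<in>schwartz_funs.
          space_qnorm (A 2) \<Psi> M (s 2) (p 2) (q 2) (dist_of_fun (\<lambda>x. f x * g x))
            \<le> c * space_qnorm (A 0) \<Psi> M (s 0) (p 0) (q 0) (dist_of_fun f)
                * space_qnorm (A 1) \<Psi> M (s 1) (p 1) (q 1) (dist_of_fun g)" by (elim exE conjE)
    show ?thesis
    proof (intro exI[of _ c] conjI ballI \<open>c < \<infinity>\<close>)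
      fix a b assume ab: "a \<in> paley" "b \<in> paley"
      from bspec[OF bspec[OF c paley_schwartz[OF ab(1)]] paley_schwartz[OF ab(2)]]
      show "block_qnorm (A 2) (s 2) (p 2) (q 2) (\<lambda>l. blk l (\<lambda>x. a x * b x))
        \<le> c * block_qnorm (A 0) (s 0) (p 0) (q 0) (\<lambda>l. blk l a) * block_qnorm (A 1) (s 1) (p 1) (q 1) (\<lambda>l. blk l b)"
        by (simp only: f[OF ab(1)] f[OF ab(2)] fg[OF ab])
    qed
  next
    assume "\<exists>c<\<infinity>. \<forall>f\<in>schwartz_funs. \<forall>g\<in>schwartz_funs.
          \<exists>w. tempered w \<and> has_product M (dist_of_fun f) (dist_of_fun g) w \<and>
            space_qnorm (A 2) \<Psi> M (s 2) (p 2) (q 2) w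
              \<le> c * space_qnorm (A 0) \<Psi> M (s 0) (p 0) (q 0) (dist_of_fun f)
                  * space_qnorm (A 1) \<Psi> M (s 1) (p 1) (q 1) (dist_of_fun g)"
    then obtain c where "c < \<infinity>" and c: "\<forall>f\<in>schwartz_funs. \<forall>g\<in>schwartz_funs.
          \<exists>w. tempered w \<and> has_product M (dist_of_fun f) (dist_of_fun g) w \<and>
            space_qnorm (A 2) \<Psi> M (s 2) (p 2) (q 2) w
              \<le> c * space_qnorm (A 0) \<Psi> M (s 0) (p 0) (q 0) (dist_of_fun f)
                  * space_qnorm (A 1) \<Psi> M (s 1) (p 1) (q 1) (dist_of_fun g)" by (elim exE conjE)
    show ?thesis
    proof (intro exI[of _ c] conjI ballI \<open>c < \<infinity>\<close>)
      fix a b assume ab: "a \<in> paley" "b \<in> paley"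
      from bspec[OF bspec[OF c paley_schwartz[OF ab(1)]] paley_schwartz[OF ab(2)]]
      obtain w where w: "tempered w" "has_product M (dist_of_fun a) (dist_of_fun b) w" and
        le: "space_qnorm (A 2) \<Psi> M (s 2) (p 2) (q 2) w
              \<le> c * space_qnorm (A 0) \<Psi> M (s 0) (p 0) (q 0) (dist_of_fun a)
                  * space_qnorm (A 1) \<Psi> M (s 1) (p 1) (q 1) (dist_of_fun b)" by (elim exE conjE)
      have "space_qnorm (A 2) \<Psi> M (s 2) (p 2) (q 2) w = block_qnorm (A 2) (s 2) (p 2) (q 2) (\<lambda>l. blk l (\<lambda>x. a x * b x))"
        by (simp add: space_qnorm_eq LP_block_product[OF ab w])
      thus "block_qnorm (A 2) (s 2) (p 2) (q 2) (\<lambda>l. blk l (\<lambda>x. a x * b x))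
        \<le> c * block_qnorm (A 0) (s 0) (p 0) (q 0) (\<lambda>l. blk l a) * block_qnorm (A 1) (s 1) (p 1) (q 1) (\<lambda>l. blk l b)"
        using le by (simp only: f[OF ab(1)] f[OF ab(2)])
    qed
  qed
qed (use pos fin in auto)

text \<open>The product is commutative, so every condition proved for the first factor also holds
  for the second.\<close>

lemma (in multiplication) swapped:
  "multiplication M \<Psi> (A(0 := A 1, 1 := A 0)) (s(0 := s 1, 1 := s 0)) (p(0 := p 1, 1 := p 0)) (q(0 := q 1, 1 := q 0))"
proof
  obtain c where c: "c < \<infinity>" "\<forall>f\<in>paley. \<forall>g\<in>paley.
      block_qnorm (A 2) (s 2) (p 2) (q 2) (\<lambda>l. blk l (\<lambda>x. f x * g x))
        \<le> c * block_qnorm (A 0) (s 0) (p 0) (q 0) (\<lambda>l. blk l f) * block_qnorm (A 1) (s 1) (p 1) (q 1) (\<lambda>l. blk l g)"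
    using bounded_product by (elim exE conjE)
  let ?A = "A(0 := A 1, 1 := A 0)" and ?s = "s(0 := s 1, 1 := s 0)" and ?p = "p(0 := p 1, 1 := p 0)" and ?q = "q(0 := q 1, 1 := q 0)"
  show "\<exists>c<\<infinity>. \<forall>f\<in>paley. \<forall>g\<in>paley.
      block_qnorm (?A 2) (?s 2) (?p 2) (?q 2) (\<lambda>l. blk l (\<lambda>x. f x * g x))
        \<le> c * block_qnorm (?A 0) (?s 0) (?p 0) (?q 0) (\<lambda>l. blk l f) * block_qnorm (?A 1) (?s 1) (?p 1) (?q 1) (\<lambda>l. blk l g)"
  proof (intro exI[of _ c] conjI ballI c(1))
    fix f g assume "f \<in> paley" "g \<in> paley"
    from bspec[OF bspec[OF c(2) this(2)] this(1)]
    show "block_qnorm (?A 2) (?s 2) (?p 2) (?q 2) (\<lambda>l. blk l (\<lambda>x. f x * g x))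
        \<le> c * block_qnorm (?A 0) (?s 0) (?p 0) (?q 0) (\<lambda>l. blk l f) * block_qnorm (?A 1) (?s 1) (?p 1) (?q 1) (\<lambda>l. blk l g)"
      by (simp add: mult_ac)
  qed
qed (use pos fin in auto)

section \<open>Sums of wave packets\<close>

lemma sum_times_diagonal:
  assumes "finite K" "\<And>k l. k \<in> K \<Longrightarrow> l \<in> K \<Longrightarrow> k \<noteq> l \<Longrightarrow> F (k, l) = 0"
  shows "(\<Sum>z\<in>K \<times> K. F z) = (\<Sum>k\<in>K. F (k, k))"
proof -
  have "(\<Sum>z\<in>K \<times> K. F z) = (\<Sum>k\<in>K. \<Sum>l\<in>K. F (k, l))" by (simp add: sum.cartesian_product)
  also have "\<dots> = (\<Sum>k\<in>K. \<Sum>l\<in>K. if l = k then F (k, k) else 0)"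
    by (intro sum.cong refl) (auto simp: assms(2))
  finally show ?thesis using assms(1) by simp
qed

lemma power_two_separated:
  assumes "k < (l::nat)"
  shows "(2::real) ^ k \<le> 2 ^ l / 2"
proof -
  have "(2::real) ^ Suc k \<le> 2 ^ l" using assms by (intro power_increasing) auto
  thus ?thesis by simp
qed

lemma ennreal_Lp_finite_real:
  "x < \<infinity> \<Longrightarrow> x = ennreal (enn2real x)"
  by (cases x) auto

context aniso
begin

lemma adist_ball_norm:
  assumes "adist y < r" "r \<le> 1"
  shows "norm y \<le> r * real CARD('n)"
proof -
  have "norm y \<le> (\<Sum>i\<in>UNIV. \<bar>y $ i\<bar>)" by (rule norm_le_l1_cart)
  also have "\<dots> \<le> (\<Sum>i\<in>(UNIV :: 'n set). r)"
  proof (rule sum_mono)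
    fix i
    have "\<bar>y $ i\<bar> \<le> adist y powr (M $ i)" by (rule component_le_adist_powr)
    also have "\<dots> \<le> adist y powr 1"
    proof (cases "y = 0")
      case False
      thus ?thesis using assms M_ge[of i] adist_pos[OF False] by (intro powr_mono') auto
    qed simp
    finally show "\<bar>y $ i\<bar> \<le> r" using assms by simp
  qed
  finally show ?thesis by (simp add: mult.commute)
qed

lemma adist_continuity_at_0:
  fixes F :: "real ^ 'n \<Rightarrow> complex"
  assumes "continuous_on UNIV F" "e > 0"
  obtains r where "0 < r" "r \<le> 1" "\<And>y. adist y < r \<Longrightarrow> cmod (F y - F 0) < e"
proof -
  have "\<exists>d>0. \<forall>y\<in>UNIV. dist y 0 < d \<longrightarrow> dist (F y) (F 0) < e"
    using assms unfolding continuous_on_iff by blast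
  then obtain d where d: "d > 0" "\<And>y. dist y 0 < d \<Longrightarrow> dist (F y) (F 0) < e" by blast
  define r where "r = min 1 (d / (real CARD('n) + 1))"
  have r: "0 < r" "r \<le> 1" using d(1) by (auto simp: r_def)
  have "cmod (F y - F 0) < e" if "adist y < r" for y
  proof -
    have "norm y \<le> r * real CARD('n)" by (rule adist_ball_norm[OF that r(2)])
    also have "\<dots> < r * (real CARD('n) + 1)" using r by simp
    also have "r \<le> d / (real CARD('n) + 1)" by (simp add: r_def)
    hence "r * (real CARD('n) + 1) \<le> d" by (simp add: pos_le_divide_eq add_nonneg_pos)
    finally show ?thesis using d(2)[of y] by (simp add: dist_norm)
  qed
  thus ?thesis using that r by blast
qed

end

context cutoff
begin

text \<open>The integrand is continuous, nonnegative and nonzero at the origin. Up to constants, m =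
  1 gives the value of \<open>bump\<close> at 0 and m = 2 the transform of its square at 0.\<close>

lemma integral_symb_pos:
  assumes "t > 0" "m \<ge> 1"
  shows "(\<integral>\<zeta>. (Re (symb t 0 \<zeta>)) ^ m \<partial>lborel) > 0"
proof -
  have c: "continuous_on UNIV (\<lambda>\<zeta>. (Re (symb t 0 \<zeta>)) ^ m)"
    by (intro continuous_intros test_funs_continuous symb_test_funs assms)
  have nn: "(Re (symb t 0 \<zeta>)) ^ m \<ge> 0" for \<zeta> by (simp add: symb_eq)
  have "integrable lborel (\<lambda>\<zeta>. complex_of_real ((Re (symb t 0 \<zeta>)) ^ m))"
  proof (rule bounded_support_integrable)
    show "continuous_on UNIV (\<lambda>\<zeta>. complex_of_real ((Re (symb t 0 \<zeta>)) ^ m))" by (intro continuous_intros c)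
    show "bounded {x. complex_of_real ((Re (symb t 0 x)) ^ m) \<noteq> 0}"
      using assms(2) by (intro bounded_subset[OF test_funs_support[OF symb_test_funs[OF assms(1), of 0]]]) auto
  qed
  from integrable_Re[OF this] have i: "integrable lborel (\<lambda>\<zeta>. (Re (symb t 0 \<zeta>)) ^ m)"
    by (simp only: Re_complex_of_real)
  have "symb t 0 0 = of_real (t powr (- wsize))"
    by (simp add: symb_eq gauge_def \<Psi>_one axis_def)
  hence "(Re (symb t 0 0)) ^ m \<noteq> 0" using assms by simp
  hence "\<not> (AE \<zeta> in lborel. (Re (symb t 0 \<zeta>)) ^ m = 0)" using continuous_AE_zero[OF c] by blast
  hence "(\<integral>\<zeta>. (Re (symb t 0 \<zeta>)) ^ m \<partial>lborel) \<noteq> 0"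
    using integral_nonneg_eq_0_iff_AE[OF i] nn by auto
  moreover have "(\<integral>\<zeta>. (Re (symb t 0 \<zeta>)) ^ m \<partial>lborel) \<ge> 0" by (intro Bochner_Integration.integral_nonneg nn)
  ultimately show ?thesis by linarith
qed

lemma symb_Re: "symb t \<sigma> \<zeta> = of_real (Re (symb t \<sigma> \<zeta>))"
  by (simp add: symb_eq)

lemma bump_0: "bump 0 \<noteq> 0"
proof -
  have "ft 1 (symb 1 0) 0 = (\<integral>\<zeta>. complex_of_real ((Re (symb 1 0 \<zeta>)) ^ 1) \<partial>lborel)"
    unfolding ft_def by (intro Bochner_Integration.integral_cong refl) (simp add: symb_Re[symmetric])
  also have "\<dots> = of_real (\<integral>\<zeta>. (Re (symb 1 0 \<zeta>)) ^ 1 \<partial>lborel)" by (rule integral_complex_of_real)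
  finally have "ft 1 (symb 1 0) 0 \<noteq> 0" using integral_symb_pos[of 1 1] by simp
  thus ?thesis by (simp add: bump_def wave_def inv_fourier_eq_ft)
qed

lemma bump_sq_bandlimited: "bandlimited (spot 0 (1/50)) (\<lambda>x. bump x * bump x)"
  using wave_mult_bandlimited[of 1 1 0 0] by (simp add: bump_def)

text \<open>The symbol is real and even, so its convolution with itself at 0 is the integral of its
  square.\<close>

lemma fourier_bump_sq_0: "fourier (\<lambda>x. bump x * bump x) 0 \<noteq> 0"
proof -
  have i: "integrable lborel (symb 1 0)" by (intro test_funs_integrable symb_test_funs) simp
  have ib: "integrable lborel bump" by (rule schwartz_integrable[OF bump_schwartz])
  have fb: "fourier bump = symb 1 0"
    unfolding bump_def wave_def by (intro fourier_inv_fourier_test symb_test_funs) simp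
  have ev: "symb 1 0 (- \<zeta>) = symb 1 0 \<zeta>" for \<zeta>
    by (simp add: symb_def gauge_def axis_def)
  have "(\<integral>\<zeta>. symb 1 0 \<zeta> * fourier bump (0 - \<zeta>) \<partial>lborel) = (\<integral>\<zeta>. complex_of_real ((Re (symb 1 0 \<zeta>)) ^ 2) \<partial>lborel)"
    unfolding fb by (intro Bochner_Integration.integral_cong refl) (simp add: ev power2_eq_square symb_Re[symmetric])
  also have "\<dots> = of_real (\<integral>\<zeta>. (Re (symb 1 0 \<zeta>)) ^ 2 \<partial>lborel)" by (rule integral_complex_of_real)
  finally have "(\<integral>\<zeta>. symb 1 0 \<zeta> * fourier bump (0 - \<zeta>) \<partial>lborel) \<noteq> 0"
    using integral_symb_pos[of 1 2] by simp
  thus ?thesis using fourier_mult[OF i ib, of 0] by (simp add: bump_def[unfolded wave_def, symmetric])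
qed

text \<open>Half of the value at the origin persists on the ball of radius \<open>r0\<close>; the
  lower bounds for packets are read off on dilates of this ball, whose volume is
  \<open>v0\<close>.\<close>

definition b0 :: real where "b0 = cmod (bump 0) / 2"
definition r0 :: real where "r0 = (SOME r. 0 < r \<and> r \<le> 1 \<and> (\<forall>y. adist y < r \<longrightarrow> b0 \<le> cmod (bump y)))"

lemma b0_pos: "b0 > 0" using bump_0 by (simp add: b0_def)

lemma r0: "0 < r0" "r0 \<le> 1" "adist y < r0 \<Longrightarrow> b0 \<le> cmod (bump y)"
proof -
  obtain r where r: "0 < r" "r \<le> 1" "\<And>y. adist y < r \<Longrightarrow> cmod (bump y - bump 0) < b0"
    by (rule adist_continuity_at_0[OF bump_continuous b0_pos]) blast
  have "b0 \<le> cmod (bump y)" if "adist y < r" for y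
    using r(3)[OF that] norm_triangle_ineq2[of "bump 0" "bump y"] by (simp add: norm_minus_commute b0_def)
  hence "\<exists>r. 0 < r \<and> r \<le> 1 \<and> (\<forall>y. adist y < r \<longrightarrow> b0 \<le> cmod (bump y))" using r by blast
  from someI_ex[OF this] show "0 < r0" "r0 \<le> 1" "adist y < r0 \<Longrightarrow> b0 \<le> cmod (bump y)"
    unfolding r0_def by blast+
qed

lemma adist_ball_measure:
  obtains v where "v > 0" "emeasure lborel {y. adist y < r0} = ennreal v"
proof -
  let ?U = "{y. adist y < r0}"
  have o: "open ?U" by (rule open_adist_less)
  have "bounded ?U" by (rule bounded_subset[OF bounded_adist_ball[of 0 r0]]) auto
  hence f: "emeasure lborel ?U < \<infinity>" by (rule emeasure_bounded_finite)
  have "0 \<in> ?U" using r0(1) by simp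
  hence "\<not> negligible ?U" using open_not_negligible[OF o] by blast
  hence "?U \<notin> null_sets lborel"
    using negligible_iff_null_sets[of ?U] null_sets_completionI[of ?U lborel] by blast
  hence "emeasure lborel ?U \<noteq> 0" using o by (simp add: null_sets_def)
  thus ?thesis using that[of "enn2real (emeasure lborel ?U)"] f
    by (cases "emeasure lborel ?U") auto
qed

definition v0 :: real where "v0 = enn2real (emeasure lborel {y. adist y < r0})"

lemma v0: "v0 > 0" "emeasure lborel {y. adist y < r0} = ennreal v0"
proof -
  obtain v where "v > 0" "emeasure lborel {y. adist y < r0} = ennreal v" by (rule adist_ball_measure)
  thus "v0 > 0" "emeasure lborel {y. adist y < r0} = ennreal v0" by (simp_all add: v0_def)
qed

text \<open>\<open>F\<close> is large on the ball of radius \<open>r0\<close> scaled by 1/t; undoing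
  this dilation by \<open>Lp_qnorm_dil\<close> produces the power of \<open>t\<close>.\<close>

lemma Lp_lower:
  assumes P: "0 < P" and F: "continuous_on UNIV F" and t: "t > 0" and \<delta>: "\<delta> > 0"
    and ge: "\<And>y. adist y < r0 \<Longrightarrow> \<delta> \<le> cmod (F (dil (1 / t) y))"
  shows "ennreal (t powr (- wsize * recip P) * (\<delta> * v0 powr recip P)) \<le> Lp_qnorm lborel P (\<lambda>x. ennreal (cmod (F x)))"
proof -
  define h where "h y = ennreal (cmod (F (dil (1 / t) y)))" for y
  have hm: "h \<in> borel_measurable borel" unfolding h_def
    by (intro Lp_norm_measurable continuous_on_compose2[OF F dil_continuous]) auto
  have "ennreal (\<delta> * v0 powr recip P) \<le> Lp_qnorm lborel P h"
    by (rule Lp_qnorm_ge[OF P hm \<delta> _ v0(2,1)])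
      (use open_adist_less[of r0] in \<open>auto simp: h_def intro!: ennreal_leI ge\<close>)
  hence "ennreal (t powr (- wsize * recip P)) * ennreal (\<delta> * v0 powr recip P)
     \<le> ennreal (t powr (- wsize * recip P)) * Lp_qnorm lborel P h" by (rule mult_left_mono) simp
  also have "\<dots> = Lp_qnorm lborel P (\<lambda>x. h (dil t x))" by (rule Lp_qnorm_dil[OF P t hm, symmetric])
  also have "(\<lambda>x. h (dil t x)) = (\<lambda>x. ennreal (cmod (F x)))" using t by (simp add: h_def)
  finally show ?thesis using \<delta> by (simp add: ennreal_mult)
qed

text \<open>The test functions of the necessity proof: \<open>T k = 1\<close> gives modulations of a fixed bump,
  \<open>T k = 2\<^sup>k\<close> modulated and dilated bumps.\<close>

definition waves :: "(nat \<Rightarrow> real) \<Rightarrow> real \<Rightarrow> real \<Rightarrow> nat set \<Rightarrow> real ^ 'n \<Rightarrow> complex"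
  where "waves T \<sigma> \<epsilon> K = (\<lambda>x. \<Sum>k\<in>K. of_real (2 powr (- \<sigma> * real k)) * wave (T k) (\<epsilon> * 2 ^ k) x)"

lemma waves_paley: "(\<And>k. T k > 0) \<Longrightarrow> waves T \<sigma> \<epsilon> K \<in> paley"
  unfolding waves_def by (rule wave_sum_paley)

lemma wave_paley: "t > 0 \<Longrightarrow> wave t \<sigma> \<in> paley"
  using wave_sum_paley[of "{0::nat}" "\<lambda>_. t" "\<lambda>_. 1" "\<lambda>_. \<sigma>"] by simp

lemma wave_integrable: "t > 0 \<Longrightarrow> integrable lborel (wave t \<sigma>)"
  by (rule bandlimited_integrable[OF wave_bandlimited])

text \<open>The packet radius \<open>T k / 100\<close> is at most 2^k/100, which stays within the
  distance of 2^k from both edges of the annulus of index k.\<close>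

lemma blk_waves:
  assumes T: "\<And>k. 0 < T k" "\<And>k. T k \<le> 2 ^ k" and \<epsilon>: "\<bar>\<epsilon>\<bar> = 1" and K: "finite K"
  shows "blk l (waves T \<sigma> \<epsilon> K) = (if l \<in> K then (\<lambda>x. of_real (2 powr (- \<sigma> * real l)) * wave (T l) (\<epsilon> * 2 ^ l) x) else (\<lambda>_. 0))"
proof -
  have "blk l (wave (T k) (\<epsilon> * 2 ^ k)) = (if l = k then wave (T k) (\<epsilon> * 2 ^ k) else (\<lambda>_. 0))" for k
  proof (rule blk_annulus[OF wave_bandlimited spot_annulus])
    have a: "\<bar>\<epsilon> * 2 ^ k\<bar> = 2 ^ k" using \<epsilon> by (simp add: abs_mult)
    have p: "(0::real) < 2 ^ k" by simp
    show "\<bar>\<epsilon> * 2 ^ k\<bar> + T k / 100 \<le> 11/10 * 2 ^ k"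
      using T(2)[of k] p unfolding a by linarith
    show "k = 0 \<or> 65/100 * 2 ^ k \<le> \<bar>\<epsilon> * 2 ^ k\<bar> - T k / 100"
      using T(2)[of k] p unfolding a by (intro disjI2) linarith
  qed (rule T)
  note H = this
  have "blk l (waves T \<sigma> \<epsilon> K) = (\<lambda>x. \<Sum>k\<in>K. of_real (2 powr (- \<sigma> * real k)) * blk l (wave (T k) (\<epsilon> * 2 ^ k)) x)"
    unfolding waves_def by (rule blk_sum[OF wave_integrable[OF T(1)]])
  also have "\<dots> = (\<lambda>x. \<Sum>k\<in>K. of_real (2 powr (- \<sigma> * real k)) * (if l = k then wave (T k) (\<epsilon> * 2 ^ k) x else 0))"
    by (intro ext sum.cong refl) (simp only: H, simp)
  finally show ?thesis using K by (auto simp: fun_eq_iff if_distrib cong: if_cong)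
qed

lemma waves_mult:
  "waves T \<sigma> \<epsilon> K x * waves T' \<sigma>' \<epsilon>' L x = (\<Sum>z\<in>K \<times> L. of_real (2 powr (- \<sigma> * real (fst z)) * 2 powr (- \<sigma>' * real (snd z))) *
     (wave (T (fst z)) (\<epsilon> * 2 ^ fst z) x * wave (T' (snd z)) (\<epsilon>' * 2 ^ snd z) x))"
  unfolding waves_def sum_product by (simp add: sum.cartesian_product case_prod_beta mult_ac)

lemma blk_waves_mult:
  assumes "\<And>k. 0 < T k" "\<And>k. 0 < T' k"
  shows "blk l (\<lambda>x. waves T \<sigma> \<epsilon> K x * waves T' \<sigma>' \<epsilon>' L x) = (\<lambda>x. \<Sum>z\<in>K \<times> L. of_real (2 powr (- \<sigma> * real (fst z)) * 2 powr (- \<sigma>' * real (snd z))) *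
     blk l (\<lambda>x. wave (T (fst z)) (\<epsilon> * 2 ^ fst z) x * wave (T' (snd z)) (\<epsilon>' * 2 ^ snd z) x) x)"
  unfolding waves_mult
  by (rule blk_sum) (rule bandlimited_integrable[OF wave_mult_bandlimited[OF assms]])

lemma wave_mult_cancel: "t > 0 \<Longrightarrow> wave t \<sigma> x * wave t (- \<sigma>) x = bump (dil t x) * bump (dil t x)"
proof -
  assume "t > 0"
  hence "wave t \<sigma> x * wave t (- \<sigma>) x = (iexp (\<sigma> * x $ i0) * iexp (- \<sigma> * x $ i0)) * (bump (dil t x) * bump (dil t x))"
    by (simp only: wave_eq mult_ac)
  thus ?thesis by (simp add: exp_add[symmetric])
qed

end

section \<open>Upper bounds for the factors, lower bounds for the product\<close>

context multiplication
begin

abbreviation n :: "nat \<Rightarrow> (nat \<Rightarrow> real ^ 'n \<Rightarrow> complex) \<Rightarrow> ennreal"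
  where "n j \<equiv> block_qnorm (A j) (s j) (p j) (q j)"

abbreviation \<rho> :: "nat \<Rightarrow> real" where "\<rho> j \<equiv> recip (p j)"

text \<open>The exponent with which \<open>card K\<close> enters the quasi-norm of sums of dilated
  packets.\<close>

definition \<tau> :: "nat \<Rightarrow> real" where "\<tau> j = (if A j = Besov then recip (q j) else recip (p j))"

lemma pq: "j \<in> {0, 1, 2} \<Longrightarrow> 0 < p j" "j \<in> {0, 1, 2} \<Longrightarrow> 0 < q j"
  "j \<in> {0, 1, 2} \<Longrightarrow> A j = Triebel_Lizorkin \<longrightarrow> p j < \<infinity>"
  using pos fin by auto

text \<open>A positive real constant is fixed once, so that all later estimates are between real
  numbers.\<close>

definition Cm :: real
  where "Cm = (SOME C. C > 0 \<and> (\<forall>f\<in>paley. \<forall>g\<in>paley. n 2 (\<lambda>l. blk l (\<lambda>x. f x * g x))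
    \<le> ennreal C * n 0 (\<lambda>l. blk l f) * n 1 (\<lambda>l. blk l g)))"

lemma Cm: "Cm > 0" "f \<in> paley \<Longrightarrow> g \<in> paley \<Longrightarrow> n 2 (\<lambda>l. blk l (\<lambda>x. f x * g x))
    \<le> ennreal Cm * n 0 (\<lambda>l. blk l f) * n 1 (\<lambda>l. blk l g)"
proof -
  obtain c where c: "c < \<infinity>" "\<forall>f\<in>paley. \<forall>g\<in>paley. n 2 (\<lambda>l. blk l (\<lambda>x. f x * g x))
    \<le> c * n 0 (\<lambda>l. blk l f) * n 1 (\<lambda>l. blk l g)" using bounded_product by (elim exE conjE)
  have le: "c \<le> ennreal (enn2real c + 1)" using c(1) by (cases c) (auto intro: ennreal_leI)
  have "\<exists>C. C > 0 \<and> (\<forall>f\<in>paley. \<forall>g\<in>paley. n 2 (\<lambda>l. blk l (\<lambda>x. f x * g x))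
    \<le> ennreal C * n 0 (\<lambda>l. blk l f) * n 1 (\<lambda>l. blk l g))"
  proof (intro exI[of _ "enn2real c + 1"] conjI ballI)
    fix f g assume "f \<in> paley" "g \<in> paley"
    from bspec[OF bspec[OF c(2) this(1)] this(2)]
    show "n 2 (\<lambda>l. blk l (\<lambda>x. f x * g x)) \<le> ennreal (enn2real c + 1) * n 0 (\<lambda>l. blk l f) * n 1 (\<lambda>l. blk l g)"
      by (rule order_trans) (intro mult_right_mono le; simp)
  qed (simp add: add_nonneg_pos)
  from someI_ex[OF this] show "Cm > 0" "f \<in> paley \<Longrightarrow> g \<in> paley \<Longrightarrow> n 2 (\<lambda>l. blk l (\<lambda>x. f x * g x))
    \<le> ennreal Cm * n 0 (\<lambda>l. blk l f) * n 1 (\<lambda>l. blk l g)"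
    unfolding Cm_def by blast+
qed

text \<open>Upper bounds for the two factors and a lower bound for the product are all that is fed
  into the hypothesis; finiteness makes the result an inequality of real numbers.\<close>

lemma product_bound:
  assumes fg: "f \<in> paley" "g \<in> paley" and X: "n 0 (\<lambda>l. blk l f) \<le> ennreal X" "X \<ge> 0"
    and Y: "n 1 (\<lambda>l. blk l g) \<le> ennreal Y" "Y \<ge> 0" and Z: "ennreal Z \<le> n 2 (\<lambda>l. blk l (\<lambda>x. f x * g x))"
  shows "Z \<le> Cm * X * Y"
proof -
  have "ennreal Z \<le> ennreal Cm * n 0 (\<lambda>l. blk l f) * n 1 (\<lambda>l. blk l g)" using Z Cm(2)[OF fg] by (rule order_trans)
  also have "\<dots> \<le> ennreal Cm * ennreal X * ennreal Y" by (intro mult_mono X Y) auto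
  also have "\<dots> = ennreal (Cm * X * Y)" using X Y Cm(1) by (simp add: ennreal_mult)
  finally show ?thesis using X Y Cm(1) by (simp add: ennreal_le_iff)
qed

definition Nb :: "nat \<Rightarrow> real" where "Nb j = enn2real (Lp_qnorm lborel (p j) (\<lambda>x. ennreal (cmod (bump x))))"

lemma Nb: "j \<in> {0, 1, 2} \<Longrightarrow> Lp_qnorm lborel (p j) (\<lambda>x. ennreal (cmod (bump x))) = ennreal (Nb j)"
  unfolding Nb_def by (intro ennreal_Lp_finite_real schwartz_Lp_finite bump_schwartz pq)

lemma Nb_nonneg: "Nb j \<ge> 0" by (simp add: Nb_def)

lemma norm_modulated:
  assumes j: "j \<in> {0, 1, 2}" and \<epsilon>: "\<bar>\<epsilon>\<bar> = 1" and K: "finite K" "K \<noteq> {}"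
  shows "n j (\<lambda>l. blk l (waves (\<lambda>_. 1) (s j) \<epsilon> K)) \<le> ennreal (real (card K) powr recip (q j) * Nb j)"
proof -
  have "n j (\<lambda>l. blk l (waves (\<lambda>_. 1) (s j) \<epsilon> K)) = ennreal (real (card K) powr recip (q j)) * Lp_qnorm lborel (p j) (\<lambda>x. ennreal (cmod (bump x)))"
    by (rule block_qnorm_common_modulus[OF pq[OF j] K bump_continuous])
      (simp add: blk_waves[OF _ _ \<epsilon> K(1)] norm_mult cmod_wave)
  thus ?thesis by (simp add: Nb[OF j] ennreal_mult Nb_nonneg)
qed

lemma norm_low:
  assumes j: "j \<in> {0, 1, 2}" and t: "0 < t" "t \<le> 1"
  shows "n j (\<lambda>l. blk l (wave t 0)) \<le> ennreal (t powr (- wsize * \<rho> j) * Nb j)"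
proof -
  have b: "blk l (wave t 0) = (if l = 0 then wave t 0 else (\<lambda>_. 0))" for l
    using t by (intro blk_annulus[OF wave_bandlimited spot_annulus]) auto
  have "n j (\<lambda>l. blk l (wave t 0)) = ennreal (real (card {0::nat}) powr recip (q j)) * Lp_qnorm lborel (p j) (\<lambda>x. ennreal (cmod (wave t 0 x)))"
    by (rule block_qnorm_common_modulus[OF pq[OF j] _ _ bandlimited_continuous[OF wave_bandlimited[OF t(1)]]]) (auto simp: b)
  also have "\<dots> = Lp_qnorm lborel (p j) (\<lambda>x. ennreal (cmod (bump (dil t x))))" using t by (simp add: cmod_wave)
  also have "\<dots> = ennreal (t powr (- wsize * \<rho> j)) * ennreal (Nb j)"
    unfolding Nb[OF j, symmetric] by (rule Lp_qnorm_dil[OF pq(1)[OF j] t(1) Lp_norm_measurable[OF bump_continuous]])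
  finally show ?thesis by (simp add: ennreal_mult Nb_nonneg)
qed

text \<open>The differential dimension s - |M|/p: the coefficient 2^(-\<sigma> k) normalises a
  packet that is modulated and dilated by 2^k.\<close>

abbreviation \<sigma> :: "nat \<Rightarrow> real" where "\<sigma> j \<equiv> s j - wsize * \<rho> j"

text \<open>In Besov spaces the normalisation gives every weighted block the quasi-norm
  \<open>Nb j\<close>; in Triebel-Lizorkin spaces the bound is
  \<open>triebel_lizorkin_bumps_le\<close>. The constant has to be uniform in \<open>K\<close>,
  whose cardinality later tends to infinity.\<close>

lemma norm_dilated_ex:
  assumes j: "j \<in> {0, 1, 2}"
  shows "\<exists>C>0. \<forall>\<epsilon> K. \<bar>\<epsilon>\<bar> = 1 \<longrightarrow> finite K \<longrightarrow> K \<noteq> {} \<longrightarrow>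
    n j (\<lambda>l. blk l (waves (\<lambda>k. 2 ^ k) (\<sigma> j) \<epsilon> K)) \<le> ennreal (C * real (card K) powr \<tau> j)"
proof (cases "A j")
  case Besov
  have "n j (\<lambda>l. blk l (waves (\<lambda>k. 2 ^ k) (\<sigma> j) \<epsilon> K)) \<le> ennreal ((Nb j + 1) * real (card K) powr \<tau> j)"
    if \<epsilon>: "\<bar>\<epsilon>\<bar> = 1" and K: "finite K" "K \<noteq> {}" for \<epsilon> K
  proof -
    have "ennreal (2 powr (s j * real l)) * Lp_qnorm lborel (p j) (\<lambda>x. ennreal (cmod (blk l (waves (\<lambda>k. 2 ^ k) (\<sigma> j) \<epsilon> K) x)))
      \<le> (if l \<in> K then ennreal (Nb j + 1) else 0)" for l
    proof (cases "l \<in> K")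
      case True
      have "Lp_qnorm lborel (p j) (\<lambda>x. ennreal (cmod (blk l (waves (\<lambda>k. 2 ^ k) (\<sigma> j) \<epsilon> K) x)))
         = Lp_qnorm lborel (p j) (\<lambda>x. ennreal (2 powr (- \<sigma> j * real l)) * ennreal (cmod (bump (dil (2 ^ l) x))))"
        using True by (simp add: blk_waves[OF _ _ \<epsilon> K(1)] norm_mult cmod_wave ennreal_mult)
      also have "\<dots> = ennreal (2 powr (- \<sigma> j * real l)) * Lp_qnorm lborel (p j) (\<lambda>x. ennreal (cmod (bump (dil (2 ^ l) x))))"
        using pq[OF j] Lp_norm_measurable[OF continuous_on_compose2[OF bump_continuous dil_continuous[of "2 ^ l"]]]
        by (intro Lp_qnorm_cmult) auto
      also have "Lp_qnorm lborel (p j) (\<lambda>x. ennreal (cmod (bump (dil (2 ^ l) x)))) = ennreal ((2 ^ l) powr (- wsize * \<rho> j)) * ennreal (Nb j)"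
        unfolding Nb[OF j, symmetric] by (rule Lp_qnorm_dil[OF pq(1)[OF j] _ Lp_norm_measurable[OF bump_continuous]]) simp
      finally have "ennreal (2 powr (s j * real l)) * Lp_qnorm lborel (p j) (\<lambda>x. ennreal (cmod (blk l (waves (\<lambda>k. 2 ^ k) (\<sigma> j) \<epsilon> K) x)))
        = ennreal ((2 powr (s j * real l) * (2 powr (- \<sigma> j * real l) * 2 powr (- wsize * \<rho> j * real l))) * Nb j)"
        by (simp add: ennreal_mult Nb_nonneg two_power_powr mult.assoc)
      also have "2 powr (s j * real l) * (2 powr (- \<sigma> j * real l) * 2 powr (- wsize * \<rho> j * real l)) = 1"
        unfolding powr_add[symmetric] by (simp add: algebra_simps)
      finally show ?thesis using True by (simp add: ennreal_leI)
    next
      case False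
      thus ?thesis using pq(1)[OF j] by (simp add: blk_waves[OF _ _ \<epsilon> K(1)] Lp_qnorm_zero)
    qed
    from besov_block_qnorm_le[OF pq(2)[OF j] K this]
    have "block_qnorm Besov (s j) (p j) (q j) (\<lambda>l. blk l (waves (\<lambda>k. 2 ^ k) (\<sigma> j) \<epsilon> K))
      \<le> ennreal (real (card K) powr recip (q j)) * ennreal (Nb j + 1)" .
    also have "\<dots> = ennreal ((Nb j + 1) * real (card K) powr recip (q j))"
      using Nb_nonneg[of j] by (subst ennreal_mult[symmetric]) (auto simp: mult.commute)
    finally show ?thesis using Besov by (simp only: \<tau>_def refl if_True)
  qed
  moreover have "Nb j + 1 > 0" using Nb_nonneg[of j] by linarith
  ultimately show ?thesis by blast
next
  case Triebel_Lizorkin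
  obtain C where C: "C > 0" "\<And>K s B. finite K \<Longrightarrow> K \<noteq> {} \<Longrightarrow>
    (\<And>j' x. 2 powr (s * real j') * cmod (B j' x) \<le> (if j' \<in> K then (2 ^ j') powr (wsize * recip (p j)) * cmod (bump (dil (2 ^ j') x)) else 0)) \<Longrightarrow>
    block_qnorm Triebel_Lizorkin s (p j) (q j) B \<le> ennreal (C * real (card K) powr recip (p j))"
    using triebel_lizorkin_bumps_le[OF pq(1)[OF j] _ pq(2)[OF j] bump_schwartz] pq(3)[OF j] Triebel_Lizorkin by metis
  have "n j (\<lambda>l. blk l (waves (\<lambda>k. 2 ^ k) (\<sigma> j) \<epsilon> K)) \<le> ennreal (C * real (card K) powr \<tau> j)"
    if \<epsilon>: "\<bar>\<epsilon>\<bar> = 1" and K: "finite K" "K \<noteq> {}" for \<epsilon> K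
  proof -
    have "2 powr (s j * real l) * cmod (blk l (waves (\<lambda>k. 2 ^ k) (\<sigma> j) \<epsilon> K) x)
      \<le> (if l \<in> K then (2 ^ l) powr (wsize * recip (p j)) * cmod (bump (dil (2 ^ l) x)) else 0)" for l x
    proof (cases "l \<in> K")
      case True
      have "2 powr (s j * real l) * 2 powr (- \<sigma> j * real l) = 2 powr (wsize * \<rho> j * real l)"
        unfolding powr_add[symmetric] by (simp add: algebra_simps)
      thus ?thesis using True
        by (simp add: blk_waves[OF _ _ \<epsilon> K(1)] norm_mult cmod_wave two_power_powr mult.assoc[symmetric])
    qed (simp add: blk_waves[OF _ _ \<epsilon> K(1)])
    from C(2)[OF K this] show ?thesis using Triebel_Lizorkin by (simp add: \<tau>_def)
  qed
  thus ?thesis using C(1) by blast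
qed

definition Cd :: "nat \<Rightarrow> real"
  where "Cd j = (SOME C. C > 0 \<and> (\<forall>\<epsilon> K. \<bar>\<epsilon>\<bar> = 1 \<longrightarrow> finite K \<longrightarrow> K \<noteq> {} \<longrightarrow>
    n j (\<lambda>l. blk l (waves (\<lambda>k. 2 ^ k) (\<sigma> j) \<epsilon> K)) \<le> ennreal (C * real (card K) powr \<tau> j)))"

lemma norm_dilated:
  assumes "j \<in> {0, 1, 2}"
  shows "Cd j > 0" "\<bar>\<epsilon>\<bar> = 1 \<Longrightarrow> finite K \<Longrightarrow> K \<noteq> {} \<Longrightarrow>
    n j (\<lambda>l. blk l (waves (\<lambda>k. 2 ^ k) (\<sigma> j) \<epsilon> K)) \<le> ennreal (Cd j * real (card K) powr \<tau> j)"
  using someI_ex[OF norm_dilated_ex[OF assms]] unfolding Cd_def by blast+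

lemma paley_mult_continuous: "f \<in> paley \<Longrightarrow> g \<in> paley \<Longrightarrow> continuous_on UNIV (blk l (\<lambda>x. f x * g x))"
proof -
  assume fg: "f \<in> paley" "g \<in> paley"
  obtain S where S: "bandlimited S f" using paley_bandlimited[OF fg(1)] .
  obtain T where T: "bandlimited T g" using paley_bandlimited[OF fg(2)] .
  show ?thesis by (rule blk_continuous[OF bandlimited_integrable[OF bandlimited_mult[OF S T]]])
qed

lemma block_lower_bound:
  assumes fg: "f \<in> paley" "g \<in> paley" and t: "t > 0" and \<delta>: "\<delta> > 0"
    and ge: "\<And>y. adist y < r0 \<Longrightarrow> \<delta> \<le> cmod (blk l (\<lambda>x. f x * g x) (dil (1 / t) y))"
  shows "ennreal (2 powr (s 2 * real l) * t powr (- wsize * \<rho> 2) * (\<delta> * v0 powr \<rho> 2)) \<le>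
    ennreal (2 powr (s 2 * real l)) * Lp_qnorm lborel (p 2) (\<lambda>x. ennreal (cmod (blk l (\<lambda>x. f x * g x) x)))"
proof -
  have "ennreal (t powr (- wsize * \<rho> 2) * (\<delta> * v0 powr \<rho> 2)) \<le> Lp_qnorm lborel (p 2) (\<lambda>x. ennreal (cmod (blk l (\<lambda>x. f x * g x) x)))"
    by (rule Lp_lower[OF pq(1) paley_mult_continuous[OF fg] t \<delta> ge]) simp_all
  hence "ennreal (2 powr (s 2 * real l)) * ennreal (t powr (- wsize * \<rho> 2) * (\<delta> * v0 powr \<rho> 2)) \<le>
    ennreal (2 powr (s 2 * real l)) * Lp_qnorm lborel (p 2) (\<lambda>x. ennreal (cmod (blk l (\<lambda>x. f x * g x) x)))"
    by (rule mult_left_mono) simp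
  thus ?thesis using \<delta> by (simp add: ennreal_mult[symmetric] mult.assoc)
qed

text \<open>Here \<open>l\<close> selects the block of the product that is tested and
  \<open>t\<close> the scale on which it is concentrated; the power of \<open>t\<close> records the
  volume of the set where the block is large.\<close>

lemma master:
  assumes fg: "f \<in> paley" "g \<in> paley" and t: "t > 0" and \<delta>: "\<delta> > 0"
    and ge: "\<And>y. adist y < r0 \<Longrightarrow> \<delta> \<le> cmod (blk l (\<lambda>x. f x * g x) (dil (1 / t) y))"
    and X: "n 0 (\<lambda>l. blk l f) \<le> ennreal X" "X \<ge> 0" and Y: "n 1 (\<lambda>l. blk l g) \<le> ennreal Y" "Y \<ge> 0"
  shows "2 powr (s 2 * real l) * t powr (- wsize * \<rho> 2) * (\<delta> * v0 powr \<rho> 2) \<le> Cm * X * Y"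
proof (rule product_bound[OF fg X Y])
  have "ennreal (2 powr (s 2 * real l)) * Lp_qnorm lborel (p 2) (\<lambda>x. ennreal (cmod (blk l (\<lambda>x. f x * g x) x)))
    \<le> n 2 (\<lambda>l. blk l (\<lambda>x. f x * g x))"
    by (rule block_qnorm_ge[OF pq paley_mult_continuous[OF fg]]) simp_all
  thus "ennreal (2 powr (s 2 * real l) * t powr (- wsize * \<rho> 2) * (\<delta> * v0 powr \<rho> 2)) \<le> n 2 (\<lambda>l. blk l (\<lambda>x. f x * g x))"
    using block_lower_bound[OF fg t \<delta> ge] by (rule order_trans[rotated])
qed

text \<open>In a Besov target every block with index in \<open>K\<close> contributes at least
  \<open>c\<close>, which yields the power of \<open>card K\<close>. Height and scale may vary with
  the block as long as the weighted bounds have the common value \<open>c\<close> below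
  them.\<close>

lemma master_besov:
  assumes fg: "f \<in> paley" "g \<in> paley" and B: "A 2 = Besov" and K: "finite K" "K \<noteq> {}"
    and \<delta>: "\<And>l. l \<in> K \<Longrightarrow> \<delta> l > 0" and t: "\<And>l. l \<in> K \<Longrightarrow> t l > 0"
    and ge: "\<And>l y. l \<in> K \<Longrightarrow> adist y < r0 \<Longrightarrow> \<delta> l \<le> cmod (blk l (\<lambda>x. f x * g x) (dil (1 / t l) y))"
    and c: "\<And>l. l \<in> K \<Longrightarrow> c \<le> 2 powr (s 2 * real l) * t l powr (- wsize * \<rho> 2) * (\<delta> l * v0 powr \<rho> 2)" and c0: "c \<ge> 0"
    and X: "n 0 (\<lambda>l. blk l f) \<le> ennreal X" "X \<ge> 0" and Y: "n 1 (\<lambda>l. blk l g) \<le> ennreal Y" "Y \<ge> 0"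
  shows "real (card K) powr recip (q 2) * c \<le> Cm * X * Y"
proof (rule product_bound[OF fg X Y])
  have "ennreal c \<le> ennreal (2 powr (s 2 * real l)) * Lp_qnorm lborel (p 2) (\<lambda>x. ennreal (cmod (blk l (\<lambda>x. f x * g x) x)))"
    if "l \<in> K" for l
    using block_lower_bound[OF fg t[OF that] \<delta>[OF that] ge[OF that]] by (rule order_trans[OF ennreal_leI[OF c[OF that]]])
  from besov_block_qnorm_ge[OF pq(2) K this]
  show "ennreal (real (card K) powr recip (q 2) * c) \<le> n 2 (\<lambda>l. blk l (\<lambda>x. f x * g x))"
    using B c0 by (simp add: ennreal_mult)
qed

end

section \<open>Estimates from below for products\<close>

context multiplication
begin

text \<open>A packet dilated by \<open>t\<close> is large on the ball scaled by 1/t, which contains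
  the ball scaled by 1/t'. Factors of different widths can thus be tested on the finer
  scale.\<close>

lemma wave_lower:
  assumes "0 < t" "t \<le> t'" "adist y < r0"
  shows "b0 \<le> cmod (wave t a (dil (1 / t') y))"
proof -
  have "t / t' * adist y \<le> 1 * adist y" using assms by (intro mult_right_mono) auto
  hence "adist (dil (t / t') y) < r0" using assms by (simp add: adist_dil)
  hence "b0 \<le> cmod (bump (dil (t / t') y))" by (rule r0(3))
  thus ?thesis using assms by (simp add: cmod_wave)
qed

lemma wave_mult_lower:
  assumes "0 < t" "t \<le> u" "0 < t'" "t' \<le> u" "adist y < r0"
  shows "b0\<^sup>2 \<le> cmod (wave t a (dil (1 / u) y) * wave t' a' (dil (1 / u) y))"
  unfolding norm_mult power2_eq_square
  using wave_lower[OF assms(1,2,5), of a] wave_lower[OF assms(3,4,5), of a'] b0_pos by (intro mult_mono) auto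

text \<open>With a the smaller and b >= 2a the larger power, b - a - (a + b)/100 is at least 0.97 a,
  and a is at least 4.\<close>

lemma opposite_far:
  assumes "k \<noteq> l" "2 \<le> k" "2 \<le> l"
  shows "13/10 \<le> \<bar>1 * 2 ^ k + - 1 * 2 ^ l\<bar> - (2 ^ k + 2 ^ l :: real) / 100"
proof -
  have *: "13/10 \<le> \<bar>1 * 2 ^ k + - 1 * 2 ^ l\<bar> - (2 ^ k + 2 ^ l :: real) / 100" if "k < l" "2 \<le> k" for k l :: nat
  proof -
    have "(2::real) ^ 2 \<le> 2 ^ k" using that by (intro power_increasing) auto
    moreover have "\<bar>1 * 2 ^ k + - 1 * 2 ^ l\<bar> = (2 ^ l - 2 ^ k :: real)" using that by simp
    moreover have "13/10 \<le> b - a - (a + b) / 100" if "4 \<le> a" "a \<le> b / 2" for a b :: real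
      using that unfolding add_divide_distrib by linarith
    ultimately show ?thesis using power_two_separated[OF that(1)] by simp
  qed
  show ?thesis using *[of k l] *[of l k] assms by (cases k l rule: linorder_cases) (auto simp: abs_minus_commute add.commute)
qed

text \<open>Terms with different indices have their spectrum beyond 13/10. In the others the
  modulations cancel, which leaves squares of bumps without oscillation.\<close>

lemma blk0_opposite:
  assumes T: "\<And>k. 0 < T k" "\<And>k. T k \<le> 2 ^ k" and K: "finite K" "\<And>k. k \<in> K \<Longrightarrow> 2 \<le> k"
  shows "blk 0 (\<lambda>x. waves T a 1 K x * waves T b (- 1) K x) = (\<lambda>x. \<Sum>k\<in>K. of_real (2 powr (- a * real k) * 2 powr (- b * real k)) *
     blk 0 (\<lambda>x. bump (dil (T k) x) * bump (dil (T k) x)) x)"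
proof -
  have off: "blk 0 (\<lambda>x. wave (T k) (1 * 2 ^ k) x * wave (T l) (- 1 * 2 ^ l) x) = (\<lambda>_. 0)"
    if "k \<in> K" "l \<in> K" "k \<noteq> l" for k l
  proof (rule blk_0_far[OF wave_mult_bandlimited[OF T(1) T(1)]])
    show "13 / 10 \<le> \<bar>1 * 2 ^ k + - 1 * 2 ^ l\<bar> - (T k + T l) / 100"
      by (rule order_trans[OF opposite_far[OF that(3) K(2)[OF that(1)] K(2)[OF that(2)]] diff_left_mono])
        (intro divide_right_mono add_mono T, simp)
  qed
  have diag: "(\<lambda>x. wave (T k) (1 * 2 ^ k) x * wave (T k) (- 1 * 2 ^ k) x) = (\<lambda>x. bump (dil (T k) x) * bump (dil (T k) x))" for k
    using wave_mult_cancel[OF T(1), of k "2 ^ k"] by (simp add: fun_eq_iff)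
  show ?thesis
    unfolding blk_waves_mult[OF T(1) T(1)]
  proof
    fix x
    show "(\<Sum>z\<in>K \<times> K. of_real (2 powr (- a * real (fst z)) * 2 powr (- b * real (snd z))) *
       blk 0 (\<lambda>x. wave (T (fst z)) (1 * 2 ^ fst z) x * wave (T (snd z)) (- 1 * 2 ^ snd z) x) x) =
     (\<Sum>k\<in>K. of_real (2 powr (- a * real k) * 2 powr (- b * real k)) * blk 0 (\<lambda>x. bump (dil (T k) x) * bump (dil (T k) x)) x)"
      by (subst sum_times_diagonal[OF K(1)]) (simp_all only: off diag fst_conv snd_conv mult_zero_right simp_thms)
  qed
qed

lemma norm_wave_1: "n 1 (\<lambda>l. blk l (wave 1 0)) \<le> ennreal (Nb 1)"
  using norm_low[of 1 1] by simp

lemmas norm_rules = waves_paley wave_paley norm_wave_1 norm_modulated norm_dilated(2) norm_low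

text \<open>Without dilation all the squares coincide, so the lowest block is one fixed function
  times the full sum of the coefficients. This is the source of \<open>condition_2\<close> and
  \<open>condition_2'\<close>.\<close>

lemma estimate_modulated_opposite:
  fixes K :: "nat set"
  assumes K: "finite K" "K \<noteq> {}" "\<And>k. k \<in> K \<Longrightarrow> 2 \<le> k"
  shows "(\<Sum>k\<in>K. 2 powr (- (s 0 + s 1) * real k)) * (b0\<^sup>2 * v0 powr \<rho> 2)
    \<le> Cm * (real (card K) powr recip (q 0) * Nb 0) * (real (card K) powr recip (q 1) * Nb 1)"
proof -
  define S where "S = (\<Sum>k\<in>K. 2 powr (- (s 0 + s 1) * real k))"
  have S: "S > 0" unfolding S_def using K by (intro sum_pos) auto
  let ?f = "waves (\<lambda>_. 1) (s 0) 1 K" and ?g = "waves (\<lambda>_. 1) (s 1) (- 1) K"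
  have sq: "blk 0 (\<lambda>x. bump (dil 1 x) * bump (dil 1 x)) = (\<lambda>x. bump x * bump x)"
    using blk_annulus[OF bump_sq_bandlimited spot_annulus, of 0 0] by simp
  have "blk 0 (\<lambda>x. ?f x * ?g x) = (\<lambda>x. \<Sum>k\<in>K. of_real (2 powr (- s 0 * real k) * 2 powr (- s 1 * real k)) * (bump x * bump x))"
    by (subst blk0_opposite) (simp_all only: sq K zero_less_one one_le_power one_le_numeral)
  also have "\<dots> = (\<lambda>x. of_real S * (bump x * bump x))"
  proof -
    have "2 powr (- s 0 * real k) * 2 powr (- s 1 * real k) = 2 powr (- (s 0 + s 1) * real k)" for k
      unfolding powr_add[symmetric] by (simp add: algebra_simps)
    thus ?thesis unfolding S_def of_real_sum sum_distrib_right by (simp only:)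
  qed
  finally have b: "blk 0 (\<lambda>x. ?f x * ?g x) = (\<lambda>x. of_real S * (bump x * bump x))" .
  have "2 powr (s 2 * real 0) * 1 powr (- wsize * \<rho> 2) * ((S * b0\<^sup>2) * v0 powr \<rho> 2)
    \<le> Cm * (real (card K) powr recip (q 0) * Nb 0) * (real (card K) powr recip (q 1) * Nb 1)"
  proof (rule master[where f = ?f and g = ?g])
    fix y assume "adist y < r0"
    hence "b0\<^sup>2 \<le> cmod (bump y * bump y)"
      unfolding norm_mult power2_eq_square using r0(3)[of y] b0_pos by (intro mult_mono) auto
    thus "S * b0\<^sup>2 \<le> cmod (blk 0 (\<lambda>x. ?f x * ?g x) (dil (1 / 1) y))"
      unfolding b using S by (simp add: norm_mult)
  qed ((rule norm_rules | (use S b0_pos Nb_nonneg K in force))+)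
  thus ?thesis by (simp add: S_def mult.assoc)
qed

text \<open>The low factor enlarges the spectral ball by 1/100 without moving its centre, and from k
  = 1 on the result still fits into the annulus of index k.\<close>

lemma blk_waves_low:
  assumes T: "\<And>k. 0 < T k" "\<And>k. T k \<le> 2 ^ k" and K: "finite K" "\<And>k. k \<in> K \<Longrightarrow> 1 \<le> k"
  shows "blk l (\<lambda>x. waves T a 1 K x * wave 1 0 x) =
    (if l \<in> K then (\<lambda>x. of_real (2 powr (- a * real l)) * (wave (T l) (1 * 2 ^ l) x * wave 1 0 x)) else (\<lambda>_. 0))"
proof -
  have H: "blk l (\<lambda>x. wave (T k) (1 * 2 ^ k) x * wave 1 0 x) = (if l = k then (\<lambda>x. wave (T k) (1 * 2 ^ k) x * wave 1 0 x) else (\<lambda>_. 0))"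
    if "k \<in> K" for k
  proof (rule blk_annulus[OF wave_mult_bandlimited[OF T(1) zero_less_one] spot_annulus])
    have p: "(2::real) ^ 1 \<le> 2 ^ k" using K(2)[OF that] by (intro power_increasing) auto
    show "\<bar>1 * 2 ^ k + 0\<bar> + (T k + 1) / 100 \<le> 11/10 * 2 ^ k" using T(2)[of k] p by simp
    show "k = 0 \<or> 65/100 * 2 ^ k \<le> \<bar>1 * 2 ^ k + 0\<bar> - (T k + 1) / 100"
      using T(2)[of k] p by simp
  qed
  have "(\<lambda>x. waves T a 1 K x * wave 1 0 x) = (\<lambda>x. \<Sum>k\<in>K. of_real (2 powr (- a * real k)) * (wave (T k) (1 * 2 ^ k) x * wave 1 0 x))"
    by (simp only: waves_def sum_distrib_right mult.assoc)
  hence "blk l (\<lambda>x. waves T a 1 K x * wave 1 0 x) = (\<lambda>x. \<Sum>k\<in>K. of_real (2 powr (- a * real k)) * blk l (\<lambda>x. wave (T k) (1 * 2 ^ k) x * wave 1 0 x) x)"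
    by (simp only:) (rule blk_sum[OF bandlimited_integrable[OF wave_mult_bandlimited[OF T(1) zero_less_one]]])
  also have "\<dots> = (\<lambda>x. \<Sum>k\<in>K. if l = k then of_real (2 powr (- a * real k)) * (wave (T k) (1 * 2 ^ k) x * wave 1 0 x) else 0)"
    by (intro ext sum.cong refl) (simp only: H, simp)
  finally show ?thesis using K(1) by (auto simp: fun_eq_iff)
qed

text \<open>A fixed low-frequency factor keeps the packet in its block and changes its size only by
  constants, so the weights 2^(k s) of source and target are compared.\<close>

lemma estimate_modulated_low:
  assumes "1 \<le> k"
  shows "2 powr ((s 2 - s 0) * real k) * (b0\<^sup>2 * v0 powr \<rho> 2) \<le> Cm * Nb 0 * Nb 1"
proof -
  let ?f = "waves (\<lambda>_. 1) (s 0) 1 {k}" and ?g = "wave 1 0"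
  have "2 powr (s 2 * real k) * 1 powr (- wsize * \<rho> 2) * ((2 powr (- s 0 * real k) * b0\<^sup>2) * v0 powr \<rho> 2)
    \<le> Cm * (real (card {k}) powr recip (q 0) * Nb 0) * Nb 1"
  proof (rule master[where f = ?f and g = ?g])
    fix y assume y: "adist y < r0"
    have "blk k (\<lambda>x. ?f x * ?g x) (dil (1 / 1) y) = of_real (2 powr (- s 0 * real k)) * (wave 1 (1 * 2 ^ k) (dil (1 / 1) y) * wave 1 0 (dil (1 / 1) y))"
      using assms by (subst blk_waves_low) auto
    thus "2 powr (- s 0 * real k) * b0\<^sup>2 \<le> cmod (blk k (\<lambda>x. ?f x * ?g x) (dil (1 / 1) y))"
      using wave_mult_lower[of 1 1 1 y "1 * 2 ^ k" 0] y by (simp add: norm_mult)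
  qed ((rule norm_rules | (use b0_pos Nb_nonneg norm_wave_1 in force))+)
  moreover have "2 powr (s 2 * real k) * 2 powr (- s 0 * real k) = 2 powr ((s 2 - s 0) * real k)"
    by (simp add: powr_add[symmetric] algebra_simps)
  ultimately show ?thesis by (simp add: mult.assoc[symmetric])
qed

text \<open>Since \<open>s 2 = s 0\<close>, the weighted blocks of the product share one modulus.
  The quasi-norm of the product is therefore known exactly in both kinds of spaces.\<close>

lemma estimate_modulated_low_sum:
  fixes K :: "nat set"
  assumes s: "s 2 = s 0" and K: "finite K" "K \<noteq> {}" "\<And>k. k \<in> K \<Longrightarrow> 1 \<le> k"
  shows "real (card K) powr recip (q 2) * (b0\<^sup>2 * v0 powr \<rho> 2) \<le> Cm * (real (card K) powr recip (q 0) * Nb 0) * Nb 1"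
proof (rule product_bound)
  let ?f = "waves (\<lambda>_. 1) (s 0) 1 K" and ?g = "wave 1 0"
  have b2: "continuous_on UNIV (\<lambda>x. bump x * bump x)" by (intro continuous_intros bump_continuous)
  have "n 2 (\<lambda>l. blk l (\<lambda>x. ?f x * ?g x)) = ennreal (real (card K) powr recip (q 2)) * Lp_qnorm lborel (p 2) (\<lambda>x. ennreal (cmod (bump x * bump x)))"
  proof (rule block_qnorm_common_modulus[OF pq K(1,2) b2])
    fix j x
    show "cmod (blk j (\<lambda>x. ?f x * ?g x) x) = (if j \<in> K then 2 powr (- s 2 * real j) * cmod (bump x * bump x) else 0)"
      using K by (subst blk_waves_low) (auto simp: s norm_mult cmod_wave)
  qed simp_all
  moreover have "ennreal (1 powr (- wsize * \<rho> 2) * (b0\<^sup>2 * v0 powr \<rho> 2)) \<le> Lp_qnorm lborel (p 2) (\<lambda>x. ennreal (cmod (bump x * bump x)))"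
  proof (rule Lp_lower[OF pq(1) b2])
    fix y assume "adist y < r0"
    thus "b0\<^sup>2 \<le> cmod (bump (dil (1 / 1) y) * bump (dil (1 / 1) y))"
      unfolding norm_mult power2_eq_square using r0(3)[of y] b0_pos by (intro mult_mono) auto
  qed (use b0_pos in auto)
  ultimately show "ennreal (real (card K) powr recip (q 2) * (b0\<^sup>2 * v0 powr \<rho> 2)) \<le> n 2 (\<lambda>l. blk l (\<lambda>x. ?f x * ?g x))"
    by (simp add: ennreal_mult mult_left_mono)
qed ((rule norm_rules | (use Nb_nonneg norm_wave_1 K in force))+)

text \<open>As \<open>t\<close> tends to 0 the packet spreads out but stays in the lowest block, so
  that smoothness and sum exponents have no influence.\<close>

lemma estimate_spread:
  assumes t: "0 < t" "t \<le> 1"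
  shows "t powr (- wsize * \<rho> 2) * (b0\<^sup>2 * v0 powr \<rho> 2) \<le> Cm * (t powr (- wsize * \<rho> 0) * Nb 0) * (t powr (- wsize * \<rho> 1) * Nb 1)"
proof -
  have b: "blk 0 (\<lambda>x. wave t 0 x * wave t 0 x) = (\<lambda>x. wave t 0 x * wave t 0 x)"
    using t by (subst blk_annulus[OF wave_mult_bandlimited[OF t(1) t(1)] spot_annulus[of _ _ 0]]) auto
  have "2 powr (s 2 * real 0) * t powr (- wsize * \<rho> 2) * (b0\<^sup>2 * v0 powr \<rho> 2)
    \<le> Cm * (t powr (- wsize * \<rho> 0) * Nb 0) * (t powr (- wsize * \<rho> 1) * Nb 1)"
  proof (rule master[where f = "wave t 0" and g = "wave t 0"])
    fix y assume "adist y < r0"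
    thus "b0\<^sup>2 \<le> cmod (blk 0 (\<lambda>x. wave t 0 x * wave t 0 x) (dil (1 / t) y))"
      unfolding b using t by (intro wave_mult_lower) auto
  qed ((rule norm_rules | (use t b0_pos Nb_nonneg in force))+)
  thus ?thesis by simp
qed

lemma exponent_combine:
  "2 powr (s 2 * real l) * (2 ^ l) powr (- wsize * \<rho> 2) * ((2 powr (- a * real l) * b) * v) = 2 powr ((\<sigma> 2 - a) * real l) * (b * v)"
proof -
  have "2 powr (s 2 * real l) * 2 powr (- wsize * \<rho> 2 * real l) * 2 powr (- a * real l) = 2 powr ((\<sigma> 2 - a) * real l)"
    unfolding powr_add[symmetric] by (simp add: algebra_simps)
  from arg_cong[OF this, of "\<lambda>z. z * (b * v)"] show ?thesis unfolding two_power_powr by (simp only: mult.assoc)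
qed

lemma dilated_low_lower:
  assumes K: "finite K" "\<And>k. k \<in> K \<Longrightarrow> 1 \<le> k" and l: "l \<in> K" and y: "adist y < r0"
  shows "2 powr (- a * real l) * b0\<^sup>2 \<le> cmod (blk l (\<lambda>x. waves (\<lambda>k. 2 ^ k) a 1 K x * wave 1 0 x) (dil (1 / 2 ^ l) y))"
proof -
  have "blk l (\<lambda>x. waves (\<lambda>k. 2 ^ k) a 1 K x * wave 1 0 x) (dil (1 / 2 ^ l) y)
    = of_real (2 powr (- a * real l)) * (wave (2 ^ l) (1 * 2 ^ l) (dil (1 / 2 ^ l) y) * wave 1 0 (dil (1 / 2 ^ l) y))"
    using K l by (subst blk_waves_low) auto
  thus ?thesis using wave_mult_lower[of "2 ^ l" "2 ^ l" 1 y "1 * 2 ^ l" 0] y by (simp add: norm_mult)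
qed

text \<open>On the scale 2^(-k) of the dilated packet the low factor is bounded below, so the
  product is as large as the packet and differential dimensions are compared.\<close>

lemma estimate_dilated_low:
  assumes "1 \<le> k"
  shows "2 powr ((\<sigma> 2 - \<sigma> 0) * real k) * (b0\<^sup>2 * v0 powr \<rho> 2) \<le> Cm * Cd 0 * Nb 1"
proof -
  have "2 powr (s 2 * real k) * (2 ^ k) powr (- wsize * \<rho> 2) * ((2 powr (- \<sigma> 0 * real k) * b0\<^sup>2) * v0 powr \<rho> 2)
    \<le> Cm * (Cd 0 * real (card {k}) powr \<tau> 0) * Nb 1"
    by (rule master[where f = "waves (\<lambda>k. 2 ^ k) (\<sigma> 0) 1 {k}" and g = "wave 1 0", OF _ _ _ _ dilated_low_lower])
      ((rule norm_rules | (use assms b0_pos Nb_nonneg norm_wave_1 norm_dilated(1)[of 0] in force))+)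
  thus ?thesis unfolding exponent_combine by simp
qed

text \<open>Equality of the differential dimensions cancels the powers of 2, which gives all blocks
  the common lower bound required by \<open>master_besov\<close>.\<close>

lemma estimate_dilated_low_besov:
  fixes K :: "nat set"
  assumes A: "A 2 = Besov" and eq: "\<sigma> 2 = \<sigma> 0" and K: "finite K" "K \<noteq> {}" "\<And>k. k \<in> K \<Longrightarrow> 1 \<le> k"
  shows "real (card K) powr recip (q 2) * (b0\<^sup>2 * v0 powr \<rho> 2) \<le> Cm * (Cd 0 * real (card K) powr \<tau> 0) * Nb 1"
proof (rule master_besov[where f = "waves (\<lambda>k. 2 ^ k) (\<sigma> 0) 1 K" and g = "wave 1 0" and t = "\<lambda>l. 2 ^ l" and
    \<delta> = "\<lambda>l. 2 powr (- \<sigma> 0 * real l) * b0\<^sup>2", OF _ _ A K(1,2)])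
  fix l y assume "l \<in> K" "adist y < r0"
  thus "2 powr (- \<sigma> 0 * real l) * b0\<^sup>2 \<le> cmod (blk l (\<lambda>x. waves (\<lambda>k. 2 ^ k) (\<sigma> 0) 1 K x * wave 1 0 x) (dil (1 / 2 ^ l) y))"
    by (intro dilated_low_lower[OF K(1)] K(3))
next
  fix l
  show "b0\<^sup>2 * v0 powr \<rho> 2 \<le> 2 powr (s 2 * real l) * (2 ^ l) powr (- wsize * \<rho> 2) * ((2 powr (- \<sigma> 0 * real l) * b0\<^sup>2) * v0 powr \<rho> 2)"
    unfolding exponent_combine by (simp add: eq)
qed ((rule norm_rules | (use K b0_pos Nb_nonneg norm_wave_1 norm_dilated(1)[of 0] in force))+)

text \<open>With a gap of 10 the lower frequency is at most 1/1024 of the higher one, a perturbation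
  well inside the margins of the annulus.\<close>

lemma separated_annulus:
  assumes "k + 10 \<le> l"
  shows "spot (1 * 2 ^ k + 1 * 2 ^ l) ((2 ^ k + 2 ^ l) / 100) \<subseteq> annulus l"
proof (rule spot_annulus)
  have "(2::real) ^ (k + 10) \<le> 2 ^ l" using assms by (intro power_increasing) auto
  hence p: "1024 * (2::real) ^ k \<le> 2 ^ l" by (simp add: power_add)
  have k: "(0::real) < 2 ^ k" by simp
  have a: "\<bar>1 * 2 ^ k + 1 * 2 ^ l\<bar> = (2 ^ k + 2 ^ l :: real)" by simp
  have *: "a + b + (a + b) / 100 \<le> 11/10 * b" "65/100 * b \<le> a + b - (a + b) / 100"
    if "1024 * a \<le> b" "0 < a" for a b :: real
    using that unfolding add_divide_distrib by linarith+
  show "\<bar>1 * 2 ^ k + 1 * 2 ^ l\<bar> + (2 ^ k + 2 ^ l) / 100 \<le> (11/10 * 2 ^ l :: real)" unfolding a by (rule *(1)[OF p k])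
  show "l = 0 \<or> 65/100 * 2 ^ l \<le> (\<bar>1 * 2 ^ k + 1 * 2 ^ l\<bar> - (2 ^ k + 2 ^ l) / 100 :: real)" unfolding a by (intro disjI2 *(2)[OF p k])
qed

text \<open>The square of the packet of frequency 2^m has frequency 2^(m+1) and lies in block m + 1.
  A mixed product lies in the block of its larger index, which is a multiple of 10 and hence never
  equal to m + 1.\<close>

lemma blk_sum_frequencies:
  assumes K: "finite K" "\<And>k. k \<in> K \<Longrightarrow> 10 dvd k" and m: "m \<in> K"
  shows "blk (Suc m) (\<lambda>x. waves (\<lambda>k. 2 ^ k) a 1 K x * waves (\<lambda>k. 2 ^ k) b 1 K x) =
    (\<lambda>x. of_real (2 powr (- (a + b) * real m)) * (wave (2 ^ m) (1 * 2 ^ m) x * wave (2 ^ m) (1 * 2 ^ m) x))"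
proof -
  have pos: "0 < (2::real) ^ k" for k by simp
  have off: "blk (Suc m) (\<lambda>x. wave (2 ^ k) (1 * 2 ^ k) x * wave (2 ^ l) (1 * 2 ^ l) x) = (\<lambda>_. 0)"
    if kl: "k \<in> K" "l \<in> K" "k \<noteq> l" for k l
  proof -
    obtain k' l' m' where d: "k = 10 * k'" "l = 10 * l'" "m = 10 * m'" using K(2) kl(1,2) m by (metis dvd_def)
    have "k + 10 \<le> l \<or> l + 10 \<le> k" using kl(3) d by presburger
    then consider "k + 10 \<le> l" | "l + 10 \<le> k" by blast
    thus ?thesis
    proof cases
      case 1
      have "Suc m \<noteq> l" using d by presburger
      thus ?thesis using blk_annulus[OF wave_mult_bandlimited[OF pos pos] separated_annulus[OF 1], of "Suc m"] by simp
    next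
      case 2
      have "Suc m \<noteq> k" using d by presburger
      moreover have "bandlimited (spot (1 * 2 ^ l + 1 * 2 ^ k) ((2 ^ l + 2 ^ k) / 100)) (\<lambda>x. wave (2 ^ k) (1 * 2 ^ k) x * wave (2 ^ l) (1 * 2 ^ l) x)"
        using wave_mult_bandlimited[OF pos[of k] pos[of l], of "1 * 2 ^ k" "1 * 2 ^ l"] by (simp only: add.commute)
      ultimately show ?thesis using blk_annulus[OF _ separated_annulus[OF 2], of _ "Suc m"] by simp
    qed
  qed
  have diag: "blk (Suc m) (\<lambda>x. wave (2 ^ k) (1 * 2 ^ k) x * wave (2 ^ k) (1 * 2 ^ k) x)
      = (if m = k then (\<lambda>x. wave (2 ^ k) (1 * 2 ^ k) x * wave (2 ^ k) (1 * 2 ^ k) x) else (\<lambda>_. 0))" for k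
    using blk_annulus[OF wave_mult_bandlimited[OF pos pos] spot_annulus[of _ _ "Suc k"], of "1 * 2 ^ k" "1 * 2 ^ k" k k "Suc m"]
    by simp
  show ?thesis unfolding blk_waves_mult[OF pos pos]
  proof
    fix x
    have "(\<Sum>z\<in>K \<times> K. of_real (2 powr (- a * real (fst z)) * 2 powr (- b * real (snd z))) *
       blk (Suc m) (\<lambda>x. wave (2 ^ fst z) (1 * 2 ^ fst z) x * wave (2 ^ snd z) (1 * 2 ^ snd z) x) x)
      = (\<Sum>k\<in>K. of_real (2 powr (- a * real k) * 2 powr (- b * real k)) *
       blk (Suc m) (\<lambda>x. wave (2 ^ k) (1 * 2 ^ k) x * wave (2 ^ k) (1 * 2 ^ k) x) x)"
      by (subst sum_times_diagonal[OF K(1)]) (simp_all only: off fst_conv snd_conv mult_zero_right simp_thms)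
    also have "\<dots> = (\<Sum>k\<in>K. if m = k then of_real (2 powr (- a * real k) * 2 powr (- b * real k)) *
       (wave (2 ^ k) (1 * 2 ^ k) x * wave (2 ^ k) (1 * 2 ^ k) x) else 0)"
      by (intro sum.cong refl) (simp only: diag, simp)
    also have "\<dots> = of_real (2 powr (- a * real m) * 2 powr (- b * real m)) * (wave (2 ^ m) (1 * 2 ^ m) x * wave (2 ^ m) (1 * 2 ^ m) x)"
      using K(1) m by simp
    also have "2 powr (- a * real m) * 2 powr (- b * real m) = 2 powr (- (a + b) * real m)"
      unfolding powr_add[symmetric] by (simp add: algebra_simps)
    finally show "(\<Sum>z\<in>K \<times> K. of_real (2 powr (- a * real (fst z)) * 2 powr (- b * real (snd z))) *
       blk (Suc m) (\<lambda>x. wave (2 ^ fst z) (1 * 2 ^ fst z) x * wave (2 ^ snd z) (1 * 2 ^ snd z) x) x)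
      = of_real (2 powr (- (a + b) * real m)) * (wave (2 ^ m) (1 * 2 ^ m) x * wave (2 ^ m) (1 * 2 ^ m) x)" .
  qed
qed

lemma dilated_product_lower:
  assumes K: "finite K" "\<And>k. k \<in> K \<Longrightarrow> 10 dvd k" and m: "m \<in> K" and y: "adist y < r0"
  shows "2 powr (- (a + b) * real m) * b0\<^sup>2 \<le>
    cmod (blk (Suc m) (\<lambda>x. waves (\<lambda>k. 2 ^ k) a 1 K x * waves (\<lambda>k. 2 ^ k) b 1 K x) (dil (1 / 2 ^ m) y))"
proof -
  have eq: "blk (Suc m) (\<lambda>x. waves (\<lambda>k. 2 ^ k) a 1 K x * waves (\<lambda>k. 2 ^ k) b 1 K x) =
    (\<lambda>x. of_real (2 powr (- (a + b) * real m)) * (wave (2 ^ m) (1 * 2 ^ m) x * wave (2 ^ m) (1 * 2 ^ m) x))"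
    by (rule blk_sum_frequencies[OF K m])
  have "b0\<^sup>2 \<le> cmod (wave (2 ^ m) (1 * 2 ^ m) (dil (1 / 2 ^ m) y) * wave (2 ^ m) (1 * 2 ^ m) (dil (1 / 2 ^ m) y))"
    using y by (intro wave_mult_lower) auto
  from mult_left_mono[OF this, of "2 powr (- (a + b) * real m)"] show ?thesis
    unfolding eq by (simp only: norm_mult[of "of_real _"] norm_of_real abs_of_nonneg powr_ge_zero)
qed

lemma exponent_combine_Suc:
  "2 powr (s 2 * real (Suc l)) * (2 ^ l) powr (- wsize * \<rho> 2) * ((2 powr (- a * real l) * b) * v) = 2 powr (s 2) * (2 powr ((\<sigma> 2 - a) * real l) * (b * v))"
  unfolding exponent_combine[symmetric] by (simp add: distrib_left powr_add)

text \<open>Both factors have the same frequency and the same width, so the coefficients multiply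
  and the sum of two differential dimensions is compared with that of the target.\<close>

lemma estimate_dilated_product:
  assumes "10 dvd m"
  shows "2 powr (s 2) * (2 powr ((\<sigma> 2 - (\<sigma> 0 + \<sigma> 1)) * real m) * (b0\<^sup>2 * v0 powr \<rho> 2)) \<le> Cm * Cd 0 * Cd 1"
proof -
  have "2 powr (s 2 * real (Suc m)) * (2 ^ m) powr (- wsize * \<rho> 2) * ((2 powr (- (\<sigma> 0 + \<sigma> 1) * real m) * b0\<^sup>2) * v0 powr \<rho> 2)
    \<le> Cm * (Cd 0 * real (card {m}) powr \<tau> 0) * (Cd 1 * real (card {m}) powr \<tau> 1)"
    by (rule master[where f = "waves (\<lambda>k. 2 ^ k) (\<sigma> 0) 1 {m}" and g = "waves (\<lambda>k. 2 ^ k) (\<sigma> 1) 1 {m}", OF _ _ _ _ dilated_product_lower])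
      ((rule norm_rules | (use assms b0_pos norm_dilated(1)[of 0] norm_dilated(1)[of 1] in force))+)
  thus ?thesis unfolding exponent_combine_Suc by simp
qed

text \<open>Equality of the exponents again gives a common lower bound for the blocks. Both factors
  now contribute a power of \<open>card K\<close>, which is why the reciprocals of
  \<open>q 0\<close> and \<open>q 1\<close> get added.\<close>

lemma estimate_dilated_product_besov:
  fixes K :: "nat set"
  assumes A: "A 2 = Besov" and eq: "\<sigma> 2 = \<sigma> 0 + \<sigma> 1" and K: "finite K" "K \<noteq> {}" "\<And>k. k \<in> K \<Longrightarrow> 10 dvd k"
  shows "real (card K) powr recip (q 2) * (2 powr (s 2) * (b0\<^sup>2 * v0 powr \<rho> 2))
    \<le> Cm * (Cd 0 * real (card K) powr \<tau> 0) * (Cd 1 * real (card K) powr \<tau> 1)"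
proof -
  let ?f = "waves (\<lambda>k. 2 ^ k) (\<sigma> 0) 1 K" and ?g = "waves (\<lambda>k. 2 ^ k) (\<sigma> 1) 1 K"
  have "real (card (Suc ` K)) powr recip (q 2) * (2 powr (s 2) * (b0\<^sup>2 * v0 powr \<rho> 2))
    \<le> Cm * (Cd 0 * real (card K) powr \<tau> 0) * (Cd 1 * real (card K) powr \<tau> 1)"
  \<comment> \<open>The block index is \<open>l = Suc m\<close>, while width and coefficient belong
    to m; hence the shift to \<open>l - 1\<close>.\<close>
  proof (rule master_besov[where f = ?f and g = ?g and t = "\<lambda>l. 2 ^ (l - 1)" and
      \<delta> = "\<lambda>l. 2 powr (- (\<sigma> 0 + \<sigma> 1) * real (l - 1)) * b0\<^sup>2", OF _ _ A])
    fix l y assume "l \<in> Suc ` K" and y: "adist y < r0"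
    then obtain m where m: "m \<in> K" "l = Suc m" by blast
    show "2 powr (- (\<sigma> 0 + \<sigma> 1) * real (l - 1)) * b0\<^sup>2 \<le> cmod (blk l (\<lambda>x. ?f x * ?g x) (dil (1 / 2 ^ (l - 1)) y))"
      using dilated_product_lower[OF K(1,3) m(1) y, of "\<sigma> 0" "\<sigma> 1"] by (simp only: m(2) diff_Suc_1)
  next
    fix l assume "l \<in> Suc ` K"
    then obtain m where m: "m \<in> K" "l = Suc m" by blast
    show "2 powr (s 2) * (b0\<^sup>2 * v0 powr \<rho> 2) \<le> 2 powr (s 2 * real l) * (2 ^ (l - 1)) powr (- wsize * \<rho> 2) * ((2 powr (- (\<sigma> 0 + \<sigma> 1) * real (l - 1)) * b0\<^sup>2) * v0 powr \<rho> 2)"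
      unfolding m(2) diff_Suc_1 exponent_combine_Suc eq by simp
  qed ((rule norm_rules | (use K b0_pos norm_dilated(1)[of 0] norm_dilated(1)[of 1] in force))+)
  thus ?thesis by (simp add: card_image)
qed

text \<open>The low frequency factor is \<open>N\<close> times a constant near the origin, where the
  second factor concentrates as \<open>L\<close> tends to infinity.\<close>

lemma estimate_peak:
  assumes eq: "\<sigma> 2 = \<sigma> 1" and s0: "\<sigma> 0 = 0" and N: "1 \<le> N"
  shows "real N * (b0\<^sup>2 * v0 powr \<rho> 2) \<le> Cm * (Cd 0 * real N powr \<tau> 0) * Cd 1"
proof -
  define f where "f = waves (\<lambda>k. 2 ^ k) (\<sigma> 0) 1 {1..N}"
  have fp: "f \<in> paley" unfolding f_def by (intro waves_paley) simp
  \<comment> \<open>At the origin all modulations equal 1, and all coefficients are 1 because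
    \<open>\<sigma> 0\<close> vanishes, so the packets add up to the full height N.\<close>
  have "f 0 = of_real (real N) * bump 0"
  proof -
    have "dil t 0 = 0" for t by (simp add: vec_eq_iff)
    thus ?thesis by (simp add: f_def waves_def wave_eq s0)
  qed
  hence f0: "cmod (f 0) = real N * (2 * b0)" by (simp add: b0_def norm_mult)
  obtain r where r: "0 < r" "r \<le> 1" "\<And>y. adist y < r \<Longrightarrow> cmod (f y - f 0) < real N * b0"
    using N b0_pos by (rule_tac adist_continuity_at_0[OF schwartz_continuous[OF paley_schwartz[OF fp]], of "real N * b0"]) auto
  obtain L0 where L0: "1 / r < 2 ^ L0" using real_arch_pow[of 2 "1 / r"] by auto
  \<comment> \<open>\<open>L0\<close> brings the ball scaled by 2^(-L) into the region where
    \<open>f\<close> is close to its peak. \<open>N + 10\<close> separates 2^L from every frequency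
    of \<open>f\<close>, so that the whole product lies in block L.\<close>
  define L where "L = L0 + N + 10"
  have "2 ^ L0 \<le> (2::real) ^ L" unfolding L_def by (intro power_increasing) auto
  hence "r * 2 ^ L0 \<le> r * 2 ^ L" using r(1) by (intro mult_left_mono) auto
  moreover have "1 < r * 2 ^ L0" using L0 r(1) by (simp add: pos_divide_less_eq mult.commute)
  ultimately have Lr: "1 / 2 ^ L < r" by (simp add: pos_divide_less_eq)
  let ?g = "waves (\<lambda>k. 2 ^ k) (\<sigma> 1) 1 {L}"
  have pos: "0 < (2::real) ^ k" for k by simp
  have b: "blk L (\<lambda>x. f x * ?g x) = (\<lambda>x. f x * ?g x)"
  proof -
    have "blk L (\<lambda>x. wave (2 ^ fst z) (1 * 2 ^ fst z) x * wave (2 ^ snd z) (1 * 2 ^ snd z) x)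
       = (\<lambda>x. wave (2 ^ fst z) (1 * 2 ^ fst z) x * wave (2 ^ snd z) (1 * 2 ^ snd z) x)" if "z \<in> {1..N} \<times> {L}" for z
    proof -
      have z: "snd z = L" "fst z + 10 \<le> L" using that by (auto simp: L_def)
      show ?thesis unfolding z(1)
        using blk_annulus[OF wave_mult_bandlimited[OF pos pos] separated_annulus[OF z(2)], of L] by simp
    qed
    thus ?thesis unfolding f_def blk_waves_mult[OF pos pos] by (intro ext) (simp only: waves_mult cong: sum.cong)
  qed
  have "2 powr (s 2 * real L) * (2 ^ L) powr (- wsize * \<rho> 2) * ((2 powr (- \<sigma> 1 * real L) * (real N * b0\<^sup>2)) * v0 powr \<rho> 2)
    \<le> Cm * (Cd 0 * real (card {1..N}) powr \<tau> 0) * (Cd 1 * real (card {L}) powr \<tau> 1)"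
  proof (rule master[where f = f and g = ?g, OF fp])
    fix y assume y: "adist y < r0"
    have "1 / 2 ^ L * adist y \<le> 1 / 2 ^ L * 1" using y r0(2) by (intro mult_left_mono) auto
    hence "adist (dil (1 / 2 ^ L) y) < r" using Lr by (simp add: adist_dil)
    from r(3)[OF this] have "real N * b0 \<le> cmod (f (dil (1 / 2 ^ L) y))"
      using norm_triangle_ineq2[of "f 0" "f (dil (1 / 2 ^ L) y)"] f0 by (simp add: norm_minus_commute)
    moreover have "2 powr (- \<sigma> 1 * real L) * b0 \<le> cmod (?g (dil (1 / 2 ^ L) y))"
      using wave_lower[of "2 ^ L" "2 ^ L" y "1 * 2 ^ L"] y by (simp add: waves_def norm_mult)
    ultimately have "(real N * b0) * (2 powr (- \<sigma> 1 * real L) * b0) \<le> cmod (f (dil (1 / 2 ^ L) y)) * cmod (?g (dil (1 / 2 ^ L) y))"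
      using b0_pos by (intro mult_mono) auto
    thus "2 powr (- \<sigma> 1 * real L) * (real N * b0\<^sup>2) \<le> cmod (blk L (\<lambda>x. f x * ?g x) (dil (1 / 2 ^ L) y))"
      unfolding b norm_mult by (simp add: power2_eq_square mult_ac)
  next
    show "n 0 (\<lambda>l. blk l f) \<le> ennreal (Cd 0 * real (card {1..N}) powr \<tau> 0)"
      unfolding f_def using N by (intro norm_dilated) auto
  qed ((rule norm_rules | (use N b0_pos norm_dilated(1)[of 0] norm_dilated(1)[of 1] in force))+)
  thus ?thesis unfolding exponent_combine eq by (simp add: mult.assoc)
qed

end

section \<open>The necessary conditions\<close>

context cutoff
begin

lemma fourier_dil:
  fixes F :: "real ^ 'n \<Rightarrow> complex"
  assumes t: "t > 0" and [measurable]: "F \<in> borel_measurable borel"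
  shows "fourier (\<lambda>x. F (dil t x)) \<xi> = of_real (t powr (- wsize)) * fourier F (dil (1 / t) \<xi>)"
proof -
  have i: "dil t x \<bullet> dil (1 / t) \<xi> = x \<bullet> \<xi>" for x using t by (simp add: inner_dil[symmetric])
  have "fourier F (dil (1 / t) \<xi>) = (\<integral>x. iexp (-1 * (dil (1 / t) \<xi> \<bullet> x)) * F x \<partial>lborel)"
    by (simp add: fourier_eq_ft ft_def)
  also have "\<dots> = of_real (t powr wsize) * (\<integral>x. iexp (-1 * (dil (1 / t) \<xi> \<bullet> dil t x)) * F (dil t x) \<partial>lborel)"
    by (rule integral_dil[OF t]) measurable
  also have "(\<integral>x. iexp (-1 * (dil (1 / t) \<xi> \<bullet> dil t x)) * F (dil t x) \<partial>lborel) = fourier (\<lambda>x. F (dil t x)) \<xi>"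
    by (simp only: fourier_eq_ft ft_def inner_commute[of "dil (1 / t) \<xi>"] i inner_commute[of \<xi>])
  finally have "fourier F (dil (1 / t) \<xi>) = of_real (t powr wsize) * fourier (\<lambda>x. F (dil t x)) \<xi>" .
  moreover have "complex_of_real (t powr (- wsize)) * of_real (t powr wsize) = 1"
    unfolding of_real_mult[symmetric] using t by (simp add: powr_add[symmetric])
  ultimately show ?thesis by (simp add: mult.assoc[symmetric])
qed

definition G :: "real ^ 'n \<Rightarrow> complex" where "G = fourier (\<lambda>x. bump x * bump x)"

lemma G_continuous: "continuous_on UNIV G"
  unfolding G_def by (rule fourier_continuous[OF bandlimited_integrable[OF bump_sq_bandlimited]])

lemma G_dil_continuous: "continuous_on UNIV (\<lambda>\<xi>. G (dil t \<xi>))"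
  by (rule continuous_on_compose2[OF G_continuous dil_continuous]) auto

text \<open>Dilation by a large \<open>t\<close> stretches the transform of the square, so the
  lowest block sees only the values of \<open>G\<close> near the origin; the factor t^(-|M|)
  reflects the loss.\<close>

lemma blk0_bump_sq:
  assumes t: "t > 0"
  shows "blk 0 (\<lambda>x. bump (dil t x) * bump (dil t x)) =
    (\<lambda>x. of_real (t powr (- wsize)) * inv_fourier (\<lambda>\<xi>. LP_Phi \<Psi> M 0 \<xi> * G (dil (1 / t) \<xi>)) x)"
proof -
  have m: "(\<lambda>x. bump x * bump x) \<in> borel_measurable borel"
    by (rule borel_measurable_continuous_onI[OF bandlimited_continuous[OF bump_sq_bandlimited]])
  have "blk 0 (\<lambda>x. bump (dil t x) * bump (dil t x)) = inv_fourier (\<lambda>\<xi>. of_real (t powr (- wsize)) * (LP_Phi \<Psi> M 0 \<xi> * G (dil (1 / t) \<xi>)))"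
    unfolding blk_def G_def fourier_dil[OF t m] by (simp add: mult_ac)
  also have "\<dots> = (\<lambda>x. of_real (t powr (- wsize)) * inv_fourier (\<lambda>\<xi>. LP_Phi \<Psi> M 0 \<xi> * G (dil (1 / t) \<xi>)) x)"
    unfolding inv_fourier_eq_ft ft_cmult by (simp only: mult.left_commute)
  finally show ?thesis .
qed

text \<open>Its transform takes the value 1 at the origin, so the function cannot vanish
  identically.\<close>

lemma inv_LP_Phi_0_nonzero: obtains x0 where "inv_fourier (LP_Phi \<Psi> M 0) x0 \<noteq> 0"
proof -
  have "fourier (inv_fourier (LP_Phi \<Psi> M 0)) 0 = LP_Phi \<Psi> M 0 0"
    by (simp add: fourier_inv_fourier_test[OF LP_Phi_test_funs])
  also have "\<dots> = 1" by (simp add: LP_Phi_def LP_Psi_def \<Psi>_one)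
  finally have "inv_fourier (LP_Phi \<Psi> M 0) \<noteq> (\<lambda>_. 0)" by (auto simp: fourier_def)
  thus ?thesis using that by (auto simp: fun_eq_iff)
qed

text \<open>The low-frequency blocks of the squares of shrinking bumps converge, after normalisation,
  uniformly to a multiple of the inverse transform of \<open>LP_Phi \<Psi> M 0\<close>. As the cutoff is complex
  valued, the latter need not be nonzero at the origin.\<close>

lemma low_block_limit:
  obtains z x0 d k1 where "z \<noteq> 0" "d > 0"
    "\<And>k x. k1 \<le> k \<Longrightarrow> x \<in> ball x0 d \<Longrightarrow>
      cmod (inv_fourier (\<lambda>\<xi>. LP_Phi \<Psi> M 0 \<xi> * G (dil (1 / 2 ^ k) \<xi>)) x - z) \<le> cmod z / 2"
proof -
  obtain x0 where x0: "inv_fourier (LP_Phi \<Psi> M 0) x0 \<noteq> 0" by (rule inv_LP_Phi_0_nonzero)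
  define \<phi> where "\<phi> x = G 0 * inv_fourier (LP_Phi \<Psi> M 0) x" for x
  define z where "z = \<phi> x0"
  have z: "z \<noteq> 0" using x0 fourier_bump_sq_0 by (simp add: z_def \<phi>_def G_def)
  have "continuous_on UNIV \<phi>" unfolding \<phi>_def
    by (intro continuous_intros schwartz_continuous inv_fourier_schwartz LP_Phi_test_funs)
  moreover have "cmod z / 4 > 0" using z by simp
  ultimately have "\<exists>d>0. \<forall>x\<in>UNIV. dist x x0 < d \<longrightarrow> dist (\<phi> x) (\<phi> x0) < cmod z / 4"
    unfolding continuous_on_iff by blast
  then obtain d where d: "d > 0" "\<And>x. dist x x0 < d \<Longrightarrow> dist (\<phi> x) (\<phi> x0) < cmod z / 4" by blast
  define I where "I = (\<integral>\<xi>. cmod (LP_Phi \<Psi> M 0 \<xi>) \<partial>lborel)"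
  define cc where "cc = 1 / (2 * pi) ^ DIM(real ^ 'n)"
  have I: "I \<ge> 0" unfolding I_def by (rule Bochner_Integration.integral_nonneg) simp
  have cc: "cc > 0" by (simp add: cc_def)
  \<comment> \<open>Chosen so that replacing \<open>G\<close> by \<open>G 0\<close> on the support
    of the lowest block function changes the inverse transform by at most a quarter of
    \<open>cmod z\<close>.\<close>
  define e where "e = cmod z / 4 / (cc * I + 1)"
  have e: "e > 0" using z I cc by (simp add: e_def add_nonneg_pos)
  obtain r where r: "0 < r" "r \<le> 1" "\<And>y. adist y < r \<Longrightarrow> cmod (G y - G 0) < e"
    by (rule adist_continuity_at_0[OF G_continuous e]) blast
  \<comment> \<open>From \<open>k1\<close> on, the dilation by 2^(-k) moves that support, where the
    distance is below 13/10, into the ball on which \<open>G\<close> is within \<open>e\<close> of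
    \<open>G 0\<close>.\<close>
  obtain k1 where k1: "(13/10) / r < 2 ^ k1" using real_arch_pow[of 2 "(13/10) / r"] by auto
  have main: "cmod (inv_fourier (\<lambda>\<xi>. LP_Phi \<Psi> M 0 \<xi> * G (dil (1 / 2 ^ k) \<xi>)) x - z) \<le> cmod z / 2"
    if k: "k1 \<le> k" and x: "x \<in> ball x0 d" for k x
  proof -
    let ?D = "\<lambda>\<xi>. LP_Phi \<Psi> M 0 \<xi> * (G (dil (1 / 2 ^ k) \<xi>) - G 0)"
    have Dle: "cmod (?D \<xi>) \<le> e * cmod (LP_Phi \<Psi> M 0 \<xi>)" for \<xi>
    proof (cases "13/10 \<le> adist \<xi>")
      case True
      hence "LP_Phi \<Psi> M 0 \<xi> = 0" using LP_Psi_zero[of 0 \<xi>] by (simp add: LP_Phi_0)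
      thus ?thesis by simp
    next
      case False
      have "(13/10) < r * 2 ^ k1" using k1 r(1) by (simp add: field_simps)
      also have "\<dots> \<le> r * 2 ^ k" using r(1) k by (intro mult_left_mono power_increasing) auto
      finally have "adist \<xi> < r * 2 ^ k" using False by linarith
      hence "adist (dil (1 / 2 ^ k) \<xi>) < r" by (simp add: adist_dil pos_divide_less_eq)
      from less_imp_le[OF r(3)[OF this]] show ?thesis unfolding norm_mult by (subst mult.commute) (rule mult_right_mono, auto)
    qed
    have i1: "integrable lborel (\<lambda>\<xi>. LP_Phi \<Psi> M 0 \<xi> * G (dil (1 / 2 ^ k) \<xi>))"
      by (rule LP_Phi_mult_integrable[OF G_dil_continuous])
    have i0: "integrable lborel (LP_Phi \<Psi> M 0)" by (rule test_funs_integrable[OF LP_Phi_test_funs])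
    have "ft 1 ?D x = ft 1 (\<lambda>\<xi>. LP_Phi \<Psi> M 0 \<xi> * G (dil (1 / 2 ^ k) \<xi>) + (- G 0) * LP_Phi \<Psi> M 0 \<xi>) x"
      by (simp add: algebra_simps)
    also have "\<dots> = ft 1 (\<lambda>\<xi>. LP_Phi \<Psi> M 0 \<xi> * G (dil (1 / 2 ^ k) \<xi>)) x - G 0 * ft 1 (LP_Phi \<Psi> M 0) x"
      by (simp only: ft_add[OF i1 integrable_mult_right[OF i0]] ft_cmult) simp
    finally have "inv_fourier (\<lambda>\<xi>. LP_Phi \<Psi> M 0 \<xi> * G (dil (1 / 2 ^ k) \<xi>)) x - \<phi> x = of_real cc * ft 1 ?D x"
      unfolding inv_fourier_eq_ft \<phi>_def cc_def by (simp only: right_diff_distrib mult.left_commute[of "G 0"])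
    also have "cmod \<dots> \<le> cc * (\<integral>\<xi>. cmod (?D \<xi>) \<partial>lborel)"
      unfolding norm_mult[of "of_real cc"] norm_of_real abs_of_pos[OF cc] using cc by (intro mult_left_mono ft_bound) simp
    also have "(\<integral>\<xi>. cmod (?D \<xi>) \<partial>lborel) \<le> (\<integral>\<xi>. e * cmod (LP_Phi \<Psi> M 0 \<xi>) \<partial>lborel)"
      by (intro integral_mono Dle integrable_norm integrable_mult_right i0 LP_Phi_mult_integrable continuous_intros G_dil_continuous)
    hence "cc * (\<integral>\<xi>. cmod (?D \<xi>) \<partial>lborel) \<le> cc * (e * I)" using cc by (simp add: I_def)
    also have "cc * (e * I) \<le> cmod z / 4"
    proof -
      have "cc * (e * I) \<le> e * (cc * I + 1)" using e by (simp add: algebra_simps)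
      also have "\<dots> = cmod z / 4"
      proof -
        have "cc * I + 1 > 0" using I cc by (simp add: add_nonneg_pos)
        thus ?thesis unfolding e_def by (metis less_irrefl nonzero_eq_divide_eq)
      qed
      finally show ?thesis .
    qed
    finally have "cmod (inv_fourier (\<lambda>\<xi>. LP_Phi \<Psi> M 0 \<xi> * G (dil (1 / 2 ^ k) \<xi>)) x - \<phi> x) \<le> cmod z / 4" .
    moreover have "cmod (\<phi> x - z) \<le> cmod z / 4"
      using d(2)[of x] x by (simp add: z_def dist_norm norm_minus_commute)
    ultimately show ?thesis
      using norm_triangle_ineq[of "inv_fourier (\<lambda>\<xi>. LP_Phi \<Psi> M 0 \<xi> * G (dil (1 / 2 ^ k) \<xi>)) x - \<phi> x" "\<phi> x - z"] by simp
  qed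
  show ?thesis by (rule that[OF z d(1) main])
qed

end

context multiplication
begin

text \<open>The coefficients contribute \<open>\<sigma> 0 + \<sigma> 1\<close> to the exponent, and
  the loss in \<open>blk0_bump_sq\<close> contributes |M|. Beyond the threshold all normalised terms
  lie in a disc about \<open>z\<close> of radius half the modulus of \<open>z\<close>, so they
  cannot cancel and the sum is at least half of what it would be with all terms equal to
  \<open>z\<close>.\<close>

lemma estimate_dilated_opposite:
  "\<exists>c>0. \<exists>k1. \<forall>K. finite K \<longrightarrow> K \<noteq> {} \<longrightarrow> (\<forall>k\<in>K. k1 \<le> k) \<longrightarrow>
    (\<Sum>k\<in>K. 2 powr (- (\<sigma> 0 + \<sigma> 1 + wsize) * real k)) * c \<le> Cm * (Cd 0 * real (card K) powr \<tau> 0) * (Cd 1 * real (card K) powr \<tau> 1)"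
proof -
  obtain z x0 d k1 where z: "z \<noteq> 0" "d > 0" and lim: "\<And>k x. k1 \<le> k \<Longrightarrow> x \<in> ball x0 d \<Longrightarrow>
      cmod (inv_fourier (\<lambda>\<xi>. LP_Phi \<Psi> M 0 \<xi> * G (dil (1 / 2 ^ k) \<xi>)) x - z) \<le> cmod z / 2"
    by (rule low_block_limit) blast
  have ball: "emeasure lborel (ball x0 d) = ennreal (measure lborel (ball x0 d))"
    using emeasure_lborel_ball_finite[of x0 d] by (intro emeasure_eq_ennreal_measure) (simp add: less_top)
  have vpos: "measure lborel (ball x0 d) > 0" using content_ball_pos[OF z(2), of x0] by simp
  define v where "v = measure lborel (ball x0 d) powr \<rho> 2"
  have v: "v > 0" unfolding v_def using vpos by simp
  have "(\<Sum>k\<in>K. 2 powr (- (\<sigma> 0 + \<sigma> 1 + wsize) * real k)) * (cmod z / 2 * v)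
      \<le> Cm * (Cd 0 * real (card K) powr \<tau> 0) * (Cd 1 * real (card K) powr \<tau> 1)"
    if K: "finite K" "K \<noteq> {}" "\<forall>k\<in>K. max 2 k1 \<le> k" for K
  proof -
    define c where "c k = 2 powr (- (\<sigma> 0 + \<sigma> 1 + wsize) * real k)" for k
    define H where "H k = inv_fourier (\<lambda>\<xi>. LP_Phi \<Psi> M 0 \<xi> * G (dil (1 / 2 ^ k) \<xi>))" for k :: nat
    define S where "S = sum c K"
    have S: "S > 0" unfolding S_def c_def using K by (intro sum_pos) auto
    let ?f = "waves (\<lambda>k. 2 ^ k) (\<sigma> 0) 1 K" and ?g = "waves (\<lambda>k. 2 ^ k) (\<sigma> 1) (- 1) K"
    have fp: "?f \<in> paley" "?g \<in> paley" by (intro waves_paley; simp)+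
    have "blk 0 (\<lambda>x. ?f x * ?g x) = (\<lambda>x. \<Sum>k\<in>K. of_real (2 powr (- \<sigma> 0 * real k) * 2 powr (- \<sigma> 1 * real k)) *
       blk 0 (\<lambda>x. bump (dil (2 ^ k) x) * bump (dil (2 ^ k) x)) x)"
      using K by (intro blk0_opposite) auto
    also have "\<dots> = (\<lambda>x. \<Sum>k\<in>K. of_real (c k) * H k x)"
    proof (intro ext sum.cong refl)
      fix x k
      have "2 powr (- \<sigma> 0 * real k) * 2 powr (- \<sigma> 1 * real k) * (2 ^ k) powr (- wsize) = c k"
        unfolding two_power_powr c_def powr_add[symmetric] by (simp add: algebra_simps)
      thus "of_real (2 powr (- \<sigma> 0 * real k) * 2 powr (- \<sigma> 1 * real k)) *
       blk 0 (\<lambda>x. bump (dil (2 ^ k) x) * bump (dil (2 ^ k) x)) x = of_real (c k) * H k x"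
        by (subst blk0_bump_sq) (simp_all add: H_def mult.assoc[symmetric] of_real_mult[symmetric] del: of_real_mult)
    qed
    finally have b: "blk 0 (\<lambda>x. ?f x * ?g x) = (\<lambda>x. \<Sum>k\<in>K. of_real (c k) * H k x)" .
    have low: "S * (cmod z / 2) \<le> cmod (blk 0 (\<lambda>x. ?f x * ?g x) x)" if x: "x \<in> ball x0 d" for x
    proof -
      have "blk 0 (\<lambda>x. ?f x * ?g x) x - of_real S * z = (\<Sum>k\<in>K. of_real (c k) * (H k x - z))"
        unfolding b S_def of_real_sum sum_distrib_right sum_subtractf[symmetric] by (simp add: right_diff_distrib)
      also have "cmod \<dots> \<le> (\<Sum>k\<in>K. c k * (cmod z / 2))"
      proof (rule sum_norm_le)
        fix k assume "k \<in> K"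
        hence "cmod (H k x - z) \<le> cmod z / 2" using lim[OF _ x, of k] K(3) by (simp add: H_def)
        thus "cmod (of_real (c k) * (H k x - z)) \<le> c k * (cmod z / 2)"
          unfolding norm_mult by (simp add: c_def mult_left_mono)
      qed
      also have "\<dots> = S * (cmod z / 2)" unfolding S_def sum_distrib_right ..
      finally have "cmod (blk 0 (\<lambda>x. ?f x * ?g x) x - of_real S * z) \<le> S * (cmod z / 2)" .
      moreover have "cmod (of_real S * z) = S * cmod z" using S by (simp add: norm_mult)
      ultimately show ?thesis
        using norm_triangle_ineq2[of "of_real S * z" "blk 0 (\<lambda>x. ?f x * ?g x) x"] by (simp add: norm_minus_commute)
    qed
    have pos: "S * (cmod z / 2) > 0" using S z by simp
    have "ennreal (S * (cmod z / 2) * measure lborel (ball x0 d) powr \<rho> 2) \<le>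
        Lp_qnorm lborel (p 2) (\<lambda>x. ennreal (cmod (blk 0 (\<lambda>x. ?f x * ?g x) x)))"
      by (rule Lp_qnorm_ge[OF pq(1) Lp_norm_measurable[OF paley_mult_continuous[OF fp]] pos _ ball vpos])
        (simp, simp, rule ennreal_leI[OF low])
    also have "\<dots> \<le> n 2 (\<lambda>l. blk l (\<lambda>x. ?f x * ?g x))"
      using block_qnorm_ge[where B = "\<lambda>l. blk l (\<lambda>x. ?f x * ?g x)" and j = 0, OF pq(1)[of 2] pq(2)[of 2] pq(3)[of 2] paley_mult_continuous[OF fp], of "s 2"]
      by simp
    finally have "S * (cmod z / 2) * measure lborel (ball x0 d) powr \<rho> 2
      \<le> Cm * (Cd 0 * real (card K) powr \<tau> 0) * (Cd 1 * real (card K) powr \<tau> 1)"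
      using K norm_dilated(1)[of 0] norm_dilated(1)[of 1]
      by (intro product_bound[OF fp]) (auto intro!: norm_dilated(2))
    thus ?thesis by (simp only: S_def c_def[abs_def] v_def mult.assoc)
  qed
  moreover have "cmod z / 2 * v > 0" using z v by simp
  ultimately show ?thesis by (intro exI[of _ "cmod z / 2 * v"] conjI exI[of _ "max 2 k1"]) blast+
qed

end

text \<open>A growing exponential is not bounded. The indices are multiples of 10 beyond an
  arbitrary \<open>k0\<close>, so that one formulation fits the estimates with a threshold as well
  as those requiring divisibility.\<close>

lemma exponent_nonpos:
  assumes "\<And>m. 2 powr (\<beta> * real (10 * (k0 + Suc m))) * c \<le> C" and c: "c > 0"
  shows "\<beta> \<le> 0"
proof (rule ccontr)
  assume "\<not> \<beta> \<le> 0"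
  hence \<beta>: "\<beta> > 0" by simp
  have C: "C > 0" using assms(1)[of 0] c by (rule_tac less_le_trans[OF mult_pos_pos]) auto
  obtain m :: nat where "log 2 (C / c) / \<beta> < real m" using reals_Archimedean2 by blast
  hence "log 2 (C / c) < \<beta> * real m" using \<beta> by (simp add: pos_divide_less_eq mult.commute)
  also have "\<dots> \<le> \<beta> * real (10 * (k0 + Suc m))" using \<beta> by (intro mult_left_mono) auto
  finally have "C / c < 2 powr (\<beta> * real (10 * (k0 + Suc m)))" using C c by (subst (asm) log_less_iff) auto
  thus False using assms(1)[of m] c by (simp add: pos_divide_less_eq not_less[symmetric])
qed

text \<open>Along the powers N = 2^k a comparison of powers of N becomes one of exponentials in
  k.\<close>

lemma exponent_le:
  assumes "\<And>N. 1 \<le> N \<Longrightarrow> real N powr a * c \<le> C * real N powr b" and c: "c > 0"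
  shows "a \<le> b"
proof -
  have "2 powr ((a - b) * real (10 * (0 + Suc m))) * c \<le> C" for m
  proof -
    define k where "k = 10 * (0 + Suc m)"
    have "(2 ^ k) powr a * c \<le> C * (2 ^ k) powr b" using assms(1)[of "2 ^ k"] by simp
    hence "2 powr (- b * real k) * (2 powr (a * real k) * c) \<le> 2 powr (- b * real k) * (C * 2 powr (b * real k))"
      unfolding two_power_powr by (intro mult_left_mono) auto
    moreover have "2 powr (- b * real k) * 2 powr (b * real k) = 1" "2 powr (- b * real k) * 2 powr (a * real k) = 2 powr ((a - b) * real k)"
      unfolding powr_add[symmetric] by (simp_all add: algebra_simps)
    ultimately have "2 powr ((a - b) * real k) * c \<le> C * 1"
      by (metis mult.assoc mult.left_commute)
    thus ?thesis by (simp only: k_def mult_1_right)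
  qed
  from exponent_nonpos[OF this c] show ?thesis by simp
qed

text \<open>Index sets of size N that satisfy the restrictions of all estimates at once: a
  prescribed threshold, a lower bound and divisibility by 10.\<close>

definition progression :: "nat \<Rightarrow> nat \<Rightarrow> nat set"
  where "progression k0 N = (\<lambda>m. 10 * (k0 + Suc m)) ` {..<N}"

lemma progression:
  "finite (progression k0 N)" "card (progression k0 N) = N" "1 \<le> N \<Longrightarrow> progression k0 N \<noteq> {}"
  "k \<in> progression k0 N \<Longrightarrow> k0 \<le> k" "k \<in> progression k0 N \<Longrightarrow> 10 \<le> k" "k \<in> progression k0 N \<Longrightarrow> 10 dvd k"
  by (auto simp: progression_def card_image inj_on_def lessThan_empty_iff)

lemma recip_le_imp_le:
  assumes q: "0 < q" and q': "0 < q'" and le: "recip q \<le> recip q'"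
  shows "q' \<le> q"
  using q
proof (cases q rule: exponent_cases)
  case (2 r)
  from q' show ?thesis
  proof (cases q' rule: exponent_cases)
    case (2 r')
    hence "1 / r \<le> 1 / r'" using le \<open>recip q = 1 / r\<close> by simp
    hence "r' \<le> r" using 2 \<open>0 < r\<close> by (simp add: field_simps)
    thus ?thesis using 2 \<open>q = ennreal r\<close> by (simp add: ennreal_leI)
  qed (use le 2 in auto)
qed simp

lemma ennreal_inverse_involution: "inverse (inverse x) = (x :: ennreal)"
proof (cases x)
  case (real r)
  thus ?thesis by (cases "r = 0") (simp_all add: inverse_ennreal)
qed simp

section \<open>Comparison of exponents\<close>

context multiplication
begin

lemma condition_1: "wsize * (\<rho> 0 + \<rho> 1 - 1) \<le> s 0 + s 1"
  and condition_1': "s 0 + s 1 = wsize * \<rho> 0 + wsize * \<rho> 1 - wsize \<Longrightarrow> 1 \<le> \<tau> 0 + \<tau> 1"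
proof -
  obtain c k1 where c: "c > 0" and est: "\<forall>K. finite K \<longrightarrow> K \<noteq> {} \<longrightarrow> (\<forall>k\<in>K. k1 \<le> k) \<longrightarrow>
    (\<Sum>k\<in>K. 2 powr (- (\<sigma> 0 + \<sigma> 1 + wsize) * real k)) * c \<le> Cm * (Cd 0 * real (card K) powr \<tau> 0) * (Cd 1 * real (card K) powr \<tau> 1)"
    using estimate_dilated_opposite by (elim exE conjE)
  have "- (\<sigma> 0 + \<sigma> 1 + wsize) \<le> 0"
  proof (rule exponent_nonpos[OF _ c])
    fix m
    show "2 powr (- (\<sigma> 0 + \<sigma> 1 + wsize) * real (10 * (k1 + Suc m))) * c \<le> Cm * Cd 0 * Cd 1"
      using est[rule_format, of "{10 * (k1 + Suc m)}"] by simp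
  qed
  thus "wsize * (\<rho> 0 + \<rho> 1 - 1) \<le> s 0 + s 1" by (simp add: algebra_simps)
  assume "s 0 + s 1 = wsize * \<rho> 0 + wsize * \<rho> 1 - wsize"
  \<comment> \<open>All summands in the estimate are now 1, so its left side is proportional to the
    cardinality.\<close>
  hence z: "\<sigma> 0 + \<sigma> 1 + wsize = 0" by simp
  show "1 \<le> \<tau> 0 + \<tau> 1"
  proof (rule exponent_le[OF _ c])
    fix N :: nat assume N: "1 \<le> N"
    have "(\<Sum>k\<in>progression k1 N. 2 powr (- (\<sigma> 0 + \<sigma> 1 + wsize) * real k)) * c
      \<le> Cm * (Cd 0 * real (card (progression k1 N)) powr \<tau> 0) * (Cd 1 * real (card (progression k1 N)) powr \<tau> 1)"
      using progression(1-3)[of k1 N] N by (intro est[rule_format]) (auto dest: progression(4))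
    thus "real N powr 1 * c \<le> Cm * Cd 0 * Cd 1 * real N powr (\<tau> 0 + \<tau> 1)"
      unfolding z using progression(2)[of k1 N] N by (simp add: powr_add mult_ac)
  qed
qed

lemma bump_const_pos: "b0\<^sup>2 * v0 powr \<rho> 2 > 0"
  using b0_pos v0(1) by simp

lemma condition_2: "0 \<le> s 0 + s 1"
  and condition_2': "s 0 + s 1 = 0 \<Longrightarrow> 1 \<le> recip (q 0) + recip (q 1)"
proof -
  have "- (s 0 + s 1) \<le> 0"
  proof (rule exponent_nonpos[OF _ bump_const_pos])
    fix m
    show "2 powr (- (s 0 + s 1) * real (10 * (0 + Suc m))) * (b0\<^sup>2 * v0 powr \<rho> 2) \<le> Cm * Nb 0 * Nb 1"
      using estimate_modulated_opposite[of "{10 * (0 + Suc m)}"] by simp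
  qed
  thus "0 \<le> s 0 + s 1" by simp
  assume z: "s 0 + s 1 = 0"
  show "1 \<le> recip (q 0) + recip (q 1)"
  proof (rule exponent_le[OF _ bump_const_pos])
    fix N :: nat assume N: "1 \<le> N"
    have "(\<Sum>k\<in>progression 0 N. 2 powr (- (s 0 + s 1) * real k)) * (b0\<^sup>2 * v0 powr \<rho> 2)
      \<le> Cm * (real (card (progression 0 N)) powr recip (q 0) * Nb 0) * (real (card (progression 0 N)) powr recip (q 1) * Nb 1)"
      using progression(1-3)[of 0 N] N by (intro estimate_modulated_opposite) (auto dest: progression(5,6))
    thus "real N powr 1 * (b0\<^sup>2 * v0 powr \<rho> 2) \<le> Cm * Nb 0 * Nb 1 * real N powr (recip (q 0) + recip (q 1))"
      unfolding z using progression(2)[of 0 N] N by (simp add: powr_add mult_ac)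
  qed
qed

lemma condition_3: "s 2 \<le> s 0"
  and condition_3': "s 2 = s 0 \<Longrightarrow> q 0 \<le> q 2"
proof -
  have "s 2 - s 0 \<le> 0"
    by (rule exponent_nonpos[OF _ bump_const_pos, of _ 0], rule estimate_modulated_low) simp
  thus "s 2 \<le> s 0" by simp
  assume z: "s 2 = s 0"
  have "recip (q 2) \<le> recip (q 0)"
  proof (rule exponent_le[OF _ bump_const_pos])
    fix N :: nat assume N: "1 \<le> N"
    have "real (card (progression 0 N)) powr recip (q 2) * (b0\<^sup>2 * v0 powr \<rho> 2)
        \<le> Cm * (real (card (progression 0 N)) powr recip (q 0) * Nb 0) * Nb 1"
      using progression(1-3)[of 0 N] N by (intro estimate_modulated_low_sum[OF z]) (auto dest: progression(5,6))
    thus "real N powr recip (q 2) * (b0\<^sup>2 * v0 powr \<rho> 2) \<le> Cm * Nb 0 * Nb 1 * real N powr recip (q 0)"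
      using progression(2)[of 0 N] by (simp add: mult_ac)
  qed
  thus "q 0 \<le> q 2" by (intro recip_le_imp_le pq) auto
qed

lemma condition_4: "\<rho> 2 \<le> \<rho> 0 + \<rho> 1"
proof -
  have "wsize * (\<rho> 2 - \<rho> 0 - \<rho> 1) \<le> 0"
  proof (rule exponent_nonpos[OF _ bump_const_pos])
    fix m
    define k where "k = 10 * (0 + Suc m)"
    \<comment> \<open>The spreading parameter tends to 0 through powers of 2, so that
      \<open>exponent_nonpos\<close> applies.\<close>
    define t :: real where "t = 2 powr (- real k)"
    have t: "0 < t" "t \<le> 1" by (auto simp: t_def powr_le_one_le powr_minus inverse_le_1_iff ge_one_powr_ge_zero)
    have e: "t powr (- wsize * a) = 2 powr (wsize * a * real k)" for a by (simp add: t_def powr_powr mult_ac)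
    have "2 powr (- (wsize * (\<rho> 0 + \<rho> 1)) * real k) * (2 powr (wsize * \<rho> 2 * real k) * (b0\<^sup>2 * v0 powr \<rho> 2))
      \<le> 2 powr (- (wsize * (\<rho> 0 + \<rho> 1)) * real k) * (Cm * (2 powr (wsize * \<rho> 0 * real k) * Nb 0) * (2 powr (wsize * \<rho> 1 * real k) * Nb 1))"
      using estimate_spread[OF t] unfolding e by (rule mult_left_mono) simp
    also have "\<dots> = (2 powr (- (wsize * (\<rho> 0 + \<rho> 1)) * real k) * (2 powr (wsize * \<rho> 0 * real k) * 2 powr (wsize * \<rho> 1 * real k))) * (Cm * Nb 0 * Nb 1)"
      by (simp only: mult_ac)
    also have "2 powr (- (wsize * (\<rho> 0 + \<rho> 1)) * real k) * (2 powr (wsize * \<rho> 0 * real k) * 2 powr (wsize * \<rho> 1 * real k)) = 1"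
      unfolding powr_add[symmetric] by (simp add: algebra_simps)
    also have "2 powr (- (wsize * (\<rho> 0 + \<rho> 1)) * real k) * (2 powr (wsize * \<rho> 2 * real k) * (b0\<^sup>2 * v0 powr \<rho> 2))
      = 2 powr (wsize * (\<rho> 2 - \<rho> 0 - \<rho> 1) * real k) * (b0\<^sup>2 * v0 powr \<rho> 2)"
      unfolding mult.assoc[symmetric] powr_add[symmetric] by (simp add: algebra_simps)
    finally show "2 powr (wsize * (\<rho> 2 - \<rho> 0 - \<rho> 1) * real (10 * (0 + Suc m))) * (b0\<^sup>2 * v0 powr \<rho> 2) \<le> 1 * (Cm * Nb 0 * Nb 1)"
      by (simp only: k_def)
  qed
  thus ?thesis using size_pos by (simp add: mult_le_0_iff)
qed

lemma condition_5: "\<sigma> 2 \<le> \<sigma> 0"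
  and condition_5': "\<sigma> 2 = \<sigma> 0 \<Longrightarrow> A 0 = Besov \<Longrightarrow> A 2 = Besov \<Longrightarrow> q 0 \<le> q 2"
proof -
  have "\<sigma> 2 - \<sigma> 0 \<le> 0"
    by (rule exponent_nonpos[OF _ bump_const_pos, of _ 0], rule estimate_dilated_low) simp
  thus "\<sigma> 2 \<le> \<sigma> 0" by simp
  assume z: "\<sigma> 2 = \<sigma> 0" and A: "A 0 = Besov" "A 2 = Besov"
  have "recip (q 2) \<le> recip (q 0)"
  proof (rule exponent_le[OF _ bump_const_pos])
    fix N :: nat assume N: "1 \<le> N"
    have "real (card (progression 0 N)) powr recip (q 2) * (b0\<^sup>2 * v0 powr \<rho> 2)
        \<le> Cm * (Cd 0 * real (card (progression 0 N)) powr \<tau> 0) * Nb 1"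
      using progression(1-3)[of 0 N] N by (intro estimate_dilated_low_besov[OF A(2) z]) (auto dest: progression(5,6))
    thus "real N powr recip (q 2) * (b0\<^sup>2 * v0 powr \<rho> 2) \<le> Cm * Cd 0 * Nb 1 * real N powr recip (q 0)"
      using progression(2)[of 0 N] A by (simp add: \<tau>_def mult_ac)
  qed
  thus "q 0 \<le> q 2" by (intro recip_le_imp_le pq) auto
qed

lemma condition_6: "\<sigma> 2 \<le> \<sigma> 0 + \<sigma> 1"
  and condition_6': "\<sigma> 2 = \<sigma> 0 + \<sigma> 1 \<Longrightarrow> A 0 = Besov \<Longrightarrow> A 1 = Besov \<Longrightarrow> A 2 = Besov \<Longrightarrow>
    inverse (inverse (q 0) + inverse (q 1)) \<le> q 2"
proof -
  have c: "2 powr (s 2) * (b0\<^sup>2 * v0 powr \<rho> 2) > 0" using bump_const_pos by simp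
  have "\<sigma> 2 - (\<sigma> 0 + \<sigma> 1) \<le> 0"
  proof (rule exponent_nonpos[OF _ c])
    fix m
    show "2 powr ((\<sigma> 2 - (\<sigma> 0 + \<sigma> 1)) * real (10 * (0 + Suc m))) * (2 powr (s 2) * (b0\<^sup>2 * v0 powr \<rho> 2)) \<le> Cm * Cd 0 * Cd 1"
      using estimate_dilated_product[of "10 * (0 + Suc m)"] unfolding mult.left_commute[of _ "2 powr (s 2)"] by simp
  qed
  thus "\<sigma> 2 \<le> \<sigma> 0 + \<sigma> 1" by simp
  assume z: "\<sigma> 2 = \<sigma> 0 + \<sigma> 1" and A: "A 0 = Besov" "A 1 = Besov" "A 2 = Besov"
  have "recip (q 2) \<le> recip (q 0) + recip (q 1)"
  proof (rule exponent_le[OF _ c])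
    fix N :: nat assume N: "1 \<le> N"
    have "real (card (progression 0 N)) powr recip (q 2) * (2 powr (s 2) * (b0\<^sup>2 * v0 powr \<rho> 2))
        \<le> Cm * (Cd 0 * real (card (progression 0 N)) powr \<tau> 0) * (Cd 1 * real (card (progression 0 N)) powr \<tau> 1)"
      using progression(1-3)[of 0 N] N by (intro estimate_dilated_product_besov[OF A(3) z]) (auto dest: progression(5,6))
    thus "real N powr recip (q 2) * (2 powr (s 2) * (b0\<^sup>2 * v0 powr \<rho> 2)) \<le> Cm * Cd 0 * Cd 1 * real N powr (recip (q 0) + recip (q 1))"
      using progression(2)[of 0 N] A by (simp add: \<tau>_def powr_add mult_ac)
  qed
  \<comment> \<open>Positive exponents have finite reciprocals, so the conversion to real numbers is
    additive here.\<close>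
  moreover have f: "inverse (q 0) < top" "inverse (q 1) < top" using pq(2)[of 0] pq(2)[of 1] by (auto simp: less_top[symmetric])
  ultimately have "recip (q 2) \<le> recip (inverse (inverse (q 0) + inverse (q 1)))"
    by (simp add: ennreal_inverse_involution enn2real_plus)
  moreover have "0 < inverse (inverse (q 0) + inverse (q 1))"
    using f by (simp add: zero_less_iff_neq_zero ennreal_inverse_eq_0_iff less_top[symmetric])
  ultimately show "inverse (inverse (q 0) + inverse (q 1)) \<le> q 2" by (intro recip_le_imp_le pq) auto
qed

text \<open>The first factor has a peak of height N but a quasi-norm of order only N to the power
  \<open>\<tau> 0\<close>; as N grows this forces \<open>\<tau> 0\<close> to be at least 1.\<close>

lemma condition_7:
  assumes "\<sigma> 2 = \<sigma> 1" "\<sigma> 0 = 0"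
  shows "1 \<le> \<tau> 0"
proof (rule exponent_le[OF _ bump_const_pos])
  fix N :: nat assume "1 \<le> N"
  from estimate_peak[OF assms this]
  show "real N powr 1 * (b0\<^sup>2 * v0 powr \<rho> 2) \<le> Cm * Cd 0 * Cd 1 * real N powr \<tau> 0"
    using \<open>1 \<le> N\<close> by (simp add: mult_ac)
qed

end

theorem theorem4p2:
  fixes M :: "real ^ 'n"
    and \<Psi> :: "real \<Rightarrow> complex"
    and A :: "nat \<Rightarrow> space_kind"
    and s :: "nat \<Rightarrow> real"
    and p q :: "nat \<Rightarrow> ennreal"
  assumes weight: "is_weight M"
    and cutoff: "is_cutoff \<Psi>"
    and pos: "\<forall>j\<in>{0, 1, 2}. 0 < p j \<and> 0 < q j"
    and fin: "\<forall>j\<in>{0, 1, 2}. A j = Triebel_Lizorkin \<longrightarrow> p j < \<infinity>"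
    and ineq:
      "(\<exists>c<\<infinity>. \<forall>f\<in>schwartz_funs. \<forall>g\<in>schwartz_funs.
          space_qnorm (A 2) \<Psi> M (s 2) (p 2) (q 2) (dist_of_fun (\<lambda>x. f x * g x))
            \<le> c * space_qnorm (A 0) \<Psi> M (s 0) (p 0) (q 0) (dist_of_fun f)
                * space_qnorm (A 1) \<Psi> M (s 1) (p 1) (q 1) (dist_of_fun g))
       \<or>
       (\<exists>c<\<infinity>. \<forall>f\<in>schwartz_funs. \<forall>g\<in>schwartz_funs.
          \<exists>w. tempered w \<and> has_product M (dist_of_fun f) (dist_of_fun g) w \<and>
            space_qnorm (A 2) \<Psi> M (s 2) (p 2) (q 2) w
              \<le> c * space_qnorm (A 0) \<Psi> M (s 0) (p 0) (q 0) (dist_of_fun f)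
                  * space_qnorm (A 1) \<Psi> M (s 1) (p 1) (q 1) (dist_of_fun g))"
  shows
    "s 0 + s 1 \<ge> weight_size M * (recip (p 0) + recip (p 1) - 1)
   \<and> s 0 + s 1 \<ge> 0
   \<and> s 2 \<le> min (s 0) (s 1)
   \<and> recip (p 2) \<le> recip (p 0) + recip (p 1)
   \<and> s 2 - weight_size M * recip (p 2)
        \<le> min (s 0 - weight_size M * recip (p 0)) (s 1 - weight_size M * recip (p 1))
   \<and> s 2 - weight_size M * recip (p 2)
        \<le> s 0 + s 1 - weight_size M * (recip (p 0) + recip (p 1))
   \<and> (s 2 - weight_size M * recip (p 2) = s 1 - weight_size M * recip (p 1)
        \<and> s 0 = weight_size M * recip (p 0)
        \<longrightarrow> (A 0 = Besov \<longrightarrow> q 0 \<le> 1) \<and> (A 0 = Triebel_Lizorkin \<longrightarrow> p 0 \<le> 1))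
   \<and> (s 0 + s 1 = weight_size M * recip (p 0) + weight_size M * recip (p 1) - weight_size M
        \<longrightarrow> (A 0 = Besov \<and> A 1 = Besov \<longrightarrow> recip (q 0) + recip (q 1) \<ge> 1)
          \<and> (A 0 = Besov \<and> A 1 = Triebel_Lizorkin \<longrightarrow> recip (q 0) + recip (p 1) \<ge> 1))
   \<and> (s 0 + s 1 = 0 \<longrightarrow> recip (q 0) + recip (q 1) \<ge> 1)
   \<and> (\<forall>j\<in>{0, 1}. s 2 = s j \<longrightarrow> q 2 \<ge> q j)
   \<and> (\<forall>j\<in>{0, 1}.
        s 2 - weight_size M * recip (p 2) = s j - weight_size M * recip (p j)
        \<and> A j = Besov \<and> A 2 = Besov
        \<longrightarrow> q 2 \<ge> q j)
   \<and> (s 2 - weight_size M * recip (p 2)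
          = s 0 - weight_size M * recip (p 0) + (s 1 - weight_size M * recip (p 1))
        \<and> A 0 = Besov \<and> A 1 = Besov \<and> A 2 = Besov
        \<longrightarrow> q 2 \<ge> inverse (inverse (q 0) + inverse (q 1)))"
proof -
  interpret cutoff M \<Psi> by unfold_locales (rule weight cutoff)+
  have m: "multiplication M \<Psi> A s p q" by (rule multiplicationI[OF pos fin ineq])
  note m' = multiplication.swapped[OF m]
  have c3: "s 2 \<le> s 1" using multiplication.condition_3[OF m'] by simp
  have c3': "q 1 \<le> q 2" if "s 2 = s 1" using multiplication.condition_3'[OF m'] that by simp
  have c5: "s 2 - weight_size M * recip (p 2) \<le> s 1 - weight_size M * recip (p 1)"
    using multiplication.condition_5[OF m'] by simp
  have c5': "q 1 \<le> q 2" if "s 2 - weight_size M * recip (p 2) = s 1 - weight_size M * recip (p 1)" "A 1 = Besov" "A 2 = Besov"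
    using multiplication.condition_5'[OF m'] that by simp
  \<comment> \<open>A lower bound 1 for \<open>\<tau> 0\<close> is one for the reciprocal of
    \<open>q 0\<close> or of \<open>p 0\<close>, and hence an upper bound 1 for the exponent
    itself.\<close>
  have one: "x \<le> 1" if "1 \<le> recip x" "0 < x" for x :: ennreal
    by (rule recip_le_imp_le) (use that in simp_all)
  have c7: "(A 0 = Besov \<longrightarrow> q 0 \<le> 1) \<and> (A 0 = Triebel_Lizorkin \<longrightarrow> p 0 \<le> 1)"
    if "s 2 - weight_size M * recip (p 2) = s 1 - weight_size M * recip (p 1)" "s 0 = weight_size M * recip (p 0)"
    using multiplication.condition_7[OF m] that pos by (auto simp: multiplication.\<tau>_def[OF m] intro!: one)
  have c1': "(A 0 = Besov \<and> A 1 = Besov \<longrightarrow> recip (q 0) + recip (q 1) \<ge> 1)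
      \<and> (A 0 = Besov \<and> A 1 = Triebel_Lizorkin \<longrightarrow> recip (q 0) + recip (p 1) \<ge> 1)"
    if "s 0 + s 1 = weight_size M * recip (p 0) + weight_size M * recip (p 1) - weight_size M"
    using multiplication.condition_1'[OF m that] by (auto simp: multiplication.\<tau>_def[OF m])
  have c6: "s 2 - weight_size M * recip (p 2) \<le> s 0 + s 1 - weight_size M * (recip (p 0) + recip (p 1))"
    using multiplication.condition_6[OF m] by (simp add: algebra_simps)
  show ?thesis
    using multiplication.condition_1[OF m] multiplication.condition_2[OF m] multiplication.condition_3[OF m] c3
      multiplication.condition_4[OF m] multiplication.condition_5[OF m] c5 c6 c7 c1' multiplication.condition_2'[OF m]
      multiplication.condition_3'[OF m] c3' multiplication.condition_5'[OF m] c5' multiplication.condition_6'[OF m]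
    by (intro conjI impI ballI) auto
qed

end
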